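(* Let $G=G_1\ast\cdots\ast G_n$ be a free product of finitely many nontrivial finite groups, let $\Sigma Aut_1(G)$ be the group of automorphisms of $G$ sending each $G_i$ to a conjugate of $G_i$, and let $F$ be a finite subgroup of $\Sigma Aut_1(G)$ which fixes a vertex $[\mathcal{H}_0,\underline{\underline{A}}]$ of $L(G)$ that is reduced in $L(G)^F$. Then the fixed point subcomplex $L(G)^F$ is contractible.
   Context: A basis of $G$ is a set $\mathcal{H}=\{H_1,\dots,H_n\}$ of subgroups with $H_i$ conjugate to $G_i$ and $G=H_1\ast\cdots\ast H_n$; $H_i$ has label $i$. A pointed labelled tree is a finite bipartite tree whose vertices are labelled (labels $\ast,1,\dots,n$, each once) or unlabelled, each edge joining a labelled and an unlabelled vertex, unlabelled vertices of valence at least 2, $\ast$ of valence 1. For a labelled vertex $k$, the petals at $k$ are the label sets of components of $T-\{k\}$, forming a partition $\underline{\underline{A}}(k)$; the tree is identified with the family $\underline{\underline{A}}$; $\underline{\underline{A}}\le\underline{\underline{B}}$ means each petal of $\underline{\underline{A}}(k)$ is a union of petals of $\underline{\underline{B}}(k)$. For a basis $\mathcal{H}$, $k\in\{1,\dots,n\}$ and $x_j\in H_k$ ($x_k=1$), the symmetric Whitehead automorphism $(\mathcal{H},x)$ acts on $H_j$ by $h\mapsto x_jhx_j^{-1}$, trivially on $H_k$; it is carried by $(\mathcal{H},\underline{\underline{A}})$ if $x$ is constant on petals of $\underline{\underline{A}}(k)$ and trivial on the petal containing $\ast$. Pairs $(\mathcal{H},\underline{\underline{A}})$, $(\rho(\mathcal{H}),\underline{\underline{A}})$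 with $\rho$ a product of carried symmetric Whitehead automorphisms are identified, giving vertex types $[\mathcal{H},\underline{\underline{A}}]$, ordered by: $[\mathcal{H},\underline{\underline{A}}]\le[\mathcal{K},\underline{\underline{B}}]$ iff they have representatives with common basis and $\underline{\underline{A}}\le\underline{\underline{B}}$. $L(G)$ is the realization of this poset; $\phi\in\Sigma Aut_1(G)$ acts by $\phi\cdot[\mathcal{H},\underline{\underline{A}}]=[\phi(\mathcal{H}),\underline{\underline{A}}]$. $L(G)^F$ is the subcomplex spanned by vertices fixed by all of $F$. A vertex of $L(G)^F$ is reduced in $L(G)^F$ if no other vertex of $L(G)^F$ lies below it in the poset order. *)

theory Defs
  imports "HOL-Analysis.Analysis" "HOL-Algebra.Group"
begin

section \<open>Free products of subgroups (internal, via normal forms)\<close>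

text \<open>Labels: the base point \<open>*\<close> is encoded as 0, the factor labels are 1..n.\<close>

definition conjugate_set :: "('g, 'b) monoid_scheme \<Rightarrow> 'g \<Rightarrow> 'g set \<Rightarrow> 'g set" where
  "conjugate_set G g H = {g \<otimes>\<^bsub>G\<^esub> h \<otimes>\<^bsub>G\<^esub> inv\<^bsub>G\<^esub> g | h. h \<in> H}"

definition word_prod :: "('g, 'b) monoid_scheme \<Rightarrow> (nat \<times> 'g) list \<Rightarrow> 'g" where
  "word_prod G ws = foldr (\<lambda>p acc. snd p \<otimes>\<^bsub>G\<^esub> acc) ws \<one>\<^bsub>G\<^esub>"

definition reduced_word :: "('g, 'b) monoid_scheme \<Rightarrow> nat \<Rightarrow> (nat \<Rightarrow> 'g set) \<Rightarrow> (nat \<times> 'g) list \<Rightarrow> bool" where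
  "reduced_word G n H ws \<longleftrightarrow>
     (\<forall>p \<in> set ws. fst p \<in> {1..n} \<and> snd p \<in> H (fst p) \<and> snd p \<noteq> \<one>\<^bsub>G\<^esub>) \<and>
     (\<forall>m. Suc m < length ws \<longrightarrow> fst (ws ! m) \<noteq> fst (ws ! Suc m))"

text \<open>\<open>G = H 1 * ... * H n\<close> (internal free product): each \<open>H i\<close> is a subgroup and every
  element of \<open>G\<close> has a unique reduced normal form.\<close>
definition is_free_product :: "('g, 'b) monoid_scheme \<Rightarrow> nat \<Rightarrow> (nat \<Rightarrow> 'g set) \<Rightarrow> bool" where
  "is_free_product G n H \<longleftrightarrow>
     (\<forall>i \<in> {1..n}. subgroup (H i) G) \<and>
     (\<forall>g \<in> carrier G. \<exists>!ws. reduced_word G n H ws \<and> word_prod G ws = g)"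

text \<open>A basis: labelled family \<open>H 1, ..., H n\<close> with \<open>H i\<close> conjugate to \<open>Gs i\<close> and \<open>G\<close> their free product.\<close>
definition is_basis :: "('g, 'b) monoid_scheme \<Rightarrow> nat \<Rightarrow> (nat \<Rightarrow> 'g set) \<Rightarrow> (nat \<Rightarrow> 'g set) \<Rightarrow> bool" where
  "is_basis G n Gs H \<longleftrightarrow> H \<in> extensional {1..n} \<and>
     (\<forall>i \<in> {1..n}. \<exists>g \<in> carrier G. H i = conjugate_set G g (Gs i)) \<and>
     is_free_product G n H"

text \<open>\<open>\<Sigma>Aut_1(G)\<close>, automorphisms as extensional functions on the carrier.\<close>
definition sigma_aut1 :: "('g, 'b) monoid_scheme \<Rightarrow> nat \<Rightarrow> (nat \<Rightarrow> 'g set) \<Rightarrow> ('g \<Rightarrow> 'g) set" where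
  "sigma_aut1 G n Gs = {\<phi>. \<phi> \<in> hom G G \<and> bij_betw \<phi> (carrier G) (carrier G) \<and>
      \<phi> \<in> extensional (carrier G) \<and>
      (\<forall>i \<in> {1..n}. \<exists>g \<in> carrier G. \<phi> ` Gs i = conjugate_set G g (Gs i))}"

definition finite_subgroup_SA :: "('g, 'b) monoid_scheme \<Rightarrow> nat \<Rightarrow> (nat \<Rightarrow> 'g set) \<Rightarrow> ('g \<Rightarrow> 'g) set \<Rightarrow> bool" where
  "finite_subgroup_SA G n Gs F \<longleftrightarrow> F \<subseteq> sigma_aut1 G n Gs \<and> finite F \<and>
     restrict id (carrier G) \<in> F \<and>
     (\<forall>\<phi> \<in> F. \<forall>\<psi> \<in> F. compose (carrier G) \<phi> \<psi> \<in> F) \<and>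
     (\<forall>\<phi> \<in> F. restrict (inv_into (carrier G) \<phi>) (carrier G) \<in> F)"

definition basis_img :: "nat \<Rightarrow> ('g \<Rightarrow> 'g) \<Rightarrow> (nat \<Rightarrow> 'g set) \<Rightarrow> (nat \<Rightarrow> 'g set)" where
  "basis_img n \<phi> H = (\<lambda>i \<in> {1..n}. \<phi> ` H i)"

section \<open>Pointed labelled trees\<close>

text \<open>A tree is given by a vertex set \<open>V\<close> (of naturals), a set \<open>E\<close> of two-element edges and a
  partial labelling \<open>lab\<close> (\<open>None\<close> = unlabelled, \<open>Some 0\<close> = \<open>*\<close>, \<open>Some i\<close> = label i).\<close>

definition is_tree :: "nat set \<Rightarrow> nat set set \<Rightarrow> bool" where
  "is_tree V E \<longleftrightarrow> finite V \<and> V \<noteq> {} \<and>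
     (\<forall>e \<in> E. \<exists>u v. e = {u, v} \<and> u \<noteq> v \<and> u \<in> V \<and> v \<in> V) \<and>
     (\<forall>u \<in> V. \<forall>v \<in> V. (u, v) \<in> {(a, b). {a, b} \<in> E}\<^sup>*) \<and>
     card E + 1 = card V"

definition valence :: "nat set set \<Rightarrow> nat \<Rightarrow> nat" where
  "valence E v = card {u. {u, v} \<in> E \<and> u \<noteq> v}"

definition is_plt :: "nat \<Rightarrow> nat set \<Rightarrow> nat set set \<Rightarrow> (nat \<Rightarrow> nat option) \<Rightarrow> bool" where
  "is_plt n V E lab \<longleftrightarrow> is_tree V E \<and>
     bij_betw (\<lambda>v. the (lab v)) {v \<in> V. lab v \<noteq> None} {0..n} \<and>
     (\<forall>e \<in> E. \<exists>u v. e = {u, v} \<and> lab u \<noteq> None \<and> lab v = None) \<and>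
     (\<forall>v \<in> V. lab v = None \<longrightarrow> valence E v \<ge> 2) \<and>
     (\<forall>v \<in> V. lab v = Some 0 \<longrightarrow> valence E v = 1)"

text \<open>Petals at the labelled vertex with label k: label sets of the components of \<open>T - {k}\<close>.\<close>
definition petals :: "nat set \<Rightarrow> nat set set \<Rightarrow> (nat \<Rightarrow> nat option) \<Rightarrow> nat \<Rightarrow> nat set set" where
  "petals V E lab k =
     (let vk = (THE v. v \<in> V \<and> lab v = Some k);
          R = {(a, b). {a, b} \<in> E \<and> a \<noteq> vk \<and> b \<noteq> vk}
      in {{the (lab w) | w. w \<in> V \<and> (u, w) \<in> R\<^sup>* \<and> lab w \<noteq> None} | u. u \<in> V - {vk}})"

definition petal_family :: "nat \<Rightarrow> nat set \<Rightarrow> nat set set \<Rightarrow> (nat \<Rightarrow> nat option) \<Rightarrow> nat \<Rightarrow> nat set set" where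
  "petal_family n V E lab = (\<lambda>k. if k \<in> {0..n} then petals V E lab k else {})"

text \<open>Pointed labelled trees, identified with their petal families.\<close>
definition plt_families :: "nat \<Rightarrow> (nat \<Rightarrow> nat set set) set" where
  "plt_families n = {petal_family n V E lab | V E lab. is_plt n V E lab}"

definition tree_le :: "nat \<Rightarrow> (nat \<Rightarrow> nat set set) \<Rightarrow> (nat \<Rightarrow> nat set set) \<Rightarrow> bool" where
  "tree_le n A B \<longleftrightarrow> (\<forall>k \<in> {0..n}. \<forall>P \<in> A k. \<exists>S \<subseteq> B k. P = \<Union>S)"

section \<open>Symmetric Whitehead automorphisms\<close>

text \<open>The automorphism \<open>(H, x)\<close>: the unique endomorphism acting on \<open>H j\<close> by conjugation by \<open>x j\<close>.\<close>
definition whitehead :: "('g, 'b) monoid_scheme \<Rightarrow> nat \<Rightarrow> (nat \<Rightarrow> 'g set) \<Rightarrow> (nat \<Rightarrow> 'g) \<Rightarrow> ('g \<Rightarrow> 'g)" where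
  "whitehead G n H x = (THE \<phi>. \<phi> \<in> hom G G \<and> \<phi> \<in> extensional (carrier G) \<and>
     (\<forall>j \<in> {1..n}. \<forall>h \<in> H j. \<phi> h = x j \<otimes>\<^bsub>G\<^esub> h \<otimes>\<^bsub>G\<^esub> inv\<^bsub>G\<^esub> (x j)))"

definition is_sym_wh :: "('g, 'b) monoid_scheme \<Rightarrow> nat \<Rightarrow> (nat \<Rightarrow> 'g set) \<Rightarrow> nat \<Rightarrow> (nat \<Rightarrow> 'g) \<Rightarrow> bool" where
  "is_sym_wh G n H k x \<longleftrightarrow> k \<in> {1..n} \<and> (\<forall>j \<in> {1..n}. x j \<in> H k) \<and> x k = \<one>\<^bsub>G\<^esub>"

definition carried :: "('g, 'b) monoid_scheme \<Rightarrow> nat \<Rightarrow> (nat \<Rightarrow> 'g set) \<Rightarrow> (nat \<Rightarrow> nat set set) \<Rightarrow> nat \<Rightarrow> (nat \<Rightarrow> 'g) \<Rightarrow> bool" where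
  "carried G n H A k x \<longleftrightarrow> is_sym_wh G n H k x \<and>
     (\<forall>P \<in> A k. \<forall>i \<in> P - {0}. \<forall>j \<in> P - {0}. x i = x j) \<and>
     (\<forall>P \<in> A k. 0 \<in> P \<longrightarrow> (\<forall>i \<in> P - {0}. x i = \<one>\<^bsub>G\<^esub>))"

text \<open>Products of symmetric Whitehead automorphisms carried by \<open>(H, A)\<close>.\<close>
inductive_set carried_prods :: "('g, 'b) monoid_scheme \<Rightarrow> nat \<Rightarrow> (nat \<Rightarrow> 'g set) \<Rightarrow> (nat \<Rightarrow> nat set set) \<Rightarrow> ('g \<Rightarrow> 'g) set"
  for G n H A where
  cp_id: "restrict id (carrier G) \<in> carried_prods G n H A"
| cp_step: "\<rho> \<in> carried_prods G n H A \<Longrightarrow> carried G n H A k x \<Longrightarrow>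
      compose (carrier G) (whitehead G n H x) \<rho> \<in> carried_prods G n H A"

section \<open>The complex L(G)\<close>

type_synonym 'g lpair = "(nat \<Rightarrow> 'g set) \<times> (nat \<Rightarrow> nat set set)"

definition LG_pairs :: "('g, 'b) monoid_scheme \<Rightarrow> nat \<Rightarrow> (nat \<Rightarrow> 'g set) \<Rightarrow> 'g lpair set" where
  "LG_pairs G n Gs = {(H, A). is_basis G n Gs H \<and> A \<in> plt_families n}"

definition LG_step :: "('g, 'b) monoid_scheme \<Rightarrow> nat \<Rightarrow> (nat \<Rightarrow> 'g set) \<Rightarrow> ('g lpair \<times> 'g lpair) set" where
  "LG_step G n Gs = {((H, A), (basis_img n \<rho> H, A)) | H A \<rho>.
      (H, A) \<in> LG_pairs G n Gs \<and> \<rho> \<in> carried_prods G n H A}"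

text \<open>Vertex types \<open>[H, A]\<close>: classes of the equivalence relation generated by the identifications.\<close>
definition vclass :: "('g, 'b) monoid_scheme \<Rightarrow> nat \<Rightarrow> (nat \<Rightarrow> 'g set) \<Rightarrow> 'g lpair \<Rightarrow> 'g lpair set" where
  "vclass G n Gs p = {q. (p, q) \<in> (LG_step G n Gs \<union> (LG_step G n Gs)\<inverse>)\<^sup>*}"

definition LG_vertices :: "('g, 'b) monoid_scheme \<Rightarrow> nat \<Rightarrow> (nat \<Rightarrow> 'g set) \<Rightarrow> 'g lpair set set" where
  "LG_vertices G n Gs = vclass G n Gs ` LG_pairs G n Gs"

definition vle :: "nat \<Rightarrow> 'g lpair set \<Rightarrow> 'g lpair set \<Rightarrow> bool" where
  "vle n c d \<longleftrightarrow> (\<exists>H A B. (H, A) \<in> c \<and> (H, B) \<in> d \<and> tree_le n A B)"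

definition vact :: "('g, 'b) monoid_scheme \<Rightarrow> nat \<Rightarrow> (nat \<Rightarrow> 'g set) \<Rightarrow> ('g \<Rightarrow> 'g) \<Rightarrow> 'g lpair set \<Rightarrow> 'g lpair set" where
  "vact G n Gs \<phi> c = vclass G n Gs (basis_img n \<phi> (fst (SOME p. p \<in> c)), snd (SOME p. p \<in> c))"

definition LG_fixed :: "('g, 'b) monoid_scheme \<Rightarrow> nat \<Rightarrow> (nat \<Rightarrow> 'g set) \<Rightarrow> ('g \<Rightarrow> 'g) set \<Rightarrow> 'g lpair set set" where
  "LG_fixed G n Gs F = {c \<in> LG_vertices G n Gs. \<forall>\<phi> \<in> F. vact G n Gs \<phi> c = c}"

definition reduced_in :: "nat \<Rightarrow> 'g lpair set set \<Rightarrow> 'g lpair set \<Rightarrow> bool" where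
  "reduced_in n S c \<longleftrightarrow> c \<in> S \<and> \<not> (\<exists>d \<in> S. d \<noteq> c \<and> vle n d c)"

section \<open>Geometric realization of a poset (order complex, weak topology)\<close>

definition is_chain_in :: "'v set \<Rightarrow> ('v \<Rightarrow> 'v \<Rightarrow> bool) \<Rightarrow> 'v set \<Rightarrow> bool" where
  "is_chain_in V rel \<sigma> \<longleftrightarrow> \<sigma> \<subseteq> V \<and> (\<forall>a \<in> \<sigma>. \<forall>b \<in> \<sigma>. rel a b \<or> rel b a)"

definition simplex_pts :: "'v set \<Rightarrow> ('v \<Rightarrow> real) set" where
  "simplex_pts \<sigma> = {f. (\<forall>v. 0 \<le> f v) \<and> (\<forall>v. v \<notin> \<sigma> \<longrightarrow> f v = 0) \<and> sum f \<sigma> = 1}"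

definition is_face :: "'v set \<Rightarrow> ('v \<Rightarrow> 'v \<Rightarrow> bool) \<Rightarrow> 'v set \<Rightarrow> bool" where
  "is_face V rel \<sigma> \<longleftrightarrow> finite \<sigma> \<and> \<sigma> \<noteq> {} \<and> is_chain_in V rel \<sigma>"

definition realization_set :: "'v set \<Rightarrow> ('v \<Rightarrow> 'v \<Rightarrow> bool) \<Rightarrow> ('v \<Rightarrow> real) set" where
  "realization_set V rel = \<Union>{simplex_pts \<sigma> | \<sigma>. is_face V rel \<sigma>}"

definition realization :: "'v set \<Rightarrow> ('v \<Rightarrow> 'v \<Rightarrow> bool) \<Rightarrow> ('v \<Rightarrow> real) topology" where
  "realization V rel = topology (\<lambda>U. U \<subseteq> realization_set V rel \<and>
     (\<forall>\<sigma>. is_face V rel \<sigma> \<longrightarrow>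
        openin (subtopology (powertop_real UNIV) (simplex_pts \<sigma>)) (U \<inter> simplex_pts \<sigma>)))"

lemma istopology_realization:
  fixes V :: "'v set"
  shows "istopology (\<lambda>U. U \<subseteq> realization_set V rel \<and>
     (\<forall>\<sigma>. is_face V rel \<sigma> \<longrightarrow>
        openin (subtopology (powertop_real UNIV) (simplex_pts \<sigma>)) (U \<inter> simplex_pts \<sigma>)))"
  unfolding istopology_def
proof (intro conjI allI impI ballI)
  fix S T :: "('v \<Rightarrow> real) set"
  assume S: "S \<subseteq> realization_set V rel \<and> (\<forall>\<sigma>. is_face V rel \<sigma> \<longrightarrow>
        openin (subtopology (powertop_real UNIV) (simplex_pts \<sigma>)) (S \<inter> simplex_pts \<sigma>))"
    and T: "T \<subseteq> realization_set V rel \<and> (\<forall>\<sigma>. is_face V rel \<sigma> \<longrightarrow>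
        openin (subtopology (powertop_real UNIV) (simplex_pts \<sigma>)) (T \<inter> simplex_pts \<sigma>))"
  show "S \<inter> T \<subseteq> realization_set V rel" using S by blast
  fix \<sigma> assume "is_face V rel \<sigma>"
  then have "openin (subtopology (powertop_real UNIV) (simplex_pts \<sigma>)) ((S \<inter> simplex_pts \<sigma>) \<inter> (T \<inter> simplex_pts \<sigma>))"
    using S T by (metis openin_Int)
  moreover have "(S \<inter> simplex_pts \<sigma>) \<inter> (T \<inter> simplex_pts \<sigma>) = S \<inter> T \<inter> simplex_pts \<sigma>" by blast
  ultimately show "openin (subtopology (powertop_real UNIV) (simplex_pts \<sigma>)) (S \<inter> T \<inter> simplex_pts \<sigma>)" by simp
next
  fix K :: "('v \<Rightarrow> real) set set"
  assume K: "\<forall>U \<in> K. U \<subseteq> realization_set V rel \<and> (\<forall>\<sigma>. is_face V rel \<sigma> \<longrightarrow>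
        openin (subtopology (powertop_real UNIV) (simplex_pts \<sigma>)) (U \<inter> simplex_pts \<sigma>))"
  show "\<Union>K \<subseteq> realization_set V rel" using K by blast
  fix \<sigma> assume "is_face V rel \<sigma>"
  then have "openin (subtopology (powertop_real UNIV) (simplex_pts \<sigma>)) (\<Union>U\<in>K. U \<inter> simplex_pts \<sigma>)"
    using K by (intro openin_Union) blast
  moreover have "(\<Union>U\<in>K. U \<inter> simplex_pts \<sigma>) = \<Union>K \<inter> simplex_pts \<sigma>" by blast
  ultimately show "openin (subtopology (powertop_real UNIV) (simplex_pts \<sigma>)) (\<Union>K \<inter> simplex_pts \<sigma>)" by simp
qed

end

theory Submission
  imports Defs
begin

text \<open>
  A vertex type \<open>c0\<close> fixed by \<open>F\<close> has a Bass--Serre tree, whose labelled vertices are the translates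
  of the base point and the conjugates of the factors. It is recorded by the relation \<open>S l p q\<close>: the
  vertex \<open>l\<close> separates \<open>p\<close> from \<open>q\<close>. This relation is invariant under \<open>G\<close>, and under \<open>F\<close> because
  \<open>F\<close> fixes \<open>c0\<close>. The volume of a vertex type is the number of edges of this tree, counted with
  multiplicity, in the hulls of the unlabelled vertices of the vertex type. It is
  monotone for the poset order. Among the vertex types above a given one and of the same volume there
  is a largest one, obtained by splitting the unlabelled vertices along \<open>S\<close>. If \<open>m\<close> is maximal in
  this sense and differs from \<open>c0\<close>, then its edges can be folded towards the tree of \<open>c0\<close>; doing as
  many foldings as possible gives \<open>\<mu> < m\<close> of smaller volume. The predecessors \<open>x\<close> of
  \<open>m\<close> of smaller volume are conically contractible via \<open>x \<le> f x \<ge> \<mu>\<close>, where \<open>f x\<close> undoes those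
  identifications of \<open>x\<close> which are not foldings. All constructions are canonical, hence respect the
  fixed points of \<open>F\<close>, and the filtration by volume contracts the fixed point complex to \<open>c0\<close>.
\<close>

section \<open>Order complexes with the weak topology\<close>

text \<open>Trees enter only as separation relations: the order of pointed labelled trees becomes
  implication, and refining or folding a tree becomes a pointwise operation on relations. Folding
  lowers the volume because two edges at a labelled vertex which begin with the same edge of
  \<open>S\<close> count this edge at two unlabelled vertices, and after merging these it is counted
  once. Merging which folds nothing leaves paths geodesic in \<open>S\<close> and loses no volume;
  hence undoing such merging in \<open>x\<close> never brings \<open>f x\<close> back to the volume
  of \<open>m\<close>. The obstacle is that foldability depends on the representing basis: two edges
  may agree in \<open>S\<close> only after one of them is translated by an element of a factor. So a
  basis is first normalised by symmetric Whitehead automorphisms. Normalised bases of one vertex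
  type have the same maximal folding, and this uniqueness yields both the invariance of \<mu> under
  \<open>F\<close> and the relation between \<mu> and \<open>f x\<close>.\<close>

lemma openin_realization:
  "openin (realization V rel) U \<longleftrightarrow> U \<subseteq> realization_set V rel \<and>
     (\<forall>\<sigma>. is_face V rel \<sigma> \<longrightarrow> openin (top_of_set (simplex_pts \<sigma>)) (U \<inter> simplex_pts \<sigma>))"
  unfolding realization_def
  by (subst topology_inverse'[OF istopology_realization]) (simp add: euclidean_product_topology)

lemma topspace_realization [simp]: "topspace (realization V rel) = realization_set V rel"
proof (rule antisym)
  show "topspace (realization V rel) \<subseteq> realization_set V rel"
    using openin_realization openin_topspace by blast
  have "openin (realization V rel) (realization_set V rel)"
  proof -
    have "realization_set V rel \<inter> simplex_pts \<sigma> = simplex_pts \<sigma>" if "is_face V rel \<sigma>" for \<sigma>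
      using that unfolding realization_set_def by auto
    then show ?thesis by (auto simp: openin_realization)
  qed
  then show "realization_set V rel \<subseteq> topspace (realization V rel)"
    by (rule openin_subset)
qed

lemma closedin_realizationD:
  assumes "closedin (realization V rel) C" "is_face V rel \<sigma>"
  shows "closedin (top_of_set (simplex_pts \<sigma>)) (C \<inter> simplex_pts \<sigma>)"
proof -
  have "openin (top_of_set (simplex_pts \<sigma>)) ((realization_set V rel - C) \<inter> simplex_pts \<sigma>)"
    using assms by (auto simp: closedin_def openin_realization)
  moreover have "simplex_pts \<sigma> \<subseteq> realization_set V rel"
    using assms(2) unfolding realization_set_def by auto
  then have "(realization_set V rel - C) \<inter> simplex_pts \<sigma> = simplex_pts \<sigma> - (C \<inter> simplex_pts \<sigma>)"
    by auto
  ultimately show ?thesis by (simp add: closedin_def)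
qed

lemma realization_set_iff:
  "p \<in> realization_set V rel \<longleftrightarrow> (\<forall>v. 0 \<le> p v) \<and> finite {v. p v \<noteq> 0} \<and>
     is_chain_in V rel {v. p v \<noteq> 0} \<and> sum p {v. p v \<noteq> 0} = 1" (is "_ \<longleftrightarrow> ?R")
proof
  assume "p \<in> realization_set V rel"
  then obtain \<sigma> where s: "is_face V rel \<sigma>" "p \<in> simplex_pts \<sigma>"
    unfolding realization_set_def by auto
  have sub: "{v. p v \<noteq> 0} \<subseteq> \<sigma>" and fin: "finite \<sigma>"
    using s by (auto simp: simplex_pts_def is_face_def)
  have "sum p {v. p v \<noteq> 0} = sum p \<sigma>"
    by (rule sum.mono_neutral_left) (use sub fin in auto)
  moreover have "is_chain_in V rel {v. p v \<noteq> 0}"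
    using s(1) sub unfolding is_face_def is_chain_in_def by blast
  ultimately show ?R using s sub fin finite_subset[OF sub fin]
    by (simp add: simplex_pts_def)
next
  assume R: ?R
  then have "{v. p v \<noteq> 0} \<noteq> {}" by force
  then have "is_face V rel {v. p v \<noteq> 0}" "p \<in> simplex_pts {v. p v \<noteq> 0}"
    using R by (auto simp: is_face_def simplex_pts_def)
  then show "p \<in> realization_set V rel" unfolding realization_set_def by blast
qed

lemma face_supp:
  assumes "p \<in> realization_set V rel"
  shows "is_face V rel {v. p v \<noteq> 0}" "p \<in> simplex_pts {v. p v \<noteq> 0}"
proof -
  from assms have R: "(\<forall>v. 0 \<le> p v) \<and> finite {v. p v \<noteq> 0} \<and>
     is_chain_in V rel {v. p v \<noteq> 0} \<and> sum p {v. p v \<noteq> 0} = 1"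
    by (simp add: realization_set_iff)
  then have "{v. p v \<noteq> 0} \<noteq> {}" by force
  then show "is_face V rel {v. p v \<noteq> 0}" "p \<in> simplex_pts {v. p v \<noteq> 0}"
    using R by (auto simp: is_face_def simplex_pts_def)
qed

lemma simplex_in_realization_set: "is_face V rel \<sigma> \<Longrightarrow> simplex_pts \<sigma> \<subseteq> realization_set V rel"
  unfolding realization_set_def by auto

lemma is_face_mono: "is_face W rel \<sigma> \<Longrightarrow> W \<subseteq> V \<Longrightarrow> is_face V rel \<sigma>"
  by (auto simp: is_face_def is_chain_in_def)

lemma realization_set_mono: "W \<subseteq> V \<Longrightarrow> realization_set W rel \<subseteq> realization_set V rel"
  unfolding realization_set_def using is_face_mono by blast

lemma closed_simplex_pts:
  assumes "finite (\<sigma> :: 'v set)" shows "closed (simplex_pts \<sigma>)"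
proof -
  have "simplex_pts \<sigma> = (\<Inter>v. {f. 0 \<le> f v}) \<inter> (\<Inter>v\<in>-\<sigma>. {f. f v = 0}) \<inter> {f. sum f \<sigma> = 1}"
    by (auto simp: simplex_pts_def)
  moreover have "closed {f::'v \<Rightarrow> real. 0 \<le> f v}" "closed {f::'v \<Rightarrow> real. f v = 0}" for v
    by (auto intro!: closed_Collect_le closed_Collect_eq continuous_on_product_coordinates)
  moreover have "closed {f::'v \<Rightarrow> real. sum f \<sigma> = 1}"
    by (auto intro!: closed_Collect_eq continuous_on_sum continuous_on_product_coordinates)
  ultimately show ?thesis by (auto intro!: closed_Int closed_INT)
qed

text \<open>The weak topology may be finer than the product topology, so continuity of the
  coordinates does not suffice by itself. With all supports in one finite set \<open>N\<close>, only
  finitely many simplices are met; each is closed, and the preimage of a closed set is a finite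
  union of closed sets.\<close>

lemma continuous_map_into_realization:
  fixes g :: "'a \<Rightarrow> 'v \<Rightarrow> real"
  assumes cont: "\<And>v. continuous_map Y euclideanreal (\<lambda>y. g y v)"
    and N: "finite N" "\<And>y v. y \<in> topspace Y \<Longrightarrow> v \<notin> N \<Longrightarrow> g y v = 0"
    and rs: "\<And>y. y \<in> topspace Y \<Longrightarrow> g y \<in> realization_set W rel"
  shows "continuous_map Y (realization W rel) g"
  unfolding continuous_map_closedin
proof (intro conjI allI impI ballI)
  show "g \<in> topspace Y \<rightarrow> topspace (realization W rel)" using rs by simp
next
  fix C assume C: "closedin (realization W rel) C"
  have contg: "continuous_map Y euclidean g"
    unfolding euclidean_product_topology[symmetric]
    using cont by (simp add: continuous_map_componentwise_UNIV)
  define \<Phi> where "\<Phi> = {\<sigma>. \<sigma> \<subseteq> N \<and> is_face W rel \<sigma>}"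
  have eq: "{y \<in> topspace Y. g y \<in> C} = (\<Union>\<sigma>\<in>\<Phi>. {y \<in> topspace Y. g y \<in> C \<inter> simplex_pts \<sigma>})"
  proof -
    have "\<exists>\<sigma>\<in>\<Phi>. g y \<in> simplex_pts \<sigma>" if "y \<in> topspace Y" for y
    proof
      show "g y \<in> simplex_pts {v. g y v \<noteq> 0}" by (rule face_supp(2)[OF rs[OF that]])
      show "{v. g y v \<noteq> 0} \<in> \<Phi>"
        using face_supp(1)[OF rs[OF that]] N(2)[OF that] by (auto simp: \<Phi>_def)
    qed
    then show ?thesis by blast
  qed
  have "finite \<Phi>" using N(1) by (auto simp: \<Phi>_def)
  moreover have "closedin Y {y \<in> topspace Y. g y \<in> C \<inter> simplex_pts \<sigma>}" if "\<sigma> \<in> \<Phi>" for \<sigma>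
  proof (rule closedin_continuous_map_preimage[OF contg])
    have f: "is_face W rel \<sigma>" using that by (simp add: \<Phi>_def)
    then have "closed (simplex_pts \<sigma>)" by (simp add: closed_simplex_pts is_face_def)
    then show "closedin euclidean (C \<inter> simplex_pts \<sigma>)"
      using closedin_realizationD[OF C f] by (simp add: closedin_closed_eq)
  qed
  ultimately show "closedin Y {y \<in> topspace Y. g y \<in> C}"
    unfolding eq by (intro closedin_Union) auto
qed

text \<open>A product with the unit interval still carries the weak topology with respect to the
  simplices, by the tube lemma.\<close>

lemma continuous_map_prod_realization:
  assumes "\<And>\<sigma>. is_face V rel \<sigma> \<Longrightarrow>
     continuous_map (prod_topology (top_of_set {0..1::real}) (top_of_set (simplex_pts \<sigma>))) Z K"
  shows "continuous_map (prod_topology (top_of_set {0..1::real}) (realization V rel)) Z K"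
  unfolding continuous_map
proof (intro conjI allI impI)
  let ?P = "prod_topology (top_of_set {0..1::real}) (realization V rel)"
  show "K ` topspace ?P \<subseteq> topspace Z"
  proof
    fix z assume "z \<in> K ` topspace ?P"
    then obtain t p where tp: "t \<in> {0..1}" "p \<in> realization_set V rel" "z = K (t,p)" by auto
    then have "continuous_map (prod_topology (top_of_set {0..1::real}) (top_of_set (simplex_pts {v. p v \<noteq> 0}))) Z K"
      "p \<in> simplex_pts {v. p v \<noteq> 0}"
      using assms face_supp by blast+
    then show "z \<in> topspace Z" using tp unfolding continuous_map by auto
  qed
  fix U assume U: "openin Z U"
  let ?W = "{x \<in> topspace ?P. K x \<in> U}"
  have Wopen: "openin (prod_topology (top_of_set {0..1::real}) (top_of_set (simplex_pts \<sigma>)))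
      (?W \<inter> ({0..1} \<times> simplex_pts \<sigma>))" if "is_face V rel \<sigma>" for \<sigma>
  proof -
    have "?W \<inter> ({0..1} \<times> simplex_pts \<sigma>) =
      {x \<in> topspace (prod_topology (top_of_set {0..1::real}) (top_of_set (simplex_pts \<sigma>))). K x \<in> U}"
      using simplex_in_realization_set[OF that] by auto
    then show ?thesis using assms[OF that] U by (simp only: continuous_map)
  qed
  show "openin ?P ?W"
    unfolding openin_prod_topology_alt
  proof (intro allI impI)
    fix t0 x0 assume tx: "(t0, x0) \<in> ?W"
    then have t0: "t0 \<in> {0..1}" and x0: "x0 \<in> realization_set V rel" by auto
    let ?s0 = "{v. x0 v \<noteq> 0}"
    have f0: "is_face V rel ?s0" "x0 \<in> simplex_pts ?s0" using face_supp[OF x0] by auto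
    have "openin (top_of_set {0..1}) {t \<in> topspace (top_of_set {0..1}).
        (t, x0) \<in> ?W \<inter> ({0..1} \<times> simplex_pts ?s0)}"
      by (rule openin_continuous_map_preimage[OF _ Wopen[OF f0(1)]])
         (intro continuous_map_pairedI continuous_map_id continuous_map_const[THEN iffD2], use f0 in auto)
    moreover have "t0 \<in> {t \<in> topspace (top_of_set {0..1}).
        (t, x0) \<in> ?W \<inter> ({0..1} \<times> simplex_pts ?s0)}" using tx t0 f0 by auto
    ultimately have "\<exists>e>0. \<forall>t\<in>{0..1}. dist t t0 < e \<longrightarrow> t \<in> {t \<in> topspace (top_of_set {0..1}).
        (t, x0) \<in> ?W \<inter> ({0..1} \<times> simplex_pts ?s0)}"
      unfolding openin_euclidean_subtopology_iff by (elim conjE) (drule (1) bspec)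
    then obtain e where e: "e > 0" "\<And>t. t \<in> {0..1} \<Longrightarrow> dist t t0 < e \<Longrightarrow> (t,x0) \<in> ?W"
      by (elim exE conjE) (metis (no_types, lifting) IntD1 mem_Collect_eq)
    \<comment> \<open>Half the radius gives a compact neighbourhood of \<open>t0\<close>.
      Compactness is what the tube lemma needs to make \<open>B\<close>, the set of points whose
      whole slice over \<open>J\<close> lies in the preimage, open on every simplex.\<close>
    define J where "J = {0..1} \<inter> cball t0 (e/2)"
    have J: "compactin (top_of_set {0..1}) J"
      by (auto simp: J_def compactin_subtopology intro!: compact_Int)
    have Jx0: "J \<times> {x0} \<subseteq> ?W" using e by (auto simp: J_def dist_commute)
    define B where "B = {x \<in> realization_set V rel. J \<times> {x} \<subseteq> ?W}"
    have "openin (realization V rel) B"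
      unfolding openin_realization
    proof (intro conjI allI impI)
      show "B \<subseteq> realization_set V rel" by (auto simp: B_def)
      fix \<sigma> assume f: "is_face V rel \<sigma>"
      show "openin (top_of_set (simplex_pts \<sigma>)) (B \<inter> simplex_pts \<sigma>)"
      proof (subst openin_subopen, intro ballI)
        fix x assume x: "x \<in> B \<inter> simplex_pts \<sigma>"
        then have "J \<times> {x} \<subseteq> ?W \<inter> ({0..1} \<times> simplex_pts \<sigma>)" by (auto simp: B_def J_def)
        then obtain U' V' where UV: "openin (top_of_set {0..1::real}) U'" "openin (top_of_set (simplex_pts \<sigma>)) V'"
          "J \<subseteq> U'" "x \<in> V'" "U' \<times> V' \<subseteq> ?W \<inter> ({0..1} \<times> simplex_pts \<sigma>)"
          using tube_lemma_left[OF Wopen[OF f] J, of x] x by auto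
        have "V' \<subseteq> simplex_pts \<sigma>" using UV(2) openin_subset by fastforce
        then have "V' \<subseteq> B \<inter> simplex_pts \<sigma>"
          using UV simplex_in_realization_set[OF f] unfolding B_def by blast
        then show "\<exists>T. openin (top_of_set (simplex_pts \<sigma>)) T \<and> x \<in> T \<and> T \<subseteq> B \<inter> simplex_pts \<sigma>"
          using UV by blast
      qed
    qed
    moreover have "openin (top_of_set {0..1}) ({0..1} \<inter> ball t0 (e/2))"
      by (simp add: openin_open_Int)
    moreover have "({0..1} \<inter> ball t0 (e/2)) \<times> B \<subseteq> ?W"
    proof -
      have "{0..1} \<inter> ball t0 (e/2) \<subseteq> J" by (auto simp: J_def)
      then show ?thesis unfolding B_def by blast
    qed
    moreover have "t0 \<in> {0..1} \<inter> ball t0 (e/2)" "x0 \<in> B" using t0 x0 Jx0 e(1) by (auto simp: B_def)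
    ultimately show "\<exists>U V'. openin (top_of_set {0..1}) U \<and> openin (realization V rel) V' \<and> t0 \<in> U \<and> x0 \<in> V' \<and> U \<times> V' \<subseteq> ?W"
      by blast
  qed
qed

lemma continuous_map_homotopy_realization:
  fixes K :: "real \<times> ('v \<Rightarrow> real) \<Rightarrow> 'v \<Rightarrow> real"
  assumes 1: "\<And>\<sigma>. is_face V rel \<sigma> \<Longrightarrow> \<exists>N. finite N \<and> (\<forall>t\<in>{0..1}. \<forall>p\<in>simplex_pts \<sigma>.
        K (t,p) \<in> realization_set W rel \<and> (\<forall>v. v \<notin> N \<longrightarrow> K (t,p) v = 0))"
    and 2: "\<And>\<sigma> v. is_face V rel \<sigma> \<Longrightarrow> continuous_on ({0..1} \<times> simplex_pts \<sigma>) (\<lambda>z. K z v)"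
  shows "continuous_map (prod_topology (top_of_set {0..1}) (realization V rel)) (realization W rel) K"
proof (rule continuous_map_prod_realization)
  fix \<sigma> assume f: "is_face V rel \<sigma>"
  then obtain N where N: "finite N" "\<And>t p. t \<in> {0..1} \<Longrightarrow> p \<in> simplex_pts \<sigma> \<Longrightarrow>
        K (t,p) \<in> realization_set W rel \<and> (\<forall>v. v \<notin> N \<longrightarrow> K (t,p) v = 0)"
    using 1[OF f] by (elim exE conjE) (metis (no_types))
  show "continuous_map (prod_topology (top_of_set {0..1}) (top_of_set (simplex_pts \<sigma>))) (realization W rel) K"
  proof (rule continuous_map_into_realization[OF _ N(1)])
    show "continuous_map (prod_topology (top_of_set {0..1}) (top_of_set (simplex_pts \<sigma>))) euclideanreal (\<lambda>y. K y v)" for v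
      using 2[OF f] by simp
  qed (use N(2) in auto)
qed

lemma continuous_map_realization_incl:
  assumes "W \<subseteq> V" shows "continuous_map (realization W rel) (realization V rel) (\<lambda>p. p)"
  unfolding continuous_map
proof (intro conjI allI impI)
  show "(\<lambda>p. p) ` topspace (realization W rel) \<subseteq> topspace (realization V rel)"
    using realization_set_mono[OF assms] by auto
  fix U assume "openin (realization V rel) U"
  moreover have "{x \<in> realization_set W rel. x \<in> U} \<inter> simplex_pts \<sigma> = U \<inter> simplex_pts \<sigma>"
    if "is_face W rel \<sigma>" for \<sigma> using simplex_in_realization_set[OF that] by auto
  ultimately show "openin (realization W rel) {x \<in> topspace (realization W rel). x \<in> U}"
    using is_face_mono[OF _ assms] by (auto simp: openin_realization)
qed

lemma continuous_map_simplex_incl: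
  assumes "is_face V rel \<sigma>"
  shows "continuous_map (top_of_set (simplex_pts \<sigma>)) (realization V rel) (\<lambda>p. p)"
proof (rule continuous_map_into_realization[where N=\<sigma>])
  show "continuous_map (top_of_set (simplex_pts \<sigma>)) euclideanreal (\<lambda>p. p v)" for v
    by (simp add: continuous_on_subset[OF continuous_on_product_coordinates])
qed (use assms subsetD[OF simplex_in_realization_set[OF assms]] in \<open>simp_all add: is_face_def simplex_pts_def\<close>)

section \<open>Strong deformation retracts and increasing unions\<close>

text \<open>The time-one map is continuous into the realization of \<open>W\<close> with its own
  weak topology, so that successive retractions compose without comparing topologies on
  subcomplexes.\<close>

definition strong_deformation_retract :: "('v \<Rightarrow> 'v \<Rightarrow> bool) \<Rightarrow> 'v set \<Rightarrow> 'v set \<Rightarrow> bool" where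
  "strong_deformation_retract rel V W \<longleftrightarrow> W \<subseteq> V \<and>
     (\<exists>K. continuous_map (prod_topology (top_of_set {0..1::real}) (realization V rel)) (realization V rel) K \<and>
          continuous_map (realization V rel) (realization W rel) (\<lambda>p. K (1, p)) \<and>
          (\<forall>p\<in>realization_set V rel. K (0, p) = p) \<and>
          (\<forall>t\<in>{0..1}. \<forall>p\<in>realization_set W rel. K (t, p) = p))"

lemma strong_deformation_retractI:
  fixes K :: "real \<times> ('v \<Rightarrow> real) \<Rightarrow> 'v \<Rightarrow> real"
  assumes "W \<subseteq> V"
    and 1: "\<And>\<sigma>. is_face V rel \<sigma> \<Longrightarrow> \<exists>N. finite N \<and> (\<forall>t\<in>{0..1}. \<forall>p\<in>simplex_pts \<sigma>.
        K (t,p) \<in> realization_set V rel \<and> (\<forall>v. v \<notin> N \<longrightarrow> K (t,p) v = 0))"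
    and 2: "\<And>\<sigma> v. is_face V rel \<sigma> \<Longrightarrow> continuous_on ({0..1} \<times> simplex_pts \<sigma>) (\<lambda>z. K z v)"
    and 3: "\<And>p. p \<in> realization_set V rel \<Longrightarrow> K (1,p) \<in> realization_set W rel"
    and 4: "\<And>p. p \<in> realization_set V rel \<Longrightarrow> K (0,p) = p"
    and 5: "\<And>t p. p \<in> realization_set W rel \<Longrightarrow> t \<in> {0..1} \<Longrightarrow> K (t,p) = p"
  shows "strong_deformation_retract rel V W"
proof -
  have "continuous_map (prod_topology (top_of_set {0..1::real}) (realization V rel)) (realization V rel) K"
    by (rule continuous_map_homotopy_realization[OF 1 2])
  moreover have c: "continuous_map (prod_topology (top_of_set {0..1::real}) (realization V rel)) (realization W rel) (\<lambda>z. K (1, snd z))"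
  proof (rule continuous_map_homotopy_realization)
    fix \<sigma> assume f: "is_face V rel \<sigma>"
    show "\<exists>N. finite N \<and> (\<forall>t\<in>{0..1::real}. \<forall>p\<in>simplex_pts \<sigma>.
        K (1,snd (t,p)) \<in> realization_set W rel \<and> (\<forall>v. v \<notin> N \<longrightarrow> K (1, snd (t,p)) v = 0))"
    proof -
      obtain N where N: "finite N" "\<forall>t\<in>{0..1}. \<forall>p\<in>simplex_pts \<sigma>.
          K (t,p) \<in> realization_set V rel \<and> (\<forall>v. v \<notin> N \<longrightarrow> K (t,p) v = 0)"
        using 1[OF f] by (elim exE conjE)
      have "\<forall>p\<in>simplex_pts \<sigma>. \<forall>v. v \<notin> N \<longrightarrow> K (1,p) v = 0"
        using N(2)[THEN bspec, of 1] by simp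
      moreover have "\<forall>p\<in>simplex_pts \<sigma>. K (1,p) \<in> realization_set W rel"
        using 3 simplex_in_realization_set[OF f] by auto
      ultimately show ?thesis using N(1) by (intro exI[of _ N]) simp
    qed
    fix v
    have "continuous_on ({0..1::real} \<times> simplex_pts \<sigma>) ((\<lambda>z. K z v) \<circ> (\<lambda>z. (1, snd z)))"
      by (intro continuous_on_compose continuous_intros continuous_on_subset[OF 2[OF f]]) auto
    then show "continuous_on ({0..1::real} \<times> simplex_pts \<sigma>) (\<lambda>z. K (1, snd z) v)" by (simp add: o_def)
  qed
  moreover have "continuous_map (realization V rel) (realization W rel) (\<lambda>p. K (1, p))"
  proof -
    have "continuous_map (realization V rel) (prod_topology (top_of_set {0..1::real}) (realization V rel)) (\<lambda>p. (0, p))"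
      by (intro continuous_map_pairedI continuous_map_const[THEN iffD2] continuous_map_id[unfolded id_def]) auto
    from continuous_map_compose[OF this c] show ?thesis by (simp add: o_def)
  qed
  ultimately show ?thesis
    unfolding strong_deformation_retract_def using assms(1) 4 5 by blast
qed

text \<open>An increasing union of strong deformation retracts is contracted by running the retraction of
  the \<open>(i+1)\<close>-st stage during the time interval from \<open>(1/2)^(i+2)\<close> to \<open>(1/2)^(i+1)\<close>.\<close>

primrec telescope :: "(nat \<Rightarrow> real \<times> 'p \<Rightarrow> 'p) \<Rightarrow> nat \<Rightarrow> real \<times> 'p \<Rightarrow> 'p" where
  "telescope H 0 = snd"
| "telescope H (Suc i) = (\<lambda>z. if fst z \<le> (1/2)^(i+1) then H i (max 0 (fst z * 2^(i+2) - 1), snd z)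
      else telescope H i (fst z, H i (1, snd z)))"

lemma contractible_realization_union:
  fixes S :: "nat \<Rightarrow> 'v set"
  assumes sdr: "\<And>i. strong_deformation_retract rel (S (Suc i)) (S i)"
    and S0: "S 0 = {m}" and V: "V = (\<Union>i. S i)" and m: "rel m m"
  shows "contractible_space (realization V rel)"
proof -
  let ?I = "top_of_set {0..1::real}"
  let ?X = "\<lambda>i. realization (S i) rel"
  have "\<forall>i. \<exists>K. continuous_map (prod_topology ?I (?X (Suc i))) (?X (Suc i)) K \<and>
          continuous_map (?X (Suc i)) (?X i) (\<lambda>p. K (1, p)) \<and>
          (\<forall>p\<in>realization_set (S (Suc i)) rel. K (0, p) = p) \<and>
          (\<forall>t\<in>{0..1}. \<forall>p\<in>realization_set (S i) rel. K (t, p) = p)"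
    using sdr unfolding strong_deformation_retract_def by blast
  then obtain H where H: "\<And>i. continuous_map (prod_topology ?I (?X (Suc i))) (?X (Suc i)) (H i)"
    "\<And>i. continuous_map (?X (Suc i)) (?X i) (\<lambda>p. H i (1, p))"
    "\<And>i p. p \<in> realization_set (S (Suc i)) rel \<Longrightarrow> H i (0, p) = p"
    "\<And>i t p. t \<in> {0..1} \<Longrightarrow> p \<in> realization_set (S i) rel \<Longrightarrow> H i (t, p) = p"
    by metis
  have SS: "S i \<subseteq> S (Suc i)" for i using sdr unfolding strong_deformation_retract_def by blast
  have Smono: "S i \<subseteq> S j" if "i \<le> j" for i j using lift_Suc_mono_le[of S, OF SS that] .
  let ?T = "telescope H"
  \<comment> \<open>On stage \<open>i\<close> nothing moves before time (1/2)^(i+1). This is why the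
    two branches of the telescope agree at the switching time.\<close>
  have T_early: "?T i (s, p) = p" if "p \<in> realization_set (S i) rel" "s \<le> (1/2)^(i+1)" for i s p
  proof (cases i)
    case (Suc j)
    have "s \<le> (1/2)^(j+2)" using that Suc by simp
    then have "s * 2^(j+2) \<le> (1/2)^(j+2) * 2^(j+2)" by (intro mult_right_mono) auto
    also have "\<dots> = (1/2 * 2)^(j+2)" by (simp only: power_mult_distrib)
    finally have a: "max 0 (s * 2^(j+2) - 1) = 0" by simp
    have "s \<le> (1/2)^(j+1)" using \<open>s \<le> (1/2)^(j+2)\<close> order_trans[OF _ power_decreasing[of "j+1" "j+2" "1/2::real"]] by auto
    then show ?thesis using a that H(3)[of p j] Suc by simp
  qed simp
  have T_cont: "continuous_map (prod_topology ?I (?X i)) (?X i) (?T i)" for i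
  proof (induction i)
    case 0
    then show ?case by (simp add: continuous_map_snd[unfolded comp_def])
  next
    case (Suc i)
    let ?P = "prod_topology ?I (?X (Suc i))"
    have fst: "continuous_map Q euclideanreal fst" if "Q = subtopology ?P A" for Q A
      using continuous_map_fst[of ?I "?X (Suc i)"] that
      by (auto intro: continuous_map_from_subtopology continuous_map_into_fulltopology)
    have fstP: "continuous_map ?P euclideanreal fst"
      using fst[OF subtopology_topspace[symmetric]] .
    have snd: "continuous_map (subtopology ?P A) (?X (Suc i)) snd" for A
      by (intro continuous_map_from_subtopology continuous_map_snd)
    have "continuous_map ?P (?X (Suc i)) (\<lambda>z. if fst z \<le> (1/2)^(i+1) then H i (max 0 (fst z * 2^(i+2) - 1), snd z)
      else ?T i (fst z, H i (1, snd z)))"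
    proof (rule continuous_map_cases_le)
      let ?A = "{x \<in> topspace ?P. fst x \<le> (1/2)^(i+1)}"
      have le1: "x * 2^(i+2) - 1 \<le> 1" if "x \<le> (1/2)^(i+1)" for x :: real
      proof -
        have "x * 2^(i+1) \<le> (1/2)^(i+1) * 2^(i+1)" by (intro mult_right_mono that) auto
        also have "\<dots> = (1/2 * 2)^(i+1)" by (simp only: power_mult_distrib)
        finally show ?thesis by simp
      qed
      have "continuous_map (subtopology ?P ?A) (prod_topology ?I (?X (Suc i))) (\<lambda>z. (max 0 (fst z * 2^(i+2) - 1), snd z))"
        by (intro continuous_map_pairedI snd continuous_map_into_subtopology continuous_map_real_max
              continuous_map_diff continuous_map_real_mult continuous_map_const[THEN iffD2] fst[OF refl])
           (use le1 in auto)
      from continuous_map_compose[OF this H(1)]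
      show "continuous_map (subtopology ?P ?A) (?X (Suc i)) (\<lambda>z. H i (max 0 (fst z * 2^(i+2) - 1), snd z))"
        by (simp add: o_def)
      let ?B = "{x \<in> topspace ?P. (1/2)^(i+1) \<le> fst x}"
      have "continuous_map (subtopology ?P ?B) (prod_topology ?I (?X i)) (\<lambda>z. (fst z, H i (1, snd z)))"
        using continuous_map_compose[OF snd H(2)]
        by (intro continuous_map_pairedI continuous_map_into_subtopology fst[OF refl]) (auto simp: o_def)
      from continuous_map_compose[OF continuous_map_compose[OF this Suc.IH] continuous_map_realization_incl[OF SS]]
      show "continuous_map (subtopology ?P ?B) (?X (Suc i)) (\<lambda>z. ?T i (fst z, H i (1, snd z)))"
        by (simp add: o_def)
    next
      fix x assume x: "x \<in> topspace ?P" "fst x = (1/2)^(i+1)"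
      have "fst x * 2^(i+2) = 2" using x(2) by (simp add: power_one_over)
      then have a: "max 0 (fst x * 2^(i+2) - 1) = 1" by simp
      have "H i (1, snd x) \<in> realization_set (S i) rel"
        using H(2)[of i] x unfolding continuous_map by auto
      then show "H i (max 0 (fst x * 2^(i+2) - 1), snd x) = ?T i (fst x, H i (1, snd x))"
        unfolding a using T_early[OF _ order_eq_refl[OF x(2)]] by metis
    qed (auto intro: fstP)
    then show ?case by simp
  qed
  \<comment> \<open>The additional retraction is stationary on \<open>S i\<close>. Hence the
    telescopes of all later stages agree there and glue to one map on the union.\<close>
  have T_Suc: "?T (Suc i) (s, p) = ?T i (s, p)" if "p \<in> realization_set (S i) rel" "s \<in> {0..1}" for i s p
  proof (cases "s \<le> (1/2)^(i+1)")
    case True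
    have "s * 2^(i+1) \<le> (1/2)^(i+1) * 2^(i+1)" by (intro mult_right_mono True) auto
    also have "\<dots> = (1/2 * 2)^(i+1)" by (simp only: power_mult_distrib)
    finally have "max 0 (s * 2^(i+2) - 1) \<in> {0..1}" by simp
    then show ?thesis using True H(4)[OF _ that(1)] T_early[OF that(1) True] by simp
  next
    case False
    then show ?thesis using H(4)[OF _ that(1), of 1] by simp
  qed
  have T_mono: "?T j (s, p) = ?T i (s, p)" if "p \<in> realization_set (S i) rel" "s \<in> {0..1}" "i \<le> j" for i j s p
    using that(3)
  proof (induction j rule: dec_induct)
    case (step j)
    have "p \<in> realization_set (S j) rel" using realization_set_mono[OF Smono[OF step(1)]] that(1) by blast
    from T_Suc[OF this that(2)] show ?case using step.IH by (simp only:)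
  qed simp
  define e where "e = (\<lambda>v. if v = m then 1 else 0 :: real)"
  have rs0: "p = e" if "p \<in> realization_set {m} rel" for p
  proof -
    have p: "{v. p v \<noteq> 0} \<subseteq> {m}" "sum p {v. p v \<noteq> 0} = 1" using that by (auto simp: realization_set_iff is_chain_in_def)
    then have "{v. p v \<noteq> 0} = {m}" by (metis subset_singletonD sum.empty zero_neq_one)
    then show ?thesis using p by (auto simp: e_def fun_eq_iff set_eq_iff)
  qed
  have T_1: "?T i (1, p) = e" if "p \<in> realization_set (S i) rel" for i p
    using that
  proof (induction i arbitrary: p)
    case 0 then show ?case using rs0 S0 by simp
  next
    case (Suc i)
    have "H i (1, p) \<in> realization_set (S i) rel"
      using H(2)[of i] Suc.prems unfolding continuous_map by auto
    moreover have "\<not> (1::real) \<le> (1/2)^(i+1)" using power_Suc_less_one[of "1/2::real" i] by simp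
    ultimately show ?case using Suc.IH by simp
  qed
  have idx: "\<exists>i. \<sigma> \<subseteq> S i" if "finite \<sigma>" "\<sigma> \<subseteq> V" for \<sigma>
    using that
  proof (induction \<sigma> rule: finite_induct)
    case (insert x F)
    then obtain i j where "F \<subseteq> S i" "x \<in> S j" using V by auto
    then have "insert x F \<subseteq> S (max i j)" using Smono[of i "max i j"] Smono[of j "max i j"] by auto
    then show ?case by blast
  qed simp
  have face_idx: "\<exists>i. is_face (S i) rel \<sigma>" if "is_face V rel \<sigma>" for \<sigma>
    using idx[of \<sigma>] that by (auto simp: is_face_def is_chain_in_def)
  have p_idx: "\<exists>i. p \<in> realization_set (S i) rel" if "p \<in> realization_set V rel" for p
    using face_idx face_supp[OF that] simplex_in_realization_set by blast
  \<comment> \<open>The least stage is only a way to name a value: by \<open>T_mono\<close> every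
    stage containing the point gives the same one, which makes \<open>L\<close> continuous on each
    simplex.\<close>
  define L where "L = (\<lambda>z. ?T (LEAST i. snd z \<in> realization_set (S i) rel) z)"
  have L: "L (s, p) = ?T i (s, p)" if "p \<in> realization_set (S i) rel" "s \<in> {0..1}" for i s p
    using T_mono[of p "LEAST i. p \<in> realization_set (S i) rel" s i] that
      LeastI[of "\<lambda>i. p \<in> realization_set (S i) rel" i] Least_le[of "\<lambda>i. p \<in> realization_set (S i) rel" i]
    unfolding L_def by simp
  have "continuous_map (prod_topology ?I (realization V rel)) (realization V rel) L"
  proof (rule continuous_map_prod_realization)
    fix \<sigma> assume "is_face V rel \<sigma>"
    then obtain i where f: "is_face (S i) rel \<sigma>" using face_idx by blast
    have "continuous_map (prod_topology ?I (top_of_set (simplex_pts \<sigma>))) (prod_topology ?I (?X i)) (\<lambda>z. (fst z, snd z))"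
      using continuous_map_compose[OF continuous_map_snd continuous_map_simplex_incl[OF f]]
      by (intro continuous_map_pairedI continuous_map_fst) (simp add: o_def del: prod_topology_subtopology_eu)
    from continuous_map_compose[OF continuous_map_compose[OF this T_cont] continuous_map_realization_incl[of "S i" V]]
    have "continuous_map (prod_topology ?I (top_of_set (simplex_pts \<sigma>))) (realization V rel) (?T i)"
      using V by (simp add: o_def UN_upper del: prod_topology_subtopology_eu)
    then show "continuous_map (prod_topology ?I (top_of_set (simplex_pts \<sigma>))) (realization V rel) L"
      by (rule continuous_map_eq) (use L simplex_in_realization_set[OF f] in auto)
  qed
  moreover have "L (0, p) = p" "L (1, p) = e" if pV: "p \<in> realization_set V rel" for p
  proof -
    obtain i where i: "p \<in> realization_set (S i) rel" using p_idx[OF pV] by blast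
    show "L (0, p) = p" using L[OF i, of 0] T_early[OF i, of 0] by simp
    show "L (1, p) = e" using L[OF i, of 1] T_1[OF i] by simp
  qed
  ultimately have "homotopic_with (\<lambda>x. True) (realization V rel) (realization V rel) id (\<lambda>x. e)"
    by (subst homotopic_with) (auto intro!: exI[of _ L])
  then show ?thesis unfolding contractible_space_def by blast
qed

section \<open>Retractions of order complexes: linear pushing and cones\<close>

lemma continuous_on_snd_coordinate:
  "continuous_on S (\<lambda>z :: 'a :: topological_space \<times> ('v \<Rightarrow> 'b :: topological_space). snd z w)"
  by (rule continuous_on_compose2[OF continuous_on_product_coordinates continuous_on_snd[OF continuous_on_id] subset_UNIV])

lemma simplex_ptsD:
  assumes "p \<in> simplex_pts \<sigma>"
  shows "0 \<le> p v" "v \<notin> \<sigma> \<Longrightarrow> p v = 0" "sum p \<sigma> = 1"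
  using assms by (auto simp: simplex_pts_def)

lemma simplex_pts_le_1:
  assumes "p \<in> simplex_pts \<sigma>" "finite \<sigma>" shows "p v \<le> 1"
proof (cases "v \<in> \<sigma>")
  case True
  then have "p v \<le> sum p \<sigma>" using assms simplex_ptsD(1)[OF assms(1)] by (intro member_le_sum) auto
  then show ?thesis using simplex_ptsD(3)[OF assms(1)] by simp
qed (use simplex_ptsD(2)[OF assms(1)] in simp)

text \<open>A chain together with its image under \<open>u\<close> is again a chain, so the segment
  from a point to its push-forward lies in one simplex. Vertices with the same image add their
  masses.\<close>

lemma strong_deformation_retract_linear:
  fixes u :: "'v \<Rightarrow> 'v"
  assumes W: "W \<subseteq> V" and u: "\<And>x. x \<in> V \<Longrightarrow> u x \<in> W" "\<And>x. x \<in> W \<Longrightarrow> u x = x"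
    and ch: "\<And>\<sigma>. is_face V rel \<sigma> \<Longrightarrow> is_face V rel (\<sigma> \<union> u ` \<sigma>)"
  shows "strong_deformation_retract rel V W"
proof -
  define push where "push = (\<lambda>p v. \<Sum>w | p w \<noteq> 0 \<and> u w = v. (p w :: real))"
  define K where "K = (\<lambda>z v. (1 - fst z) * snd z v + fst z * push (snd z) v)"
  have push: "push p v = (\<Sum>w | w \<in> \<sigma> \<and> u w = v. p w)" if "p \<in> simplex_pts \<sigma>" "finite \<sigma>" for p \<sigma> v
    unfolding push_def
    by (rule sum.mono_neutral_left) (use that simplex_ptsD[OF that(1)] in auto)
  have push_sum: "sum (push p) T = 1" if "p \<in> simplex_pts \<sigma>" "finite \<sigma>" "u ` \<sigma> \<subseteq> T" "finite T" for p \<sigma> T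
    using sum.group[OF that(2) that(4) that(3), of p] push[OF that(1,2)] simplex_ptsD(3)[OF that(1)]
    by simp
  have push_nn: "0 \<le> push p v" if "p \<in> simplex_pts \<sigma>" "finite \<sigma>" for p \<sigma> v
    unfolding push[OF that] by (intro sum_nonneg) (use simplex_ptsD[OF that(1)] in auto)
  have push_0: "push p v = 0" if "p \<in> simplex_pts \<sigma>" "finite \<sigma>" "v \<notin> u ` \<sigma>" for p \<sigma> v
    unfolding push[OF that(1,2)] using that(3) by (intro sum.neutral) auto
  have K_in: "K (t, p) \<in> simplex_pts (\<sigma> \<union> u ` \<sigma>)" if "p \<in> simplex_pts \<sigma>" "is_face V rel \<sigma>" "t \<in> {0..1}" for t p \<sigma>
  proof -
    have fin: "finite \<sigma>" using that(2) by (simp add: is_face_def)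
    have 1: "sum p (\<sigma> \<union> u ` \<sigma>) = 1"
      using simplex_ptsD[OF that(1)] fin
      by (metis (no_types, lifting) DiffD2 finite_UnI finite_imageI inf_sup_ord(3) sum.mono_neutral_left)
    have "sum (K (t,p)) (\<sigma> \<union> u ` \<sigma>) = (1 - t) * sum p (\<sigma> \<union> u ` \<sigma>) + t * sum (push p) (\<sigma> \<union> u ` \<sigma>)"
      by (simp add: K_def sum.distrib sum_distrib_left)
    also have "\<dots> = 1" using 1 push_sum[OF that(1) fin, of "\<sigma> \<union> u ` \<sigma>"] fin by simp
    finally show ?thesis
      using that(3) simplex_ptsD[OF that(1)] push_nn[OF that(1) fin] push_0[OF that(1) fin]
      by (auto simp: simplex_pts_def K_def)
  qed
  show ?thesis
  proof (rule strong_deformation_retractI[where K=K, OF W])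
    fix \<sigma> assume f: "is_face V rel \<sigma>"
    then have fin: "finite \<sigma>" by (simp add: is_face_def)
    show "\<exists>N. finite N \<and> (\<forall>t\<in>{0..1}. \<forall>p\<in>simplex_pts \<sigma>.
        K (t,p) \<in> realization_set V rel \<and> (\<forall>v. v \<notin> N \<longrightarrow> K (t,p) v = 0))"
    proof (intro exI[of _ "\<sigma> \<union> u ` \<sigma>"] conjI ballI allI impI)
      fix t :: real and p assume "t \<in> {0..1}" "p \<in> simplex_pts \<sigma>"
      then have K: "K (t, p) \<in> simplex_pts (\<sigma> \<union> u ` \<sigma>)" using K_in f by blast
      then show "K (t, p) \<in> realization_set V rel" using simplex_in_realization_set[OF ch[OF f]] by blast
      show "K (t, p) v = 0" if "v \<notin> \<sigma> \<union> u ` \<sigma>" for v using simplex_ptsD(2)[OF K that] .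
    qed (use fin in simp)
    fix v
    have "continuous_on ({0..1} \<times> simplex_pts \<sigma>)
       (\<lambda>z. (1 - fst z) * snd z v + fst z * (\<Sum>w | w \<in> \<sigma> \<and> u w = v. snd z w))"
      by (intro continuous_intros continuous_on_snd_coordinate)
    then show "continuous_on ({0..1} \<times> simplex_pts \<sigma>) (\<lambda>z. K z v)"
      by (rule continuous_on_eq) (auto simp: K_def push[OF _ fin])
  next
    fix p assume p: "p \<in> realization_set V rel"
    let ?s = "{v. p v \<noteq> 0}"
    have f: "is_face V rel ?s" "p \<in> simplex_pts ?s" "finite ?s" using face_supp[OF p] by (auto simp: is_face_def)
    have "push p \<in> simplex_pts (u ` ?s)"
      using push_sum[OF f(2,3) order_refl] f(3) push_nn[OF f(2,3)] push_0[OF f(2,3)] by (simp add: simplex_pts_def)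
    moreover have "is_face W rel (u ` ?s)"
    proof -
      have "?s \<subseteq> V" using f(1) by (simp add: is_face_def is_chain_in_def)
      then have "u ` ?s \<subseteq> W" using u(1) by blast
      then show ?thesis using ch[OF f(1)] f(1) by (simp add: is_face_def is_chain_in_def)
    qed
    moreover have "K (1, p) = push p" by (simp add: K_def)
    ultimately show "K (1, p) \<in> realization_set W rel" using simplex_in_realization_set by auto
    show "K (0, p) = p" by (simp add: K_def)
  next
    fix t :: real and p assume p: "p \<in> realization_set W rel" "t \<in> {0..1}"
    let ?s = "{v. p v \<noteq> 0}"
    have f: "is_face W rel ?s" "p \<in> simplex_pts ?s" "finite ?s" using face_supp[OF p(1)] by (auto simp: is_face_def)
    have "push p v = p v" for v
    proof -
      have "?s \<subseteq> W" using f(1) by (simp add: is_face_def is_chain_in_def)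
      then have "{w. w \<in> ?s \<and> u w = v} = (if v \<in> ?s then {v} else {})" using u(2) by auto
      then show ?thesis unfolding push[OF f(2,3)] by auto
    qed
    then show "K (t, p) = p" by (auto simp: K_def fun_eq_iff algebra_simps)
  qed
qed

text \<open>The retraction of a cone with apex \<open>m\<close> onto its base, given a contraction \<open>x \<le> f x \<ge> \<mu>\<close> of
  the base. A point with apex mass \<open>t\<close> moves, at time \<open>s\<close>, the uppermost part of its base mass along
  \<open>f\<close>, and then along the segments towards \<open>\<mu>\<close>; the result is normalised.\<close>

definition stay :: "('v \<Rightarrow> 'v \<Rightarrow> bool) \<Rightarrow> 'v \<Rightarrow> 'v set \<Rightarrow> real \<Rightarrow> ('v \<Rightarrow> real) \<Rightarrow> 'v \<Rightarrow> real" where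
  "stay rel m X s p w = min (p w) (max 0 (max 0 (1 - p m - s * p m) - (\<Sum>z | z \<in> X \<and> rel z w \<and> z \<noteq> w. p z)))"

text \<open>The amount of base mass to be moved is \<open>s * p m\<close>, so the flow is the
  identity where the apex has no mass. The term \<open>max 0 (s * p m + p m - 1)\<close> is the
  excess of this amount over the base mass \<open>1 - p m\<close>; it is placed at \<mu>. The
  denominator is the resulting total mass.\<close>

definition cone_flow :: "('v \<Rightarrow> 'v \<Rightarrow> bool) \<Rightarrow> ('v \<Rightarrow> 'v) \<Rightarrow> 'v \<Rightarrow> 'v \<Rightarrow> 'v set \<Rightarrow> real \<Rightarrow> ('v \<Rightarrow> real) \<Rightarrow> 'v \<Rightarrow> real" where
  "cone_flow rel f \<mu> m X s p v =
     ((if v = m then p m * (1 - s) else stay rel m X s p v)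
      + (\<Sum>w | w \<in> X \<and> f w = v. p w - stay rel m X s p w)
      + (if v = \<mu> then max 0 (s * p m + p m - 1) else 0))
     / (1 - s * p m + max 0 (s * p m + p m - 1))"

context
  fixes rel :: "'v \<Rightarrow> 'v \<Rightarrow> bool" and V Q :: "'v set" and f :: "'v \<Rightarrow> 'v" and \<mu> m :: 'v and \<sigma> :: "'v set"
  assumes refl: "\<And>x. x \<in> V \<Longrightarrow> rel x x"
    and trans: "\<And>x y z. x \<in> V \<Longrightarrow> y \<in> V \<Longrightarrow> z \<in> V \<Longrightarrow> rel x y \<Longrightarrow> rel y z \<Longrightarrow> rel x z"
    and antisym: "\<And>x y. x \<in> V \<Longrightarrow> y \<in> V \<Longrightarrow> rel x y \<Longrightarrow> rel y x \<Longrightarrow> x = y"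
    and QV: "Q \<subseteq> V" and mV: "m \<in> V" "m \<notin> Q"
    and f: "\<And>x. x \<in> Q \<Longrightarrow> rel x m \<Longrightarrow> f x \<in> Q \<and> rel x (f x) \<and> rel (f x) m \<and> rel \<mu> (f x)"
    and fmono: "\<And>x y. x \<in> Q \<Longrightarrow> y \<in> Q \<Longrightarrow> rel x y \<Longrightarrow> rel y m \<Longrightarrow> rel (f x) (f y)"
    and mu: "\<mu> \<in> Q" "rel \<mu> m"
    and face: "is_face V rel \<sigma>" "m \<in> \<sigma>" "\<sigma> - {m} \<subseteq> Q" "\<And>x. x \<in> \<sigma> \<Longrightarrow> rel x m"
begin

private abbreviation X where "X \<equiv> \<sigma> - {m}"

private lemma X: "finite X" "\<And>x. x \<in> X \<Longrightarrow> x \<in> Q \<and> x \<in> V \<and> rel x m"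
    "\<And>x y. x \<in> X \<Longrightarrow> y \<in> X \<Longrightarrow> rel x y \<or> rel y x"
  using face QV by (auto simp: is_face_def is_chain_in_def)

private lemma stay_bounds:
  assumes "p \<in> simplex_pts \<sigma>" shows "0 \<le> stay rel m X s p w" "stay rel m X s p w \<le> p w"
  using simplex_ptsD(1)[OF assms] by (auto simp: stay_def)

private lemma stay_0: "p \<in> simplex_pts \<sigma> \<Longrightarrow> w \<notin> \<sigma> \<Longrightarrow> stay rel m X s p w = 0"
  using stay_bounds[of p s w] simplex_ptsD(2)[of p \<sigma> w] by simp

private lemma sum_X: "p \<in> simplex_pts \<sigma> \<Longrightarrow> sum p X = 1 - p m"
  using simplex_ptsD(3)[of p \<sigma>] face(1,2) by (simp add: is_face_def sum_diff1)

private lemma total_pos: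
  assumes "p \<in> simplex_pts \<sigma>" "s \<in> {0..1}"
  shows "1 - s * p m + max 0 (s * p m + p m - 1) > 0"
proof -
  have b: "0 \<le> p m" "p m \<le> 1" using simplex_ptsD(1)[OF assms(1)] simplex_pts_le_1[OF assms(1)] face(1)
    by (auto simp: is_face_def)
  have "s * p m \<le> 1 * p m" using assms(2) b by (intro mult_right_mono) auto
  \<comment> \<open>At the apex itself the base is empty, and the excess \<open>s\<close> placed at
    \<mu> replaces exactly the mass lost by the apex.\<close>
  then show ?thesis using b by (cases "p m = 1") auto
qed

private lemma cone_flow_sum:
  assumes p: "p \<in> simplex_pts \<sigma>" and s: "s \<in> {0..1}"
  shows "sum (cone_flow rel f \<mu> m X s p) (X \<union> f ` X \<union> {\<mu>, m}) = 1"
proof -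
  let ?N = "X \<union> f ` X \<union> {\<mu>, m}"
  let ?a = "max 0 (s * p m + p m - 1)"
  have fin: "finite ?N" using X(1) by simp
  have "(\<Sum>v\<in>?N. if v = m then p m * (1 - s) else stay rel m X s p v)
      = p m * (1 - s) + (\<Sum>v\<in>?N - {m}. stay rel m X s p v)"
    using fin by (subst sum.remove[of _ m]) (auto intro!: sum.cong)
  also have "(\<Sum>v\<in>?N - {m}. stay rel m X s p v) = (\<Sum>v\<in>X. stay rel m X s p v)"
    by (rule sum.mono_neutral_right) (use fin stay_0[OF p] in auto)
  finally have 1: "(\<Sum>v\<in>?N. if v = m then p m * (1 - s) else stay rel m X s p v)
      = p m * (1 - s) + (\<Sum>v\<in>X. stay rel m X s p v)" .
  have 2: "(\<Sum>v\<in>?N. \<Sum>w | w \<in> X \<and> f w = v. p w - stay rel m X s p w) = (\<Sum>w\<in>X. p w - stay rel m X s p w)"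
    by (rule sum.group) (use X(1) in auto)
  have 3: "(\<Sum>v\<in>?N. if v = \<mu> then ?a else 0) = ?a" using fin by (simp add: sum.delta')
  have "sum (cone_flow rel f \<mu> m X s p) ?N =
     (p m * (1 - s) + (\<Sum>v\<in>X. stay rel m X s p v) + (\<Sum>w\<in>X. p w - stay rel m X s p w) + ?a) / (1 - s * p m + ?a)"
    unfolding cone_flow_def sum_divide_distrib[symmetric] sum.distrib 1 2 3 ..
  also have "\<dots> = (1 - s * p m + ?a) / (1 - s * p m + ?a)"
    using sum_X[OF p] by (simp add: sum_subtractf algebra_simps)
  also have "\<dots> = 1" using total_pos[OF p s] by simp
  finally show ?thesis .
qed

private lemma cone_flow_nonneg:
  assumes p: "p \<in> simplex_pts \<sigma>" and s: "s \<in> {0..1}"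
  shows "0 \<le> cone_flow rel f \<mu> m X s p v"
proof -
  have "0 \<le> (\<Sum>w | w \<in> X \<and> f w = v. p w - stay rel m X s p w)"
    using stay_bounds[OF p] by (intro sum_nonneg) auto
  moreover have "0 \<le> p m * (1 - s)" using s simplex_ptsD(1)[OF p] by simp
  ultimately show ?thesis
    using total_pos[OF p s] stay_bounds[OF p, of s] unfolding cone_flow_def
    by (intro divide_nonneg_pos add_nonneg_nonneg) auto
qed

private lemma cone_flow_supp:
  assumes p: "p \<in> simplex_pts \<sigma>" and nz: "cone_flow rel f \<mu> m X s p v \<noteq> 0"
  obtains "v = m" "p m * (1 - s) \<noteq> 0" | "v \<in> X" "stay rel m X s p v > 0"
    | w where "w \<in> X" "f w = v" "stay rel m X s p w < p w" | "v = \<mu>" "s * p m + p m > 1"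
proof -
  have "(if v = m then p m * (1 - s) else stay rel m X s p v) \<noteq> 0
      \<or> (\<Sum>w | w \<in> X \<and> f w = v. p w - stay rel m X s p w) \<noteq> 0
      \<or> (if v = \<mu> then max 0 (s * p m + p m - 1) else 0) \<noteq> 0"
    using nz unfolding cone_flow_def by auto
  then consider "(if v = m then p m * (1 - s) else stay rel m X s p v) \<noteq> 0"
    | "(\<Sum>w | w \<in> X \<and> f w = v. p w - stay rel m X s p w) \<noteq> 0"
    | "(if v = \<mu> then max 0 (s * p m + p m - 1) else 0) \<noteq> 0" by blast
  then show ?thesis
  proof cases
    case 1
    show ?thesis
    proof (cases "v = m")
      case False
      then have "stay rel m X s p v > 0" using 1 stay_bounds(1)[OF p, of s v] by (auto simp: order.strict_iff_order)
      moreover have "v \<in> X" using False stay_0[OF p, of v s] calculation by force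
      ultimately show ?thesis using that(2) by blast
    qed (use 1 that(1) in auto)
  next
    case 2
    then obtain w where "w \<in> X" "f w = v" "p w - stay rel m X s p w \<noteq> 0"
      by (metis (mono_tags, lifting) mem_Collect_eq sum.neutral)
    then show ?thesis using that(3) stay_bounds(2)[OF p, of s w] by force
  next
    case 3
    then show ?thesis using that(4) by (auto split: if_splits)
  qed
qed

text \<open>Retained mass fills the chain from the bottom. If \<open>w\<close> were strictly below
  \<open>v\<close>, all the mass of \<open>w\<close> would be retained before any mass of
  \<open>v\<close>, so \<open>w\<close> could not have lost some.\<close>

private lemma stay_below_moved:
  assumes p: "p \<in> simplex_pts \<sigma>" and v: "v \<in> X" "stay rel m X s p v > 0"
    and w: "w \<in> X" "stay rel m X s p w < p w"
  shows "rel v w"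
proof (rule ccontr)
  assume n: "\<not> rel v w"
  then have wv: "rel w v" "w \<noteq> v" using X(2,3) v w refl by auto
  let ?B = "\<lambda>u. {z. z \<in> X \<and> rel z u \<and> z \<noteq> u}"
  have "insert w (?B w) \<subseteq> ?B v"
  proof
    fix z assume "z \<in> insert w (?B w)"
    then consider "z = w" | "z \<in> X" "rel z w" "z \<noteq> w" by blast
    then show "z \<in> ?B v"
    proof cases
      case 1 then show ?thesis using wv w by blast
    next
      case 2
      have zV: "z \<in> V" "w \<in> V" "v \<in> V" using X(2) 2(1) w(1) v(1) by blast+
      have "rel z v" using trans[OF zV] 2(2) wv(1) by blast
      moreover have "z \<noteq> v" using 2(2) n by blast
      ultimately show ?thesis using 2(1) by blast
    qed
  qed
  then have "sum p (insert w (?B w)) \<le> sum p (?B v)"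
    using X(1) simplex_ptsD(1)[OF p] by (intro sum_mono2) auto
  then have "p w + sum p (?B w) \<le> sum p (?B v)" using X(1) by simp
  then show False using v(2) w(2) by (auto simp: stay_def)
qed

text \<open>Retained vertices lie below the moved ones and hence below the images of these under
  \<open>f\<close>. The vertex \<mu> lies below all images, and it receives mass only when nothing
  is retained any more. All of them lie below \<open>m\<close>.\<close>

private lemma cone_flow_chain:
  assumes p: "p \<in> simplex_pts \<sigma>" and s: "s \<in> {0..1}"
  shows "is_chain_in (insert m Q) rel {v. cone_flow rel f \<mu> m X s p v \<noteq> 0}"
  unfolding is_chain_in_def
proof (intro conjI ballI)
  let ?S = "{v. cone_flow rel f \<mu> m X s p v \<noteq> 0}"
  have V: "insert m Q \<subseteq> V" using QV mV by auto
  show "?S \<subseteq> insert m Q"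
  proof
    fix v assume "v \<in> ?S"
    then have "cone_flow rel f \<mu> m X s p v \<noteq> 0" by simp
    from cone_flow_supp[OF p this] show "v \<in> insert m Q"
      by cases (use X(2) f mu in auto)
  qed
  have le_m: "rel v m" if "v \<in> ?S" for v
  proof -
    have "cone_flow rel f \<mu> m X s p v \<noteq> 0" using that by simp
    from cone_flow_supp[OF p this] show ?thesis
      by cases (use X(2) f mu refl mV in auto)
  qed
  have no_mu: "\<not> s * p m + p m > 1" if "stay rel m X s p v > 0" "v \<in> X" for v
  proof
    assume "s * p m + p m > 1"
    moreover have "0 \<le> (\<Sum>z | z \<in> X \<and> rel z v \<and> z \<noteq> v. p z)"
      using simplex_ptsD(1)[OF p] by (intro sum_nonneg) auto
    ultimately show False using that by (auto simp: stay_def)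
  qed
  have mov: "rel v (f w)" if "v \<in> X" "stay rel m X s p v > 0" "w \<in> X" "stay rel m X s p w < p w" for v w
    using stay_below_moved[OF p that] X(2)[OF that(1)] X(2)[OF that(3)] f[of w] trans[of v w "f w"] QV by blast
  fix a b assume ab: "a \<in> ?S" "b \<in> ?S"
  then have ab': "cone_flow rel f \<mu> m X s p a \<noteq> 0" "cone_flow rel f \<mu> m X s p b \<noteq> 0" by auto
  from cone_flow_supp[OF p ab'(1)] show "rel a b \<or> rel b a"
  proof cases
    case 1 then show ?thesis using le_m ab by auto
  next
    case a: 2
    from cone_flow_supp[OF p ab'(2)] show ?thesis
    proof cases
      case 4 then show ?thesis using no_mu[OF a(2,1)] by simp
    qed (use le_m ab a X(3) mov in auto)
  next
    case a: (3 w)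
    have fa: "f w \<in> Q" "rel \<mu> (f w)" using f X(2) a by auto
    from cone_flow_supp[OF p ab'(2)] show ?thesis
    proof cases
      case b: (3 w')
      then show ?thesis using a X(3)[of w w'] X(2) fmono[of w w'] fmono[of w' w] by auto
    qed (use le_m ab a mov fa in auto)
  next
    case a: 4
    from cone_flow_supp[OF p ab'(2)] show ?thesis
    proof cases
      case b: (3 w)
      then show ?thesis using f X(2) a by auto
    next
      case 2 then show ?thesis using no_mu[OF 2(2,1)] a by simp
    qed (use le_m ab a mu QV refl in auto)
  qed
qed

lemma cone_flow_in:
  assumes p: "p \<in> simplex_pts \<sigma>" and s: "s \<in> {0..1}"
  shows "cone_flow rel f \<mu> m X s p \<in> realization_set (insert m Q) rel"
    and "v \<notin> X \<union> f ` X \<union> {\<mu>, m} \<Longrightarrow> cone_flow rel f \<mu> m X s p v = 0"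
proof -
  have out: "cone_flow rel f \<mu> m X s p v = 0" if "v \<notin> X \<union> f ` X \<union> {\<mu>, m}" for v
  proof (rule ccontr)
    assume "cone_flow rel f \<mu> m X s p v \<noteq> 0"
    from cone_flow_supp[OF p this] show False by cases (use that in auto)
  qed
  let ?S = "{v. cone_flow rel f \<mu> m X s p v \<noteq> 0}"
  have sub: "?S \<subseteq> X \<union> f ` X \<union> {\<mu>, m}" using out by blast
  have fin: "finite (X \<union> f ` X \<union> {\<mu>, m})" using X(1) by simp
  have "sum (cone_flow rel f \<mu> m X s p) ?S = sum (cone_flow rel f \<mu> m X s p) (X \<union> f ` X \<union> {\<mu>, m})"
    by (rule sum.mono_neutral_left[OF fin sub]) auto
  then show "cone_flow rel f \<mu> m X s p \<in> realization_set (insert m Q) rel"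
    using cone_flow_sum[OF p s] cone_flow_nonneg[OF p s] cone_flow_chain[OF p s] finite_subset[OF sub fin]
    by (simp add: realization_set_iff)
  show "v \<notin> X \<union> f ` X \<union> {\<mu>, m} \<Longrightarrow> cone_flow rel f \<mu> m X s p v = 0" by (rule out)
qed

lemma cone_flow_end:
  assumes p: "p \<in> simplex_pts \<sigma>"
  shows "cone_flow rel f \<mu> m X 1 p \<in> realization_set Q rel"
proof -
  have "cone_flow rel f \<mu> m X 1 p m = 0"
  proof (rule ccontr)
    assume "\<not> ?thesis"
    from cone_flow_supp[OF p this] show False
      by cases (use mV mu f X(2) in auto)
  qed
  then have "{v. cone_flow rel f \<mu> m X 1 p v \<noteq> 0} \<subseteq> Q"
    using cone_flow_in(1)[OF p, of 1] by (auto simp: realization_set_iff is_chain_in_def)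
  then show ?thesis using cone_flow_in(1)[OF p, of 1] by (simp add: realization_set_iff is_chain_in_def)
qed

private lemma stay_full:
  assumes p: "p \<in> simplex_pts \<sigma>" and s: "s * p m = 0" and w: "w \<noteq> m"
  shows "stay rel m X s p w = p w"
proof (cases "w \<in> X")
  case True
  let ?B = "{z. z \<in> X \<and> rel z w \<and> z \<noteq> w}"
  have "sum p (insert w ?B) \<le> sum p X"
    using X(1) True simplex_ptsD(1)[OF p] by (intro sum_mono2) auto
  then have "p w + sum p ?B \<le> 1 - p m" using X(1) sum_X[OF p] by simp
  then show ?thesis using s by (auto simp: stay_def)
next
  case False
  then show ?thesis using w stay_0[OF p] simplex_ptsD(2)[OF p] by auto
qed

lemma cone_flow_id:
  assumes p: "p \<in> simplex_pts \<sigma>" and s: "s * p m = 0"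
  shows "cone_flow rel f \<mu> m X s p = p"
proof
  fix v
  have "(\<Sum>w | w \<in> X \<and> f w = v. p w - stay rel m X s p w) = 0"
    by (intro sum.neutral) (use stay_full[OF p s] in auto)
  moreover have "p m \<le> 1" using simplex_pts_le_1[OF p] face(1) by (simp add: is_face_def)
  ultimately show "cone_flow rel f \<mu> m X s p v = p v"
    using s stay_full[OF p s, of v] by (auto simp: cone_flow_def algebra_simps)
qed

text \<open>The flow can thus be defined from the support of a point alone, while its continuity is
  proved on a closed simplex with a fixed vertex set.\<close>

lemma cone_flow_indep:
  assumes p: "p \<in> simplex_pts \<sigma>"
  shows "cone_flow rel f \<mu> m ({v. p v \<noteq> 0} - {m}) s p = cone_flow rel f \<mu> m X s p"
proof
  fix v
  let ?Y = "{v. p v \<noteq> 0} - {m}"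
  have YX: "?Y \<subseteq> X" using simplex_ptsD(2)[OF p] by auto
  have st: "stay rel m ?Y s p w = stay rel m X s p w" for w
  proof -
    have "(\<Sum>z | z \<in> ?Y \<and> rel z w \<and> z \<noteq> w. p z) = (\<Sum>z | z \<in> X \<and> rel z w \<and> z \<noteq> w. p z)"
      by (rule sum.mono_neutral_left) (use X(1) YX in auto)
    then show ?thesis by (simp add: stay_def)
  qed
  have st0: "stay rel m X s p w = 0" if "p w = 0" for w
    using stay_bounds[OF p, of s w] that by simp
  have "(\<Sum>w | w \<in> ?Y \<and> f w = v. p w - stay rel m X s p w) = (\<Sum>w | w \<in> X \<and> f w = v. p w - stay rel m X s p w)"
    by (rule sum.mono_neutral_left) (use X(1) YX st0 in auto)
  then show "cone_flow rel f \<mu> m ?Y s p v = cone_flow rel f \<mu> m X s p v"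
    by (simp add: cone_flow_def st)
qed

lemma cone_flow_continuous:
  "continuous_on ({0..1} \<times> simplex_pts \<sigma>) (\<lambda>z. cone_flow rel f \<mu> m X (fst z) (snd z) v)"
proof -
  have c: "continuous_on ({0..1} \<times> simplex_pts \<sigma>) (\<lambda>z. snd z w)" for w :: 'v
    by (rule continuous_on_snd_coordinate)
  have st: "continuous_on ({0..1} \<times> simplex_pts \<sigma>) (\<lambda>z. stay rel m X (fst z) (snd z) w)" for w
    unfolding stay_def by (intro continuous_intros c)
  have "1 - fst z * snd z m + max 0 (fst z * snd z m + snd z m - 1) \<noteq> 0" if "z \<in> {0..1} \<times> simplex_pts \<sigma>" for z
    using total_pos[of "snd z" "fst z"] that by auto
  then show ?thesis
    unfolding cone_flow_def
    by (cases "v = m"; cases "v = \<mu>"; simp; intro continuous_intros c st; auto)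
qed

end

text \<open>The elements of \<open>M\<close> are maximal, so no chain contains two of them. Every
  simplex has at most one apex, and the retractions of all the cones can be carried out
  simultaneously.\<close>

lemma strong_deformation_retract_cones:
  fixes f :: "'v \<Rightarrow> 'v \<Rightarrow> 'v"
  assumes refl: "\<And>x. x \<in> V \<Longrightarrow> rel x x"
    and trans: "\<And>x y z. x \<in> V \<Longrightarrow> y \<in> V \<Longrightarrow> z \<in> V \<Longrightarrow> rel x y \<Longrightarrow> rel y z \<Longrightarrow> rel x z"
    and antisym: "\<And>x y. x \<in> V \<Longrightarrow> y \<in> V \<Longrightarrow> rel x y \<Longrightarrow> rel y x \<Longrightarrow> x = y"
    and V: "V = Q \<union> M" "Q \<inter> M = {}"
    and maxi: "\<And>m x. m \<in> M \<Longrightarrow> x \<in> V \<Longrightarrow> rel m x \<Longrightarrow> x = m"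
    and f: "\<And>m x. m \<in> M \<Longrightarrow> x \<in> Q \<Longrightarrow> rel x m \<Longrightarrow> f m x \<in> Q \<and> rel x (f m x) \<and> rel (f m x) m \<and> rel (\<mu> m) (f m x)"
    and fmono: "\<And>m x y. m \<in> M \<Longrightarrow> x \<in> Q \<Longrightarrow> y \<in> Q \<Longrightarrow> rel x y \<Longrightarrow> rel y m \<Longrightarrow> rel (f m x) (f m y)"
    and mu: "\<And>m. m \<in> M \<Longrightarrow> \<mu> m \<in> Q \<and> rel (\<mu> m) m"
  shows "strong_deformation_retract rel V Q"
proof -
  define K where "K = (\<lambda>(s :: real, p). if \<exists>m\<in>M. p m \<noteq> 0 then
      (let m = (THE m. m \<in> M \<and> p m \<noteq> 0) in cone_flow rel (f m) (\<mu> m) m ({v. p v \<noteq> 0} - {m}) s p) else p)"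
  have QV: "Q \<subseteq> V" using V by auto
  have fm: "\<sigma> - {m} \<subseteq> Q \<and> m \<in> V \<and> m \<notin> Q \<and> (\<forall>x\<in>\<sigma>. rel x m)"
    if "is_face V rel \<sigma>" "m \<in> M" "m \<in> \<sigma>" for \<sigma> m
  proof -
    have le: "rel x m" if "x \<in> \<sigma>" for x
      using that \<open>is_face V rel \<sigma>\<close> \<open>m \<in> M\<close> \<open>m \<in> \<sigma>\<close> maxi[of m x] refl
      unfolding is_face_def is_chain_in_def by blast
    moreover have "x \<in> Q" if "x \<in> \<sigma> - {m}" for x
    proof (rule ccontr)
      assume "x \<notin> Q"
      then have "x \<in> M" using that \<open>is_face V rel \<sigma>\<close> V by (auto simp: is_face_def is_chain_in_def)
      then have "m = x" using le[of x] that maxi[of x m] V \<open>m \<in> M\<close> by auto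
      then show False using that by simp
    qed
    ultimately show ?thesis using V that by blast
  qed
  have loc: "cone_flow rel (f m) (\<mu> m) m (\<sigma> - {m}) s p \<in> realization_set V rel
      \<and> (\<forall>v. v \<notin> (\<sigma> - {m}) \<union> f m ` (\<sigma> - {m}) \<union> {\<mu> m, m} \<longrightarrow> cone_flow rel (f m) (\<mu> m) m (\<sigma> - {m}) s p v = 0)
      \<and> cone_flow rel (f m) (\<mu> m) m (\<sigma> - {m}) 1 p \<in> realization_set Q rel
      \<and> (s * p m = 0 \<longrightarrow> cone_flow rel (f m) (\<mu> m) m (\<sigma> - {m}) s p = p)
      \<and> cone_flow rel (f m) (\<mu> m) m ({v. p v \<noteq> 0} - {m}) s p = cone_flow rel (f m) (\<mu> m) m (\<sigma> - {m}) s p"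
    if "is_face V rel \<sigma>" "m \<in> M" "m \<in> \<sigma>" "p \<in> simplex_pts \<sigma>" "s \<in> {0..1}" for \<sigma> m s p
  proof -
    have *: "\<sigma> - {m} \<subseteq> Q" "m \<in> V" "m \<notin> Q" "\<And>x. x \<in> \<sigma> \<Longrightarrow> rel x m" using fm[OF that(1-3)] by auto
    have mm: "\<mu> m \<in> Q" "rel (\<mu> m) m" using mu[OF that(2)] by auto
    note prems = refl trans antisym QV *(2,3) f[OF that(2)] fmono[OF that(2)] mm that(1,3) *(1,4)
    have "insert m Q \<subseteq> V" using QV * by auto
    then have "realization_set (insert m Q) rel \<subseteq> realization_set V rel" by (rule realization_set_mono)
    then have "cone_flow rel (f m) (\<mu> m) m (\<sigma> - {m}) s p \<in> realization_set V rel"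
      using cone_flow_in(1)[where V=V and Q=Q and rel=rel and f="f m" and \<mu>="\<mu> m", OF prems that(4,5)]
      by (rule subsetD)
    moreover note cone_flow_in(2)[where V=V and Q=Q and rel=rel and f="f m" and \<mu>="\<mu> m", OF prems that(4,5)]
      cone_flow_end[where V=V and Q=Q and rel=rel and f="f m" and \<mu>="\<mu> m", OF prems that(4)]
      cone_flow_id[where V=V and Q=Q and rel=rel and f="f m" and \<mu>="\<mu> m", OF prems that(4)]
      cone_flow_indep[where V=V and Q=Q and rel=rel and f="f m" and \<mu>="\<mu> m", OF prems that(4)]
    ultimately show ?thesis by (intro conjI allI impI)
  qed
  have KQ: "K (s, p) = p" if "\<And>m. m \<in> M \<Longrightarrow> p m = 0" for s p using that by (auto simp: K_def)
  have KM: "K (s, p) = cone_flow rel (f m) (\<mu> m) m (\<sigma> - {m}) s p"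
    if "is_face V rel \<sigma>" "m \<in> M" "m \<in> \<sigma>" "p \<in> simplex_pts \<sigma>" "s \<in> {0..1}" for \<sigma> m s p
  proof (cases "p m = 0")
    case True
    have "p m' = 0" if "m' \<in> M" for m'
    proof (cases "m' = m")
      case False
      then have "m' \<notin> \<sigma>" using fm[OF \<open>is_face V rel \<sigma>\<close> \<open>m \<in> M\<close> \<open>m \<in> \<sigma>\<close>] that V(2) by auto
      then show ?thesis using simplex_ptsD(2)[OF \<open>p \<in> simplex_pts \<sigma>\<close>] by simp
    qed (use True in simp)
    then show ?thesis using KQ loc[OF that] True by simp
  next
    case False
    have "m' = m" if "m' \<in> M" "p m' \<noteq> 0" for m'
    proof (rule ccontr)
      assume "m' \<noteq> m"
      then have "m' \<notin> \<sigma>" using fm[OF \<open>is_face V rel \<sigma>\<close> \<open>m \<in> M\<close> \<open>m \<in> \<sigma>\<close>] that V(2) by auto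
      then show False using simplex_ptsD(2)[OF \<open>p \<in> simplex_pts \<sigma>\<close>] that by simp
    qed
    then have "(THE m. m \<in> M \<and> p m \<noteq> 0) = m" using \<open>m \<in> M\<close> False by blast
    then show ?thesis using loc[OF that] False \<open>m \<in> M\<close> by (auto simp: K_def Let_def)
  qed
  have faceQ: "is_face Q rel \<sigma>" if "is_face V rel \<sigma>" "\<sigma> \<inter> M = {}" for \<sigma>
    using that V(1) by (auto simp: is_face_def is_chain_in_def)
  have K0: "K (s, p) = p" if "is_face V rel \<sigma>" "\<sigma> \<inter> M = {}" "p \<in> simplex_pts \<sigma>" for \<sigma> s p
    by (rule KQ) (use that simplex_ptsD(2)[OF that(3)] in auto)
  show ?thesis
  proof (rule strong_deformation_retractI[where K=K, OF QV])
    fix \<sigma> assume fc: "is_face V rel \<sigma>"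
    then have fin: "finite \<sigma>" by (simp add: is_face_def)
    show "\<exists>N. finite N \<and> (\<forall>t\<in>{0..1}. \<forall>p\<in>simplex_pts \<sigma>.
        K (t,p) \<in> realization_set V rel \<and> (\<forall>v. v \<notin> N \<longrightarrow> K (t,p) v = 0))"
    proof (cases "\<sigma> \<inter> M = {}")
      case True
      then show ?thesis using K0[OF fc] simplex_in_realization_set[OF fc] simplex_ptsD(2) fin
        by (intro exI[of _ \<sigma>] conjI ballI allI impI) auto
    next
      case False
      then obtain m where m: "m \<in> M" "m \<in> \<sigma>" by auto
      show ?thesis
        by (intro exI[of _ "(\<sigma> - {m}) \<union> f m ` (\<sigma> - {m}) \<union> {\<mu> m, m}"] conjI ballI)
           (use fin KM[OF fc m] loc[OF fc m] in auto)
    qed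
    fix v
    show "continuous_on ({0..1} \<times> simplex_pts \<sigma>) (\<lambda>z. K z v)"
    proof (cases "\<sigma> \<inter> M = {}")
      case True
      have "continuous_on ({0..1::real} \<times> simplex_pts \<sigma>) (\<lambda>z. snd z v)"
        by (rule continuous_on_snd_coordinate)
      then show ?thesis by (rule continuous_on_eq) (use K0[OF fc True] in auto)
    next
      case False
      then obtain m where m: "m \<in> M" "m \<in> \<sigma>" by auto
      have *: "\<sigma> - {m} \<subseteq> Q" "m \<in> V" "m \<notin> Q" "\<And>x. x \<in> \<sigma> \<Longrightarrow> rel x m" using fm[OF fc m] by auto
      have mm: "\<mu> m \<in> Q" "rel (\<mu> m) m" using mu[OF m(1)] by auto
      note prems = refl trans antisym QV *(2,3) f[OF m(1)] fmono[OF m(1)] mm fc m(2) *(1,4)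
      have "continuous_on ({0..1} \<times> simplex_pts \<sigma>) (\<lambda>z. cone_flow rel (f m) (\<mu> m) m (\<sigma> - {m}) (fst z) (snd z) v)"
        by (rule cone_flow_continuous[where V=V and Q=Q and rel=rel and f="f m" and \<mu>="\<mu> m", OF prems])
      then show ?thesis by (rule continuous_on_eq) (use KM[OF fc m] in auto)
    qed
  next
    fix p assume "p \<in> realization_set V rel"
    from face_supp[OF this] have s: "is_face V rel {v. p v \<noteq> 0}" "p \<in> simplex_pts {v. p v \<noteq> 0}" .
    show "K (1, p) \<in> realization_set Q rel"
    proof (cases "{v. p v \<noteq> 0} \<inter> M = {}")
      case True
      then show ?thesis using K0[OF s(1) True s(2)] simplex_in_realization_set[OF faceQ[OF s(1) True]] s(2) by auto
    next
      case False
      then obtain m where m: "m \<in> M" "m \<in> {v. p v \<noteq> 0}" by auto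
      show ?thesis using KM[OF s(1) m s(2), of 1] loc[OF s(1) m s(2), of 1] by simp
    qed
    show "K (0, p) = p"
    proof (cases "{v. p v \<noteq> 0} \<inter> M = {}")
      case True
      then show ?thesis using K0[OF s(1) True s(2)] by simp
    next
      case False
      then obtain m where m: "m \<in> M" "m \<in> {v. p v \<noteq> 0}" by auto
      show ?thesis using KM[OF s(1) m s(2), of 0] loc[OF s(1) m s(2), of 0] by simp
    qed
  next
    fix t p assume p: "p \<in> realization_set Q rel"
    show "K (t, p) = p"
      by (rule KQ) (use p V(2) in \<open>auto simp: realization_set_iff is_chain_in_def\<close>)
  qed
qed

section \<open>Contractibility from a filtration by volume\<close>

lemma choice2_on:
  assumes "\<And>m. m \<in> A \<Longrightarrow> \<exists>x y. P m x y" shows "\<exists>X Y. \<forall>m\<in>A. P m (X m) (Y m)"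
  using assms by metis

text \<open>The sets of elements of volume below a bound form a filtration. One passes from one stage to
  the previous one by pushing the elements of top volume up to their closures, and then removing these
  closures, each of which has a conically contractible set of predecessors of smaller volume.\<close>

theorem contractible_realization_by_volume:
  fixes vol :: "'v \<Rightarrow> nat"
  assumes refl: "\<And>x. x \<in> V \<Longrightarrow> rel x x"
    and trans: "\<And>x y z. x \<in> V \<Longrightarrow> y \<in> V \<Longrightarrow> z \<in> V \<Longrightarrow> rel x y \<Longrightarrow> rel y z \<Longrightarrow> rel x z"
    and antisym: "\<And>x y. x \<in> V \<Longrightarrow> y \<in> V \<Longrightarrow> rel x y \<Longrightarrow> rel y x \<Longrightarrow> x = y"
    and vol: "\<And>x y. x \<in> V \<Longrightarrow> y \<in> V \<Longrightarrow> rel x y \<Longrightarrow> vol x \<le> vol y"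
    and R: "\<And>x. x \<in> V \<Longrightarrow> R x \<in> V \<and> rel x (R x) \<and> vol (R x) = vol x"
    and R_eq: "\<And>x y. x \<in> V \<Longrightarrow> y \<in> V \<Longrightarrow> rel x y \<Longrightarrow> vol x = vol y \<Longrightarrow> R x = R y"
    and m0: "m0 \<in> V"
    and red: "\<And>m. m \<in> V \<Longrightarrow> R m = m \<Longrightarrow> m \<noteq> m0 \<Longrightarrow> \<exists>\<mu> f. \<mu> \<in> V \<and> vol \<mu> < vol m \<and> rel \<mu> m \<and>
        (\<forall>x\<in>V. rel x m \<and> vol x < vol m \<longrightarrow> f x \<in> V \<and> vol (f x) < vol m \<and> rel x (f x) \<and> rel (f x) m \<and> rel \<mu> (f x)) \<and>
        (\<forall>x\<in>V. \<forall>y\<in>V. rel x y \<and> rel y m \<and> vol y < vol m \<longrightarrow> rel (f x) (f y))"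
  shows "contractible_space (realization V rel)"
proof -
  have RR: "R (R x) = R x" if "x \<in> V" for x using R_eq[of x "R x"] R[OF that] that by auto
  \<comment> \<open>The closure of an element of least volume has nothing of smaller volume below
    it, so by \<open>red\<close> this closure is \<open>m0\<close>.\<close>
  have vmin: "vol m0 \<le> vol x \<and> R m0 = m0" if "x \<in> V" for x
  proof -
    obtain y where y: "y \<in> V" "\<And>x. x \<in> V \<Longrightarrow> vol y \<le> vol x"
      using ex_has_least_nat[of "\<lambda>x. x \<in> V" m0 vol] m0 by blast
    have "R y = m0"
    proof (rule ccontr)
      assume "R y \<noteq> m0"
      then obtain \<mu> where "\<mu> \<in> V" "vol \<mu> < vol (R y)" using red[of "R y"] R RR y by blast
      then show False using y R[of y] by (metis not_le)
    qed
    then show ?thesis using RR[OF y(1)] R[OF y(1)] y(2) that by metis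
  qed
  define E where "E = (\<lambda>i. {x \<in> V. vol x < vol m0 + i})"
  define M where "M = (\<lambda>i. {x \<in> V. vol x = vol m0 + i \<and> R x = x})"
  \<comment> \<open>Odd stages contain everything of volume below a bound. Even stages add to such a
    set only the closed elements of the next volume: these are the apexes of the cones.\<close>
  define S where "S = (\<lambda>j. if even j then E (j div 2) \<union> M (j div 2) else E (j div 2 + 1))"
  have EV: "E i \<subseteq> V" "M i \<subseteq> V" for i by (auto simp: E_def M_def)
  have lin: "strong_deformation_retract rel (E (i + 1)) (E i \<union> M i)" for i
  proof (rule strong_deformation_retract_linear[where u="\<lambda>x. if vol x = vol m0 + i then R x else x"])
    show "E i \<union> M i \<subseteq> E (i + 1)" by (auto simp: E_def M_def)
    fix \<sigma> assume f: "is_face (E (i+1)) rel \<sigma>"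
    let ?u = "\<lambda>x. if vol x = vol m0 + i then R x else x"
    have sV: "x \<in> V" "vol x \<le> vol m0 + i" if "x \<in> \<sigma>" for x using f that by (auto simp: is_face_def is_chain_in_def E_def)
    have cmp: "rel a b \<or> rel b a" if "a \<in> \<sigma>" "b \<in> \<sigma>" for a b using f that by (auto simp: is_face_def is_chain_in_def)
    have 1: "rel a (R b)" if ab: "a \<in> \<sigma>" "b \<in> \<sigma>" "vol b = vol m0 + i" for a b
      using cmp[OF ab(1,2)]
    proof
      assume "rel a b"
      then show ?thesis using trans[of a b "R b"] R[of b] sV ab by blast
    next
      assume ba: "rel b a"
      then have "vol a = vol b" using vol[of b a] sV[of a] sV[of b] ab by auto
      then show ?thesis using R_eq[of b a] ba R[of a] sV ab by auto
    qed
    have 2: "R a = R b" if "a \<in> \<sigma>" "b \<in> \<sigma>" "vol a = vol m0 + i" "vol b = vol m0 + i" for a b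
      using cmp[OF that(1,2)] R_eq[of a b] R_eq[of b a] sV that by auto
    show "is_face (E (i+1)) rel (\<sigma> \<union> ?u ` \<sigma>)"
      unfolding is_face_def is_chain_in_def
    proof (intro conjI ballI)
      show "finite (\<sigma> \<union> ?u ` \<sigma>)" "\<sigma> \<union> ?u ` \<sigma> \<noteq> {}" using f by (auto simp: is_face_def)
      show "\<sigma> \<union> ?u ` \<sigma> \<subseteq> E (i + 1)" using sV R by (fastforce simp: E_def)
      have uR: "y \<in> \<sigma> \<or> (\<exists>b\<in>\<sigma>. vol b = vol m0 + i \<and> y = R b)" if "y \<in> \<sigma> \<union> ?u ` \<sigma>" for y
        using that by auto
      have 3: "rel (R a) (R b)" if "a \<in> \<sigma>" "b \<in> \<sigma>" "vol a = vol m0 + i" "vol b = vol m0 + i" for a b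
        using 2[OF that] refl[of "R b"] R[of b] sV(1)[OF that(2)] by simp
      fix a b assume "a \<in> \<sigma> \<union> ?u ` \<sigma>" "b \<in> \<sigma> \<union> ?u ` \<sigma>"
      from uR[OF this(1)] uR[OF this(2)] show "rel a b \<or> rel b a"
        using cmp 1 3 by (elim disjE bexE conjE) auto
    qed
  qed (use R RR in \<open>auto simp: E_def M_def\<close>)
  have cone: "strong_deformation_retract rel (E (i + 1) \<union> M (i + 1)) (E (i + 1))" for i
  proof -
    have ne: "m \<in> V" "R m = m" "m \<noteq> m0" if "m \<in> M (i + 1)" for m using that by (auto simp: M_def)
    have "\<exists>\<mu> f. \<forall>m \<in> M (i+1). \<mu> m \<in> V \<and> vol (\<mu> m) < vol m \<and> rel (\<mu> m) m \<and>
        (\<forall>x\<in>V. rel x m \<and> vol x < vol m \<longrightarrow> f m x \<in> V \<and> vol (f m x) < vol m \<and> rel x (f m x) \<and> rel (f m x) m \<and> rel (\<mu> m) (f m x)) \<and>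
        (\<forall>x\<in>V. \<forall>y\<in>V. rel x y \<and> rel y m \<and> vol y < vol m \<longrightarrow> rel (f m x) (f m y))"
      using red[OF ne] by (intro choice2_on) blast
    then obtain \<mu> f where mf: "\<And>m. m \<in> M (i+1) \<Longrightarrow> \<mu> m \<in> V \<and> vol (\<mu> m) < vol m \<and> rel (\<mu> m) m \<and>
        (\<forall>x\<in>V. rel x m \<and> vol x < vol m \<longrightarrow> f m x \<in> V \<and> vol (f m x) < vol m \<and> rel x (f m x) \<and> rel (f m x) m \<and> rel (\<mu> m) (f m x)) \<and>
        (\<forall>x\<in>V. \<forall>y\<in>V. rel x y \<and> rel y m \<and> vol y < vol m \<longrightarrow> rel (f m x) (f m y))"
      by blast
    have Mv: "vol m = vol m0 + (i + 1)" if "m \<in> M (i + 1)" for m using that by (auto simp: M_def)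
    show ?thesis
    proof (rule strong_deformation_retract_cones[where M="M (i+1)" and f=f and \<mu>=\<mu>])
      fix x assume "x \<in> E (i + 1) \<union> M (i + 1)" then show "rel x x" using EV refl by blast
    next
      fix x y z assume "x \<in> E (i + 1) \<union> M (i + 1)" "y \<in> E (i + 1) \<union> M (i + 1)" "z \<in> E (i + 1) \<union> M (i + 1)"
        "rel x y" "rel y z"
      then show "rel x z" using EV trans by (metis UnE subsetD)
    next
      fix x y assume "x \<in> E (i + 1) \<union> M (i + 1)" "y \<in> E (i + 1) \<union> M (i + 1)" "rel x y" "rel y x"
      then show "x = y" using EV antisym by (metis UnE subsetD)
    next
      show "E (i + 1) \<inter> M (i + 1) = {}" by (auto simp: E_def M_def)
    next
      fix m x assume a: "m \<in> M (i + 1)" "x \<in> E (i + 1) \<union> M (i + 1)" "rel m x"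
      then have V: "m \<in> V" "x \<in> V" using EV by auto
      then have "x \<in> M (i + 1)" using vol[OF V a(3)] a(2) Mv[OF a(1)] by (auto simp: E_def)
      then have "R x = x" "vol x = vol m0 + (i + 1)" "R m = m" using a(1) unfolding M_def by blast+
      then have "R x = x" "vol m = vol x" "R m = m" using Mv[OF a(1)] by (simp_all only:)
      then show "x = m" using R_eq[OF V a(3)] by metis
    next
      fix m x assume a: "m \<in> M (i + 1)" "x \<in> E (i + 1)" "rel x m"
      then show "f m x \<in> E (i + 1) \<and> rel x (f m x) \<and> rel (f m x) m \<and> rel (\<mu> m) (f m x)"
        using mf[OF a(1)] Mv[OF a(1)] by (auto simp: E_def)
    next
      fix m x y assume a: "m \<in> M (i + 1)" "x \<in> E (i + 1)" "y \<in> E (i + 1)" "rel x y" "rel y m"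
      then show "rel (f m x) (f m y)"
        using mf[OF a(1)] Mv[OF a(1)] by (auto simp: E_def)
    next
      fix m assume a: "m \<in> M (i + 1)"
      then show "\<mu> m \<in> E (i + 1) \<and> rel (\<mu> m) m" using mf[OF a(1)] Mv[OF a(1)] by (auto simp: E_def)
    qed simp
  qed
  show ?thesis
  proof (rule contractible_realization_union[where S=S and m=m0])
    fix j show "strong_deformation_retract rel (S (Suc j)) (S j)"
    proof (cases "even j")
      case True
      then show ?thesis using lin[of "j div 2"] by (simp add: S_def)
    next
      case False
      then have "Suc j div 2 = j div 2 + 1" by (simp add: odd_Suc_div_two)
      then show ?thesis using False cone[of "j div 2"] by (simp add: S_def)
    qed
  next
    have "x = m0" if "x \<in> M 0" for x
    proof (rule ccontr)
      assume "x \<noteq> m0"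
      moreover have x: "x \<in> V" "R x = x" "vol x = vol m0" using that by (auto simp: M_def)
      ultimately obtain \<mu> where "\<mu> \<in> V" "vol \<mu> < vol x" using red[OF x(1,2)] by blast
      then show False using vmin[of \<mu>] x by auto
    qed
    moreover have "m0 \<in> M 0" using m0 vmin[OF m0] unfolding M_def by (intro CollectI conjI) auto
    ultimately have "M 0 = {m0}" by blast
    moreover have "E 0 = {}" using vmin unfolding E_def by (metis (no_types, lifting) Collect_empty_eq add.right_neutral not_le)
    ultimately show "S 0 = {m0}" by (simp add: S_def)
  next
    have "x \<in> S (2 * (vol x - vol m0) + 1)" if "x \<in> V" for x
      using that vmin[OF that] by (auto simp: S_def E_def)
    moreover have "S i \<subseteq> V" for i by (cases "even i") (simp_all add: S_def EV)
    ultimately show "V = (\<Union>i. S i)" by blast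
  qed (use refl m0 in auto)
qed

section \<open>Trees as separation relations\<close>

text \<open>A tree with labelled vertices \<open>N\<close> is described by the relation \<open>s k i j\<close>: the vertex \<open>k\<close>
  separates \<open>i\<close> from \<open>j\<close>. Its unlabelled vertices correspond to the maximal sets of pairwise adjacent
  (that is, unseparated) labels.\<close>

locale sep_tree =
  fixes N :: "'a set" and s :: "'a \<Rightarrow> 'a \<Rightarrow> 'a \<Rightarrow> bool"
  assumes dom: "s k i j \<Longrightarrow> k \<in> N \<and> i \<in> N \<and> j \<in> N \<and> i \<noteq> k \<and> j \<noteq> k"
    and irrefl: "\<not> s k i i"
    and sym: "s k i j \<Longrightarrow> s k j i"
    and tri: "s k i l \<Longrightarrow> j \<in> N \<Longrightarrow> j \<noteq> k \<Longrightarrow> s k i j \<or> s k j l"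
    and ax: "s k i l \<Longrightarrow> \<not> s l i k"

definition sep_adj :: "'a set \<Rightarrow> ('a \<Rightarrow> 'a \<Rightarrow> 'a \<Rightarrow> bool) \<Rightarrow> 'a \<Rightarrow> 'a \<Rightarrow> bool" where
  "sep_adj N s i j \<longleftrightarrow> i \<in> N \<and> j \<in> N \<and> i \<noteq> j \<and> (\<forall>l. \<not> s l i j)"

text \<open>The first label on the way from \<open>k\<close> to \<open>i\<close>.\<close>

definition sep_nb :: "'a set \<Rightarrow> ('a \<Rightarrow> 'a \<Rightarrow> 'a \<Rightarrow> bool) \<Rightarrow> 'a \<Rightarrow> 'a \<Rightarrow> 'a" where
  "sep_nb N s k i = (SOME a. sep_adj N s k a \<and> (a = i \<or> s a k i))"

text \<open>For adjacent \<open>k\<close> and \<open>i\<close> these are the labels around the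
  unlabelled vertex between \<open>k\<close> and \<open>i\<close>; an unlabelled vertex is
  identified with this set.\<close>

definition sep_hyp :: "'a set \<Rightarrow> ('a \<Rightarrow> 'a \<Rightarrow> 'a \<Rightarrow> bool) \<Rightarrow> 'a \<Rightarrow> 'a \<Rightarrow> 'a set" where
  "sep_hyp N s k i = insert k {j. sep_adj N s k j \<and> \<not> s k i j}"

definition sep_hyps :: "'a set \<Rightarrow> ('a \<Rightarrow> 'a \<Rightarrow> 'a \<Rightarrow> bool) \<Rightarrow> 'a set set" where
  "sep_hyps N s = {sep_hyp N s k i | k i. sep_adj N s k i}"

context sep_tree
begin

abbreviation "adj \<equiv> sep_adj N s"
abbreviation "nb \<equiv> sep_nb N s"
abbreviation "hyp \<equiv> sep_hyp N s"
abbreviation "hyps \<equiv> sep_hyps N s"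

lemma adj_sym: "adj i j \<Longrightarrow> adj j i"
  unfolding sep_adj_def using sym by blast

lemma adjD: "adj i j \<Longrightarrow> i \<in> N \<and> j \<in> N \<and> i \<noteq> j" "adj i j \<Longrightarrow> \<not> s l i j"
  by (auto simp: sep_adj_def)

lemma between_order:
  assumes "s l k a" "s a k i" shows "s a l i"
proof -
  have "\<not> s a k l" using ax[OF assms(1)] .
  moreover have "l \<in> N" "l \<noteq> a" using dom[OF assms(1)] by auto
  ultimately show ?thesis using tri[OF assms(2), of l] by blast
qed

lemma between_trans:
  assumes "s l k a" "s a k i" shows "s l k i"
proof -
  have 1: "s a l i" by (rule between_order[OF assms])
  then have "\<not> s l i a" using ax[OF sym[OF 1]] by blast
  moreover have "i \<in> N" "i \<noteq> l" using 1 dom irrefl by blast+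
  ultimately show ?thesis using tri[OF assms(1), of i] by blast
qed

text \<open>Of two different first labels each would separate the other one from \<open>i\<close>,
  against \<open>ax\<close>.\<close>

lemma nb_unique:
  assumes "adj k a" "a = i \<or> s a k i" "adj k b" "b = i \<or> s b k i" shows "a = b"
proof (rule ccontr)
  assume ne: "a \<noteq> b"
  have nab: "\<not> s a k b" "\<not> s b k a" using adjD assms by blast+
  then have sa: "s a k i" "s b k i" using assms ne by auto
  have "s a b i" using tri[OF sa(1), of b] nab ne adjD(1)[OF assms(3)] by blast
  moreover have "s b a i" using tri[OF sa(2), of a] nab ne adjD(1)[OF assms(1)] by blast
  ultimately show False using ax sym by blast
qed

lemma hyp_clique:
  assumes ki: "adj k i" and "a \<in> hyp k i" "b \<in> hyp k i" "a \<noteq> b" shows "adj a b"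
proof -
  consider "a = k" | "b = k" | "a \<noteq> k" "b \<noteq> k" by blast
  then show ?thesis
  proof cases
    case 3
    then have ab: "adj k a" "\<not> s k i a" "adj k b" "\<not> s k i b" using assms by (auto simp: sep_hyp_def)
    have "\<not> s m a b" for m
    proof
      assume m: "s m a b"
      show False
      proof (cases "m = k")
        case True
        then show False using tri[of k a b i] m ab sym adjD(1)[OF ki] by blast
      next
        case False
        then show False using tri[OF m, of k] ab adjD sym by blast
      qed
    qed
    then show ?thesis
      unfolding sep_adj_def using adjD(1)[OF ab(1)] adjD(1)[OF ab(3)] assms(4) by blast
  next
    case 1 then show ?thesis using assms by (auto simp: sep_hyp_def)
  next
    case 2 then show ?thesis using assms by (auto simp: sep_hyp_def intro: adj_sym)
  qed
qed

lemma hyp_sub: "adj k i \<Longrightarrow> hyp k i \<subseteq> N" "k \<in> hyp k i" "adj k i \<Longrightarrow> i \<in> hyp k i"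
  using irrefl by (auto simp: sep_hyp_def sep_adj_def)

lemma nb_same:
  assumes "s k l i" "adj l a" "a = k \<or> s a l k" shows "a = i \<or> s a l i"
  using assms between_trans by blast

end

locale fin_sep_tree = sep_tree +
  assumes fin: "finite N"
begin

lemma finite_sep: "finite {l. s l k i}"
  by (rule finite_subset[OF _ fin]) (use dom in auto)

lemma nb_ex:
  assumes "k \<in> N" "i \<in> N" "k \<noteq> i" shows "\<exists>a. adj k a \<and> (a = i \<or> s a k i)"
  using assms
proof (induction "card {l. s l k i}" arbitrary: i rule: less_induct)
  case less
  show ?case
  proof (cases "\<exists>l. s l k i")
    case True
    then obtain l where l: "s l k i" by blast
    have "{m. s m k l} \<subset> {m. s m k i}" using between_trans[OF _ l] l dom by blast
    then have "card {m. s m k l} < card {m. s m k i}" using finite_sep by (rule psubset_card_mono[rotated])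
    then obtain a where "adj k a" "a = l \<or> s a k l" using less.hyps[of l] dom[OF l] less.prems by auto
    then show ?thesis using between_trans[OF _ l] l by blast
  qed (use less.prems in \<open>auto simp: sep_adj_def\<close>)
qed

lemma nb:
  assumes "k \<in> N" "i \<in> N" "k \<noteq> i"
  shows "adj k (nb k i)" "nb k i = i \<or> s (nb k i) k i" "\<not> s k i (nb k i)" "nb k i \<in> N" "nb k i \<noteq> k"
proof -
  show 1: "adj k (nb k i)" and 2: "nb k i = i \<or> s (nb k i) k i"
    using someI_ex[OF nb_ex[OF assms]] unfolding sep_nb_def by auto
  show "\<not> s k i (nb k i)" using 2 irrefl ax[of "nb k i" i k] sym by metis
  show "nb k i \<in> N" "nb k i \<noteq> k" using adjD[OF 1] by auto
qed

lemma nb_eqI: "adj k a \<Longrightarrow> a = i \<or> s a k i \<Longrightarrow> nb k i = a"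
proof -
  assume a: "adj k a" "a = i \<or> s a k i"
  then have "k \<in> N" "i \<in> N" "k \<noteq> i" using adjD(1)[OF a(1)] dom irrefl a(2) by metis+
  then show "nb k i = a" using nb_unique[OF nb(1,2) a] by blast
qed

lemma nb_adj: "adj k i \<Longrightarrow> nb k i = i" by (rule nb_eqI) auto

lemma nb_sep: "s k l i \<Longrightarrow> nb l i = nb l k"
proof -
  assume a: "s k l i"
  have "k \<in> N" "l \<in> N" "l \<noteq> k" using dom[OF a] by auto
  then show "nb l i = nb l k" using nb_same[OF a] nb(1,2)[of l k] by (intro nb_eqI) auto
qed

text \<open>An unlabelled vertex is entered from outside through a single label. This is
  \<open>k0\<close> if \<open>k0\<close> separates \<open>i0\<close> from \<open>y\<close>, and
  otherwise the first label from \<open>k0\<close> towards \<open>y\<close>.\<close>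

lemma gate:
  assumes "adj k0 i0" "y \<in> N" "y \<notin> hyp k0 i0"
  obtains k where "k \<in> hyp k0 i0" "\<And>x. x \<in> hyp k0 i0 \<Longrightarrow> x \<noteq> k \<Longrightarrow> s k x y"
proof -
  have y: "y \<noteq> k0" using assms(3) hyp_sub(2) by metis
  have k0: "k0 \<in> N" "i0 \<noteq> k0" using adjD[OF assms(1)] by auto
  show ?thesis
  proof (cases "s k0 i0 y")
    case True
    show ?thesis
    proof (rule that[of k0])
      fix x assume "x \<in> hyp k0 i0" "x \<noteq> k0"
      then show "s k0 x y" using tri[OF True, of x] adjD[of k0 x] by (auto simp: sep_hyp_def)
    qed (rule hyp_sub)
  next
    case False
    let ?l = "nb k0 y"
    have l: "adj k0 ?l" "?l = y \<or> s ?l k0 y" "\<not> s k0 y ?l" "?l \<in> N" "?l \<noteq> k0" using nb[of k0 y] y k0 assms(2) by auto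
    have "\<not> s k0 i0 ?l" using tri[of k0 i0 ?l y] False l(3) y assms(2) by blast
    then have lh: "?l \<in> hyp k0 i0" using l(1) by (simp add: sep_hyp_def)
    then have sl: "s ?l k0 y" using l(2) assms(3) by metis
    show ?thesis
    proof (rule that[of ?l])
      fix x assume x: "x \<in> hyp k0 i0" "x \<noteq> ?l"
      show "s ?l x y"
      proof (cases "x = k0")
        case False
        then have "adj k0 x" using x by (simp add: sep_hyp_def)
        then show ?thesis using tri[OF sl, of x] adjD x by blast
      qed (use sl in simp)
    qed (rule lh)
  qed
qed

text \<open>A tree has no cycles, so two unlabelled vertices share at most one label: by
  \<open>gate\<close>, a label outside \<open>u\<close> is separated from all but one label of
  \<open>u\<close> and cannot be adjacent to both shared ones.\<close>

lemma hyps_eq: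
  assumes "u \<in> hyps" "v \<in> hyps" "a \<in> u \<inter> v" "b \<in> u \<inter> v" "a \<noteq> b" shows "u = v"
proof -
  have "v \<subseteq> u" if uv: "u \<in> hyps" "v \<in> hyps" "a \<in> u \<inter> v" "b \<in> u \<inter> v" for u v
  proof
    fix y assume y: "y \<in> v"
    obtain k0 i0 where u: "u = hyp k0 i0" "adj k0 i0" using uv by (auto simp: sep_hyps_def)
    obtain k1 i1 where v: "v = hyp k1 i1" "adj k1 i1" using uv by (auto simp: sep_hyps_def)
    show "y \<in> u"
    proof (rule ccontr)
      assume n: "y \<notin> u"
      have "y \<in> N" using hyp_sub(1)[OF v(2)] y v by auto
      then obtain k where k: "k \<in> u" "\<And>x. x \<in> u \<Longrightarrow> x \<noteq> k \<Longrightarrow> s k x y" using gate[OF u(2), of y] n u(1) by blast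
      obtain c where c: "c \<in> u" "c \<in> v" "c \<noteq> k" using uv assms(5) by blast
      then have "s k c y" using k by blast
      moreover have "c = y \<or> adj c y" using hyp_clique[OF v(2), of c y] c v y by blast
      ultimately show False using adjD irrefl by blast
    qed
  qed
  from this[OF assms(1-4)] this[OF assms(2,1)] show ?thesis using assms(3,4) by blast
qed

lemma hyp_in: "adj k i \<Longrightarrow> hyp k i \<in> hyps" by (auto simp: sep_hyps_def)

lemma hypsD:
  assumes "u \<in> hyps" shows "u \<subseteq> N" "a \<in> u \<Longrightarrow> b \<in> u \<Longrightarrow> a \<noteq> b \<Longrightarrow> adj a b \<and> u = hyp a b"
proof -
  obtain k i where u: "u = hyp k i" "adj k i" using assms by (auto simp: sep_hyps_def)
  show "u \<subseteq> N" using u hyp_sub by auto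
  assume ab: "a \<in> u" "b \<in> u" "a \<noteq> b"
  then have "adj a b" using u hyp_clique[OF u(2)] by blast
  moreover have "a \<in> hyp a b" "b \<in> hyp a b" using hyp_sub calculation by auto
  ultimately show "adj a b \<and> u = hyp a b" using hyps_eq[OF assms hyp_in, of a b a b] ab by blast
qed

text \<open>The gate is the label of \<open>u\<close> nearest to \<open>v\<close>. It may belong to
  \<open>v\<close> as well, so it is excluded on both sides.\<close>

lemma hyps_gate:
  assumes "u \<in> hyps" "v \<in> hyps" "u \<noteq> v"
  obtains k where "k \<in> u" "\<And>x y. x \<in> u \<Longrightarrow> x \<noteq> k \<Longrightarrow> y \<in> v \<Longrightarrow> y \<noteq> k \<Longrightarrow> s k x y"
proof -
  obtain k0 i0 where u: "u = hyp k0 i0" "adj k0 i0" using assms by (auto simp: sep_hyps_def)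
  obtain k1 i1 where v: "v = hyp k1 i1" "adj k1 i1" using assms by (auto simp: sep_hyps_def)
  have "\<not> v \<subseteq> u"
  proof
    assume "v \<subseteq> u"
    then show False using hyps_eq[OF assms(1,2), of k1 i1] v hyp_sub[of k1 i1] adjD(1)[OF v(2)] assms(3) by blast
  qed
  then obtain y where y: "y \<in> v" "y \<notin> u" by blast
  then have "y \<in> N" using v hyp_sub by blast
  then obtain k where k: "k \<in> u" "\<And>x. x \<in> u \<Longrightarrow> x \<noteq> k \<Longrightarrow> s k x y" using gate[OF u(2), of y] y u(1) by blast
  show ?thesis
  proof (rule that[OF k(1)])
    fix x z assume xz: "x \<in> u" "x \<noteq> k" "z \<in> v" "z \<noteq> k"
    have "\<not> s k z y" using hypsD(2)[OF assms(2) xz(3) y(1)] adjD irrefl by blast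
    then show "s k x z" using tri[OF k(2)[OF xz(1,2)], of z] xz hypsD(1)[OF assms(2)] by blast
  qed
qed

lemma finite_hyps: "finite hyps"
  by (rule finite_subset[of _ "Pow N"]) (use hypsD fin in auto)

text \<open>A discrete intermediate value property along the path from \<open>a\<close> to
  \<open>b\<close>. The colour will be membership in a half-space.\<close>

lemma colour_change:
  assumes "a \<in> N" "b \<in> N" "D a \<noteq> D b"
  obtains l m where "adj l m" "D l \<noteq> D m" "l = a \<or> l = b \<or> s l a b" "m = a \<or> m = b \<or> s m a b"
proof -
  have "\<exists>l m. adj l m \<and> D l \<noteq> D m \<and> (l = a \<or> l = b \<or> s l a b) \<and> (m = a \<or> m = b \<or> s m a b)"
    using assms
  proof (induction "card {l. s l a b}" arbitrary: a rule: less_induct)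
    case less
    then have ne: "a \<noteq> b" by auto
    let ?c = "nb a b"
    have c: "adj a ?c" "?c = b \<or> s ?c a b" "?c \<in> N" using nb[OF less.prems(1,2) ne] by auto
    show ?case
    proof (cases "D a = D ?c")
      case False
      then show ?thesis using c by blast
    next
      case True
      then have sc: "s ?c a b" using c less.prems by auto
      have sub: "s l a b" if "s l ?c b" for l
        using between_trans[of l b ?c a] that sc sym by blast
      then have "{l. s l ?c b} \<subset> {l. s l a b}" using sc dom by blast
      then have "card {l. s l ?c b} < card {l. s l a b}" using finite_sep by (rule psubset_card_mono[rotated])
      from less.hyps[OF this] True less.prems c
      obtain l m where "adj l m" "D l \<noteq> D m" "l = ?c \<or> l = b \<or> s l ?c b" "m = ?c \<or> m = b \<or> s m ?c b" by auto
      then show ?thesis using sub sc by blast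
    qed
  qed
  then show ?thesis using that by blast
qed

end

text \<open>Refining every unlabelled vertex by a compatible relation \<open>T\<close>.\<close>

definition sep_refine :: "'a set \<Rightarrow> ('a \<Rightarrow> 'a \<Rightarrow> 'a \<Rightarrow> bool) \<Rightarrow> ('a \<Rightarrow> 'a \<Rightarrow> 'a \<Rightarrow> bool) \<Rightarrow> ('a \<Rightarrow> 'a \<Rightarrow> 'a \<Rightarrow> bool)
    \<Rightarrow> 'a \<Rightarrow> 'a \<Rightarrow> 'a \<Rightarrow> bool" where
  "sep_refine N s T s' k i j \<longleftrightarrow> k \<in> N \<and> i \<in> N \<and> j \<in> N \<and> i \<noteq> k \<and> j \<noteq> k \<and>
     (s' k i j \<or> T k (sep_nb N s k i) (sep_nb N s k j))"

context fin_sep_tree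
begin

text \<open>The conditions on \<open>T\<close> are local: they concern only neighbours of
  \<open>k\<close>, or labels around one unlabelled vertex. The delicate axiom is \<open>ax\<close>.
  If it failed for \<open>k\<close>, \<open>l\<close> and \<open>i\<close>, neither separation would
  come from \<open>s\<close>. Then \<open>k\<close> and \<open>l\<close> are adjacent, and
  \<open>i\<close> may be replaced by the first label towards it, which lies at the same unlabelled
  vertex; there \<open>T_ax\<close> applies.\<close>

lemma sep_tree_refine:
  assumes T_irrefl: "\<And>k i. \<not> T k i i" and T_sym: "\<And>k i j. T k i j \<Longrightarrow> T k j i"
    and T_tri: "\<And>k i j l. adj k i \<Longrightarrow> adj k j \<Longrightarrow> adj k l \<Longrightarrow> T k i l \<Longrightarrow> T k i j \<or> T k j l"
    and T_ax: "\<And>k i l. adj k i \<Longrightarrow> adj k l \<Longrightarrow> adj i l \<Longrightarrow> T k i l \<Longrightarrow> \<not> T l i k"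
  shows "fin_sep_tree N (sep_refine N s T s)"
proof
  fix k i j l
  let ?r = "sep_refine N s T s"
  show "?r k i j \<Longrightarrow> k \<in> N \<and> i \<in> N \<and> j \<in> N \<and> i \<noteq> k \<and> j \<noteq> k" by (auto simp: sep_refine_def)
  show "\<not> ?r k i i" using irrefl T_irrefl by (auto simp: sep_refine_def)
  show "?r k i j \<Longrightarrow> ?r k j i" using sym T_sym by (auto simp: sep_refine_def)
  show "?r k i j \<or> ?r k j l" if "?r k i l" "j \<in> N" "j \<noteq> k"
    using that tri[of k i l j] T_tri[of k "nb k i" "nb k j" "nb k l"] nb(1)[of k i] nb(1)[of k j] nb(1)[of k l]
    unfolding sep_refine_def by blast
  show "\<not> ?r l i k" if r: "?r k i l"
  proof
    assume r': "?r l i k"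
    have m: "k \<in> N" "i \<in> N" "l \<in> N" "i \<noteq> k" "l \<noteq> k" "i \<noteq> l" using r r' by (auto simp: sep_refine_def)
    have nsl: "\<not> s l i k"
    proof
      assume a: "s l i k"
      then have "nb k i = nb k l" using nb_sep[OF sym[OF a]] by simp
      then show False using r ax[OF a] T_irrefl sym by (auto simp: sep_refine_def)
    qed
    then have T': "T l (nb l i) (nb l k)" using r' by (simp add: sep_refine_def)
    have nsk: "\<not> s k i l"
    proof
      assume a: "s k i l"
      then have "nb l i = nb l k" using nb_sep[OF sym[OF a]] by simp
      then show False using T' T_irrefl by simp
    qed
    then have T: "T k (nb k i) (nb k l)" using r by (simp add: sep_refine_def)
    then have ne: "nb k i \<noteq> nb k l" using T_irrefl by metis
    note ni = nb[of k i, OF m(1,2) m(4)[symmetric]] and nl = nb[of k l, OF m(1,3) m(5)[symmetric]]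
    show False
    proof (cases "nb k l = l")
      case False
      then have sl: "s (nb k l) k l" using nl(2) by blast
      have "i \<noteq> nb k l" using ne nb_adj[of k i] nl(1) by metis
      moreover have "\<not> s (nb k l) k i" using nb_eqI[of k "nb k l" i] nl(1) ne by blast
      ultimately have "s (nb k l) i l" using tri[OF sl, of i] m by blast
      then have "nb l i = nb l (nb k l)" "nb l k = nb l (nb k l)" using nb_sep sl sym by blast+
      then show False using T' T_irrefl by simp
    next
      case True
      then have kl: "adj k l" using nl(1) by simp
      have "\<not> s k l (nb k i)" using tri[of k l "nb k i" i] nsk ni(3) m sym by blast
      then have il: "adj (nb k i) l" using hyp_clique[OF kl, of "nb k i" l] ni(1) kl ne True irrefl by (auto simp: sep_hyp_def)
      have "nb l i = nb k i"
      proof (rule nb_eqI[OF adj_sym[OF il]])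
        show "nb k i = i \<or> s (nb k i) l i"
          using ni(2) tri[of "nb k i" k i l] adjD(2)[OF kl] m ne True by auto
      qed
      moreover have "nb l k = k" using nb_adj adj_sym[OF kl] by blast
      ultimately show False using T T' True T_ax[OF ni(1) kl il] by simp
    qed
  qed
qed (rule fin)

end

text \<open>The axioms which forbid separations pass to every subrelation; only symmetry and
  \<open>tri\<close> have to be checked.\<close>

lemma sep_tree_coarsen:
  assumes "fin_sep_tree N s" and "\<And>k i j. s' k i j \<Longrightarrow> s k i j"
    and "\<And>k i j. s' k i j \<Longrightarrow> s' k j i"
    and "\<And>k i j l. s' k i l \<Longrightarrow> j \<in> N \<Longrightarrow> j \<noteq> k \<Longrightarrow> s' k i j \<or> s' k j l"
  shows "fin_sep_tree N s'"
proof -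
  interpret fin_sep_tree N s by fact
  show ?thesis
  proof
    fix k i j l
    show "s' k i j \<Longrightarrow> k \<in> N \<and> i \<in> N \<and> j \<in> N \<and> i \<noteq> k \<and> j \<noteq> k" by (rule dom[OF assms(2)])
    show "\<not> s' k i i" using assms(2) irrefl by metis
    show "\<not> s' l i k" if "s' k i l" using ax assms(2) that by metis
  qed (use fin assms(3,4) in auto)
qed

text \<open>Passing from \<open>t\<close> to \<open>s\<close> folds edges at labelled vertices
  together, so unlabelled vertices of \<open>t\<close> are merged and never split.\<close>

locale sep_tree_pair = A: fin_sep_tree N s + B: fin_sep_tree N t for N s t +
  assumes le: "s k i j \<Longrightarrow> t k i j"
begin

lemma adj_le: "B.adj i j \<Longrightarrow> A.adj i j" using le unfolding sep_adj_def by blast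

lemma hyp_le: "B.adj k i \<Longrightarrow> B.hyp k i \<subseteq> A.hyp k i"
  using le adj_le by (auto simp: sep_hyp_def)

text \<open>The unlabelled vertices of \<open>t\<close> that are merged into one of \<open>s\<close>
  form a subtree, so a path of \<open>t\<close> between two of its labels does not leave it.\<close>

lemma between_in_hyp:
  assumes "A.adj a b" "t l a b" shows "l \<in> A.hyp a b"
proof -
  have "\<not> s m a l" for m
  proof
    assume m: "s m a l"
    have l: "l \<in> N" "l \<noteq> a" "l \<noteq> b" using B.dom[OF assms(2)] by auto
    show False
    proof (cases "m = b")
      case True
      then have "t b a l" using le m by simp
      then show False using assms(2) B.ax by blast
    next
      case False
      have b: "b \<in> N" using A.adjD(1)[OF assms(1)] by simp
      have "s m b l" using A.tri[OF m b] False A.adjD(2)[OF assms(1)] by blast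
      then have "t m b l" using le by blast
      moreover have "t l m b" using B.between_order[of m a l b] le[OF m] assms(2) by blast
      ultimately show False using B.ax[OF B.sym] B.sym by blast
    qed
  qed
  moreover have "\<not> s a b l" using assms(2) B.ax[OF B.sym[OF assms(2)]] le by blast
  ultimately show ?thesis using B.dom[OF assms(2)] by (auto simp: sep_hyp_def sep_adj_def)
qed

lemma hyps_up:
  assumes "u \<in> B.hyps" shows "\<exists>!v. v \<in> A.hyps \<and> u \<subseteq> v"
proof -
  obtain k i where u: "u = B.hyp k i" "B.adj k i" using assms by (auto simp: sep_hyps_def)
  have 1: "A.hyp k i \<in> A.hyps" "u \<subseteq> A.hyp k i" using A.hyp_in adj_le hyp_le u by auto
  have ki: "k \<in> u" "i \<in> u" "k \<noteq> i" using u B.hyp_sub B.adjD by auto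
  show ?thesis using 1 A.hyps_eq[OF _ _ _ _ ki(3)] ki by (intro ex1I[of _ "A.hyp k i"]) blast+
qed

text \<open>Going along the path in \<open>t\<close> from \<open>a\<close> to \<open>b\<close>, the
  colour changes at some step. A colouring which splits a merged vertex therefore splits one of its
  parts.\<close>

lemma split_down:
  assumes "v \<in> A.hyps" "a \<in> v" "b \<in> v" "D a \<noteq> D b"
  obtains l m where "B.adj l m" "D l \<noteq> D m" "B.hyp l m \<subseteq> v"
proof -
  have ab: "A.adj a b" "v = A.hyp a b" using A.hypsD(2)[OF assms(1-3)] assms(4) by auto
  obtain l m where lm: "B.adj l m" "D l \<noteq> D m" "l = a \<or> l = b \<or> t l a b" "m = a \<or> m = b \<or> t m a b"
    using B.colour_change[of a b D] assms A.adjD(1)[OF ab(1)] by blast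
  then have "l \<in> v" "m \<in> v" using between_in_hyp[OF ab(1)] ab(2) assms by auto
  then have "v = A.hyp l m" using A.hypsD(2)[OF assms(1)] B.adjD(1)[OF lm(1)] by blast
  then show ?thesis using that lm hyp_le by blast
qed

end

section \<open>Petal families as separation relations\<close>

text \<open>The last condition makes the base point a leaf. With \<open>n = 0\<close> its unlabelled
  neighbour would have valence one, whence \<open>1 \<le> n\<close>.\<close>

definition pointed_sep :: "nat \<Rightarrow> (nat \<Rightarrow> nat \<Rightarrow> nat \<Rightarrow> bool) \<Rightarrow> bool" where
  "pointed_sep n s \<longleftrightarrow> 1 \<le> n \<and> fin_sep_tree {0..n} s \<and> (\<forall>i j. \<not> s 0 i j)"

definition fam_sep :: "nat \<Rightarrow> (nat \<Rightarrow> nat set set) \<Rightarrow> nat \<Rightarrow> nat \<Rightarrow> nat \<Rightarrow> bool" where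
  "fam_sep n A k i j \<longleftrightarrow> k \<le> n \<and> i \<le> n \<and> j \<le> n \<and> i \<noteq> k \<and> j \<noteq> k \<and> \<not> (\<exists>P\<in>A k. i \<in> P \<and> j \<in> P)"

definition sep_fam :: "nat \<Rightarrow> (nat \<Rightarrow> nat \<Rightarrow> nat \<Rightarrow> bool) \<Rightarrow> nat \<Rightarrow> nat set set" where
  "sep_fam n s k = (if k \<le> n then {{j. j \<le> n \<and> j \<noteq> k \<and> \<not> s k i j} | i. i \<le> n \<and> i \<noteq> k} else {})"

lemma fam_sep_fam:
  assumes "pointed_sep n s" shows "fam_sep n (sep_fam n s) = s"
proof -
  interpret fin_sep_tree "{0..n}" s using assms by (simp add: pointed_sep_def)
  have "fam_sep n (sep_fam n s) k i j \<longleftrightarrow> s k i j" for k i j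
  proof
    assume a: "fam_sep n (sep_fam n s) k i j"
    then have m: "k \<le> n" "i \<le> n" "j \<le> n" "i \<noteq> k" "j \<noteq> k" by (auto simp: fam_sep_def)
    let ?P = "{l. l \<le> n \<and> l \<noteq> k \<and> \<not> s k i l}"
    have P: "?P \<in> sep_fam n s k" using m by (auto simp: sep_fam_def)
    show "s k i j"
    proof (rule ccontr)
      assume "\<not> s k i j"
      then have "i \<in> ?P \<and> j \<in> ?P" using m irrefl by simp
      then have "\<exists>P\<in>sep_fam n s k. i \<in> P \<and> j \<in> P" using P by (rule bexI)
      then show False using a by (simp only: fam_sep_def) simp
    qed
  next
    assume a: "s k i j"
    then have m: "k \<le> n" "i \<le> n" "j \<le> n" "i \<noteq> k" "j \<noteq> k" using dom by fastforce+
    moreover have False if P: "P \<in> sep_fam n s k" "i \<in> P" "j \<in> P" for P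
    proof -
      obtain l where "l \<le> n" "l \<noteq> k" "P = {j. j \<le> n \<and> j \<noteq> k \<and> \<not> s k l j}"
        using P(1) m by (auto simp: sep_fam_def)
      then show False using P tri[OF a, of l] sym by auto
    qed
    ultimately show "fam_sep n (sep_fam n s) k i j" unfolding fam_sep_def by blast
  qed
  then show ?thesis by (simp add: fun_eq_iff)
qed

lemma sep_fam_inj: "pointed_sep n s \<Longrightarrow> pointed_sep n t \<Longrightarrow> sep_fam n s = sep_fam n t \<Longrightarrow> s = t"
  by (metis fam_sep_fam)

lemma tree_le_sep_fam:
  assumes "pointed_sep n s" "pointed_sep n t"
  shows "tree_le n (sep_fam n s) (sep_fam n t) \<longleftrightarrow> (\<forall>k i j. s k i j \<longrightarrow> t k i j)"
proof
  interpret s: fin_sep_tree "{0..n}" s using assms by (simp add: pointed_sep_def)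
  interpret t: fin_sep_tree "{0..n}" t using assms by (simp add: pointed_sep_def)
  let ?P = "\<lambda>s k i. {j. j \<le> n \<and> j \<noteq> k \<and> \<not> s k i j}"
  {
    assume le: "tree_le n (sep_fam n s) (sep_fam n t)"
    show "\<forall>k i j. s k i j \<longrightarrow> t k i j"
    proof (intro allI impI)
      fix k i j assume a: "s k i j"
      then have m: "k \<le> n" "i \<le> n" "j \<le> n" "i \<noteq> k" "j \<noteq> k" using s.dom by fastforce+
      then have "?P s k i \<in> sep_fam n s k" by (auto simp: sep_fam_def)
      then obtain S where S: "S \<subseteq> sep_fam n t k" "?P s k i = \<Union>S"
        using le m by (auto simp: tree_le_def) (metis (no_types, lifting) atLeastAtMost_iff le0)
      have "i \<in> ?P s k i" using m s.irrefl by simp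
      then obtain Q where Q: "Q \<in> S" "i \<in> Q" using S by auto
      then obtain l where l: "l \<le> n" "l \<noteq> k" "Q = ?P t k l" using S m by (auto simp: sep_fam_def)
      show "t k i j"
      proof (rule ccontr)
        assume "\<not> t k i j"
        then have "j \<in> Q" using l Q(2) t.tri[of k l j i] m by auto
        then have "j \<in> ?P s k i" using S(2) Q(1) by blast
        then show False using a by simp
      qed
    qed
  next
    assume le: "\<forall>k i j. s k i j \<longrightarrow> t k i j"
    show "tree_le n (sep_fam n s) (sep_fam n t)"
      unfolding tree_le_def
    proof (intro ballI)
      fix k P assume k: "k \<in> {0..n}" and P: "P \<in> sep_fam n s k"
      then obtain i where i: "i \<le> n" "i \<noteq> k" "P = ?P s k i" by (auto simp: sep_fam_def)
      have "P = \<Union> ((\<lambda>j. ?P t k j) ` P)"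
      proof
        show "P \<subseteq> \<Union> ((\<lambda>j. ?P t k j) ` P)" using i t.irrefl by blast
        show "\<Union> ((\<lambda>j. ?P t k j) ` P) \<subseteq> P"
        proof
          fix x assume "x \<in> \<Union> ((\<lambda>j. ?P t k j) ` P)"
          then obtain j where "j \<le> n" "j \<noteq> k" "\<not> s k i j" "x \<le> n" "x \<noteq> k" "\<not> t k j x" using i by auto
          then show "x \<in> P" using i s.tri[of k i x j] le by auto
        qed
      qed
      moreover have "(\<lambda>j. ?P t k j) ` P \<subseteq> sep_fam n t k" using i k by (auto simp: sep_fam_def)
      ultimately show "\<exists>S\<subseteq>sep_fam n t k. P = \<Union> S" by blast
    qed
  }
qed

section \<open>From labelled trees to separation relations\<close>

lemma rtrancl_sym_rel:
  assumes "\<And>a b. (a, b) \<in> R \<Longrightarrow> (b, a) \<in> R" "(x, y) \<in> R\<^sup>*" shows "(y, x) \<in> R\<^sup>*"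
  using assms(2) by (induction rule: rtrancl_induct) (use assms(1) in \<open>auto intro: converse_rtrancl_into_rtrancl\<close>)

context
  fixes n V E lab
  assumes plt: "is_plt n V E lab"
begin

private definition "vx k = (THE v. v \<in> V \<and> lab v = Some k)"
private definition "Rk k = {(a, b). {a, b} \<in> E \<and> a \<noteq> vx k \<and> b \<noteq> vx k}"

private lemma lab_bij: "bij_betw (\<lambda>v. the (lab v)) {v \<in> V. lab v \<noteq> None} {0..n}"
  using plt by (simp add: is_plt_def)

private lemma vx_ex1: "k \<le> n \<Longrightarrow> \<exists>!v. v \<in> V \<and> lab v = Some k"
proof -
  assume k: "k \<le> n"
  then have "k \<in> (\<lambda>v. the (lab v)) ` {v \<in> V. lab v \<noteq> None}" using lab_bij unfolding bij_betw_def by simp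
  then obtain v where v: "v \<in> V" "lab v \<noteq> None" "the (lab v) = k" by blast
  show ?thesis
  proof (rule ex1I[of _ v])
    show "v \<in> V \<and> lab v = Some k" using v by auto
    fix w assume w: "w \<in> V \<and> lab w = Some k"
    then show "w = v" using v lab_bij unfolding bij_betw_def inj_on_def by auto
  qed
qed

private lemma vx: "k \<le> n \<Longrightarrow> vx k \<in> V" "k \<le> n \<Longrightarrow> lab (vx k) = Some k"
  "v \<in> V \<Longrightarrow> lab v = Some k \<Longrightarrow> k \<le> n \<and> v = vx k"
proof -
  show "vx k \<in> V" "lab (vx k) = Some k" if "k \<le> n" using theI'[OF vx_ex1[OF that]] by (auto simp: vx_def)
  assume v: "v \<in> V" "lab v = Some k"
  then have "the (lab v) \<in> {0..n}" using lab_bij unfolding bij_betw_def by blast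
  then have k: "k \<le> n" using v by simp
  then show "k \<le> n \<and> v = vx k" using v theI'[OF vx_ex1[OF k]] vx_ex1[OF k] by (auto simp: vx_def)
qed

private lemma vx_inj: "k \<le> n \<Longrightarrow> l \<le> n \<Longrightarrow> vx k = vx l \<longleftrightarrow> k = l"
  using vx(2) by (metis option.inject)

private lemma Rk_sym: "(a, b) \<in> Rk k \<Longrightarrow> (b, a) \<in> Rk k"
  by (auto simp: Rk_def insert_commute)

private lemma Rk_rsym: "(a, b) \<in> (Rk k)\<^sup>* \<Longrightarrow> (b, a) \<in> (Rk k)\<^sup>*"
  using rtrancl_sym_rel[OF Rk_sym] by blast

private lemma edge: "{a, b} \<in> E \<Longrightarrow> a \<in> V \<and> b \<in> V \<and> a \<noteq> b \<and> (lab a = None \<longleftrightarrow> lab b \<noteq> None)"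
proof -
  assume e: "{a, b} \<in> E"
  then obtain u v where "{a,b} = {u,v}" "u \<noteq> v" "u \<in> V" "v \<in> V" using plt unfolding is_plt_def is_tree_def by metis
  moreover obtain u' v' where "{a,b} = {u',v'}" "lab u' \<noteq> None" "lab v' = None" using e plt unfolding is_plt_def by metis
  ultimately show ?thesis by (auto simp: doubleton_eq_iff)
qed

private lemma connected: "u \<in> V \<Longrightarrow> v \<in> V \<Longrightarrow> (u, v) \<in> {(a, b). {a, b} \<in> E}\<^sup>*"
  using plt unfolding is_plt_def is_tree_def by blast

private lemma petals_eq:
  "petals V E lab k = {{the (lab w) | w. w \<in> V \<and> (u, w) \<in> (Rk k)\<^sup>* \<and> lab w \<noteq> None} | u. u \<in> V - {vx k}}"
  by (simp add: petals_def Let_def Rk_def vx_def)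

private lemma comp_labels:
  assumes "u \<in> V - {vx k}" "k \<le> n"
  shows "{the (lab w) | w. w \<in> V \<and> (u, w) \<in> (Rk k)\<^sup>* \<and> lab w \<noteq> None} = {j. j \<le> n \<and> j \<noteq> k \<and> (u, vx j) \<in> (Rk k)\<^sup>*}"
proof -
  have ne: "w \<noteq> vx k" if "(u, w) \<in> (Rk k)\<^sup>*" for w
    using that by (induction rule: rtrancl_induct) (use assms in \<open>auto simp: Rk_def\<close>)
  show ?thesis
  proof (intro equalityI subsetI)
    fix j assume "j \<in> {the (lab w) | w. w \<in> V \<and> (u, w) \<in> (Rk k)\<^sup>* \<and> lab w \<noteq> None}"
    then obtain w where w: "w \<in> V" "(u, w) \<in> (Rk k)\<^sup>*" "lab w = Some j" by auto
    then show "j \<in> {j. j \<le> n \<and> j \<noteq> k \<and> (u, vx j) \<in> (Rk k)\<^sup>*}" using vx(3)[OF w(1,3)] ne[OF w(2)] by auto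
  next
    fix j assume "j \<in> {j. j \<le> n \<and> j \<noteq> k \<and> (u, vx j) \<in> (Rk k)\<^sup>*}"
    then show "j \<in> {the (lab w) | w. w \<in> V \<and> (u, w) \<in> (Rk k)\<^sup>* \<and> lab w \<noteq> None}"
      using vx(1,2)[of j] by (intro CollectI exI[of _ "vx j"]) simp
  qed
qed

lemma fam_sep_petals:
  "fam_sep n (petal_family n V E lab) k i j \<longleftrightarrow>
     k \<le> n \<and> i \<le> n \<and> j \<le> n \<and> i \<noteq> k \<and> j \<noteq> k \<and>
     ((THE v. v \<in> V \<and> lab v = Some i), (THE v. v \<in> V \<and> lab v = Some j)) \<notin>
      {(a, b). {a, b} \<in> E \<and> a \<noteq> (THE v. v \<in> V \<and> lab v = Some k) \<and> b \<noteq> (THE v. v \<in> V \<and> lab v = Some k)}\<^sup>*"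
proof -
  have "(\<exists>P\<in>petal_family n V E lab k. i \<in> P \<and> j \<in> P) \<longleftrightarrow> (vx i, vx j) \<in> (Rk k)\<^sup>*"
    if m: "k \<le> n" "i \<le> n" "j \<le> n" "i \<noteq> k" "j \<noteq> k"
  proof
    assume "\<exists>P\<in>petal_family n V E lab k. i \<in> P \<and> j \<in> P"
    then obtain P where P: "P \<in> petals V E lab k" "i \<in> P" "j \<in> P" using m by (auto simp: petal_family_def)
    then obtain u where u: "u \<in> V - {vx k}" "P = {j. j \<le> n \<and> j \<noteq> k \<and> (u, vx j) \<in> (Rk k)\<^sup>*}"
      unfolding petals_eq using comp_labels[OF _ m(1)] by blast
    then have "(u, vx i) \<in> (Rk k)\<^sup>*" "(u, vx j) \<in> (Rk k)\<^sup>*" using P by auto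
    then show "(vx i, vx j) \<in> (Rk k)\<^sup>*" using Rk_rsym rtrancl_trans by metis
  next
    assume a: "(vx i, vx j) \<in> (Rk k)\<^sup>*"
    have u: "vx i \<in> V - {vx k}" using vx(1) vx_inj m by auto
    then have "i \<in> {j. j \<le> n \<and> j \<noteq> k \<and> (vx i, vx j) \<in> (Rk k)\<^sup>*} \<and> j \<in> {j. j \<le> n \<and> j \<noteq> k \<and> (vx i, vx j) \<in> (Rk k)\<^sup>*}"
      using m a by auto
    then show "\<exists>P\<in>petal_family n V E lab k. i \<in> P \<and> j \<in> P"
      using u m unfolding comp_labels[OF u m(1), symmetric] by (auto simp: petal_family_def petals_eq)
  qed
  then show ?thesis unfolding fam_sep_def vx_def[symmetric] Rk_def[symmetric] by blast
qed

private lemma fam_sep_petals': "fam_sep n (petal_family n V E lab) k i j \<longleftrightarrow>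
     k \<le> n \<and> i \<le> n \<and> j \<le> n \<and> i \<noteq> k \<and> j \<noteq> k \<and> (vx i, vx j) \<notin> (Rk k)\<^sup>*"
  unfolding fam_sep_petals vx_def[symmetric] Rk_def[symmetric] ..

private lemma nbr_ge2:
  assumes "u \<in> V" "lab u = None" shows "\<exists>d. {u, d} \<in> E \<and> d \<noteq> x"
proof -
  have "valence E u \<ge> 2" using plt assms by (simp add: is_plt_def)
  then have "\<not> {d. {d, u} \<in> E \<and> d \<noteq> u} \<subseteq> {x}"
    unfolding valence_def using card_mono[of "{x}" "{d. {d, u} \<in> E \<and> d \<noteq> u}"] by auto
  then show ?thesis by (auto simp: insert_commute)
qed

private lemma ax': "fam_sep n (petal_family n V E lab) k i l \<Longrightarrow> \<not> fam_sep n (petal_family n V E lab) l i k"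
proof
  assume a: "fam_sep n (petal_family n V E lab) k i l" and b: "fam_sep n (petal_family n V E lab) l i k"
  then have m: "k \<le> n" "i \<le> n" "l \<le> n" "i \<noteq> k" "l \<noteq> k" "i \<noteq> l" by (auto simp: fam_sep_petals')
  have nl: "(vx i, vx l) \<notin> (Rk k)\<^sup>*" using a by (simp add: fam_sep_petals')
  \<comment> \<open>A path starting at \<open>i\<close> stays in the component of \<open>i\<close>
    off \<open>k\<close> until it reaches \<open>k\<close>. This component misses \<open>l\<close>,
    so the initial part of the path joins \<open>i\<close> to \<open>k\<close> without meeting
    \<open>l\<close>.\<close>
  have "(vx i, x) \<in> (Rk k)\<^sup>* \<or> x = vx k \<Longrightarrow> (x, vx k) \<in> (Rk l)\<^sup>*" if "(x, vx k) \<in> {(a, b). {a, b} \<in> E}\<^sup>*" for x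
    using that
  proof (induction rule: converse_rtrancl_induct)
    case (step x y)
    show ?case
    proof (cases "x = vx k")
      case False
      then have x: "(vx i, x) \<in> (Rk k)\<^sup>*" using step.prems by simp
      then have xl: "x \<noteq> vx l" using nl by auto
      have e: "{x, y} \<in> E" using step.hyps by simp
      show ?thesis
      proof (cases "y = vx k")
        case True
        then have "(x, y) \<in> Rk l" using e xl vx_inj m by (auto simp: Rk_def)
        then show ?thesis using True by blast
      next
        case yk: False
        then have "(x, y) \<in> Rk k" using e False by (auto simp: Rk_def)
        then have y: "(vx i, y) \<in> (Rk k)\<^sup>*" using x by (rule rtrancl_into_rtrancl[rotated])
        then have "y \<noteq> vx l" using nl by auto
        then have "(x, y) \<in> Rk l" using e xl by (auto simp: Rk_def)
        moreover have "(y, vx k) \<in> (Rk l)\<^sup>*" using step.IH y by simp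
        ultimately show ?thesis by (rule converse_rtrancl_into_rtrancl)
      qed
    qed simp
  qed simp
  then have "(vx i, vx k) \<in> (Rk l)\<^sup>*" using connected[of "vx i" "vx k"] vx(1) m by blast
  then show False using b by (simp add: fam_sep_petals')
qed

private lemma leaf_nbr: "\<exists>c. \<forall>u. {u, vx 0} \<in> E \<longleftrightarrow> u = c"
proof -
  have "valence E (vx 0) = 1" using plt vx(1,2)[of 0] by (simp add: is_plt_def)
  then obtain c where "{u. {u, vx 0} \<in> E \<and> u \<noteq> vx 0} = {c}" unfolding valence_def by (auto simp: card_1_singleton_iff)
  then have "\<forall>u. {u, vx 0} \<in> E \<longleftrightarrow> u = c" using edge[of _ "vx 0"] by (auto simp: set_eq_iff)
  then show ?thesis by blast
qed

private lemma leaf': "\<not> fam_sep n (petal_family n V E lab) 0 i j"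
proof -
  obtain c where c: "\<And>u. {u, vx 0} \<in> E \<longleftrightarrow> u = c" using leaf_nbr by blast
  have *: "x \<noteq> vx 0 \<Longrightarrow> (x, c) \<in> (Rk 0)\<^sup>*" if "(x, vx 0) \<in> {(a, b). {a, b} \<in> E}\<^sup>*" for x
    using that
  proof (induction rule: converse_rtrancl_induct)
    case (step x y)
    show ?case
    proof (cases "y = vx 0")
      case True
      then show ?thesis using step.hyps c by auto
    next
      case False
      then have "(x, y) \<in> Rk 0" using step by (auto simp: Rk_def)
      then show ?thesis using step.IH False by (meson converse_rtrancl_into_rtrancl)
    qed
  qed simp
  show ?thesis
  proof
    assume a: "fam_sep n (petal_family n V E lab) 0 i j"
    then have m: "i \<le> n" "j \<le> n" "i \<noteq> 0" "j \<noteq> 0" "(vx i, vx j) \<notin> (Rk 0)\<^sup>*" by (auto simp: fam_sep_petals')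
    have "(vx i, c) \<in> (Rk 0)\<^sup>*" "(vx j, c) \<in> (Rk 0)\<^sup>*"
      using * connected vx(1) vx_inj m by auto
    then show False using m(5) Rk_rsym rtrancl_trans by metis
  qed
qed

lemma pointed_sep_petals: "pointed_sep n (fam_sep n (petal_family n V E lab))"
  unfolding pointed_sep_def
proof (intro conjI allI)
  show "1 \<le> n"
  proof (rule ccontr)
    assume "\<not> 1 \<le> n"
    then have n: "n = 0" by simp
    obtain c where c: "{c, vx 0} \<in> E" using leaf_nbr by blast
    then have "c \<in> V" "lab c = None" using edge vx(2)[of 0] by fastforce+
    then obtain d where d: "{c, d} \<in> E" "d \<noteq> vx 0" using nbr_ge2 by blast
    then have "d \<in> V" "lab d \<noteq> None" using edge \<open>lab c = None\<close> by blast+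
    then obtain k where "lab d = Some k" by auto
    then show False using vx(3)[of d k] \<open>d \<in> V\<close> d n by auto
  qed
  show "fin_sep_tree {0..n} (fam_sep n (petal_family n V E lab))"
  proof
    fix k i j l
    let ?s = "fam_sep n (petal_family n V E lab)"
    show "?s k i j \<Longrightarrow> k \<in> {0..n} \<and> i \<in> {0..n} \<and> j \<in> {0..n} \<and> i \<noteq> k \<and> j \<noteq> k" by (auto simp: fam_sep_petals')
    show "\<not> ?s k i i" by (auto simp: fam_sep_petals')
    show "?s k i j \<Longrightarrow> ?s k j i" using Rk_rsym by (auto simp: fam_sep_petals')
    show "?s k i l \<Longrightarrow> j \<in> {0..n} \<Longrightarrow> j \<noteq> k \<Longrightarrow> ?s k i j \<or> ?s k j l"
      using rtrancl_trans[of "vx i" "vx j" "Rk k" "vx l"] by (auto simp: fam_sep_petals')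
    show "?s k i l \<Longrightarrow> \<not> ?s l i k" by (rule ax')
  qed simp
  show "\<not> fam_sep n (petal_family n V E lab) 0 i j" for i j by (rule leaf')
qed

lemma sep_fam_petals: "sep_fam n (fam_sep n (petal_family n V E lab)) = petal_family n V E lab"
proof
  fix k
  let ?s = "fam_sep n (petal_family n V E lab)"
  show "sep_fam n ?s k = petal_family n V E lab k"
  proof (cases "k \<le> n")
    case k: True
    let ?L = "\<lambda>u. {j. j \<le> n \<and> j \<noteq> k \<and> (u, vx j) \<in> (Rk k)\<^sup>*}"
    have 1: "petal_family n V E lab k = {?L u | u. u \<in> V - {vx k}}"
      using k comp_labels[OF _ k] by (auto simp: petal_family_def petals_eq) blast+
    have 2: "{j. j \<le> n \<and> j \<noteq> k \<and> \<not> ?s k i j} = ?L (vx i)" if "i \<le> n" "i \<noteq> k" for i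
      using that k by (auto simp: fam_sep_petals')
    \<comment> \<open>Every component of the complement of \<open>k\<close> contains a label: by the
      valence condition an unlabelled vertex has a neighbour different from
      \<open>k\<close>.\<close>
    have 3: "\<exists>i. i \<le> n \<and> i \<noteq> k \<and> ?L u = ?L (vx i)" if u: "u \<in> V - {vx k}" for u
    proof -
      have "\<exists>d. d \<in> V \<and> lab d \<noteq> None \<and> (u, d) \<in> (Rk k)\<^sup>* \<and> d \<noteq> vx k"
      proof (cases "lab u = None")
        case True
        then obtain d where d: "{u, d} \<in> E" "d \<noteq> vx k" using nbr_ge2 u by blast
        then have "(u, d) \<in> Rk k" using u by (auto simp: Rk_def)
        then show ?thesis using d edge[OF d(1)] True by blast
      qed (use u in auto)
      then obtain d i where d: "d \<in> V" "lab d = Some i" "(u, d) \<in> (Rk k)\<^sup>*" "d \<noteq> vx k" by auto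
      have "i \<le> n" "d = vx i" using vx(3)[OF d(1,2)] by auto
      moreover have "?L u = ?L d" using d(3) Rk_rsym[OF d(3)] by (auto intro: rtrancl_trans)
      ultimately show ?thesis using d(4) by blast
    qed
    show ?thesis
      unfolding 1
    proof (intro equalityI subsetI)
      fix P assume "P \<in> sep_fam n ?s k"
      then obtain i where i: "i \<le> n" "i \<noteq> k" "P = {j. j \<le> n \<and> j \<noteq> k \<and> \<not> ?s k i j}"
        using k by (auto simp: sep_fam_def)
      then show "P \<in> {?L u | u. u \<in> V - {vx k}}" using 2[OF i(1,2)] vx(1)[OF i(1)] vx_inj[OF i(1) k] by blast
    next
      fix P assume "P \<in> {?L u | u. u \<in> V - {vx k}}"
      then obtain u where "u \<in> V - {vx k}" "P = ?L u" by blast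
      then obtain i where "i \<le> n" "i \<noteq> k" "P = ?L (vx i)" using 3 by blast
      then show "P \<in> sep_fam n ?s k" using 2 k by (auto simp: sep_fam_def)
    qed
  qed (simp add: sep_fam_def petal_family_def)
qed

end

lemma plt_families_sep:
  assumes "A \<in> plt_families n"
  obtains s where "pointed_sep n s" "A = sep_fam n s"
  using assms pointed_sep_petals sep_fam_petals unfolding plt_families_def by (smt (verit) mem_Collect_eq)

section \<open>From separation relations back to labelled trees\<close>

lemma sep_fam_plt:
  assumes s: "pointed_sep n s" shows "sep_fam n s \<in> plt_families n"
proof -
  interpret fin_sep_tree "{0..n}" s using s by (simp add: pointed_sep_def)
  have n1: "1 \<le> n" and leaf: "\<not> s 0 i j" for i j using s by (auto simp: pointed_sep_def)
  obtain h :: "nat set \<Rightarrow> nat" where h: "inj_on h hyps" using finite_imp_inj_to_nat_seg[OF finite_hyps] by blast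
  \<comment> \<open>Even numbers are the labelled vertices; odd numbers code the unlabelled ones
    through the injection \<open>h\<close>.\<close>
  define V where "V = (\<lambda>j. 2 * j) ` {0..n} \<union> (\<lambda>u. 2 * h u + 1) ` hyps"
  define E where "E = {{2 * j, 2 * h u + 1} | j u. u \<in> hyps \<and> j \<in> u}"
  define lab where "lab v = (if even v then Some (v div 2) else None)" for v :: nat
  have odd_ne: "2 * (a::nat) \<noteq> 2 * b + 1" "2 * b + 1 \<noteq> 2 * (a::nat)" for a b by presburger+
  have edge_iff: "{2 * j, 2 * h u + 1} \<in> E \<longleftrightarrow> j \<in> u" if "u \<in> hyps" for j u
    using that h odd_ne by (auto simp: E_def doubleton_eq_iff inj_on_def)
  have edgeE: "\<exists>j u. u \<in> hyps \<and> j \<in> u \<and> ((a = 2 * j \<and> b = 2 * h u + 1) \<or> (b = 2 * j \<and> a = 2 * h u + 1))" if "{a, b} \<in> E" for a b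
    using that by (auto simp: E_def doubleton_eq_iff)
  have two: "\<exists>a b. a \<in> u \<and> b \<in> u \<and> a \<noteq> b" if "u \<in> hyps" for u
    using that hyp_sub adjD(1) by (auto simp: sep_hyps_def) blast
  \<comment> \<open>The removed vertex \<open>x\<close> is a parameter so that one induction serves
    twice: \<open>x = 2 * k\<close> yields the petals at \<open>k\<close>, and an odd
    \<open>x\<close> which codes no vertex removes nothing and yields connectedness.\<close>
  have path: "(2 * i, 2 * j) \<in> {(a, b). {a, b} \<in> E \<and> a \<noteq> x \<and> b \<noteq> x}\<^sup>*"
    if "i \<le> n" "j \<le> n" "\<forall>l. (l = i \<or> l = j \<or> s l i j) \<longrightarrow> x \<noteq> 2 * l" "even x \<or> x = 1 + 2 * z \<and> z \<notin> h ` hyps" for i j x z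
    using that
  proof (induction "card {l. s l i j}" arbitrary: i rule: less_induct)
    case less
    show ?case
    proof (cases "i = j")
      case False
      let ?R = "{(a, b). {a, b} \<in> E \<and> a \<noteq> x \<and> b \<noteq> x}"
      let ?c = "nb i j"
      have c: "adj i ?c" "?c = j \<or> s ?c i j" "?c \<le> n" using nb[of i j] less.prems False by auto
      let ?u = "hyp i ?c"
      have u: "?u \<in> hyps" "i \<in> ?u" "?c \<in> ?u" using hyp_in c hyp_sub by auto
      have xu: "x \<noteq> 2 * h ?u + 1" using less.prems(4) u(1) by auto
      have "x \<noteq> 2 * i" "x \<noteq> 2 * ?c" using less.prems(3) c(2) by blast+
      then have "(2 * i, 2 * h ?u + 1) \<in> ?R" "(2 * h ?u + 1, 2 * ?c) \<in> ?R"
        using edge_iff[OF u(1)] u(2,3) xu by (auto simp: insert_commute)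
      then have ic: "(2 * i, 2 * ?c) \<in> ?R\<^sup>*" by (meson r_into_rtrancl rtrancl_trans)
      show ?thesis
      proof (cases "?c = j")
        case False
        then have sc: "s ?c i j" using c by simp
        have sub: "s l i j" if "s l ?c j" for l
          using between_trans[of l j ?c i] that sc sym by blast
        then have "{l. s l ?c j} \<subset> {l. s l i j}" using sc dom by blast
        then have "card {l. s l ?c j} < card {l. s l i j}" using finite_sep by (rule psubset_card_mono[rotated])
        then have "(2 * ?c, 2 * j) \<in> ?R\<^sup>*"
          by (rule less.hyps) (use less.prems c sub sc in auto)
        then show ?thesis using ic by (rule rtrancl_trans[rotated])
      qed (use ic in simp)
    qed simp
  qed
  have tree: "is_tree V E"
    unfolding is_tree_def
  proof (intro conjI ballI)
    show "finite V" "V \<noteq> {}" using finite_hyps by (auto simp: V_def)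
    show "\<exists>u v. e = {u, v} \<and> u \<noteq> v \<and> u \<in> V \<and> v \<in> V" if e: "e \<in> E" for e
    proof -
      obtain j u where ju: "e = {2 * j, 2 * h u + 1}" "u \<in> hyps" "j \<in> u" using e by (auto simp: E_def)
      then have "2 * j \<in> V" "2 * h u + 1 \<in> V" using hypsD(1)[OF ju(2)] by (auto simp: V_def)
      then show ?thesis using ju(1) odd_ne by blast
    qed
    let ?R = "{(a, b). {a, b} \<in> E}"
    have Rsym: "(b, a) \<in> ?R\<^sup>*" if "(a, b) \<in> ?R\<^sup>*" for a b
      using rtrancl_sym_rel[of ?R a b] that by (auto simp: insert_commute)
    have to0: "(v, 0) \<in> ?R\<^sup>*" if v: "v \<in> V" for v
    proof -
      have lab0: "(2 * j, 0) \<in> ?R\<^sup>*" if "j \<le> n" for j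
      proof -
        obtain z where z: "z \<notin> h ` hyps" using ex_new_if_finite[OF infinite_UNIV_nat finite_imageI[OF finite_hyps]] by blast
        have "{(a, b). {a, b} \<in> E \<and> a \<noteq> 1 + 2 * z \<and> b \<noteq> 1 + 2 * z} \<subseteq> ?R" by auto
        moreover have "(2 * j, 2 * 0) \<in> {(a, b). {a, b} \<in> E \<and> a \<noteq> 1 + 2 * z \<and> b \<noteq> 1 + 2 * z}\<^sup>*"
        proof (rule path[where z=z])
          show "\<forall>l. l = j \<or> l = 0 \<or> s l j 0 \<longrightarrow> 1 + 2 * z \<noteq> 2 * l" by (metis odd_ne(2) add.commute)
        qed (use that z in simp_all)
        ultimately show ?thesis using rtrancl_mono by auto
      qed
      show ?thesis
      proof (cases "even v")
        case True
        then obtain j where "v = 2 * j" "j \<le> n" using v odd_ne by (auto simp: V_def)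
        then show ?thesis using lab0 by simp
      next
        case False
        then obtain u where u: "v = 2 * h u + 1" "u \<in> hyps" using v by (auto simp: V_def)
        then obtain j where j: "j \<in> u" using two by blast
        then have "(v, 2 * j) \<in> ?R" using edge_iff[OF u(2)] u by (auto simp: insert_commute)
        moreover have "j \<le> n" using j hypsD(1)[OF u(2)] by auto
        ultimately show ?thesis using lab0[of j] by (meson converse_rtrancl_into_rtrancl)
      qed
    qed
    show "(u, v) \<in> ?R\<^sup>*" if "u \<in> V" "v \<in> V" for u v
      using to0[OF that(1)] Rsym[OF to0[OF that(2)]] by (rule rtrancl_trans)
    show "card E + 1 = card V"
    proof -
      \<comment> \<open>The tree is rooted at label 0. An incidence of \<open>j\<close> and
        \<open>u\<close> is either the one through which \<open>j\<close> looks towards 0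
        (\<open>u = up j\<close>) or the one through which \<open>u\<close> does
        (\<open>j = top u\<close>), and never both. So \<open>n + card hyps\<close> edges face
        \<open>n + 1 + card hyps\<close> vertices.\<close>
      define I where "I = {(j, u). u \<in> hyps \<and> j \<in> u}"
      have "\<exists>k. k \<in> u \<and> (k = 0 \<or> 0 \<notin> u \<and> (\<forall>x\<in>u. x \<noteq> k \<longrightarrow> s k x 0))" if "u \<in> hyps" for u
      proof (cases "0 \<in> u")
        case False
        obtain k i where u: "u = hyp k i" "adj k i" using \<open>u \<in> hyps\<close> by (auto simp: sep_hyps_def)
        obtain k' where "k' \<in> u" "\<And>x. x \<in> u \<Longrightarrow> x \<noteq> k' \<Longrightarrow> s k' x 0"
          using gate[OF u(2), of 0] False u(1) by (metis atLeastAtMost_iff le0)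
        then show ?thesis using False by blast
      qed auto
      then obtain top where top: "\<And>u. u \<in> hyps \<Longrightarrow> top u \<in> u \<and> (top u = 0 \<or> 0 \<notin> u \<and> (\<forall>x\<in>u. x \<noteq> top u \<longrightarrow> s (top u) x 0))"
        by metis
      define up where "up j = hyp j (nb j 0)" for j
      have nb0: "adj j (nb j 0)" "nb j 0 = 0 \<or> s (nb j 0) j 0" "\<not> s j 0 (nb j 0)" if "j \<in> {1..n}" for j
        using nb[of j 0] that by auto
      have upH: "up j \<in> hyps" "j \<in> up j" if "j \<in> {1..n}" for j
        using hyp_in[OF nb0(1)[OF that]] hyp_sub(2) by (auto simp: up_def)
      have I: "I = (\<lambda>j. (j, up j)) ` {1..n} \<union> (\<lambda>u. (top u, u)) ` hyps"
      proof (intro equalityI subsetI)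
        fix x assume "x \<in> I"
        then obtain j u where x: "x = (j, u)" "u \<in> hyps" "j \<in> u" by (auto simp: I_def)
        show "x \<in> (\<lambda>j. (j, up j)) ` {1..n} \<union> (\<lambda>u. (top u, u)) ` hyps"
        proof (cases "j = top u")
          case False
          have t: "top u \<in> u" "top u = 0 \<or> s (top u) j 0" using top[OF x(2)] x(3) False by auto
          have "j \<noteq> 0"
          proof
            assume "j = 0"
            then have "top u = 0" using top[OF x(2)] x(3) by auto
            then show False using False \<open>j = 0\<close> by simp
          qed
          then have j: "j \<in> {1..n}" using hypsD(1)[OF x(2)] x(3) by auto
          have a: "adj j (top u)" "u = hyp j (top u)" using hypsD(2)[OF x(2,3) t(1) False] by auto
          have "nb j 0 = top u" using nb_eqI[OF a(1)] t(2) by blast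
          then have "u = up j" using a(2) by (simp add: up_def)
          then show ?thesis using x(1) j by blast
        qed (use x in auto)
      next
        fix x assume "x \<in> (\<lambda>j. (j, up j)) ` {1..n} \<union> (\<lambda>u. (top u, u)) ` hyps"
        then show "x \<in> I" using upH top by (auto simp: I_def)
      qed
      have disj: "(\<lambda>j. (j, up j)) ` {1..n} \<inter> (\<lambda>u. (top u, u)) ` hyps = {}"
      proof (rule ccontr)
        assume "\<not> ?thesis"
        then obtain j u where ju: "j \<in> {1..n}" "(j, up j) = (top u, u)" by blast
        then have j: "j \<in> {1..n}" "top (up j) = j" by auto
        have "nb j 0 \<in> up j" "nb j 0 \<noteq> j" using hyp_sub(3)[OF nb0(1)[OF j(1)]] adjD(1)[OF nb0(1)[OF j(1)]] by (auto simp: up_def)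
        then have "s j (nb j 0) 0" using top[OF upH(1)[OF j(1)]] j by auto
        then show False using nb0(3)[OF j(1)] sym by blast
      qed
      have "card I = n + card hyps"
        unfolding I using disj finite_hyps
        by (subst card_Un_disjoint) (auto simp: card_image inj_on_def)
      moreover have "card E = card I"
      proof -
        have "E = (\<lambda>(j, u). {2 * j, 2 * h u + 1}) ` I" by (auto simp: E_def I_def)
        moreover have "inj_on (\<lambda>(j, u). {2 * j, 2 * h u + 1}) I"
          using h odd_ne by (auto simp: inj_on_def I_def doubleton_eq_iff)
        ultimately show ?thesis by (simp add: card_image)
      qed
      moreover have "card V = (n + 1) + card hyps"
      proof -
        have "card ((\<lambda>j::nat. 2 * j) ` {0..n}) = n + 1" by (subst card_image) (auto simp: inj_on_def)
        moreover have "card ((\<lambda>u. 2 * h u + 1) ` hyps) = card hyps" using h by (subst card_image) (auto simp: inj_on_def)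
        moreover have "(\<lambda>j::nat. 2 * j) ` {0..n} \<inter> (\<lambda>u. 2 * h u + 1) ` hyps = {}" using odd_ne by auto
        ultimately show ?thesis unfolding V_def using finite_hyps by (subst card_Un_disjoint) auto
      qed
      ultimately show ?thesis by simp
    qed
  qed
  have labV: "{v \<in> V. lab v \<noteq> None} = (\<lambda>j. 2 * j) ` {0..n}" by (auto simp: V_def lab_def)
  have plt: "is_plt n V E lab"
    unfolding is_plt_def
  proof (intro conjI ballI impI)
    show "is_tree V E" by (rule tree)
    show "bij_betw (\<lambda>v. the (lab v)) {v \<in> V. lab v \<noteq> None} {0..n}"
      unfolding labV by (rule bij_betw_byWitness[where f'="\<lambda>j. 2 * j"]) (auto simp: lab_def)
    show "\<exists>u v. e = {u, v} \<and> lab u \<noteq> None \<and> lab v = None" if e: "e \<in> E" for e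
    proof -
      obtain j u where "e = {2 * j, 2 * h u + 1}" using e by (auto simp: E_def)
      then show ?thesis by (intro exI[of _ "2 * j"] exI[of _ "2 * h u + 1"]) (simp add: lab_def)
    qed
    have fE: "finite {w. {w, v} \<in> E \<and> w \<noteq> v}" for v
    proof (rule finite_subset)
      show "{w. {w, v} \<in> E \<and> w \<noteq> v} \<subseteq> V"
      proof
        fix w assume "w \<in> {w. {w, v} \<in> E \<and> w \<noteq> v}"
        then have "{w, v} \<in> E" by simp
        from edgeE[OF this] show "w \<in> V" using hypsD(1) by (auto simp: V_def)
      qed
      show "finite V" using tree by (simp add: is_tree_def)
    qed
    show "2 \<le> valence E v" if v: "v \<in> V" "lab v = None" for v
    proof -
      obtain u where u: "v = 2 * h u + 1" "u \<in> hyps" using v by (auto simp: V_def lab_def)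
      obtain a b where ab: "a \<in> u" "b \<in> u" "a \<noteq> b" using two[OF u(2)] by blast
      then have "{2 * a, 2 * b} \<subseteq> {w. {w, v} \<in> E \<and> w \<noteq> v}" using edge_iff[OF u(2)] u odd_ne by auto
      from card_mono[OF fE this] show ?thesis using ab by (simp add: valence_def)
    qed
    show "valence E v = 1" if "v \<in> V" "lab v = Some 0" for v
    proof -
      have v: "v = 0" using that by (auto simp: lab_def split: if_splits)
      have a0: "adj 0 (nb 0 1)" using nb[of 0 1] n1 by auto
      let ?u = "hyp 0 (nb 0 1)"
      have uu: "u = ?u" if u: "u \<in> hyps" "0 \<in> u" for u
      proof -
        obtain j where j: "j \<in> u" "j \<noteq> 0" using two[OF u(1)] by metis
        then have "u = hyp 0 j" using hypsD(2)[OF u j(1)] by auto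
        then show ?thesis using leaf by (auto simp: sep_hyp_def)
      qed
      have "{w. {w, v} \<in> E \<and> w \<noteq> v} = {2 * h ?u + 1}"
      proof (intro equalityI subsetI)
        fix w assume "w \<in> {w. {w, v} \<in> E \<and> w \<noteq> v}"
        then have "{w, 0} \<in> E" using v by simp
        from edgeE[OF this] obtain j u where "u \<in> hyps" "j \<in> u" "0 = 2 * j \<and> w = 2 * h u + 1" by auto
        then show "w \<in> {2 * h ?u + 1}" using uu[of u] by simp
      next
        fix w assume "w \<in> {2 * h ?u + 1}"
        moreover have "{2 * 0, 2 * h ?u + 1} \<in> E" using edge_iff[OF hyp_in[OF a0], of 0] hyp_sub(2) by blast
        ultimately show "w \<in> {w. {w, v} \<in> E \<and> w \<noteq> v}" using v by (simp add: insert_commute)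
      qed
      then show ?thesis by (simp add: valence_def)
    qed
  qed
  have vx: "(THE v. v \<in> V \<and> lab v = Some k) = 2 * k" if "k \<le> n" for k
    by (rule the_equality) (use that in \<open>auto simp: V_def lab_def split: if_splits\<close>)
  have "fam_sep n (petal_family n V E lab) k i j \<longleftrightarrow> s k i j" for k i j
  proof (cases "k \<le> n \<and> i \<le> n \<and> j \<le> n \<and> i \<noteq> k \<and> j \<noteq> k")
    case True
    let ?R = "{(a, b). {a, b} \<in> E \<and> a \<noteq> 2 * k \<and> b \<noteq> 2 * k}"
    \<comment> \<open>Whatever is reachable from \<open>i\<close> while avoiding \<open>k\<close>
      stays unseparated from \<open>i\<close> by \<open>k\<close>; an odd vertex carries this
      property for all labels around it.\<close>
    have inv: "(\<forall>l. x = 2 * l \<longrightarrow> l \<le> n \<and> l \<noteq> k \<and> \<not> s k i l) \<and> (\<forall>u\<in>hyps. x = 2 * h u + 1 \<longrightarrow> (\<forall>l\<in>u. l \<noteq> k \<longrightarrow> \<not> s k i l))"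
      if "(2 * i, x) \<in> ?R\<^sup>*" for x
      using that
    proof (induction rule: rtrancl_induct)
      case base
      then show ?case using True irrefl odd_ne by auto
    next
      case (step x y)
      then have xy: "{x, y} \<in> E" "x \<noteq> 2 * k" "y \<noteq> 2 * k" by auto
      obtain l u where lu: "u \<in> hyps" "l \<in> u" "(x = 2 * l \<and> y = 2 * h u + 1) \<or> (y = 2 * l \<and> x = 2 * h u + 1)"
        using edgeE[OF xy(1)] by blast
      then show ?case
      proof (elim disjE conjE)
        assume x: "x = 2 * l" and y: "y = 2 * h u + 1"
        have l: "l \<noteq> k" "\<not> s k i l" "l \<le> n" using step.IH x by auto
        have "\<not> s k i m" if "m \<in> u" "m \<noteq> k" for m
        proof (cases "m = l")
          case False
          then have "\<not> s k l m" using hypsD(2)[OF lu(1,2) that(1)] adjD(2) by blast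
          then show ?thesis using tri[of k i m l] l by auto
        qed (use l in simp)
        moreover have "u' = u" if "u' \<in> hyps" "h u' = h u" for u' using that h lu(1) by (auto simp: inj_on_def)
        ultimately show ?thesis using y odd_ne by auto
      next
        assume y: "y = 2 * l" and x: "x = 2 * h u + 1"
        have "l \<le> n" using hypsD(1)[OF lu(1)] lu(2) by auto
        then show ?thesis using step.IH x lu y xy odd_ne by auto
      qed
    qed
    have "(2 * i, 2 * j) \<in> ?R\<^sup>* \<longleftrightarrow> \<not> s k i j"
    proof
      show "\<not> s k i j" if "(2 * i, 2 * j) \<in> ?R\<^sup>*" using inv[OF that] by blast
      show "(2 * i, 2 * j) \<in> ?R\<^sup>*" if "\<not> s k i j"
        by (rule path[where z=0]) (use that True in auto)
    qed
    then show ?thesis using True by (simp add: fam_sep_petals[OF plt] vx)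
  next
    case False
    then show ?thesis using dom[of k i j] by (auto simp: fam_sep_def)
  qed
  then have "fam_sep n (petal_family n V E lab) = s" by (simp add: fun_eq_iff)
  then have "sep_fam n s = petal_family n V E lab" using sep_fam_petals[OF plt] by simp
  then show ?thesis unfolding plt_families_def using plt by blast
qed

section \<open>Free products\<close>

lemma word_prod_simps [simp]:
  "word_prod G [] = \<one>\<^bsub>G\<^esub>" "word_prod G (p # ws) = snd p \<otimes>\<^bsub>G\<^esub> word_prod G ws"
  by (simp_all add: word_prod_def)

lemma conjugate_set_image: "conjugate_set G g L = (\<lambda>h. g \<otimes>\<^bsub>G\<^esub> h \<otimes>\<^bsub>G\<^esub> inv\<^bsub>G\<^esub> g) ` L"
  by (auto simp: conjugate_set_def)

lemma (in group) conjugate_set_mult: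
  assumes "g \<in> carrier G" "h \<in> carrier G" "L \<subseteq> carrier G"
  shows "conjugate_set G (g \<otimes> h) L = conjugate_set G g (conjugate_set G h L)"
  unfolding conjugate_set_image image_image
  using assms by (intro image_cong refl) (auto simp: inv_mult_group m_assoc subset_iff)

lemma (in group) conjugate_set_one: "L \<subseteq> carrier G \<Longrightarrow> conjugate_set G \<one> L = L"
  unfolding conjugate_set_image by (auto simp: subset_iff image_iff)

lemma (in group) conjugate_set_closed: "g \<in> carrier G \<Longrightarrow> L \<subseteq> carrier G \<Longrightarrow> conjugate_set G g L \<subseteq> carrier G"
  by (auto simp: conjugate_set_def)

lemma (in group) conjugate_set_self:
  assumes "subgroup L G" "h \<in> L" shows "conjugate_set G h L = L"
proof -
  have L: "L \<subseteq> carrier G" using assms(1) by (rule subgroup.subset)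
  have sub: "conjugate_set G x L \<subseteq> L" if "x \<in> L" for x
    using that assms(1) by (auto simp: conjugate_set_def subgroup.m_closed subgroup.m_inv_closed)
  have "inv h \<in> L" using assms by (simp add: subgroup.m_inv_closed)
  have "L = conjugate_set G h (conjugate_set G (inv h) L)"
    using assms L by (subst conjugate_set_mult[symmetric]) (auto simp: conjugate_set_one subset_iff)
  also have "\<dots> \<subseteq> conjugate_set G h L" using sub[OF \<open>inv h \<in> L\<close>] by (auto simp: conjugate_set_image)
  finally show ?thesis using sub[OF assms(2)] by blast
qed

text \<open>Points: \<open>Inl g\<close> is the translate by \<open>g\<close> of the base point, \<open>Inr L\<close> the vertex with
  stabiliser \<open>L\<close>.\<close>

fun pact :: "('g, 'b) monoid_scheme \<Rightarrow> 'g \<Rightarrow> 'g + 'g set \<Rightarrow> 'g + 'g set" where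
  "pact G g (Inl a) = Inl (g \<otimes>\<^bsub>G\<^esub> a)"
| "pact G g (Inr L) = Inr (conjugate_set G g L)"

fun pmap :: "('g \<Rightarrow> 'g) \<Rightarrow> 'g + 'g set \<Rightarrow> 'g + 'g set" where
  "pmap \<phi> (Inl a) = Inl (\<phi> a)"
| "pmap \<phi> (Inr L) = Inr (\<phi> ` L)"

definition pt :: "('g, 'b) monoid_scheme \<Rightarrow> (nat \<Rightarrow> 'g set) \<Rightarrow> nat \<Rightarrow> 'g + 'g set" where
  "pt G K j = (if j = 0 then Inl \<one>\<^bsub>G\<^esub> else Inr (K j))"

definition points :: "('g, 'b) monoid_scheme \<Rightarrow> nat \<Rightarrow> (nat \<Rightarrow> 'g set) \<Rightarrow> ('g + 'g set) set" where
  "points G n K = {pact G g (pt G K j) | g j. g \<in> carrier G \<and> j \<le> n}"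

locale free_prod = group G for G (structure) +
  fixes n :: nat and H :: "nat \<Rightarrow> 'a set"
  assumes fp: "is_free_product G n H" and nontriv: "i \<in> {1..n} \<Longrightarrow> H i \<noteq> {\<one>}"
begin

abbreviation "red \<equiv> reduced_word G n H"
abbreviation "wp \<equiv> word_prod G"
abbreviation "act \<equiv> pact G"
abbreviation "vpt \<equiv> pt G H"
abbreviation "\<Lambda> \<equiv> points G n H"

lemma subH: "i \<in> {1..n} \<Longrightarrow> subgroup (H i) G"
  using fp by (simp add: is_free_product_def)

lemma H_closed: "i \<in> {1..n} \<Longrightarrow> h \<in> H i \<Longrightarrow> h \<in> carrier G"
  using subH subgroup.subset by blast

lemma H_sub: "i \<in> {1..n} \<Longrightarrow> H i \<subseteq> carrier G"
  using subH subgroup.subset by blast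

lemma H_ops: "i \<in> {1..n} \<Longrightarrow> h \<in> H i \<Longrightarrow> h' \<in> H i \<Longrightarrow> h \<otimes> h' \<in> H i"
  "i \<in> {1..n} \<Longrightarrow> h \<in> H i \<Longrightarrow> inv h \<in> H i" "i \<in> {1..n} \<Longrightarrow> \<one> \<in> H i"
  using subH by (auto simp: subgroup.m_closed subgroup.m_inv_closed subgroup.one_closed)

lemma H_nontriv: "i \<in> {1..n} \<Longrightarrow> \<exists>h\<in>H i. h \<noteq> \<one>"
  using nontriv H_ops(3) by blast

lemma red_Nil [simp]: "red []" by (simp add: reduced_word_def)

lemma red_Cons: "red ((j, h) # ws) \<longleftrightarrow> j \<in> {1..n} \<and> h \<in> H j \<and> h \<noteq> \<one> \<and> red ws \<and> (ws = [] \<or> fst (hd ws) \<noteq> j)"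
proof -
  have "(\<forall>m. Suc m < length ((j, h) # ws) \<longrightarrow> fst (((j, h) # ws) ! m) \<noteq> fst (((j, h) # ws) ! Suc m)) \<longleftrightarrow>
     (ws = [] \<or> fst (hd ws) \<noteq> j) \<and> (\<forall>m. Suc m < length ws \<longrightarrow> fst (ws ! m) \<noteq> fst (ws ! Suc m))" (is "?L \<longleftrightarrow> ?R")
  proof
    assume L: ?L
    have "fst (ws ! m) \<noteq> fst (ws ! Suc m)" if "Suc m < length ws" for m using L[rule_format, of "Suc m"] that by simp
    moreover have "ws = [] \<or> fst (hd ws) \<noteq> j" using L[rule_format, of 0] by (cases ws) auto
    ultimately show ?R by blast
  next
    assume R: ?R
    show ?L
    proof (intro allI impI)
      fix m assume "Suc m < length ((j, h) # ws)"
      then show "fst (((j, h) # ws) ! m) \<noteq> fst (((j, h) # ws) ! Suc m)"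
        using R by (cases m) (auto simp: hd_conv_nth)
    qed
  qed
  then show ?thesis unfolding reduced_word_def by auto
qed

lemma red_append: "red (u @ v) \<longleftrightarrow> red u \<and> red v \<and> (u = [] \<or> v = [] \<or> fst (last u) \<noteq> fst (hd v))"
proof (induction u)
  case (Cons p u)
  obtain j h where p: "p = (j, h)" by force
  show ?case
  proof (cases u)
    case Nil
    then show ?thesis by (cases v) (auto simp: p red_Cons)
  next
    case (Cons q u')
    then show ?thesis using Cons.IH by (auto simp: p red_Cons)
  qed
qed simp

lemma red_closed: "red ws \<Longrightarrow> wp ws \<in> carrier G"
  by (induction ws) (auto simp: red_Cons H_closed)

lemma red_unique: "red u \<Longrightarrow> red v \<Longrightarrow> wp u = wp v \<Longrightarrow> u = v"
  using fp red_closed unfolding is_free_product_def by metis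

lemma red_ex: "g \<in> carrier G \<Longrightarrow> \<exists>w. red w \<and> wp w = g"
  using fp unfolding is_free_product_def by blast

lemma wp_append: "red u \<Longrightarrow> red v \<Longrightarrow> wp (u @ v) = wp u \<otimes> wp v"
  by (induction u) (auto simp: red_Cons H_closed red_closed m_assoc)

section \<open>Homomorphisms out of a free product and Whitehead automorphisms\<close>

text \<open>Left multiplication by one syllable on normal forms, as in van der Waerden's argument:
  the syllable is absorbed, cancelled or put in front.\<close>

fun lmul :: "nat \<times> 'a \<Rightarrow> (nat \<times> 'a) list \<Rightarrow> (nat \<times> 'a) list" where
  "lmul (j, h) ws = (if h = \<one> then ws else case ws of [] \<Rightarrow> [(j, h)]
     | (i, h') # ws' \<Rightarrow> if i = j then (if h \<otimes> h' = \<one> then ws' else (j, h \<otimes> h') # ws') else (j, h) # ws)"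

lemma red_lmul:
  assumes "red ws" "j \<in> {1..n}" "h \<in> H j"
  shows "red (lmul (j, h) ws)" "wp (lmul (j, h) ws) = h \<otimes> wp ws"
proof -
  have h: "h \<in> carrier G" using H_closed assms by blast
  show "red (lmul (j, h) ws)" using assms H_ops
    by (cases ws) (auto simp: red_Cons)
  show "wp (lmul (j, h) ws) = h \<otimes> wp ws"
  proof (cases ws)
    case Nil then show ?thesis using h by simp
  next
    case (Cons p ws')
    obtain i h' where p: "p = (i, h')" by force
    have c: "h' \<in> carrier G" "wp ws' \<in> carrier G" using assms(1) red_closed[of ws'] by (auto simp: Cons p red_Cons H_closed)
    have "h \<otimes> (h' \<otimes> wp ws') = h \<otimes> h' \<otimes> wp ws'" using h c by (simp add: m_assoc)
    then show ?thesis using h c by (auto simp: Cons p)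
  qed
qed

text \<open>The value is read off the normal form. Multiplicativity needs checking only for left
  multiplication by a single syllable, where \<open>lmul\<close> gives the new normal form.\<close>

theorem hom_extension:
  assumes \<theta>: "\<And>j h. j \<in> {1..n} \<Longrightarrow> h \<in> H j \<Longrightarrow> \<theta> j h \<in> carrier G"
    and \<theta>_mult: "\<And>j h h'. j \<in> {1..n} \<Longrightarrow> h \<in> H j \<Longrightarrow> h' \<in> H j \<Longrightarrow> \<theta> j (h \<otimes> h') = \<theta> j h \<otimes> \<theta> j h'"
  obtains \<phi> where "\<phi> \<in> hom G G" "\<phi> \<in> extensional (carrier G)" "\<And>j h. j \<in> {1..n} \<Longrightarrow> h \<in> H j \<Longrightarrow> \<phi> h = \<theta> j h"
proof -
  define val where "val ws = foldr (\<lambda>p acc. \<theta> (fst p) (snd p) \<otimes> acc) ws \<one>" for ws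
  have val_simps [simp]: "val [] = \<one>" "val (p # ws) = \<theta> (fst p) (snd p) \<otimes> val ws" for p ws by (simp_all add: val_def)
  have val_c: "val ws \<in> carrier G" if "red ws" for ws using that by (induction ws) (auto simp: red_Cons \<theta>)
  have \<theta>1: "\<theta> j \<one> = \<one>" if "j \<in> {1..n}" for j
  proof -
    have "\<theta> j \<one> \<otimes> \<theta> j \<one> = \<theta> j \<one>" using \<theta>_mult[of j \<one> \<one>] H_ops that by simp
    then show ?thesis using \<theta>[of j \<one>] H_ops that by simp
  qed
  have val_lmul: "val (lmul (j, h) ws) = \<theta> j h \<otimes> val ws" if "red ws" "j \<in> {1..n}" "h \<in> H j" for j h ws
  proof (cases "h = \<one>")
    case True
    then show ?thesis using val_c[OF that(1)] \<theta>1[OF that(2)] by simp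
  next
    case h1: False
    have c: "\<theta> j h \<in> carrier G" using \<theta> that by blast
    show ?thesis
    proof (cases ws)
      case Nil then show ?thesis using h1 by simp
    next
      case (Cons p ws')
      obtain i h' where p: "p = (i, h')" by force
      have r: "i \<in> {1..n}" "h' \<in> H i" "red ws'" using that(1) by (auto simp: Cons p red_Cons)
      then have c': "\<theta> i h' \<in> carrier G" "val ws' \<in> carrier G" using \<theta> val_c by auto
      show ?thesis
      proof (cases "i = j")
        case True
        have "\<theta> j h \<otimes> (\<theta> i h' \<otimes> val ws') = \<theta> j (h \<otimes> h') \<otimes> val ws'"
          using \<theta>_mult[OF that(2,3)] r True c c' by (simp add: m_assoc)
        then show ?thesis using h1 True c' \<theta>1[OF that(2)] by (auto simp: Cons p)
      qed (use h1 in \<open>simp add: Cons p\<close>)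
    qed
  qed
  define nf where "nf g = (THE w. red w \<and> wp w = g)" for g
  have nf: "red (nf g)" "wp (nf g) = g" if "g \<in> carrier G" for g
  proof -
    have "\<exists>!w. red w \<and> wp w = g" using that fp unfolding is_free_product_def by blast
    from theI'[OF this] show "red (nf g)" "wp (nf g) = g" by (auto simp: nf_def)
  qed
  have nf_eq: "nf (wp w) = w" if "red w" for w using nf[OF red_closed[OF that]] red_unique that by blast
  define \<phi> where "\<phi> = (\<lambda>g\<in>carrier G. val (nf g))"
  have step: "\<phi> (h \<otimes> g) = \<theta> j h \<otimes> \<phi> g" if "g \<in> carrier G" "j \<in> {1..n}" "h \<in> H j" for g j h
  proof -
    have "nf (h \<otimes> g) = lmul (j, h) (nf g)"
      using nf_eq[OF red_lmul(1)[OF nf(1)[OF that(1)] that(2,3)]] red_lmul(2)[OF nf(1)[OF that(1)] that(2,3)] nf(2)[OF that(1)] by simp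
    then show ?thesis using val_lmul[OF nf(1)[OF that(1)] that(2,3)] that H_closed by (simp add: \<phi>_def)
  qed
  have \<phi>_c: "\<phi> g \<in> carrier G" if "g \<in> carrier G" for g using that val_c nf by (simp add: \<phi>_def)
  have \<phi>1: "\<phi> \<one> = \<one>" using nf_eq[of "[]"] by (simp add: \<phi>_def)
  have "\<phi> (wp w \<otimes> g) = val w \<otimes> \<phi> g" if "red w" "g \<in> carrier G" for w g
    using that(1)
  proof (induction w)
    case Nil then show ?case using that \<phi>_c by simp
  next
    case (Cons p w)
    obtain j h where p: "p = (j, h)" by force
    have r: "j \<in> {1..n}" "h \<in> H j" "red w" using Cons.prems by (auto simp: p red_Cons)
    have c: "h \<in> carrier G" "wp w \<in> carrier G" "\<theta> j h \<in> carrier G" "val w \<in> carrier G"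
      using r H_closed red_closed \<theta> val_c by auto
    show ?case using step[OF _ r(1,2), of "wp w \<otimes> g"] Cons.IH[OF r(3)] c that(2) \<phi>_c[OF that(2)]
      by (simp add: p m_assoc)
  qed
  then have "\<phi> (g \<otimes> g') = \<phi> g \<otimes> \<phi> g'" if "g \<in> carrier G" "g' \<in> carrier G" for g g'
    using nf[OF that(1)] that by (metis \<phi>_def restrict_apply')
  then have "\<phi> \<in> hom G G" using \<phi>_c by (auto simp: hom_def)
  moreover have "\<phi> h = \<theta> j h" if "j \<in> {1..n}" "h \<in> H j" for j h
    using step[OF one_closed that] H_closed[OF that] \<phi>1 \<theta>[OF that] by simp
  moreover have "\<phi> \<in> extensional (carrier G)" by (simp add: \<phi>_def)
  ultimately show ?thesis using that by blast
qed

lemma hom_eqI: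
  assumes "\<phi> \<in> hom G G" "\<psi> \<in> hom G G" "\<And>j h. j \<in> {1..n} \<Longrightarrow> h \<in> H j \<Longrightarrow> \<phi> h = \<psi> h" "g \<in> carrier G"
  shows "\<phi> g = \<psi> g"
proof -
  have one: "f \<one> = \<one>" if "f \<in> hom G G" for f using hom_one[OF that is_group is_group] .
  obtain w where w: "red w" "wp w = g" using red_ex assms(4) by blast
  have "\<phi> (wp w) = \<psi> (wp w)" using w(1)
  proof (induction w)
    case Nil then show ?case using one[OF assms(1)] one[OF assms(2)] by simp
  next
    case (Cons p w)
    obtain j h where p: "p = (j, h)" by force
    have r: "j \<in> {1..n}" "h \<in> H j" "red w" using Cons.prems by (auto simp: p red_Cons)
    then show ?case using Cons.IH assms(3)[OF r(1,2)] assms(1,2) H_closed red_closed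
      by (simp add: p hom_mult)
  qed
  then show ?thesis using w by simp
qed

text \<open>Bijectivity: inverting all values of \<open>x\<close> gives the inverse map, because
  both maps fix \<open>H k\<close> pointwise and all values lie in \<open>H k\<close>.\<close>

theorem whitehead_props:
  assumes x: "is_sym_wh G n H k x"
  shows "whitehead G n H x \<in> hom G G" "whitehead G n H x \<in> extensional (carrier G)"
    "bij_betw (whitehead G n H x) (carrier G) (carrier G)"
    "\<And>j h. j \<in> {1..n} \<Longrightarrow> h \<in> H j \<Longrightarrow> whitehead G n H x h = x j \<otimes> h \<otimes> inv (x j)"
proof -
  have ex: "whitehead G n H y \<in> hom G G \<and> whitehead G n H y \<in> extensional (carrier G) \<and>
      (\<forall>j\<in>{1..n}. \<forall>h\<in>H j. whitehead G n H y h = y j \<otimes> h \<otimes> inv (y j))" if y: "is_sym_wh G n H k y" for y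
  proof -
    have yc: "y j \<in> carrier G" if "j \<in> {1..n}" for j using y that H_closed by (auto simp: is_sym_wh_def)
    obtain \<phi> where \<phi>: "\<phi> \<in> hom G G" "\<phi> \<in> extensional (carrier G)" "\<And>j h. j \<in> {1..n} \<Longrightarrow> h \<in> H j \<Longrightarrow> \<phi> h = y j \<otimes> h \<otimes> inv (y j)"
    proof (rule hom_extension[of "\<lambda>j h. y j \<otimes> h \<otimes> inv (y j)"])
      fix j h assume j: "j \<in> {1..n}" "h \<in> H j"
      then show "y j \<otimes> h \<otimes> inv (y j) \<in> carrier G" using yc H_closed by simp
      fix h' assume "h' \<in> H j"
      then have c: "y j \<in> carrier G" "h \<in> carrier G" "h' \<in> carrier G" using j yc H_closed by auto
      have "y j \<otimes> h \<otimes> inv (y j) \<otimes> (y j \<otimes> h' \<otimes> inv (y j)) = y j \<otimes> h \<otimes> (inv (y j) \<otimes> y j) \<otimes> h' \<otimes> inv (y j)"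
        using c by (simp only: m_assoc m_closed inv_closed)
      then show "y j \<otimes> (h \<otimes> h') \<otimes> inv (y j) = y j \<otimes> h \<otimes> inv (y j) \<otimes> (y j \<otimes> h' \<otimes> inv (y j))"
        using c by (simp add: m_assoc)
    qed blast
    have "whitehead G n H y = \<phi>"
      unfolding whitehead_def
    proof (rule the_equality)
      fix \<psi> assume "\<psi> \<in> hom G G \<and> \<psi> \<in> extensional (carrier G) \<and> (\<forall>j\<in>{1..n}. \<forall>h\<in>H j. \<psi> h = y j \<otimes> h \<otimes> inv (y j))"
      then have \<psi>: "\<psi> \<in> hom G G" "\<psi> \<in> extensional (carrier G)" "\<And>j h. j \<in> {1..n} \<Longrightarrow> h \<in> H j \<Longrightarrow> \<psi> h = \<phi> h" using \<phi>(3) by auto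
      show "\<psi> = \<phi>" by (rule extensionalityI[OF \<psi>(2) \<phi>(2)]) (rule hom_eqI[OF \<psi>(1) \<phi>(1) \<psi>(3)])
    qed (use \<phi> in auto)
    then show ?thesis using \<phi> by auto
  qed
  show hom: "whitehead G n H x \<in> hom G G" "whitehead G n H x \<in> extensional (carrier G)"
    and eq: "\<And>j h. j \<in> {1..n} \<Longrightarrow> h \<in> H j \<Longrightarrow> whitehead G n H x h = x j \<otimes> h \<otimes> inv (x j)"
    using ex[OF x] by auto
  have inverse: "whitehead G n H y (whitehead G n H z g) = g"
    if y: "is_sym_wh G n H k y" and z: "is_sym_wh G n H k z" and yz: "\<And>j. j \<in> {1..n} \<Longrightarrow> z j = inv (y j)"
      and g: "g \<in> carrier G" for y z g
  proof -
    let ?Y = "whitehead G n H y" and ?Z = "whitehead G n H z"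
    have hom: "?Y \<in> hom G G" "?Z \<in> hom G G" using ex y z by auto
    have k: "k \<in> {1..n}" using y by (simp add: is_sym_wh_def)
    have "compose (carrier G) ?Y ?Z g = id g"
    proof (rule hom_eqI[OF _ _ _ g])
      show "compose (carrier G) ?Y ?Z \<in> hom G G" using hom by (rule hom_compose[rotated])
      show "id \<in> hom G G" by (simp add: hom_def)
      fix j h assume j: "j \<in> {1..n}" "h \<in> H j"
      have yj: "y j \<in> H k" "y k = \<one>" using y j by (auto simp: is_sym_wh_def)
      have c: "y j \<in> carrier G" "h \<in> carrier G" using yj j k H_closed by auto
      have fixk: "?Y v = v" if "v \<in> H k" for v using ex[OF y] that k yj H_closed[OF k that] by simp
      have "?Y (?Z h) = ?Y (inv (y j) \<otimes> h \<otimes> y j)" using ex[OF z] j yz[OF j(1)] c by simp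
      also have "\<dots> = ?Y (inv (y j)) \<otimes> ?Y h \<otimes> ?Y (y j)" using hom(1) c by (simp add: hom_mult)
      also have "\<dots> = inv (y j) \<otimes> (y j \<otimes> h \<otimes> inv (y j)) \<otimes> y j"
        using fixk[OF yj(1)] fixk[OF H_ops(2)[OF k yj(1)]] ex[OF y] j by simp
      also have "\<dots> = (inv (y j) \<otimes> y j) \<otimes> h \<otimes> (inv (y j) \<otimes> y j)" using c by (simp only: m_assoc m_closed inv_closed)
      also have "\<dots> = h" using c by simp
      finally show "compose (carrier G) ?Y ?Z h = id h" using c by (simp add: compose_eq)
    qed
    then show ?thesis using g by (simp add: compose_eq)
  qed
  define x' where "x' j = inv (x j)" for j
  have xc: "x j \<in> carrier G" if "j \<in> {1..n}" for j using x that H_closed by (auto simp: is_sym_wh_def)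
  have k: "k \<in> {1..n}" using x by (simp add: is_sym_wh_def)
  have x': "is_sym_wh G n H k x'" using x H_ops(2)[OF k] by (auto simp: is_sym_wh_def x'_def)
  show "bij_betw (whitehead G n H x) (carrier G) (carrier G)"
  proof (rule bij_betw_byWitness[where f'="whitehead G n H x'"])
    show "\<forall>a\<in>carrier G. whitehead G n H x' (whitehead G n H x a) = a"
      using inverse[OF x' x] xc by (simp add: x'_def)
    show "\<forall>a\<in>carrier G. whitehead G n H x (whitehead G n H x' a) = a"
      using inverse[OF x x'] by (simp add: x'_def)
    show "whitehead G n H x ` carrier G \<subseteq> carrier G" "whitehead G n H x' ` carrier G \<subseteq> carrier G"
      using ex[OF x] ex[OF x'] by (auto simp: hom_def)
  qed
qed

lemma free_prod_image:
  assumes \<phi>: "\<phi> \<in> hom G G" "bij_betw \<phi> (carrier G) (carrier G)"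
  shows "is_free_product G n (basis_img n \<phi> H)"
proof -
  let ?K = "basis_img n \<phi> H"
  let ?m = "map (\<lambda>p. (fst p, \<phi> (snd p)))"
  have inj: "inj_on \<phi> (carrier G)" using \<phi>(2) by (simp add: bij_betw_def)
  have \<phi>1: "\<phi> \<one> = \<one>" using hom_one[OF \<phi>(1) is_group is_group] .
  have K: "?K i = \<phi> ` H i" if "i \<in> {1..n}" for i using that by (simp add: basis_img_def)
  have gh: "group_hom G G \<phi>" using \<phi>(1) by (simp add: group_hom_def group_hom_axioms_def is_group)
  have redm: "reduced_word G n ?K (?m w) \<longleftrightarrow> red w" if "\<forall>p\<in>set w. fst p \<in> {1..n} \<and> snd p \<in> H (fst p)" for w
  proof -
    have "\<phi> (snd p) \<noteq> \<one> \<longleftrightarrow> snd p \<noteq> \<one>" if "p \<in> set w" for p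
      using inj \<phi>1 \<open>\<forall>p\<in>set w. _ p\<close> that H_closed by (metis inj_onD one_closed)
    moreover have "Suc m < length w \<Longrightarrow> fst (?m w ! m) \<noteq> fst (?m w ! Suc m) \<longleftrightarrow> fst (w ! m) \<noteq> fst (w ! Suc m)" for m by simp
    ultimately show ?thesis using that K unfolding reduced_word_def by auto
  qed
  have wpm: "wp (?m w) = \<phi> (wp w)" if "red w" for w
    using that
  proof (induction w)
    case Nil then show ?case using \<phi>1 by simp
  next
    case (Cons p w)
    obtain j h where p: "p = (j, h)" by force
    have r: "j \<in> {1..n}" "h \<in> H j" "red w" using Cons.prems by (auto simp: p red_Cons)
    show ?case using Cons.IH[OF r(3)] hom_mult[OF \<phi>(1) H_closed[OF r(1,2)] red_closed[OF r(3)]] by (simp add: p)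
  qed
  have redH: "\<forall>p\<in>set w. fst p \<in> {1..n} \<and> snd p \<in> H (fst p)" if "red w" for w using that by (auto simp: reduced_word_def)
  have lift: "\<exists>w. red w \<and> v = ?m w" if v: "reduced_word G n ?K v" for v
  proof -
    have "\<forall>p\<in>set v. \<exists>h. h \<in> H (fst p) \<and> snd p = \<phi> h" using v K by (fastforce simp: reduced_word_def)
    then obtain q where q: "\<And>p. p \<in> set v \<Longrightarrow> q p \<in> H (fst p) \<and> snd p = \<phi> (q p)" by metis
    let ?w = "map (\<lambda>p. (fst p, q p)) v"
    have "?m ?w = v" unfolding map_map by (rule map_idI) (use q in \<open>simp add: prod_eq_iff\<close>)
    moreover have "\<forall>p\<in>set ?w. fst p \<in> {1..n} \<and> snd p \<in> H (fst p)" using q v by (auto simp: reduced_word_def)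
    ultimately show ?thesis using redm[of ?w] v by metis
  qed
  show ?thesis
    unfolding is_free_product_def
  proof (intro conjI ballI)
    fix i assume "i \<in> {1..n}"
    then show "subgroup (?K i) G" using K group_hom.subgroup_img_is_subgroup[OF gh subH] by simp
  next
    fix g assume "g \<in> carrier G"
    then obtain g0 where g0: "g0 \<in> carrier G" "g = \<phi> g0" using \<phi>(2) by (auto simp: bij_betw_def)
    then obtain w where w: "red w" "wp w = g0" using red_ex by blast
    show "\<exists>!ws. reduced_word G n ?K ws \<and> wp ws = g"
    proof (rule ex1I[of _ "?m w"])
      show "reduced_word G n ?K (?m w) \<and> wp (?m w) = g" using redm[OF redH[OF w(1)]] w wpm g0 by simp
      fix v assume v: "reduced_word G n ?K v \<and> wp v = g"
      then obtain w' where w': "red w'" "v = ?m w'" using lift by blast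
      then have "\<phi> (wp w') = \<phi> (wp w)" using v wpm w g0 by simp
      then have "wp w' = wp w" using inj red_closed w w' by (auto simp: inj_on_def)
      then show "v = ?m w" using red_unique[OF w'(1) w(1)] w'(2) by simp
    qed
  qed
qed

section \<open>The action on points and normal forms of points\<close>

lemma act_closed: "g \<in> carrier G \<Longrightarrow> p \<in> \<Lambda> \<Longrightarrow> act g p \<in> \<Lambda>"
  and act_mult: "g \<in> carrier G \<Longrightarrow> h \<in> carrier G \<Longrightarrow> p \<in> \<Lambda> \<Longrightarrow> act g (act h p) = act (g \<otimes> h) p"
  and act_one: "p \<in> \<Lambda> \<Longrightarrow> act \<one> p = p"
proof -
  have base: "act g (act h (vpt j)) = act (g \<otimes> h) (vpt j)" if "g \<in> carrier G" "h \<in> carrier G" "j \<le> n" for g h j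
    using that H_sub[of j] by (auto simp: pt_def conjugate_set_mult)
  show c: "act g p \<in> \<Lambda>" if "g \<in> carrier G" "p \<in> \<Lambda>" for g p
    using that base by (auto simp: points_def) (metis m_closed)
  show m: "act g (act h p) = act (g \<otimes> h) p" if gh: "g \<in> carrier G" "h \<in> carrier G" "p \<in> \<Lambda>" for g h p
  proof -
    obtain a j where p: "p = act a (vpt j)" "a \<in> carrier G" "j \<le> n" using gh(3) by (auto simp: points_def)
    show ?thesis using gh p base by (simp add: m_assoc)
  qed
  show "act \<one> p = p" if pl: "p \<in> \<Lambda>" for p
  proof -
    obtain a j where p: "p = act a (vpt j)" "a \<in> carrier G" "j \<le> n" using pl by (auto simp: points_def)
    then show ?thesis using base[of \<one> a j] by simp
  qed
qed

lemma vpt_in: "j \<le> n \<Longrightarrow> vpt j \<in> \<Lambda>"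
proof -
  assume j: "j \<le> n"
  have "act \<one> (vpt j) = vpt j" using j H_sub[of j] by (auto simp: pt_def conjugate_set_one)
  then show ?thesis using j unfolding points_def by (metis (mono_tags, lifting) mem_Collect_eq one_closed)
qed

lemma act_inv: "g \<in> carrier G \<Longrightarrow> p \<in> \<Lambda> \<Longrightarrow> act (inv g) (act g p) = p" "g \<in> carrier G \<Longrightarrow> p \<in> \<Lambda> \<Longrightarrow> act g (act (inv g) p) = p"
  by (simp_all add: act_mult act_one)

lemma act_inj: "g \<in> carrier G \<Longrightarrow> p \<in> \<Lambda> \<Longrightarrow> q \<in> \<Lambda> \<Longrightarrow> act g p = act g q \<longleftrightarrow> p = q"
  by (metis act_inv(1))

lemma act_stab: "k \<in> {1..n} \<Longrightarrow> h \<in> H k \<Longrightarrow> act h (vpt k) = vpt k"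
  using conjugate_set_self[OF subH] by (simp add: pt_def)

definition winv :: "(nat \<times> 'a) list \<Rightarrow> (nat \<times> 'a) list" where
  "winv w = rev (map (\<lambda>p. (fst p, inv (snd p))) w)"

lemma red_winv: "red w \<Longrightarrow> red (winv w) \<and> wp (winv w) = inv (wp w)"
proof (induction w)
  case (Cons p w)
  obtain j h where p: "p = (j, h)" by force
  have r: "j \<in> {1..n}" "h \<in> H j" "h \<noteq> \<one>" "red w" "w = [] \<or> fst (hd w) \<noteq> j" using Cons.prems by (auto simp: p red_Cons)
  have eq: "winv (p # w) = winv w @ [(j, inv h)]" by (simp add: winv_def p)
  have h: "h \<in> carrier G" using H_closed r by blast
  have "inv h \<noteq> \<one>" using h r(3) by simp
  then have r1: "red [(j, inv h)]" using r H_ops(2) by (simp add: red_Cons)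
  have "w \<noteq> [] \<Longrightarrow> fst (last (winv w)) = fst (hd w)" by (simp add: winv_def last_rev hd_map)
  then have red: "red (winv (p # w))" unfolding eq red_append using Cons.IH r r1 by (auto simp: winv_def)
  have "wp (winv (p # w)) = inv (wp w) \<otimes> inv h" unfolding eq using wp_append[of "winv w" "[(j, inv h)]"] Cons.IH[OF r(4)] r1 h by simp
  then show ?case using red h red_closed[OF r(4)] by (simp add: p inv_mult_group)
qed (simp add: winv_def)

text \<open>A last syllable in \<open>H j\<close> would be absorbed by the stabiliser of
  \<open>vpt j\<close>, so it is forbidden. The base point has trivial stabiliser, hence every
  reduced word is allowed for \<open>j = 0\<close>.\<close>

definition cd :: "'a + 'a set \<Rightarrow> (nat \<times> 'a) list \<Rightarrow> nat \<Rightarrow> bool" where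
  "cd p w j \<longleftrightarrow> red w \<and> j \<le> n \<and> (w = [] \<or> j = 0 \<or> fst (last w) \<noteq> j) \<and> p = act (wp w) (vpt j)"

lemma cd_ex: assumes "g \<in> carrier G" "j \<le> n" shows "\<exists>w. cd (act g (vpt j)) w j"
proof -
  obtain w where w: "red w" "wp w = g" using red_ex assms by blast
  show ?thesis
  proof (cases "w = [] \<or> j = 0 \<or> fst (last w) \<noteq> j")
    case False
    then obtain w' h where w': "w = w' @ [(j, h)]" by (metis append_butlast_last_id prod.collapse)
    have r: "red w'" "red [(j, h)]" "w' = [] \<or> fst (last w') \<noteq> j" using w(1) by (auto simp: w' red_append)
    have j: "j \<in> {1..n}" "h \<in> H j" using r(2) by (auto simp: red_Cons)
    have "act g (vpt j) = act (wp w') (act h (vpt j))"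
      using w(2) wp_append[OF r(1,2)] act_mult[OF red_closed[OF r(1)] H_closed[OF j] vpt_in] assms(2) H_closed[OF j] by (simp add: w')
    then have "cd (act g (vpt j)) w' j" using r assms(2) act_stab[OF j] by (auto simp: cd_def)
    then show ?thesis by blast
  qed (use w assms in \<open>auto simp: cd_def\<close>)
qed

lemma cd_ex': "p \<in> \<Lambda> \<Longrightarrow> \<exists>w j. cd p w j"
  using cd_ex unfolding points_def by blast

lemma cd_unique: assumes "cd p w j" "cd p w' j'" shows "w = w'" "j = j'"
proof -
  have r: "red w" "red w'" "j \<le> n" "j' \<le> n" using assms by (auto simp: cd_def)
  have e: "act (wp w) (vpt j) = act (wp w') (vpt j')" using assms by (simp add: cd_def)
  have "w = w' \<and> j = j'"
  proof (cases "j = 0")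
    case True
    then have "j' = 0" using e by (auto simp: pt_def split: if_splits)
    then show ?thesis using True e red_unique[OF r(1,2)] red_closed r by (simp add: pt_def)
  next
    case False
    then have j': "j' \<noteq> 0" using e by (auto simp: pt_def split: if_splits)
    have J: "j \<in> {1..n}" "j' \<in> {1..n}" using False j' r by auto
    have ce: "conjugate_set G (wp w) (H j) = conjugate_set G (wp w') (H j')" using e False j' by (simp add: pt_def)
    obtain h where h: "h \<in> H j" "h \<noteq> \<one>" using H_nontriv[OF J(1)] by blast
    have "wp w \<otimes> h \<otimes> inv (wp w) \<in> conjugate_set G (wp w') (H j')" unfolding ce[symmetric] using h by (auto simp: conjugate_set_def)
    then obtain h' where h': "h' \<in> H j'" "wp w \<otimes> h \<otimes> inv (wp w) = wp w' \<otimes> h' \<otimes> inv (wp w')" by (auto simp: conjugate_set_def)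
    have c: "wp w \<in> carrier G" "wp w' \<in> carrier G" "h \<in> carrier G" "h' \<in> carrier G" using red_closed r H_closed J h h' by auto
    have "h' \<noteq> \<one>"
    proof
      assume "h' = \<one>"
      then have "wp w \<otimes> h \<otimes> inv (wp w) = \<one>" using h' c by simp
      then have "wp w \<otimes> h = wp w" using c by (metis inv_equality inv_inv m_closed inv_closed)
      then show False using h(2) c by simp
    qed
    \<comment> \<open>No cancellation occurs around \<open>y\<close>, since \<open>v\<close> does
      not end in its factor. Thus the normal form of a nontrivial element of a vertex stabiliser,
      cut in the middle, recovers the word and the label of the vertex.\<close>
    have long: "red (v @ (i, y) # winv v) \<and> wp (v @ (i, y) # winv v) = wp v \<otimes> y \<otimes> inv (wp v)"
      if v: "red v" "v = [] \<or> fst (last v) \<noteq> i" and i: "i \<in> {1..n}" "y \<in> H i" "y \<noteq> \<one>" for v i y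
    proof -
      have "v \<noteq> [] \<Longrightarrow> fst (hd (winv v)) = fst (last v)" by (simp add: winv_def hd_rev last_map)
      moreover have "winv v = [] \<longleftrightarrow> v = []" by (simp add: winv_def)
      ultimately have r2: "red ((i, y) # winv v)" using i v red_winv[OF v(1)] by (auto simp: red_Cons)
      then have "red (v @ (i, y) # winv v)" using v by (simp add: red_append)
      moreover have "wp (v @ (i, y) # winv v) = wp v \<otimes> (y \<otimes> inv (wp v))" using wp_append[OF v(1) r2] red_winv[OF v(1)] by simp
      ultimately show ?thesis using red_closed[OF v(1)] H_closed[OF i(1,2)] by (simp add: m_assoc)
    qed
    have "w @ (j, h) # winv w = w' @ (j', h') # winv w'"
      by (rule red_unique)
         (use long[of w j h] long[of w' j' h'] assms False j' h h' J \<open>h' \<noteq> \<one>\<close> in \<open>auto simp: cd_def\<close>)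
    moreover have "length w = length w'"
      using arg_cong[OF calculation, of length] by (simp add: winv_def)
    ultimately show ?thesis by simp
  qed
  then show "w = w'" "j = j'" by auto
qed

lemma label_unique:
  assumes "g \<in> carrier G" "g' \<in> carrier G" "i \<le> n" "j \<le> n" "act g (vpt i) = act g' (vpt j)" shows "i = j"
proof -
  obtain w w' where "cd (act g (vpt i)) w i" "cd (act g' (vpt j)) w' j" using cd_ex assms by blast
  then show ?thesis using cd_unique(2) assms(5) by metis
qed

lemma vpt_inj: "i \<le> n \<Longrightarrow> j \<le> n \<Longrightarrow> vpt i = vpt j \<longleftrightarrow> i = j"
  using label_unique[of \<one> \<one> i j] act_one vpt_in by auto

text \<open>Once a final syllable in \<open>H k\<close> is removed, the normal form of
  \<open>g\<close> is a code of \<open>vpt k\<close>, and by uniqueness of codes it is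
  empty.\<close>

lemma stab_vpt:
  assumes "g \<in> carrier G" "k \<in> {1..n}" "act g (vpt k) = vpt k" shows "g \<in> H k"
proof -
  have cd0: "cd (vpt k) [] k" using assms(2) act_one vpt_in by (simp add: cd_def)
  obtain w where w: "red w" "wp w = g" using red_ex assms by blast
  show ?thesis
  proof (cases "w = [] \<or> fst (last w) \<noteq> k")
    case True
    then have "cd (vpt k) w k" using w assms by (simp add: cd_def)
    then have "w = []" using cd_unique(1)[OF _ cd0] by blast
    then show ?thesis using w H_ops(3)[OF assms(2)] by simp
  next
    case False
    then obtain w' h where w': "w = w' @ [(k, h)]" by (metis append_butlast_last_id prod.collapse)
    have r: "red w'" "red [(k, h)]" "w' = [] \<or> fst (last w') \<noteq> k" using w(1) by (auto simp: w' red_append)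
    have h: "h \<in> H k" using r(2) by (auto simp: red_Cons)
    have gh: "g = wp w' \<otimes> h" using w(2) wp_append[OF r(1,2)] H_closed[OF assms(2) h] by (simp add: w')
    have "act g (vpt k) = act (wp w') (act h (vpt k))"
      using gh act_mult[OF red_closed[OF r(1)] H_closed[OF assms(2) h] vpt_in] assms(2) by simp
    then have "cd (vpt k) w' k" using r assms act_stab[OF assms(2) h] by (auto simp: cd_def)
    then have "w' = []" using cd_unique(1)[OF _ cd0] by blast
    then show ?thesis using gh h H_closed[OF assms(2) h] by simp
  qed
qed

text \<open>Distinct factors meet only in the identity, since a common element would have two normal
  forms of length one. Consequently a translation is determined by its effect on two vertices of a
  basis.\<close>

lemma pair_stab:
  assumes "g \<in> carrier G" "i \<le> n" "k \<le> n" "i \<noteq> k" "act g (vpt i) = vpt i" "act g (vpt k) = vpt k" shows "g = \<one>"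
proof (cases "i = 0 \<or> k = 0")
  case True
  then show ?thesis using assms by (auto simp: pt_def)
next
  case False
  then have gi: "g \<in> H i" "g \<in> H k" "i \<in> {1..n}" "k \<in> {1..n}" using stab_vpt assms by auto
  show ?thesis
  proof (rule ccontr)
    assume "g \<noteq> \<one>"
    then have "red [(i, g)]" "red [(k, g)]" using gi by (auto simp: red_Cons)
    then have "[(i, g)] = [(k, g)]" using red_unique[of "[(i,g)]" "[(k,g)]"] by simp
    then show False using assms(4) by simp
  qed
qed

lemma transl_unique:
  assumes "g \<in> carrier G" "g' \<in> carrier G" "i \<le> n" "k \<le> n" "i \<noteq> k"
    "act g (vpt i) = act g' (vpt i)" "act g (vpt k) = act g' (vpt k)" shows "g = g'"
proof -
  have "act (inv g' \<otimes> g) (vpt i) = vpt i" if "act g (vpt i) = act g' (vpt i)" "i \<le> n" for i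
    using that assms(1,2) act_mult[of "inv g'" g "vpt i"] act_inv(1)[of g' "vpt i"] vpt_in by simp
  then have "inv g' \<otimes> g = \<one>" using pair_stab[of "inv g' \<otimes> g" i k] assms by simp
  then show ?thesis using assms by (metis inv_equality inv_inv inv_closed)
qed

end

section \<open>The tree of a basis\<close>

text \<open>The direction at the vertex of label \<open>k\<close> of the point coded by \<open>(w, j)\<close> is the pair of the
  syllable \<open>dx k w\<close> and the label \<open>da k w j\<close>.\<close>

definition hl :: "(nat \<times> 'a) list \<Rightarrow> nat \<Rightarrow> nat" where
  "hl w j = (if w = [] then j else fst (hd w))"

definition dx :: "('a, 'b) monoid_scheme \<Rightarrow> nat \<Rightarrow> (nat \<times> 'a) list \<Rightarrow> 'a" where
  "dx G k w = (if w \<noteq> [] \<and> fst (hd w) = k then snd (hd w) else \<one>\<^bsub>G\<^esub>)"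

definition da :: "nat \<Rightarrow> (nat \<times> 'a) list \<Rightarrow> nat \<Rightarrow> nat" where
  "da k w j = (if w \<noteq> [] \<and> fst (hd w) = k then hl (tl w) j else hl w j)"

context free_prod
begin

lemma cd_Cons: "cd p ((k, y) # w) j \<longleftrightarrow> k \<in> {1..n} \<and> y \<in> H k \<and> y \<noteq> \<one> \<and> hl w j \<noteq> k \<and> (\<exists>q. cd q w j \<and> p = act y q)"
proof
  assume a: "cd p ((k, y) # w) j"
  then have r: "k \<in> {1..n}" "y \<in> H k" "y \<noteq> \<one>" "red w" "w = [] \<or> fst (hd w) \<noteq> k" "j \<le> n"
    and l: "j = 0 \<or> fst (last ((k, y) # w)) \<noteq> j" and p: "p = act (y \<otimes> wp w) (vpt j)"
    by (auto simp: cd_def red_Cons)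
  have "hl w j \<noteq> k" using r l by (auto simp: hl_def)
  moreover have "cd (act (wp w) (vpt j)) w j" using r l by (auto simp: cd_def)
  moreover have "p = act y (act (wp w) (vpt j))"
    using p act_mult[OF H_closed[OF r(1,2)] red_closed[OF r(4)] vpt_in[OF r(6)]] by simp
  ultimately show "k \<in> {1..n} \<and> y \<in> H k \<and> y \<noteq> \<one> \<and> hl w j \<noteq> k \<and> (\<exists>q. cd q w j \<and> p = act y q)" using r by blast
next
  assume a: "k \<in> {1..n} \<and> y \<in> H k \<and> y \<noteq> \<one> \<and> hl w j \<noteq> k \<and> (\<exists>q. cd q w j \<and> p = act y q)"
  then obtain q where q: "cd q w j" "p = act y q" by blast
  have r: "red w" "j \<le> n" "q = act (wp w) (vpt j)" using q by (auto simp: cd_def)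
  have "p = act (y \<otimes> wp w) (vpt j)"
    using q(2) r a act_mult[OF H_closed red_closed[OF r(1)] vpt_in[OF r(2)]] by auto
  then show "cd p ((k, y) # w) j" using a q(1) by (auto simp: cd_def red_Cons hl_def)
qed

lemma cd_Nil: "cd p [] j \<longleftrightarrow> j \<le> n \<and> p = vpt j"
  using act_one vpt_in by (auto simp: cd_def)

lemma cd_in: "cd p w j \<Longrightarrow> p \<in> \<Lambda> \<and> j \<le> n \<and> hl w j \<le> n"
proof -
  assume a: "cd p w j"
  then have "p \<in> \<Lambda>" "j \<le> n" using act_closed[OF red_closed vpt_in] by (auto simp: cd_def)
  moreover have "hl w j \<le> n" using a by (cases w) (auto simp: cd_def hl_def red_Cons)
  ultimately show ?thesis by blast
qed

lemma hl_le: "cd p w j \<Longrightarrow> hl w j \<le> n" using cd_in by blast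

lemma cd_vpt: assumes "cd p w j" "k \<le> n" shows "p = vpt k \<longleftrightarrow> w = [] \<and> j = k"
  using assms cd_unique[of p w j "[]" k] by (auto simp: cd_Nil)

text \<open>An element of the stabiliser of \<open>vpt k\<close> touches only a leading syllable in
  the factor \<open>k\<close>. So it changes the syllable of a direction at \<open>k\<close> and
  leaves its label alone.\<close>

lemma cd_lmul:
  assumes "cd p w j" "k \<in> {1..n}" "z \<in> H k" "p \<noteq> vpt k"
  shows "cd (act z p) (lmul (k, z) w) j"
    and "dx G k (lmul (k, z) w) = z \<otimes> dx G k w" "da k (lmul (k, z) w) j = da k w j"
proof -
  have kn: "k \<le> n" using assms by simp
  have wj: "w = [] \<Longrightarrow> j \<noteq> k" using assms cd_vpt kn by blast
  have p: "p \<in> \<Lambda>" using cd_in assms by blast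
  have z: "z \<in> carrier G" using H_closed assms by blast
  have "cd (act z p) (lmul (k, z) w) j \<and> dx G k (lmul (k, z) w) = z \<otimes> dx G k w \<and> da k (lmul (k, z) w) j = da k w j"
  proof (cases "z = \<one>")
    case True
    have "dx G k w \<in> carrier G" using assms(1) H_closed by (cases w) (auto simp: dx_def cd_def red_Cons)
    then show ?thesis using True assms act_one[OF p] by simp
  next
    case z1: False
    show ?thesis
    proof (cases w)
      case Nil
      then have "cd (act z p) [(k, z)] j" using assms z1 wj by (auto simp: cd_Cons hl_def)
      then show ?thesis using Nil z1 z by (simp add: dx_def da_def hl_def)
    next
      case (Cons c w')
      obtain i h where c: "c = (i, h)" by force
      obtain q where q: "i \<in> {1..n}" "h \<in> H i" "h \<noteq> \<one>" "hl w' j \<noteq> i" "cd q w' j" "p = act h q"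
        using assms(1) by (auto simp: Cons c cd_Cons)
      have qL: "q \<in> \<Lambda>" using q(5) cd_in by blast
      have h: "h \<in> carrier G" using H_closed q by blast
      show ?thesis
      proof (cases "i = k")
        case False
        then have "cd (act z p) ((k, z) # w) j" using assms z1 by (auto simp: cd_Cons Cons c hl_def)
        then show ?thesis using False z1 z by (simp add: Cons c dx_def da_def hl_def)
      next
        case True
        have m: "act z p = act (z \<otimes> h) q" using q(6) act_mult z h qL by simp
        show ?thesis
        proof (cases "z \<otimes> h = \<one>")
          case zh: True
          then have "act z p = q" using m act_one qL by simp
          moreover have "dx G k w' = \<one>" "da k w' j = hl w' j" using q(4) True by (auto simp: dx_def da_def hl_def)
          ultimately show ?thesis using zh True z1 q by (simp add: Cons c) (simp add: dx_def da_def)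
        next
          case zh: False
          have "z \<otimes> h \<in> H k" using H_ops(1) assms(2,3) q(2) True by blast
          then have "cd (act z p) ((k, z \<otimes> h) # w') j" using m q zh True by (auto simp: cd_Cons)
          then show ?thesis using True z1 zh by (simp add: Cons c dx_def da_def)
        qed
      qed
    qed
  qed
  then show "cd (act z p) (lmul (k, z) w) j" "dx G k (lmul (k, z) w) = z \<otimes> dx G k w" "da k (lmul (k, z) w) j = da k w j" by auto
qed

definition code :: "'a + 'a set \<Rightarrow> (nat \<times> 'a) list \<times> nat" where
  "code p = (SOME c. cd p (fst c) (snd c))"

definition dr :: "nat \<Rightarrow> 'a + 'a set \<Rightarrow> 'a \<times> nat" where
  "dr k p = (dx G k (fst (code p)), da k (fst (code p)) (snd (code p)))"

lemma code_eq: "cd p w j \<Longrightarrow> code p = (w, j)"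
proof -
  assume a: "cd p w j"
  then have "cd p (fst (code p)) (snd (code p))"
    unfolding code_def using someI[of "\<lambda>c. cd p (fst c) (snd c)" "(w, j)"] by simp
  then show "code p = (w, j)" using cd_unique[OF a] by (simp add: prod_eq_iff)
qed

lemma dr_eq: "cd p w j \<Longrightarrow> dr k p = (dx G k w, da k w j)"
  using code_eq by (simp add: dr_def)

lemma dr_act:
  assumes "k \<in> {1..n}" "z \<in> H k" "p \<in> \<Lambda>" "p \<noteq> vpt k" shows "dr k (act z p) = (z \<otimes> fst (dr k p), snd (dr k p))"
proof -
  obtain w j where c: "cd p w j" using cd_ex' assms by blast
  show ?thesis using dr_eq[OF c] dr_eq[OF cd_lmul(1)[OF c assms(1,2,4)]] cd_lmul(2,3)[OF c assms(1,2,4)] by simp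
qed

lemma dr_range:
  assumes "k \<in> {1..n}" "p \<in> \<Lambda>" "p \<noteq> vpt k" shows "fst (dr k p) \<in> H k" "snd (dr k p) \<le> n" "snd (dr k p) \<noteq> k"
proof -
  obtain w j where c: "cd p w j" using cd_ex' assms by blast
  have wj: "w = [] \<Longrightarrow> j \<noteq> k" using assms cd_vpt[OF c, of k] by auto
  have "fst (dr k p) \<in> H k \<and> snd (dr k p) \<le> n \<and> snd (dr k p) \<noteq> k"
  proof (cases w)
    case Nil
    then show ?thesis using dr_eq[OF c] wj H_ops(3) assms cd_in[OF c] by (simp add: dx_def da_def hl_def)
  next
    case (Cons a w')
    obtain i h where a: "a = (i, h)" by force
    obtain q where q: "i \<in> {1..n}" "h \<in> H i" "hl w' j \<noteq> i" "cd q w' j" using c by (auto simp: Cons a cd_Cons)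
    then show ?thesis using dr_eq[OF c] hl_le[OF q(4)] H_ops(3) assms by (auto simp: Cons a dx_def da_def hl_def)
  qed
  then show "fst (dr k p) \<in> H k" "snd (dr k p) \<le> n" "snd (dr k p) \<noteq> k" by auto
qed

text \<open>The inverse of the word does not cancel against the code of \<open>r\<close>, which does
  not start in the factor \<open>k\<close>. Seen from \<open>l\<close>, the point therefore lies
  behind the last letter of the word.\<close>

lemma dr_drop:
  assumes "cd r v i" "hl v i \<noteq> k" "red ((k, y) # w)" "fst (last ((k, y) # w)) \<noteq> l"
  shows "dr l (act (inv (wp ((k, y) # w))) r) = (\<one>, fst (last ((k, y) # w)))"
  using assms
proof (induction w arbitrary: k y r v)
  case Nil
  then have y: "k \<in> {1..n}" "y \<in> H k" "y \<noteq> \<one>" "y \<in> carrier G" using H_closed by (auto simp: red_Cons)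
  have "cd (act (inv y) r) ((k, inv y) # v) i" using Nil y H_ops(2) by (auto simp: cd_Cons)
  from dr_eq[OF this] show ?case using y Nil by (simp add: dx_def da_def hl_def)
next
  case (Cons c w)
  obtain k2 z where c: "c = (k2, z)" by force
  have y: "k \<in> {1..n}" "y \<in> H k" "y \<noteq> \<one>" "y \<in> carrier G" "red ((k2, z) # w)" "k2 \<noteq> k"
    using Cons.prems(3) H_closed by (auto simp: c red_Cons)
  have cd': "cd (act (inv y) r) ((k, inv y) # v) i" using Cons.prems y H_ops(2) by (auto simp: cd_Cons)
  have wc: "wp ((k2, z) # w) \<in> carrier G" using red_closed y by blast
  have "act (inv (wp ((k, y) # c # w))) r = act (inv (wp ((k2, z) # w))) (act (inv y) r)"
  proof -
    have "inv (wp ((k, y) # c # w)) = inv (wp ((k2, z) # w)) \<otimes> inv y" using inv_mult_group[OF y(4) wc] by (simp add: c)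
    then show ?thesis using act_mult[of "inv (wp ((k2, z) # w))" "inv y" r] wc y(4) cd_in[OF Cons.prems(1)] by (metis inv_closed)
  qed
  then show ?case using Cons.IH[OF cd' _ y(5)] Cons.prems(4) y(6) by (simp add: c hl_def)
qed

section \<open>Separation in the Bass--Serre tree\<close>

text \<open>The components of the Bass--Serre tree off \<open>vpt k\<close> correspond to pairs of
  an element of \<open>H k\<close> and a petal at \<open>k\<close>. The translating element
  \<open>g\<close> is unique only up to \<open>H k\<close>, which multiplies both syllables by the
  same left factor, so the condition does not depend on it.\<close>

definition base_sep :: "(nat \<Rightarrow> nat \<Rightarrow> nat \<Rightarrow> bool) \<Rightarrow> 'a + 'a set \<Rightarrow> 'a + 'a set \<Rightarrow> 'a + 'a set \<Rightarrow> bool" where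
  "base_sep s l p q \<longleftrightarrow> l \<in> \<Lambda> \<and> p \<in> \<Lambda> \<and> q \<in> \<Lambda> \<and> p \<noteq> l \<and> q \<noteq> l \<and>
     (\<exists>g\<in>carrier G. \<exists>k\<in>{1..n}. l = act g (vpt k) \<and>
       \<not> (fst (dr k (act (inv g) p)) = fst (dr k (act (inv g) q)) \<and>
          \<not> s k (snd (dr k (act (inv g) p))) (snd (dr k (act (inv g) q)))))"

lemma base_sep_iff:
  assumes g: "g \<in> carrier G" "k \<in> {1..n}" and pq: "p \<in> \<Lambda>" "q \<in> \<Lambda>" "p \<noteq> act g (vpt k)" "q \<noteq> act g (vpt k)"
  shows "base_sep s (act g (vpt k)) p q \<longleftrightarrow>
     \<not> (fst (dr k (act (inv g) p)) = fst (dr k (act (inv g) q)) \<and>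
        \<not> s k (snd (dr k (act (inv g) p))) (snd (dr k (act (inv g) q))))" (is "_ \<longleftrightarrow> ?R g")
proof -
  have kL: "vpt k \<in> \<Lambda>" using vpt_in g by simp
  have indep: "?R g \<longleftrightarrow> ?R g'" if g': "g' \<in> carrier G" "act g (vpt k) = act g' (vpt k)" for g'
  proof -
    define z where "z = inv g' \<otimes> g"
    have zc: "z \<in> carrier G" using g g' by (simp add: z_def)
    have "act z (vpt k) = vpt k" using act_mult[of "inv g'" g "vpt k"] act_inv(1)[of g' "vpt k"] g g' kL by (simp add: z_def)
    then have z: "z \<in> H k" using stab_vpt zc g by blast
    have tr: "dr k (act (inv g') p) = (z \<otimes> fst (dr k (act (inv g) p)), snd (dr k (act (inv g) p))) \<and> fst (dr k (act (inv g) p)) \<in> carrier G"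
      if p: "p \<in> \<Lambda>" "p \<noteq> act g (vpt k)" for p
    proof -
      have 1: "act (inv g) p \<in> \<Lambda>" using act_closed g p by simp
      have 2: "act (inv g) p \<noteq> vpt k" using act_inv(2)[OF g(1) p(1)] p(2) by metis
      have "z \<otimes> inv g = inv g'" using g g' by (simp add: z_def m_assoc)
      then have "act (inv g') p = act z (act (inv g) p)" using act_mult[OF zc _ p(1), of "inv g"] g by simp
      then show ?thesis using dr_act[OF g(2) z 1 2] dr_range(1)[OF g(2) 1 2] H_closed g by simp
    qed
    show ?thesis using tr[OF pq(1,3)] tr[OF pq(2,4)] zc by auto
  qed
  show ?thesis
  proof
    assume "base_sep s (act g (vpt k)) p q"
    then obtain g' k' where g': "g' \<in> carrier G" "k' \<in> {1..n}" "act g (vpt k) = act g' (vpt k')"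
      and R: "\<not> (fst (dr k' (act (inv g') p)) = fst (dr k' (act (inv g') q)) \<and>
          \<not> s k' (snd (dr k' (act (inv g') p))) (snd (dr k' (act (inv g') q))))" by (auto simp: base_sep_def)
    have "k = k'" using label_unique[OF g(1) g'(1) _ _ g'(3)] g g' by auto
    then show "?R g" using indep[of g'] g' R by simp
  next
    assume "?R g"
    then show "base_sep s (act g (vpt k)) p q" unfolding base_sep_def using g pq act_closed[OF g(1) kL] by blast
  qed
qed

lemma base_sep_dom: "base_sep s l p q \<Longrightarrow> l \<in> \<Lambda> \<and> p \<in> \<Lambda> \<and> q \<in> \<Lambda> \<and> p \<noteq> l \<and> q \<noteq> l"
  by (auto simp: base_sep_def)

lemma base_sepE:
  assumes "base_sep s l p q" obtains g k where "g \<in> carrier G" "k \<in> {1..n}" "l = act g (vpt k)"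
  using assms by (auto simp: base_sep_def)

lemma base_sep_leaf: "\<not> base_sep s (Inl a) p q"
  by (auto simp: base_sep_def pt_def)

lemma base_sep_act:
  assumes h: "h \<in> carrier G" and "l \<in> \<Lambda>" "p \<in> \<Lambda>" "q \<in> \<Lambda>"
  shows "base_sep s (act h l) (act h p) (act h q) \<longleftrightarrow> base_sep s l p q"
proof -
  have imp: "base_sep s (act h l) (act h p) (act h q)"
    if b: "base_sep s l p q" and h: "h \<in> carrier G" for h l p q
  proof -
    obtain g k where g: "g \<in> carrier G" "k \<in> {1..n}" "l = act g (vpt k)" using base_sepE b by blast
    have d: "l \<in> \<Lambda>" "p \<in> \<Lambda>" "q \<in> \<Lambda>" "p \<noteq> l" "q \<noteq> l" using base_sep_dom b by auto
    have l: "act h l = act (h \<otimes> g) (vpt k)" using g h act_mult vpt_in by simp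
    have tr: "act (inv (h \<otimes> g)) (act h r) = act (inv g) r" if "r \<in> \<Lambda>" for r
    proof -
      have "inv (h \<otimes> g) \<otimes> h = inv g" using g h by (simp add: inv_mult_group m_assoc)
      then show ?thesis using act_mult[of "inv (h \<otimes> g)" h r] g h that by simp
    qed
    have ne: "act h p \<noteq> act (h \<otimes> g) (vpt k)" "act h q \<noteq> act (h \<otimes> g) (vpt k)"
      unfolding l[symmetric] using act_inj[OF h d(2,1)] act_inj[OF h d(3,1)] d by auto
    have "base_sep s (act h l) (act h p) (act h q) \<longleftrightarrow> base_sep s l p q"
      unfolding l base_sep_iff[OF m_closed[OF h g(1)] g(2) act_closed[OF h d(2)] act_closed[OF h d(3)] ne]
        tr[OF d(2)] tr[OF d(3)]
      using base_sep_iff[OF g(1,2) d(2,3)] d(4,5) g(3) by simp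
    then show ?thesis using b by simp
  qed
  show ?thesis
  proof
    assume "base_sep s (act h l) (act h p) (act h q)"
    from imp[OF this, of "inv h"] show "base_sep s l p q" using assms act_inv(1) by simp
  qed (use imp h in blast)
qed

lemma base_sep_tree:
  assumes s: "pointed_sep n s" shows "sep_tree \<Lambda> (base_sep s)"
proof -
  interpret T: fin_sep_tree "{0..n}" s using s by (simp add: pointed_sep_def)
  have drr: "fst (dr k (act (inv g) p)) \<in> H k \<and> snd (dr k (act (inv g) p)) \<le> n \<and> snd (dr k (act (inv g) p)) \<noteq> k"
    if "g \<in> carrier G" "k \<in> {1..n}" "p \<in> \<Lambda>" "p \<noteq> act g (vpt k)" for g k p
  proof -
    have "act (inv g) p \<in> \<Lambda>" "act (inv g) p \<noteq> vpt k" using that act_closed act_inv(2)[OF that(1,3)] by (simp, metis)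
    then show ?thesis using dr_range[OF that(2)] by blast
  qed
  show ?thesis
  proof
    fix k i j l
    let ?r = "base_sep s"
    show "?r k i j \<Longrightarrow> k \<in> \<Lambda> \<and> i \<in> \<Lambda> \<and> j \<in> \<Lambda> \<and> i \<noteq> k \<and> j \<noteq> k" by (rule base_sep_dom)
    show "\<not> ?r k i i" using T.irrefl by (auto simp: base_sep_def)
    show "?r k i j \<Longrightarrow> ?r k j i" unfolding base_sep_def using T.sym by metis
    show "?r k i j \<or> ?r k j l" if a: "?r k i l" "j \<in> \<Lambda>" "j \<noteq> k"
    proof -
      obtain g c where g: "g \<in> carrier G" "c \<in> {1..n}" "k = act g (vpt c)" using base_sepE a(1) by blast
      have d: "i \<in> \<Lambda>" "l \<in> \<Lambda>" "i \<noteq> k" "l \<noteq> k" using base_sep_dom[OF a(1)] by auto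
      have "snd (dr c (act (inv g) j)) \<in> {0..n}" "snd (dr c (act (inv g) j)) \<noteq> c" using drr[OF g(1,2) a(2)] a(3) g(3) by auto
      then show ?thesis
        using a(1) base_sep_iff[OF g(1,2) d(1,2)] base_sep_iff[OF g(1,2) d(1) a(2)] base_sep_iff[OF g(1,2) a(2) d(2)]
          d a(3) g(3) T.tri by metis
    qed
    show "\<not> ?r l i k" if a: "?r k i l"
    proof (cases "\<exists>a. l = Inl a")
      case False
      obtain g0 c where g0: "g0 \<in> carrier G" "c \<in> {1..n}" "k = act g0 (vpt c)" using base_sepE a by blast
      have d: "k \<in> \<Lambda>" "i \<in> \<Lambda>" "l \<in> \<Lambda>" "i \<noteq> k" "l \<noteq> k" using base_sep_dom[OF a] by auto
      let ?x = "fst (dr c (act (inv g0) l))"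
      have x: "?x \<in> H c" using drr[OF g0(1,2) d(3)] d g0(3) by auto
      then have xc: "?x \<in> carrier G" using H_closed g0 by blast
      \<comment> \<open>Translating by \<open>g0\<close> and then by the syllable \<open>?x\<close>
        turns \<open>k\<close> into \<open>vpt c\<close> and gives the direction of \<open>l\<close>
        a trivial syllable, so that the code of \<open>l\<close> does not start in the factor
        \<open>c\<close>.\<close>
      define g where "g = g0 \<otimes> ?x"
      have g: "g \<in> carrier G" "k = act g (vpt c)"
        using g0 xc act_stab[OF g0(2) x] act_mult[OF g0(1) xc vpt_in, of c] by (auto simp: g_def)
      define l' where "l' = act (inv g) l"
      define i' where "i' = act (inv g) i"
      have li: "l' \<in> \<Lambda>" "i' \<in> \<Lambda>" "l' \<noteq> vpt c" "i' \<noteq> vpt c" "l = act g l'" "i = act g i'"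
        using d g act_closed act_inv(2) by (auto simp: l'_def i'_def) (metis)+
      have drl: "fst (dr c l') = \<one>"
      proof -
        have "l' = act (inv ?x) (act (inv g0) l)"
          using act_mult[of "inv ?x" "inv g0" l] xc g0 d by (simp add: l'_def g_def inv_mult_group)
        moreover have "act (inv g0) l \<in> \<Lambda>" "act (inv g0) l \<noteq> vpt c"
          using act_closed act_inv(2)[OF g0(1) d(3)] g0 d by (simp, metis)
        ultimately show ?thesis using dr_act[OF g0(2) H_ops(2)[OF g0(2) x]] xc by simp
      qed
      have sep: "\<not> (fst (dr c i') = \<one> \<and> \<not> s c (snd (dr c i')) (snd (dr c l')))"
        using a base_sep_iff[OF g(1) g0(2) d(2,3)] d g(2) drl by (simp add: l'_def i'_def)
      obtain w b where w: "cd l' w b" using cd_ex' li by blast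
      have b: "b \<in> {1..n}"
      proof -
        have "b \<noteq> 0"
        proof
          assume "b = 0"
          then have "\<exists>a. l' = Inl a" using w by (auto simp: cd_def pt_def)
          then show False using False li(5) by auto
        qed
        then show ?thesis using cd_in[OF w] by auto
      qed
      have rw: "red w" "wp w \<in> carrier G" "l' = act (wp w) (vpt b)" using w red_closed by (auto simp: cd_def)
      have cb: "cd (vpt c) [] c" using g0 by (simp add: cd_Nil)
      obtain v e where v: "cd i' v e" using cd_ex' li by blast
      have w0: "w = [] \<or> fst (hd w) \<noteq> c"
      proof (rule ccontr)
        assume n: "\<not> ?thesis"
        then have "fst (dr c l') = snd (hd w)" using dr_eq[OF w] by (simp add: dx_def)
        moreover have "snd (hd w) \<noteq> \<one>" using rw(1) n by (cases w) (auto simp: red_Cons)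
        ultimately show False using drl by simp
      qed
      have sl: "snd (dr c l') = hl w b" using dr_eq[OF w] w0 by (auto simp: da_def)
      \<comment> \<open>If \<open>w\<close> is not empty, both other points are seen from
        \<open>l\<close> through the last letter of \<open>w\<close>, unless \<open>i\<close> starts
        in the same factor as \<open>w\<close>, which \<open>sep\<close> excludes. If
        \<open>w\<close> is empty, \<open>l\<close> is a vertex of the basis and \<open>ax\<close>
        for \<open>s\<close> decides.\<close>
      have main: "fst (dr b (act (inv (wp w)) i')) = fst (dr b (act (inv (wp w)) (vpt c))) \<and>
         \<not> s b (snd (dr b (act (inv (wp w)) i'))) (snd (dr b (act (inv (wp w)) (vpt c))))"
      proof (cases w)
        case (Cons y w')
        obtain k1 z where y: "y = (k1, z)" by force
        have k1: "k1 \<noteq> c" using w0 by (simp add: Cons y)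
        have lastb: "fst (last ((k1, z) # w')) \<noteq> b" using w b by (auto simp: cd_def Cons y)
        have h1: "hl v e \<noteq> k1"
        proof
          assume h: "hl v e = k1"
          then have "dr c i' = (\<one>, k1)" using dr_eq[OF v] k1 by (auto simp: dx_def da_def hl_def)
          then show False using sep sl T.irrefl by (simp add: Cons y hl_def)
        qed
        have h2: "hl [] c \<noteq> k1" using k1 by (simp add: hl_def)
        have "red ((k1, z) # w')" using rw(1) by (simp only: Cons y)
        then have "dr b (act (inv (wp w)) i') = dr b (act (inv (wp w)) (vpt c))"
          using dr_drop[OF v h1 _ lastb] dr_drop[OF cb h2 _ lastb] by (simp only: Cons y)
        then show ?thesis using T.irrefl by simp
      next
        case Nil
        have bc: "b \<noteq> c" using li(3) rw(3) act_one vpt_in b by (auto simp: Nil)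
        have "act (inv (wp w)) i' = i'" "act (inv (wp w)) (vpt c) = vpt c" using Nil act_one li vpt_in g0 by auto
        moreover have "dr b (vpt c) = (\<one>, c)" using dr_eq[OF cb] bc by (simp add: dx_def da_def hl_def)
        moreover have "fst (dr b i') = \<one> \<and> \<not> s b (snd (dr b i')) c"
        proof (cases "v \<noteq> [] \<and> fst (hd v) = c")
          case True
          then have "dr b i' = (\<one>, c)" using dr_eq[OF v] bc by (auto simp: dx_def da_def hl_def)
          then show ?thesis using T.irrefl by simp
        next
          case F: False
          then have dc: "dr c i' = (\<one>, hl v e)" using dr_eq[OF v] by (auto simp: dx_def da_def)
          then have sc: "s c (hl v e) b" using sep sl by (simp add: Nil hl_def)
          then have "hl v e \<noteq> b" using T.irrefl by metis
          then have "dr b i' = (\<one>, hl v e)" using dr_eq[OF v] by (auto simp: dx_def da_def hl_def)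
          then show ?thesis using T.ax[OF sc] by simp
        qed
        ultimately show ?thesis by simp
      qed
      have eqs: "act (inv (g \<otimes> wp w)) i = act (inv (wp w)) i'" "act (inv (g \<otimes> wp w)) k = act (inv (wp w)) (vpt c)"
      proof -
        have "act (inv (g \<otimes> wp w)) (act g r) = act (inv (wp w)) r" if "r \<in> \<Lambda>" for r
        proof -
          have "inv (g \<otimes> wp w) \<otimes> g = inv (wp w)" using g rw by (simp add: inv_mult_group m_assoc)
          then show ?thesis using act_mult[of "inv (g \<otimes> wp w)" g r] g rw that by simp
        qed
        then show "act (inv (g \<otimes> wp w)) i = act (inv (wp w)) i'" "act (inv (g \<otimes> wp w)) k = act (inv (wp w)) (vpt c)"
          using li g(2) vpt_in g0 by auto
      qed
      have lw: "l = act (g \<otimes> wp w) (vpt b)" using li(5) rw act_mult[OF g(1) rw(2) vpt_in] b by simp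
      show ?thesis
      proof (cases "i = l")
        case True
        then show ?thesis using base_sep_dom by blast
      next
        case False
        then show ?thesis
          using base_sep_iff[of "g \<otimes> wp w" b i k s] lw eqs d g rw b main by simp
      qed
    qed (use base_sep_leaf in auto)
  qed
qed

lemma base_sep_free:
  assumes "k \<in> {1..n}" "g \<in> carrier G" "x \<in> carrier G" "x \<noteq> \<one>" "act x (act g (vpt k)) = act g (vpt k)"
    and p: "p \<in> \<Lambda>" "p \<noteq> act g (vpt k)"
  shows "base_sep s (act g (vpt k)) p (act x p)"
proof -
  define z where "z = inv g \<otimes> x \<otimes> g"
  have zc: "z \<in> carrier G" using assms by (simp add: z_def)
  have kL: "vpt k \<in> \<Lambda>" using vpt_in assms by simp
  have xg: "x \<otimes> g = g \<otimes> z" using assms by (simp add: z_def m_assoc[symmetric])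
  have "act g (act z (vpt k)) = act g (vpt k)" using act_mult[OF assms(2) zc kL] xg act_mult[OF assms(3,2) kL] assms(5) by simp
  then have "act z (vpt k) = vpt k" using act_inj[OF assms(2) act_closed[OF zc kL] kL] by simp
  then have z: "z \<in> H k" using stab_vpt zc assms by blast
  have z1: "z \<noteq> \<one>"
  proof
    assume "z = \<one>"
    then have "x \<otimes> g = g" using xg assms by simp
    then show False using assms by simp
  qed
  have "inv g \<otimes> x = z \<otimes> inv g" using assms by (simp add: z_def m_assoc)
  then have zi: "act (inv g) (act x p) = act z (act (inv g) p)"
    using act_mult[of "inv g" x p] act_mult[OF zc _ p(1), of "inv g"] assms by simp
  have ig: "act (inv g) p \<in> \<Lambda>" "act (inv g) p \<noteq> vpt k" using act_closed act_inv(2)[OF assms(2) p(1)] assms by (simp, metis)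
  have "fst (dr k (act (inv g) p)) \<in> carrier G" using dr_range(1)[OF assms(1) ig] H_closed assms by blast
  then have "fst (dr k (act (inv g) p)) \<noteq> fst (dr k (act z (act (inv g) p)))"
    using dr_act[OF assms(1) z ig] z1 zc by simp
  moreover have "act x p \<in> \<Lambda>" "act x p \<noteq> act g (vpt k)"
    using act_closed assms act_inj[OF assms(3) p(1) act_closed[OF assms(2) kL]] by auto
  ultimately show ?thesis using base_sep_iff[OF assms(2,1) p(1)] p zi by simp
qed

lemma base_sep_adapted:
  assumes k: "k \<in> {1..n}" and ij: "i \<le> n" "j \<le> n" "i \<noteq> k" "j \<noteq> k" and x: "x \<in> H k"
  shows "\<not> base_sep s (vpt k) (vpt i) (act x (vpt j)) \<longleftrightarrow> x = \<one> \<and> \<not> s k i j"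
proof -
  have xc: "x \<in> carrier G" using H_closed k x by blast
  have L: "vpt k \<in> \<Lambda>" "vpt i \<in> \<Lambda>" "vpt j \<in> \<Lambda>" using vpt_in k ij by auto
  have ne: "vpt i \<noteq> vpt k" "vpt j \<noteq> vpt k" using vpt_inj k ij by auto
  have ne2: "act x (vpt j) \<noteq> vpt k" using act_inj[OF xc L(3,1)] act_stab[OF k x] ne by metis
  have v: "dr k (vpt a) = (\<one>, a)" if "a \<le> n" "a \<noteq> k" for a
    using dr_eq[of "vpt a" "[]" a k] that by (simp add: cd_Nil dx_def da_def hl_def)
  have "base_sep s (act \<one> (vpt k)) (vpt i) (act x (vpt j)) \<longleftrightarrow> \<not> (\<one> = x \<and> \<not> s k i j)"
    using base_sep_iff[OF one_closed k L(2) act_closed[OF xc L(3)]] ne ne2 act_one L act_closed[OF xc L(3)]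
      dr_act[OF k x L(3) ne(2)] v ij xc by simp
  then show ?thesis using act_one L by auto
qed

end

section \<open>Vertex types\<close>

definition bas_transl :: "('g, 'b) monoid_scheme \<Rightarrow> (nat \<Rightarrow> 'g set) \<Rightarrow> (nat \<Rightarrow> 'g set) \<Rightarrow> nat set \<Rightarrow> bool" where
  "bas_transl G K K' T \<longleftrightarrow> (\<exists>g\<in>carrier G. \<forall>j\<in>T. pt G K' j = pact G g (pt G K j))"

text \<open>Two bases represent the same vertex type for a tree if they are translates of each other
  around every unlabelled vertex.\<close>

definition bas_eqv :: "('g, 'b) monoid_scheme \<Rightarrow> nat \<Rightarrow> (nat \<Rightarrow> nat \<Rightarrow> nat \<Rightarrow> bool) \<Rightarrow> (nat \<Rightarrow> 'g set) \<Rightarrow> (nat \<Rightarrow> 'g set) \<Rightarrow> bool" where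
  "bas_eqv G n s K K' \<longleftrightarrow> (\<forall>k i j. sep_adj {0..n} s k i \<and> sep_adj {0..n} s k j \<and> \<not> s k i j \<longrightarrow> bas_transl G K K' {k, i, j})"

section \<open>Bases up to translation around unlabelled vertices\<close>

locale free_prod_bases = free_prod G n Gs for G (structure) and n and Gs
begin

abbreviation "bas \<equiv> is_basis G n Gs"
abbreviation "ptK \<equiv> pt G"
abbreviation "eqv \<equiv> bas_eqv G n"
abbreviation "transl \<equiv> bas_transl G"
abbreviation "Fam \<equiv> sep_fam n"

lemma bas_conj:
  assumes "bas K" "j \<le> n" shows "\<exists>g\<in>carrier G. ptK K j = act g (vpt j)"
proof (cases "j = 0")
  case True
  then show ?thesis by (intro bexI[of _ \<one>]) (simp_all add: pt_def)
next
  case False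
  then have "\<exists>g\<in>carrier G. K j = conjugate_set G g (Gs j)" using assms by (simp add: is_basis_def)
  then show ?thesis using False by (auto simp: pt_def)
qed

lemma bas_fp: assumes "bas K" shows "free_prod G n K"
proof
  show "is_free_product G n K" using assms by (simp add: is_basis_def)
  fix i assume i: "i \<in> {1..n}"
  then obtain g where g: "g \<in> carrier G" "K i = conjugate_set G g (Gs i)" using assms unfolding is_basis_def by blast
  obtain h where h: "h \<in> Gs i" "h \<noteq> \<one>" using H_nontriv[OF i] by blast
  have hc: "h \<in> carrier G" using H_closed i h by blast
  show "K i \<noteq> {\<one>}"
  proof
    assume "K i = {\<one>}"
    then have "g \<otimes> h \<otimes> inv g = \<one>" using g h by (auto simp: conjugate_set_def)
    then have "g \<otimes> h = g" using g hc by (metis inv_equality inv_inv m_closed inv_closed)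
    then show False using h g hc by simp
  qed
qed

lemma bas_points: assumes "bas K" shows "points G n K = \<Lambda>"
proof (intro equalityI subsetI)
  fix p assume "p \<in> points G n K"
  then obtain g j where "p = act g (ptK K j)" "g \<in> carrier G" "j \<le> n" by (auto simp: points_def)
  then show "p \<in> \<Lambda>" using bas_conj[OF assms] act_closed vpt_in by metis
next
  fix p assume "p \<in> \<Lambda>"
  then obtain a j where p: "p = act a (vpt j)" "a \<in> carrier G" "j \<le> n" by (auto simp: points_def)
  obtain g where g: "g \<in> carrier G" "ptK K j = act g (vpt j)" using bas_conj[OF assms p(3)] by blast
  have "act (a \<otimes> inv g) (ptK K j) = p" using p g act_mult[of "a \<otimes> inv g" g "vpt j"] vpt_in by (simp add: m_assoc)
  moreover have "a \<otimes> inv g \<in> carrier G" using p g by simp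
  ultimately show "p \<in> points G n K" unfolding points_def using p(3) by blast
qed

lemma ptK_in: "bas K \<Longrightarrow> j \<le> n \<Longrightarrow> ptK K j \<in> \<Lambda>"
  using bas_conj act_closed vpt_in by metis

lemma bas_eqI: assumes "bas K" "bas K'" "\<And>j. j \<le> n \<Longrightarrow> ptK K j = ptK K' j" shows "K = K'"
proof (rule extensionalityI[where A="{1..n}"])
  show "K \<in> extensional {1..n}" "K' \<in> extensional {1..n}" using assms by (simp_all add: is_basis_def)
  show "K x = K' x" if "x \<in> {1..n}" for x using assms(3)[of x] that by (auto simp: pt_def)
qed

lemma transl_refl: "bas K \<Longrightarrow> T \<subseteq> {0..n} \<Longrightarrow> transl K K T"
  unfolding bas_transl_def by (intro bexI[of _ \<one>]) (auto simp: act_one ptK_in subset_iff)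

lemma transl_sym: assumes "bas K" "bas K'" "T \<subseteq> {0..n}" "transl K K' T" shows "transl K' K T"
proof -
  obtain g where g: "g \<in> carrier G" "\<And>j. j \<in> T \<Longrightarrow> ptK K' j = act g (ptK K j)" using assms by (auto simp: bas_transl_def)
  have "ptK K j = act (inv g) (ptK K' j)" if "j \<in> T" for j
  proof -
    have "j \<le> n" using that assms(3) by auto
    then show ?thesis using g(2)[OF that] act_inv(1)[OF g(1) ptK_in[OF assms(1)]] by simp
  qed
  then show ?thesis unfolding bas_transl_def using g(1) by blast
qed

lemma transl_trans: assumes "bas K" "T \<subseteq> {0..n}" "transl K K' T" "transl K' K'' T" shows "transl K K'' T"
proof -
  obtain g where g: "g \<in> carrier G" "\<And>j. j \<in> T \<Longrightarrow> ptK K' j = act g (ptK K j)" using assms by (auto simp: bas_transl_def)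
  obtain h where h: "h \<in> carrier G" "\<And>j. j \<in> T \<Longrightarrow> ptK K'' j = act h (ptK K' j)" using assms by (auto simp: bas_transl_def)
  have "ptK K'' j = act (h \<otimes> g) (ptK K j)" if "j \<in> T" for j
  proof -
    have "j \<le> n" using that assms(2) by auto
    then show ?thesis using g(2)[OF that] h(2)[OF that] act_mult[OF h(1) g(1) ptK_in[OF assms(1)]] by simp
  qed
  then show ?thesis unfolding bas_transl_def using g(1) h(1) by (meson m_closed)
qed

lemma adj_triple: "sep_adj {0..n} s k i \<Longrightarrow> sep_adj {0..n} s k j \<Longrightarrow> {k, i, j} \<subseteq> {0..n}"
  by (auto simp: sep_adj_def)

lemma eqv_refl: "bas K \<Longrightarrow> eqv s K K"
  using transl_refl adj_triple unfolding bas_eqv_def by meson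

lemma eqv_sym: "bas K \<Longrightarrow> bas K' \<Longrightarrow> eqv s K K' \<Longrightarrow> eqv s K' K"
  using transl_sym adj_triple unfolding bas_eqv_def by meson

lemma eqv_trans: "bas K \<Longrightarrow> eqv s K K' \<Longrightarrow> eqv s K' K'' \<Longrightarrow> eqv s K K''"
  using transl_trans adj_triple unfolding bas_eqv_def by meson

lemma eqv_mono:
  assumes "\<And>k i j. s k i j \<Longrightarrow> t k i j" "eqv s K K'" shows "eqv t K K'"
  unfolding bas_eqv_def
proof (intro allI impI)
  fix k i j assume "sep_adj {0..n} t k i \<and> sep_adj {0..n} t k j \<and> \<not> t k i j"
  then have "sep_adj {0..n} s k i \<and> sep_adj {0..n} s k j \<and> \<not> s k i j" using assms(1) unfolding sep_adj_def by metis
  then show "transl K K' {k, i, j}" using assms(2) unfolding bas_eqv_def by blast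
qed

lemma pmap_act:
  assumes "\<phi> \<in> hom G G" "g \<in> carrier G" "p \<in> \<Lambda>" shows "pmap \<phi> (act g p) = act (\<phi> g) (pmap \<phi> p)"
proof -
  have inv: "\<phi> (inv a) = inv (\<phi> a)" if "a \<in> carrier G" for a
    using group_hom.hom_inv[of G G \<phi> a] assms(1) that by (simp add: group_hom_def group_hom_axioms_def is_group)
  have c: "\<phi> a \<in> carrier G" if "a \<in> carrier G" for a using hom_in_carrier[OF assms(1) that] .
  show ?thesis
  proof (cases p)
    case (Inl a)
    then have "a \<in> carrier G" using assms(3) by (auto simp: points_def pt_def split: if_splits)
    then show ?thesis using Inl hom_mult[OF assms(1,2)] by simp
  next
    case (Inr L)
    have L: "L \<subseteq> carrier G"
    proof -
      obtain a j where "Inr L = act a (vpt j)" "a \<in> carrier G" "j \<le> n" using assms(3) unfolding Inr points_def by blast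
      then show ?thesis using conjugate_set_closed[OF _ H_sub] by (cases "j = 0") (auto simp: pt_def)
    qed
    have "\<phi> ` conjugate_set G g L = conjugate_set G (\<phi> g) (\<phi> ` L)"
      unfolding conjugate_set_image image_image
      by (rule image_cong) (use L assms(1,2) in \<open>auto simp: hom_mult inv subset_iff\<close>)
    then show ?thesis by (simp add: Inr)
  qed
qed

lemma pmap_pt: assumes "\<phi> \<in> hom G G" "j \<le> n" shows "pmap \<phi> (ptK K j) = ptK (basis_img n \<phi> K) j"
  using assms hom_one[OF assms(1) is_group is_group] by (auto simp: pt_def basis_img_def)

lemma bas_image:
  assumes K: "bas K" and \<phi>: "\<phi> \<in> hom G G" "bij_betw \<phi> (carrier G) (carrier G)"
    and c: "\<And>j. j \<in> {1..n} \<Longrightarrow> \<exists>g\<in>carrier G. ptK (basis_img n \<phi> K) j = act g (vpt j)"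
  shows "bas (basis_img n \<phi> K)"
  unfolding is_basis_def
proof (intro conjI ballI)
  interpret K: free_prod G n K by (rule bas_fp[OF K])
  show "is_free_product G n (basis_img n \<phi> K)" by (rule K.free_prod_image[OF \<phi>])
  show "basis_img n \<phi> K \<in> extensional {1..n}" by (simp add: basis_img_def)
  fix i assume i: "i \<in> {1..n}"
  then show "\<exists>g\<in>carrier G. basis_img n \<phi> K i = conjugate_set G g (Gs i)" using c[OF i] by (auto simp: pt_def)
qed

lemma aut_bas:
  assumes "\<phi> \<in> sigma_aut1 G n Gs" "bas K" shows "bas (basis_img n \<phi> K)"
proof (rule bas_image[OF assms(2)])
  show \<phi>: "\<phi> \<in> hom G G" "bij_betw \<phi> (carrier G) (carrier G)" using assms(1) by (auto simp: sigma_aut1_def)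
  fix j assume j: "j \<in> {1..n}"
  obtain g where g: "g \<in> carrier G" "ptK K j = act g (vpt j)" using bas_conj[OF assms(2)] j by auto
  obtain h where h: "h \<in> carrier G" "\<phi> ` Gs j = conjugate_set G h (Gs j)" using assms(1) j unfolding sigma_aut1_def by blast
  have c: "\<phi> g \<in> carrier G" using hom_in_carrier[OF \<phi>(1) g(1)] .
  have "ptK (basis_img n \<phi> K) j = pmap \<phi> (act g (vpt j))" using pmap_pt[OF \<phi>(1)] g j by (metis atLeastAtMost_iff)
  also have "\<dots> = act (\<phi> g) (pmap \<phi> (vpt j))" using pmap_act[OF \<phi>(1) g(1) vpt_in] j by simp
  also have "pmap \<phi> (vpt j) = act h (vpt j)" using h j by (simp add: pt_def)
  also have "act (\<phi> g) (act h (vpt j)) = act (\<phi> g \<otimes> h) (vpt j)" using act_mult[OF c h(1) vpt_in] j by simp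
  finally show "\<exists>g\<in>carrier G. ptK (basis_img n \<phi> K) j = act g (vpt j)" using c h by blast
qed

lemma aut_eqv:
  assumes "\<phi> \<in> hom G G" "bas K" "eqv s K K'" shows "eqv s (basis_img n \<phi> K) (basis_img n \<phi> K')"
  unfolding bas_eqv_def
proof (intro allI impI)
  fix k i j assume a: "sep_adj {0..n} s k i \<and> sep_adj {0..n} s k j \<and> \<not> s k i j"
  then obtain g where g: "g \<in> carrier G" "\<And>l. l \<in> {k, i, j} \<Longrightarrow> ptK K' l = act g (ptK K l)"
    using assms(3) unfolding bas_eqv_def bas_transl_def by meson
  have "ptK (basis_img n \<phi> K') l = act (\<phi> g) (ptK (basis_img n \<phi> K) l)" if l: "l \<in> {k, i, j}" for l
  proof -
    have ln: "l \<le> n" using l a by (auto simp: sep_adj_def)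
    show ?thesis using g(2)[OF l] pmap_pt[OF assms(1) ln] pmap_act[OF assms(1) g(1) ptK_in[OF assms(2) ln]] by metis
  qed
  then show "transl (basis_img n \<phi> K) (basis_img n \<phi> K') {k, i, j}"
    unfolding bas_transl_def using hom_in_carrier[OF assms(1) g(1)] by blast
qed

lemma whitehead_img:
  assumes K: "bas K" and x: "is_sym_wh G n K k x"
  defines "K' \<equiv> basis_img n (whitehead G n K x) K"
  shows "bas K'" "\<And>j. j \<in> {1..n} \<Longrightarrow> ptK K' j = act (x j) (ptK K j)"
proof -
  interpret K: free_prod G n K by (rule bas_fp[OF K])
  note w = K.whitehead_props[OF x]
  have "K' j = conjugate_set G (x j) (K j)" if j: "j \<in> {1..n}" for j
    unfolding K'_def basis_img_def conjugate_set_image using j w(4)[OF j] by simp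
  then show 1: "\<And>j. j \<in> {1..n} \<Longrightarrow> ptK K' j = act (x j) (ptK K j)" by (simp add: pt_def)
  show "bas K'"
    unfolding K'_def
  proof (rule bas_image[OF K w(1,3)])
    fix j assume j: "j \<in> {1..n}"
    then have jn: "j \<le> n" by simp
    have xc: "x j \<in> carrier G" using x j K.H_closed by (auto simp: is_sym_wh_def)
    obtain g where g: "g \<in> carrier G" "ptK K j = act g (vpt j)" using bas_conj[OF K jn] by blast
    then have "ptK K' j = act (x j \<otimes> g) (vpt j)" using 1[OF j] act_mult[OF xc g(1) vpt_in[OF jn]] by simp
    then show "\<exists>g\<in>carrier G. ptK (basis_img n (whitehead G n K x) K) j = act g (vpt j)" using g xc K'_def by blast
  qed
qed

lemma sep_fam_mem:
  assumes "pointed_sep n s" "i \<le> n" "i \<noteq> k" "k \<le> n"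
  shows "\<exists>P\<in>Fam s k. \<forall>j. j \<in> P \<longleftrightarrow> j \<le> n \<and> j \<noteq> k \<and> \<not> s k i j"
  using assms by (auto simp: sep_fam_def)

lemma carriedD:
  assumes s: "pointed_sep n s" and c: "carried G n K (Fam s) k x" and ij: "i \<le> n" "j \<le> n" "i \<noteq> k" "j \<noteq> k" "\<not> s k i j"
  shows "(if i = 0 then \<one> else x i) = (if j = 0 then \<one> else x j)"
proof -
  interpret T: fin_sep_tree "{0..n}" s using s by (simp add: pointed_sep_def)
  have k: "k \<le> n" using c by (auto simp: carried_def is_sym_wh_def)
  obtain P where P: "P \<in> Fam s k" "\<And>j. j \<in> P \<longleftrightarrow> j \<le> n \<and> j \<noteq> k \<and> \<not> s k i j" using sep_fam_mem[OF s ij(1,3) k] by blast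
  have "i \<in> P" "j \<in> P" using P(2) ij T.irrefl by auto
  then show ?thesis using c P(1) unfolding carried_def by (metis Diff_iff singletonD)
qed

lemma carriedI:
  assumes s: "pointed_sep n s" and x: "is_sym_wh G n K k x"
    and 1: "\<And>i j. i \<in> {1..n} \<Longrightarrow> j \<in> {1..n} \<Longrightarrow> i \<noteq> k \<Longrightarrow> j \<noteq> k \<Longrightarrow> \<not> s k i j \<Longrightarrow> x i = x j"
    and 2: "\<And>i. i \<in> {1..n} \<Longrightarrow> i \<noteq> k \<Longrightarrow> \<not> s k 0 i \<Longrightarrow> x i = \<one>"
  shows "carried G n K (Fam s) k x"
  unfolding carried_def
proof (intro conjI ballI impI)
  interpret T: fin_sep_tree "{0..n}" s using s by (simp add: pointed_sep_def)
  have k: "k \<in> {1..n}" using x by (simp add: is_sym_wh_def)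
  have same: "\<not> s k i j \<and> i \<le> n \<and> j \<le> n \<and> i \<noteq> k \<and> j \<noteq> k" if P: "P \<in> Fam s k" "i \<in> P" "j \<in> P" for P i j
  proof -
    obtain l where "l \<le> n" "l \<noteq> k" "P = {j. j \<le> n \<and> j \<noteq> k \<and> \<not> s k l j}" using P(1) by (auto simp: sep_fam_def split: if_splits)
    then show ?thesis using P T.tri[of k i j l] T.sym by auto
  qed
  show "is_sym_wh G n K k x" by (rule x)
  show "x i = x j" if "P \<in> Fam s k" "i \<in> P - {0}" "j \<in> P - {0}" for P i j
    using that same[of P i j] 1[of i j] by auto
  show "x i = \<one>" if "P \<in> Fam s k" "0 \<in> P" "i \<in> P - {0}" for P i
    using that same[of P 0 i] 2[of i] by auto
qed

text \<open>Around an unlabelled vertex all labels other than \<open>k\<close> lie in one petal at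
  \<open>k\<close>, where \<open>x\<close> has a single value. This value lies in \<open>K k\<close>
  and so fixes the vertex \<open>k\<close> too; one translation serves for all these labels.\<close>

lemma whitehead_eqv:
  assumes s: "pointed_sep n s" and K: "bas K" and c: "carried G n K (Fam s) k x"
  shows "eqv s K (basis_img n (whitehead G n K x) K)"
    and "\<And>j. j \<le> n \<Longrightarrow> transl K (basis_img n (whitehead G n K x) K) {j}"
proof -
  interpret T: fin_sep_tree "{0..n}" s using s by (simp add: pointed_sep_def)
  interpret K: free_prod G n K by (rule bas_fp[OF K])
  let ?K = "basis_img n (whitehead G n K x) K"
  have x: "is_sym_wh G n K k x" using c by (simp add: carried_def)
  then have k: "k \<in> {1..n}" "x k = \<one>" "\<And>j. j \<in> {1..n} \<Longrightarrow> x j \<in> K k" by (auto simp: is_sym_wh_def)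
  define X where "X j = (if j = 0 then \<one> else x j)" for j
  have XK: "X j \<in> K k" if "j \<le> n" for j using that k K.H_ops(3) by (auto simp: X_def)
  have Xc: "X j \<in> carrier G" if "j \<le> n" for j using XK[OF that] K.H_closed k by blast
  have pX: "ptK ?K j = act (X j) (ptK K j)" if "j \<le> n" for j
    using whitehead_img(2)[OF K x, of j] that act_one ptK_in[OF K] by (auto simp: X_def pt_def)
  have pk: "ptK ?K k = act (X j) (ptK K k)" if "j \<le> n" for j
  proof -
    have "act (X j) (ptK K k) = ptK K k" using K.act_stab[OF k(1) XK[OF that]] .
    moreover have "ptK ?K k = ptK K k" using pX[of k] k act_one ptK_in[OF K] by (simp add: X_def)
    ultimately show ?thesis by simp
  qed
  show "\<And>j. j \<le> n \<Longrightarrow> transl K ?K {j}" unfolding bas_transl_def using pX Xc by auto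
  have tr: "transl K ?K T" if T: "T \<subseteq> {0..n}" and same: "\<And>a b. a \<in> T \<Longrightarrow> b \<in> T \<Longrightarrow> a \<noteq> k \<Longrightarrow> b \<noteq> k \<Longrightarrow> \<not> s k a b" for T
  proof (cases "T \<subseteq> {k}")
    case True
    then show ?thesis unfolding bas_transl_def using pk[of 0] Xc[of 0] by (intro bexI[of _ "X 0"]) auto
  next
    case False
    then obtain a where a: "a \<in> T" "a \<noteq> k" by blast
    have "ptK ?K b = act (X a) (ptK K b)" if "b \<in> T" for b
    proof (cases "b = k")
      case False
      then have "X b = X a" using carriedD[OF s c, of b a] same[OF that a(1)] a that T unfolding X_def by fastforce
      then show ?thesis using pX[of b] that T by auto
    qed (use pk[of a] a T in auto)
    then show ?thesis unfolding bas_transl_def using Xc[of a] a T by (intro bexI[of _ "X a"]) auto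
  qed
  show "eqv s K ?K"
    unfolding bas_eqv_def
  proof (intro allI impI)
    fix l i j assume a: "T.adj l i \<and> T.adj l j \<and> \<not> s l i j"
    have hyp: "{l, i, j} \<subseteq> T.hyp l i" using a T.hyp_sub by (auto simp: sep_hyp_def)
    show "transl K ?K {l, i, j}"
    proof (rule tr)
      show "{l, i, j} \<subseteq> {0..n}" using a adj_triple by blast
      fix c d assume "c \<in> {l, i, j}" "d \<in> {l, i, j}" "c \<noteq> k" "d \<noteq> k"
      then have "c = d \<or> T.adj c d" using T.hyp_clique[of l i c d] a hyp by blast
      then show "\<not> s k c d" using T.adjD(2) T.irrefl by blast
    qed
  qed
qed

lemma carried_prods_props:
  assumes s: "pointed_sep n s" and K: "bas K" and r: "\<rho> \<in> carried_prods G n K (Fam s)"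
  shows "\<rho> \<in> hom G G \<and> bij_betw \<rho> (carrier G) (carrier G) \<and> bas (basis_img n \<rho> K) \<and> eqv s K (basis_img n \<rho> K)"
proof -
  interpret K: free_prod G n K by (rule bas_fp[OF K])
  have "\<rho> \<in> hom G G \<and> bij_betw \<rho> (carrier G) (carrier G) \<and> bas (basis_img n \<rho> K) \<and> eqv s K (basis_img n \<rho> K)
     \<and> (\<forall>j\<le>n. transl K (basis_img n \<rho> K) {j})"
    using r
  proof (induction rule: carried_prods.induct)
    case cp_id
    have img: "basis_img n (restrict id (carrier G)) K = K"
    proof (rule extensionalityI[where A="{1..n}"])
      show "K \<in> extensional {1..n}" using K by (simp add: is_basis_def)
      show "basis_img n (restrict id (carrier G)) K x = K x" if "x \<in> {1..n}" for x
        using that K.H_closed[OF that] by (auto simp: basis_img_def image_iff)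
    qed (simp add: basis_img_def)
    have "restrict id (carrier G) \<in> hom G G" by (auto simp: hom_def)
    moreover have "bij_betw (restrict id (carrier G)) (carrier G) (carrier G)" by (simp add: bij_betw_def inj_on_def)
    moreover have "\<forall>j\<le>n. transl K K {j}" using transl_refl[OF K] by auto
    ultimately show ?case unfolding img using K eqv_refl[OF K] by blast
  next
    case (cp_step \<rho> k x)
    let ?w = "whitehead G n K x" and ?c = "compose (carrier G) (whitehead G n K x) \<rho>"
    have x: "is_sym_wh G n K k x" using cp_step by (simp add: carried_def)
    note w = K.whitehead_props[OF x]
    have r: "\<rho> \<in> hom G G" "bij_betw \<rho> (carrier G) (carrier G)" using cp_step by auto
    have hom: "?c \<in> hom G G" using hom_compose[OF r(1) w(1)] .
    have bij: "bij_betw ?c (carrier G) (carrier G)" using bij_betw_compose[OF r(2) w(3)] .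
    have img: "ptK (basis_img n ?c K) j = pmap ?w (ptK (basis_img n \<rho> K) j)" if j: "j \<le> n" for j
    proof -
      have "?c ` K j = ?w ` \<rho> ` K j" if "j \<noteq> 0"
      proof -
        have "j \<in> {1..n}" using that j by simp
        then have "K j \<subseteq> carrier G" by (rule K.H_sub)
        then show ?thesis unfolding image_image by (intro image_cong) (auto simp: compose_eq subset_iff)
      qed
      then show ?thesis using j hom_one[OF w(1) is_group is_group] by (auto simp: pt_def basis_img_def)
    qed
    \<comment> \<open>Applying \<open>?w\<close> to a translate by \<open>g\<close> gives the
      translate by \<open>?w g\<close> of the image under \<open>?w\<close>, so the translations of
      the factors multiply to a translation.\<close>
    have tr: "transl K (basis_img n ?c K) T"
      if T: "T \<subseteq> {0..n}" "transl K (basis_img n \<rho> K) T" "transl K (basis_img n ?w K) T" for T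
    proof -
      obtain g where g: "g \<in> carrier G" "\<And>j. j \<in> T \<Longrightarrow> ptK (basis_img n \<rho> K) j = act g (ptK K j)" using T by (auto simp: bas_transl_def)
      obtain h where h: "h \<in> carrier G" "\<And>j. j \<in> T \<Longrightarrow> ptK (basis_img n ?w K) j = act h (ptK K j)" using T by (auto simp: bas_transl_def)
      have wg: "?w g \<in> carrier G" using hom_in_carrier[OF w(1) g(1)] .
      have "ptK (basis_img n ?c K) j = act (?w g \<otimes> h) (ptK K j)" if jT: "j \<in> T" for j
      proof -
        have j: "j \<le> n" using jT T(1) by auto
        have "ptK (basis_img n ?c K) j = act (?w g) (pmap ?w (ptK K j))"
          using img[OF j] g(2)[OF jT] pmap_act[OF w(1) g(1) ptK_in[OF K j]] by simp
        also have "\<dots> = act (?w g) (act h (ptK K j))" using pmap_pt[OF w(1) j] h(2)[OF jT] by simp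
        finally show ?thesis using act_mult[OF wg h(1) ptK_in[OF K j]] by simp
      qed
      then show ?thesis unfolding bas_transl_def using wg h by blast
    qed
    note we = whitehead_eqv[OF s K cp_step.hyps(2)]
    have one: "transl K (basis_img n ?c K) {j}" if j: "j \<le> n" for j using tr[of "{j}"] j we(2)[OF j] cp_step by auto
    have eqv: "eqv s K (basis_img n ?c K)"
      unfolding bas_eqv_def
    proof (intro allI impI)
      fix l i j assume a: "sep_adj {0..n} s l i \<and> sep_adj {0..n} s l j \<and> \<not> s l i j"
      show "transl K (basis_img n ?c K) {l, i, j}"
        by (rule tr) (use a adj_triple we(1) cp_step.IH in \<open>auto simp: bas_eqv_def sep_adj_def\<close>)
    qed
    have "bas (basis_img n ?c K)"
    proof (rule bas_image[OF K hom bij])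
      fix j assume "j \<in> {1..n}"
      then have jn: "j \<le> n" by simp
      obtain g where g: "g \<in> carrier G" "ptK (basis_img n ?c K) j = act g (ptK K j)" using one[OF jn] by (auto simp: bas_transl_def)
      obtain h where h: "h \<in> carrier G" "ptK K j = act h (vpt j)" using bas_conj[OF K jn] by blast
      show "\<exists>g\<in>carrier G. ptK (basis_img n ?c K) j = act g (vpt j)"
        using g h act_mult[OF g(1) h(1) vpt_in[OF jn]] by (intro bexI[of _ "g \<otimes> h"]) auto
    qed
    then show ?case using hom bij eqv one by blast
  qed
  then show ?thesis by blast
qed

lemma pair_in_LG: "(K, Fam s) \<in> LG_pairs G n Gs" if "bas K" "pointed_sep n s"
  using that sep_fam_plt by (simp add: LG_pairs_def)

lemma LG_step_whitehead:
  assumes "pointed_sep n s" "bas K" "carried G n K (Fam s) k x"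
  shows "((K, Fam s), (basis_img n (whitehead G n K x) K, Fam s)) \<in> LG_step G n Gs"
proof -
  interpret K: free_prod G n K by (rule bas_fp[OF assms(2)])
  have x: "is_sym_wh G n K k x" using assms by (simp add: carried_def)
  have "compose (carrier G) (whitehead G n K x) (restrict id (carrier G)) = whitehead G n K x"
    using K.whitehead_props(2)[OF x] by (intro extensionalityI[of _ "carrier G"]) (auto simp: compose_def)
  then have "whitehead G n K x \<in> carried_prods G n K (Fam s)"
    using carried_prods.cp_step[OF carried_prods.cp_id assms(3)] by simp
  then show ?thesis using pair_in_LG[OF assms(2,1)] unfolding LG_step_def by blast
qed

text \<open>Representatives of the same vertex type are matched starting from the base point: if a basis
  agrees with another one at \<open>k\<close> but not at the next vertex \<open>j\<close>, then it is corrected on the petal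
  of \<open>j\<close> at \<open>k\<close>.\<close>

lemma eqv_connected:
  assumes s: "pointed_sep n s" and "bas K" "bas K'" "eqv s K K'"
  shows "((K, Fam s), (K', Fam s)) \<in> (LG_step G n Gs \<union> (LG_step G n Gs)\<inverse>)\<^sup>*"
proof -
  interpret T: fin_sep_tree "{0..n}" s using s by (simp add: pointed_sep_def)
  have leaf: "\<not> s 0 i j" for i j using s by (simp add: pointed_sep_def)
  \<comment> \<open>The good labels: the bases agree along the whole path from the base point to the
    label. Each correction enlarges this set.\<close>
  define Gd where "Gd K = {i. i \<le> n \<and> (\<forall>l. (l = i \<or> s l 0 i) \<longrightarrow> ptK K l = ptK K' l)}" for K
  show ?thesis
    using assms(2-4)
  proof (induction "card ({0..n} - Gd K)" arbitrary: K rule: less_induct)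
    case less
    note K = less.prems(1) and K' = less.prems(2) and e = less.prems(3)
    interpret K: free_prod G n K by (rule bas_fp[OF K])
    show ?case
    proof (cases "{0..n} \<subseteq> Gd K")
      case True
      have "ptK K j = ptK K' j" if "j \<le> n" for j using subsetD[OF True, of j] that by (auto simp: Gd_def)
      then have "K = K'" by (rule bas_eqI[OF K K'])
      then show ?thesis by simp
    next
      case False
      then obtain j where j: "j \<le> n" "j \<notin> Gd K" and jmin: "\<And>l. l \<le> n \<Longrightarrow> l \<notin> Gd K \<Longrightarrow> card {m. s m 0 j} \<le> card {m. s m 0 l}"
        using ex_has_least_nat[of "\<lambda>j. j \<le> n \<and> j \<notin> Gd K" _ "\<lambda>j. card {m. s m 0 j}"] by (metis atLeastAtMost_iff le0 subsetI)
      have anc: "l \<in> Gd K" if l: "s l 0 j" for l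
      proof (rule ccontr)
        assume n: "l \<notin> Gd K"
        have "{m. s m 0 l} \<subset> {m. s m 0 j}" using T.between_trans[OF _ l] l T.dom by blast
        then have "card {m. s m 0 l} < card {m. s m 0 j}" using T.finite_sep by (rule psubset_card_mono[rotated])
        moreover have "l \<le> n" using T.dom[OF l] by simp
        ultimately show False using jmin[OF _ n] by simp
      qed
      have pj: "ptK K j \<noteq> ptK K' j"
      proof
        assume "ptK K j = ptK K' j"
        then have "j \<in> Gd K" using anc j(1) unfolding Gd_def by blast
        then show False using j by simp
      qed
      have j0: "j \<noteq> 0"
      proof
        assume "j = 0" then show False using pj by (simp add: pt_def)
      qed
      let ?k = "T.nb j 0"
      have nbk: "T.adj j ?k" "?k = 0 \<or> s ?k j 0" using T.nb[of j 0] j j0 by auto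
      have kn: "?k \<le> n" "?k \<noteq> j" using T.adjD(1)[OF nbk(1)] by auto
      have pk: "ptK K ?k = ptK K' ?k" using nbk(2) anc[of ?k] T.sym by (auto simp: Gd_def pt_def)
      have "transl K K' {?k, j, j}" using e T.adj_sym[OF nbk(1)] T.irrefl unfolding bas_eqv_def by blast
      then obtain g where g: "g \<in> carrier G" "ptK K' ?k = act g (ptK K ?k)" "ptK K' j = act g (ptK K j)" by (auto simp: bas_transl_def)
      have k0: "?k \<noteq> 0"
      proof
        assume "?k = 0"
        then have "g = \<one>" using g(1,2) by (simp add: pt_def)
        then show False using pj g(3) act_one ptK_in[OF K j(1)] by simp
      qed
      then have sk: "s ?k j 0" and k1: "?k \<in> {1..n}" using nbk kn by auto
      have gk: "g \<in> K ?k" using K.stab_vpt[OF g(1) k1] g(2) pk by metis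
      define x where "x i = (if i \<noteq> ?k \<and> \<not> s ?k j i then g else \<one>)" for i
      have x: "is_sym_wh G n K ?k x" using k1 gk K.H_ops(3)[OF k1] by (auto simp: is_sym_wh_def x_def)
      have car: "carried G n K (Fam s) ?k x"
      proof (rule carriedI[OF s x])
        fix a b assume a: "a \<in> {1..n}" "b \<in> {1..n}" "a \<noteq> ?k" "b \<noteq> ?k" "\<not> s ?k a b"
        then have "s ?k j a \<longleftrightarrow> s ?k j b" using T.tri[of ?k j a b] T.tri[of ?k j b a] T.sym by auto
        then show "x a = x b" using a by (simp add: x_def)
      next
        fix i assume i: "i \<in> {1..n}" "i \<noteq> ?k" "\<not> s ?k 0 i"
        then have "s ?k j i" using T.tri[OF sk, of i] T.sym by auto
        then show "x i = \<one>" by (simp add: x_def)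
      qed
      let ?K1 = "basis_img n (whitehead G n K x) K"
      have K1: "bas ?K1" "\<And>l. l \<in> {1..n} \<Longrightarrow> ptK ?K1 l = act (x l) (ptK K l)" using whitehead_img[OF K x] by auto
      have e1: "eqv s ?K1 K'" using eqv_trans[OF K1(1) eqv_sym[OF K K1(1) whitehead_eqv(1)[OF s K car]] e] .
      have unaff: "ptK ?K1 l = ptK K l" if l: "l \<in> Gd K" for l
      proof (cases "l = 0")
        case False
        then have l1: "l \<in> {1..n}" using l by (auto simp: Gd_def)
        \<comment> \<open>No good label \<open>l\<close> lies in the petal of \<open>j\<close>.
          Otherwise the next label \<open>?c\<close> from \<open>?k\<close> towards \<open>l\<close>
          is good as well and not separated from \<open>j\<close>, so a single element translates
          \<open>?k\<close>, \<open>j\<close> and \<open>?c\<close>. It fixes \<open>?k\<close> and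
          \<open>?c\<close>, hence is trivial, although it moves \<open>j\<close>. Thus the
          correction leaves good labels alone.\<close>
        have "\<not> (l \<noteq> ?k \<and> \<not> s ?k j l)"
        proof
          assume P: "l \<noteq> ?k \<and> \<not> s ?k j l"
          let ?c = "T.nb ?k l"
          have c: "T.adj ?k ?c" "?c = l \<or> s ?c ?k l" "\<not> s ?k l ?c" "?c \<noteq> ?k" "?c \<le> n" using T.nb[of ?k l] kn l1 P by auto
          have sl: "s ?k l 0" using T.tri[OF sk, of l] P l1 T.sym by auto
          have "?c = l \<or> s ?c 0 l"
          proof (cases "?c = l")
            case False
            then have "s ?c l ?k" using c T.sym by blast
            then show ?thesis using T.between_trans[OF _ sl] T.sym by blast
          qed simp
          then have pc: "ptK K ?c = ptK K' ?c" using l by (auto simp: Gd_def)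
          have "\<not> s ?k j ?c" using T.tri[of ?k j ?c l] P c l1 by auto
          then have "transl K K' {?k, j, ?c}" using e T.adj_sym[OF nbk(1)] c(1) unfolding bas_eqv_def by blast
          then obtain h where h: "h \<in> carrier G" "ptK K' ?k = act h (ptK K ?k)" "ptK K' j = act h (ptK K j)" "ptK K' ?c = act h (ptK K ?c)"
            by (auto simp: bas_transl_def)
          have "h = \<one>" using K.pair_stab[OF h(1) c(5) kn(1) c(4)] h(2,4) pc pk by metis
          then show False using pj h(3) act_one ptK_in[OF K j(1)] by simp
        qed
        then have "x l = \<one>" by (auto simp: x_def)
        then show ?thesis using K1(2)[OF l1] act_one ptK_in[OF K] l1 by simp
      qed (simp add: pt_def)
      have Gd_anc: "m \<in> Gd K" if "l \<in> Gd K" "s m 0 l" for l m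
        using that T.between_trans[of _ 0 m l] T.dom[OF that(2)] unfolding Gd_def by auto
      have "Gd K \<subseteq> Gd ?K1"
      proof
        fix i assume i: "i \<in> Gd K"
        have "ptK ?K1 l = ptK K' l" if "l = i \<or> s l 0 i" for l
          using unaff[of l] Gd_anc[OF i] i that unfolding Gd_def by auto
        then show "i \<in> Gd ?K1" using i unfolding Gd_def by blast
      qed
      moreover have "j \<in> Gd ?K1"
      proof -
        have "x j = g" using kn T.irrefl by (auto simp: x_def)
        then have "ptK ?K1 j = ptK K' j" using K1(2)[of j] j j0 g(3) by simp
        moreover have "ptK ?K1 l = ptK K' l" if "s l 0 j" for l using unaff[OF anc[OF that]] anc[OF that] by (auto simp: Gd_def)
        ultimately show ?thesis using j(1) unfolding Gd_def by blast
      qed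
      ultimately have "{0..n} - Gd ?K1 \<subset> {0..n} - Gd K" using j by auto
      then have "card ({0..n} - Gd ?K1) < card ({0..n} - Gd K)" by (rule psubset_card_mono[rotated]) simp
      from less.hyps[OF this K1(1) K' e1]
      show ?thesis using LG_step_whitehead[OF s K car] by (meson UnI1 converse_rtrancl_into_rtrancl)
    qed
  qed
qed

text \<open>The generated equivalence relation becomes an explicit local condition:
  \<open>carried_prods_props\<close> gives one inclusion and \<open>eqv_connected\<close> the
  other.\<close>

theorem vclass_eq:
  assumes s: "pointed_sep n s" and K: "bas K"
  shows "vclass G n Gs (K, Fam s) = {(K', Fam s) | K'. bas K' \<and> eqv s K K'}"
proof (intro equalityI subsetI)
  fix q assume "q \<in> {(K', Fam s) | K'. bas K' \<and> eqv s K K'}"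
  then show "q \<in> vclass G n Gs (K, Fam s)" using eqv_connected[OF s K] by (auto simp: vclass_def)
next
  fix q assume "q \<in> vclass G n Gs (K, Fam s)"
  then have "((K, Fam s), q) \<in> (LG_step G n Gs \<union> (LG_step G n Gs)\<inverse>)\<^sup>*" by (simp add: vclass_def)
  then show "q \<in> {(K', Fam s) | K'. bas K' \<and> eqv s K K'}"
  proof (induction rule: rtrancl_induct)
    case base
    then show ?case using K eqv_refl by blast
  next
    case (step q r)
    then obtain K' where K': "q = (K', Fam s)" "bas K'" "eqv s K K'" by blast
    from step.hyps(2) show ?case
    proof
      assume "(q, r) \<in> LG_step G n Gs"
      then obtain \<rho> where "r = (basis_img n \<rho> K', Fam s)" "\<rho> \<in> carried_prods G n K' (Fam s)" using K' by (auto simp: LG_step_def)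
      then show ?thesis using carried_prods_props[OF s K'(2)] eqv_trans[OF K K'(3)] by blast
    next
      assume "(q, r) \<in> (LG_step G n Gs)\<inverse>"
      then obtain H \<rho> where r: "r = (H, Fam s)" "K' = basis_img n \<rho> H" "(H, Fam s) \<in> LG_pairs G n Gs" "\<rho> \<in> carried_prods G n H (Fam s)"
        using K' by (auto simp: LG_step_def)
      then have H: "bas H" by (simp add: LG_pairs_def)
      then have "eqv s H K'" using carried_prods_props[OF s H r(4)] r(2) by simp
      then show ?thesis using r(1) H eqv_trans[OF K K'(3)] eqv_sym[OF H K'(2)] by blast
    qed
  qed
qed

section \<open>Vertex types, their order and the action on them\<close>

abbreviation cls :: "(nat \<Rightarrow> 'a set) \<Rightarrow> (nat \<Rightarrow> nat \<Rightarrow> nat \<Rightarrow> bool) \<Rightarrow> 'a lpair set" where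
  "cls K s \<equiv> vclass G n Gs (K, Fam s)"

lemma LG_vertexE:
  assumes "c \<in> LG_vertices G n Gs" obtains K s where "bas K" "pointed_sep n s" "c = cls K s"
proof -
  obtain K A where KA: "bas K" "A \<in> plt_families n" "c = vclass G n Gs (K, A)" using assms by (auto simp: LG_vertices_def LG_pairs_def)
  then obtain s where "pointed_sep n s" "A = Fam s" using plt_families_sep by blast
  then show ?thesis using that KA by blast
qed

lemma cls_vertex: "bas K \<Longrightarrow> pointed_sep n s \<Longrightarrow> cls K s \<in> LG_vertices G n Gs"
  using pair_in_LG by (auto simp: LG_vertices_def)

lemma cls_eq_iff:
  assumes "bas K" "bas K'" "pointed_sep n s" "pointed_sep n s'"
  shows "cls K s = cls K' s' \<longleftrightarrow> s = s' \<and> eqv s K K'"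
proof
  assume a: "cls K s = cls K' s'"
  then have "(K', Fam s') \<in> cls K s" using vclass_eq[OF assms(4,2)] assms eqv_refl by blast
  then have "Fam s = Fam s'" "eqv s K K'" using vclass_eq[OF assms(3,1)] by auto
  then show "s = s' \<and> eqv s K K'" using sep_fam_inj assms by blast
next
  assume a: "s = s' \<and> eqv s K K'"
  then show "cls K s = cls K' s'"
  proof -
    have e: "eqv s K K'" "eqv s K' K" "s' = s" using a eqv_sym[OF assms(1,2)] by auto
    then have "eqv s K L \<longleftrightarrow> eqv s K' L" if "bas L" for L using eqv_trans[OF assms(1)] eqv_trans[OF assms(2)] by blast
    then show ?thesis unfolding e(3) vclass_eq[OF assms(3,1)] vclass_eq[OF assms(3,2)] by blast
  qed
qed

lemma mem_cls:
  assumes "bas K" "pointed_sep n s" "(K', A) \<in> cls K s" shows "bas K'" "A = Fam s" "cls K' s = cls K s" "eqv s K K'"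
  using assms vclass_eq[OF assms(2,1)] cls_eq_iff[OF assms(1) _ assms(2,2)] by auto

lemma self_cls: "bas K \<Longrightarrow> pointed_sep n s \<Longrightarrow> (K, Fam s) \<in> cls K s"
  using vclass_eq eqv_refl by blast

lemma vleE:
  assumes "bas K" "pointed_sep n s" "bas K'" "pointed_sep n t" "vle n (cls K s) (cls K' t)"
  obtains L where "bas L" "cls K s = cls L s" "cls K' t = cls L t" "\<And>k i j. s k i j \<Longrightarrow> t k i j"
proof -
  obtain L A B where L: "(L, A) \<in> cls K s" "(L, B) \<in> cls K' t" "tree_le n A B" using assms(5) by (auto simp: vle_def)
  note m = mem_cls[OF assms(1,2) L(1)] and m' = mem_cls[OF assms(3,4) L(2)]
  show ?thesis by (rule that[of L]) (use m m' L(3) tree_le_sep_fam[OF assms(2,4)] in auto)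
qed

lemma vleI:
  assumes "bas L" "pointed_sep n s" "pointed_sep n t" "\<And>k i j. s k i j \<Longrightarrow> t k i j"
  shows "vle n (cls L s) (cls L t)"
  unfolding vle_def using self_cls[OF assms(1,2)] self_cls[OF assms(1,3)] tree_le_sep_fam[OF assms(2,3)] assms(4) by blast

lemma vact_cls:
  assumes "\<phi> \<in> sigma_aut1 G n Gs" "bas K" "pointed_sep n s"
  shows "vact G n Gs \<phi> (cls K s) = cls (basis_img n \<phi> K) s"
proof -
  define p where "p = (SOME p. p \<in> cls K s)"
  have "p \<in> cls K s" unfolding p_def using self_cls[OF assms(2,3)] by (rule someI)
  then obtain K' where p: "p = (K', Fam s)" "bas K'" "eqv s K K'" using vclass_eq[OF assms(3,2)] by blast
  have \<phi>: "\<phi> \<in> hom G G" using assms by (simp add: sigma_aut1_def)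
  have "vact G n Gs \<phi> (cls K s) = cls (basis_img n \<phi> K') s" unfolding vact_def p_def[symmetric] p(1) by simp
  also have "\<dots> = cls (basis_img n \<phi> K) s"
    using cls_eq_iff[OF aut_bas[OF assms(1,2)] aut_bas[OF assms(1) p(2)] assms(3,3)] aut_eqv[OF \<phi> assms(2) p(3)] by simp
  finally show ?thesis .
qed

lemma vle_refl: "bas K \<Longrightarrow> pointed_sep n s \<Longrightarrow> vle n (cls K s) (cls K s)"
  by (rule vleI)

text \<open>Two representatives of the middle type are equivalent for \<open>t\<close> and therefore
  also for the finer tree \<open>u\<close>; so the basis used for the first relation serves for the
  second.\<close>

lemma vle_chain:
  assumes "bas K" "pointed_sep n s" "bas K'" "pointed_sep n t" "bas K''" "pointed_sep n u"
    "vle n (cls K s) (cls K' t)" "vle n (cls K' t) (cls K'' u)"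
  obtains L where "bas L" "cls K s = cls L s" "cls K' t = cls L t" "cls K'' u = cls L u"
    "\<And>k i j. s k i j \<Longrightarrow> t k i j" "\<And>k i j. t k i j \<Longrightarrow> u k i j"
proof -
  obtain L where L: "bas L" "cls K s = cls L s" "cls K' t = cls L t" "\<And>k i j. s k i j \<Longrightarrow> t k i j" using vleE[OF assms(1-4,7)] by blast
  obtain M where M: "bas M" "cls K' t = cls M t" "cls K'' u = cls M u" "\<And>k i j. t k i j \<Longrightarrow> u k i j" using vleE[OF assms(3-6,8)] by metis
  have "eqv t M L" using cls_eq_iff[OF M(1) L(1) assms(4,4)] L(3) M(2) by simp
  then have "eqv u M L" using eqv_mono[of t u M L] M(4) by blast
  then have "cls K'' u = cls L u" using cls_eq_iff[OF M(1) L(1) assms(6,6)] M(3) by simp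
  then show ?thesis using that L M by blast
qed

end

section \<open>Bases and an invariant tree\<close>

lemma (in sep_tree) sep_cong:
  assumes "\<not> s l p p'" "\<not> s l q q'" "p \<in> N" "p' \<in> N" "q \<in> N" "q' \<in> N" "p \<noteq> l" "p' \<noteq> l" "q \<noteq> l" "q' \<noteq> l"
  shows "s l p q \<longleftrightarrow> s l p' q'"
proof
  assume "s l p q"
  then have "s l p' q" using tri[of l p q p'] assms by blast
  then show "s l p' q'" using tri[of l p' q q'] assms sym by blast
next
  assume "s l p' q'"
  then have "s l p q'" using tri[of l p' q' p] assms sym by blast
  then show "s l p q" using tri[of l p q' q] assms by blast
qed

text \<open>These are the features of a Bass--Serre tree that matter: invariance, translates of the
  base point as leaves, and trivial edge stabilisers, which \<open>S_free\<close> expresses as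
  freeness of a vertex stabiliser on the directions at its vertex.\<close>

locale gtree = free_prod_bases +
  fixes S :: "'a + 'a set \<Rightarrow> 'a + 'a set \<Rightarrow> 'a + 'a set \<Rightarrow> bool"
  assumes S_tree: "sep_tree \<Lambda> S"
    and S_act: "g \<in> carrier G \<Longrightarrow> l \<in> \<Lambda> \<Longrightarrow> p \<in> \<Lambda> \<Longrightarrow> q \<in> \<Lambda> \<Longrightarrow> S (act g l) (act g p) (act g q) \<longleftrightarrow> S l p q"
    and S_leaf: "\<not> S (Inl a) p q"
    and S_free: "l \<in> \<Lambda> \<Longrightarrow> x \<in> carrier G \<Longrightarrow> x \<noteq> \<one> \<Longrightarrow> act x l = l \<Longrightarrow> p \<in> \<Lambda> \<Longrightarrow> p \<noteq> l \<Longrightarrow> S l p (act x p)"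
begin

interpretation S: sep_tree \<Lambda> S by (rule S_tree)

text \<open>The tree \<open>S\<close> looks like the tree of \<open>(K, s)\<close> around every vertex of \<open>K\<close>.\<close>

definition adapted :: "(nat \<Rightarrow> 'a set) \<Rightarrow> (nat \<Rightarrow> nat \<Rightarrow> nat \<Rightarrow> bool) \<Rightarrow> bool" where
  "adapted K s \<longleftrightarrow> (\<forall>k\<in>{1..n}. \<forall>i j. sep_adj {0..n} s k i \<and> sep_adj {0..n} s k j \<longrightarrow>
     (\<forall>x\<in>K k. \<not> S (ptK K k) (ptK K i) (act x (ptK K j)) \<longleftrightarrow> x = \<one> \<and> \<not> s k i j))"

lemma S_not_trans: "\<not> S l p q \<Longrightarrow> \<not> S l q r \<Longrightarrow> q \<in> \<Lambda> \<Longrightarrow> q \<noteq> l \<Longrightarrow> \<not> S l p r"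
  using S.tri by blast

lemma S_leaf0: "\<not> S (ptK K 0) p q" using S_leaf by (simp add: pt_def)

context
  fixes K s
  assumes K: "bas K" and s: "pointed_sep n s" and ad: "adapted K s"
begin

interpretation T: fin_sep_tree "{0..n}" s using s by (simp add: pointed_sep_def)
interpretation K: free_prod G n K by (rule bas_fp[OF K])

private lemma leaf: "\<not> s 0 i j" using s by (simp add: pointed_sep_def)

private lemma KL: "points G n K = \<Lambda>" by (rule bas_points[OF K])

private lemma pin: "j \<le> n \<Longrightarrow> ptK K j \<in> \<Lambda>" by (rule ptK_in[OF K])

lemma adapted_adj:
  assumes "k \<in> {1..n}" "T.adj k i" "T.adj k j" shows "S (ptK K k) (ptK K i) (ptK K j) \<longleftrightarrow> s k i j"
proof -
  have j: "j \<le> n" using T.adjD(1)[OF assms(3)] by simp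
  have "\<not> S (ptK K k) (ptK K i) (act \<one> (ptK K j)) \<longleftrightarrow> \<one> = \<one> \<and> \<not> s k i j"
    using ad assms K.H_ops(3)[OF assms(1)] unfolding adapted_def by blast
  then show ?thesis using act_one[OF pin[OF j]] by simp
qed

text \<open>From local to global: adaptedness says that the path from \<open>k\<close> to
  \<open>i\<close> never turns back in \<open>S\<close>, so its end lies in the direction of its
  first step.\<close>

lemma adapted_nb:
  assumes "k \<le> n" "i \<le> n" "i \<noteq> k" shows "\<not> S (ptK K k) (ptK K i) (ptK K (T.nb k i))"
  using assms
proof (induction "card {l. s l k i}" arbitrary: k rule: less_induct)
  case less
  let ?c = "T.nb k i"
  have c: "T.adj k ?c" "?c = i \<or> s ?c k i" "?c \<le> n" "?c \<noteq> k" using T.nb[of k i] less.prems by auto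
  show ?case
  proof (cases "?c = i")
    case True
    then show ?thesis using S.irrefl by simp
  next
    case False
    then have sc: "s ?c k i" using c by blast
    then have c1: "?c \<in> {1..n}" using c leaf by (cases "?c = 0") auto
    have sub: "s l k i" if "s l ?c i" for l using T.between_trans[of l i ?c k] that sc T.sym by blast
    then have "{l. s l ?c i} \<subset> {l. s l k i}" using sc T.dom by blast
    then have "card {l. s l ?c i} < card {l. s l k i}" using T.finite_sep by (rule psubset_card_mono[rotated])
    then have IH: "\<not> S (ptK K ?c) (ptK K i) (ptK K (T.nb ?c i))" using less.hyps[of ?c] c less.prems False by simp
    let ?d = "T.nb ?c i"
    have d: "T.adj ?c ?d" "\<not> s ?c i ?d" "?d \<le> n" "?d \<noteq> ?c" using T.nb[of ?c i] c less.prems False by auto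
    have "s ?c k ?d" using T.tri[OF sc, of ?d] d T.sym by auto
    then have "S (ptK K ?c) (ptK K k) (ptK K ?d)" using adapted_adj[OF c1 T.adj_sym[OF c(1)] d(1)] by simp
    then have "S (ptK K ?c) (ptK K k) (ptK K i)"
      using S.tri[of "ptK K ?c" "ptK K k" "ptK K ?d" "ptK K i"] IH pin less.prems c(3) K.vpt_inj False by auto
    then show ?thesis using S.ax S.sym by blast
  qed
qed

lemma adapted_full:
  assumes "k \<in> {1..n}" "i \<le> n" "j \<le> n" "i \<noteq> k" "j \<noteq> k" "x \<in> K k"
  shows "\<not> S (ptK K k) (ptK K i) (act x (ptK K j)) \<longleftrightarrow> x = \<one> \<and> \<not> s k i j"
proof -
  let ?i = "T.nb k i" and ?j = "T.nb k j"
  have kn: "k \<le> n" using assms by simp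
  have xc: "x \<in> carrier G" using K.H_closed assms by blast
  have i: "T.adj k ?i" "\<not> s k i ?i" "?i \<le> n" "?i \<noteq> k" and j: "T.adj k ?j" "\<not> s k j ?j" "?j \<le> n" "?j \<noteq> k"
    using T.nb[of k i] T.nb[of k j] assms by auto
  have fk: "act x (ptK K k) = ptK K k" using K.act_stab[OF assms(1,6)] .
  have ne: "a \<le> n \<Longrightarrow> a \<noteq> k \<Longrightarrow> ptK K a \<noteq> ptK K k" "a \<le> n \<Longrightarrow> a \<noteq> k \<Longrightarrow> act x (ptK K a) \<noteq> ptK K k" for a
    using K.vpt_inj[of a k] kn act_inj[OF xc pin pin, of a k] fk by auto
  have 1: "\<not> S (ptK K k) (ptK K i) (ptK K ?i)" using adapted_nb[OF kn assms(2,4)] .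
  have 2: "\<not> S (ptK K k) (act x (ptK K j)) (act x (ptK K ?j))"
    using adapted_nb[OF kn assms(3,5)] S_act[OF xc pin[OF kn] pin[OF assms(3)] pin[OF j(3)]] fk by simp
  have "S (ptK K k) (ptK K i) (act x (ptK K j)) \<longleftrightarrow> S (ptK K k) (ptK K ?i) (act x (ptK K ?j))"
    by (rule S.sep_cong[OF 1 2]) (use ne assms i j pin act_closed[OF xc] in auto)
  moreover have "\<not> S (ptK K k) (ptK K ?i) (act x (ptK K ?j)) \<longleftrightarrow> x = \<one> \<and> \<not> s k ?i ?j"
    using ad assms i j unfolding adapted_def by blast
  moreover have "s k i j \<longleftrightarrow> s k ?i ?j"
    by (rule T.sep_cong[OF i(2) j(2)]) (use i j assms in auto)
  ultimately show ?thesis by blast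
qed

lemma adapted_full1:
  assumes "k \<le> n" "i \<le> n" "j \<le> n" "i \<noteq> k" "j \<noteq> k" shows "S (ptK K k) (ptK K i) (ptK K j) \<longleftrightarrow> s k i j"
proof (cases "k = 0")
  case False
  then show ?thesis using adapted_full[of k i j \<one>] assms act_one[OF pin[OF assms(3)]] K.H_ops(3)[of k] by auto
qed (use S_leaf0 leaf in auto)

text \<open>Ping-pong: a nontrivial letter in \<open>K k\<close> moves a point into a direction at
  \<open>k\<close> which contains no vertex of the basis. This propagates along the code.\<close>

lemma adapted_word:
  assumes "K.cd p ((k, y) # w) j" "i \<le> n" "i \<noteq> k" shows "S (ptK K k) p (ptK K i)"
  using assms
proof (induction w arbitrary: p k y i)
  case Nil
  then obtain q where q: "k \<in> {1..n}" "y \<in> K k" "y \<noteq> \<one>" "j \<noteq> k" "j \<le> n" "p = act y (ptK K j)"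
    by (auto simp: K.cd_Cons K.cd_Nil hl_def)
  then show ?case using adapted_full[of k i j y] Nil S.sym by blast
next
  case (Cons c w)
  obtain k2 z where c: "c = (k2, z)" by force
  obtain q where q: "k \<in> {1..n}" "y \<in> K k" "y \<noteq> \<one>" "k2 \<noteq> k" "K.cd q ((k2, z) # w) j" "p = act y q"
    using Cons.prems(1) by (auto simp: K.cd_Cons c hl_def)
  have k2: "k2 \<le> n" using q(5) by (simp add: K.cd_Cons)
  have qL: "q \<in> \<Lambda>" using K.cd_in[OF q(5)] KL by simp
  have yc: "y \<in> carrier G" using K.H_closed q by blast
  have kn: "k \<le> n" using q by simp
  have "S (ptK K k2) q (ptK K k)" using Cons.IH[OF q(5) kn] q(4) by simp
  then have "\<not> S (ptK K k) q (ptK K k2)" using S.ax by blast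
  then have 1: "\<not> S (ptK K k) p (act y (ptK K k2))"
    using S_act[OF yc pin[OF kn] qL pin[OF k2]] K.act_stab[OF q(1,2)] q(6) by simp
  have "S (ptK K k) (act y (ptK K k2)) (ptK K i)"
    using adapted_full[OF q(1) Cons.prems(2) k2 Cons.prems(3) q(4,2)] q(3) S.sym by blast
  moreover have "p \<in> \<Lambda>" "p \<noteq> ptK K k"
    using K.cd_in[OF Cons.prems(1)] KL K.cd_vpt[OF Cons.prems(1) kn] by auto
  ultimately show ?case using S.tri 1 S.sym by blast
qed

lemma adapted_word_dir:
  assumes "K.cd p w j" "k \<in> {1..n}" "p \<noteq> ptK K k"
  shows "\<not> S (ptK K k) p (act (dx G k w) (ptK K (da k w j)))"
    and "dx G k w \<in> K k" "da k w j \<le> n" "da k w j \<noteq> k"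
proof -
  have kn: "k \<le> n" using assms by simp
  have simple: "\<not> S (ptK K k) q (ptK K (hl v j))" if q: "K.cd q v j" "hl v j \<noteq> k" for q v
  proof (cases v)
    case Nil
    then show ?thesis using q S.irrefl by (auto simp: K.cd_Nil hl_def)
  next
    case (Cons c v')
    obtain k1 y where c: "c = (k1, y)" by force
    have "S (ptK K k1) q (ptK K k)" using adapted_word[of q k1 y v' j k] q kn by (simp add: Cons c hl_def)
    then show ?thesis using S.ax by (simp add: Cons c hl_def)
  qed
  have "dx G k w \<in> K k \<and> da k w j \<le> n \<and> da k w j \<noteq> k \<and> \<not> S (ptK K k) p (act (dx G k w) (ptK K (da k w j)))"
  proof (cases "w \<noteq> [] \<and> fst (hd w) = k")
    case False
    have h: "hl w j \<noteq> k" using False assms(3) K.cd_vpt[OF assms(1) kn] by (auto simp: hl_def)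
    have hn: "hl w j \<le> n" using K.hl_le[OF assms(1)] .
    have "dx G k w = \<one>" "da k w j = hl w j" using False by (auto simp: dx_def da_def)
    then show ?thesis using simple[OF assms(1) h] h hn act_one[OF pin[OF hn]] K.H_ops(3)[OF assms(2)] by simp
  next
    case True
    then obtain y w' where w: "w = (k, y) # w'" by (cases w) auto
    obtain q where q: "y \<in> K k" "hl w' j \<noteq> k" "K.cd q w' j" "p = act y q" using assms(1) by (auto simp: w K.cd_Cons)
    have yc: "y \<in> carrier G" using K.H_closed assms q by blast
    have hn: "hl w' j \<le> n" using K.hl_le[OF q(3)] .
    have "\<not> S (ptK K k) (act y q) (act y (ptK K (hl w' j)))"
      using simple[OF q(3,2)] S_act[OF yc pin[OF kn] _ pin[OF hn], of q] K.act_stab[OF assms(2) q(1)] K.cd_in[OF q(3)] KL by simp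
    then show ?thesis using q hn by (simp add: w dx_def da_def)
  qed
  then show "\<not> S (ptK K k) p (act (dx G k w) (ptK K (da k w j)))" "dx G k w \<in> K k" "da k w j \<le> n" "da k w j \<noteq> k" by auto
qed

text \<open>At the vertices of the basis an adapted tree is read off the codes of points, by the
  formula which defines the Bass--Serre tree. Hence there is at most one adapted tree.\<close>

lemma adapted_dir_iff:
  assumes "K.cd p w i" "K.cd q v j" "k \<in> {1..n}" "p \<noteq> ptK K k" "q \<noteq> ptK K k"
  shows "S (ptK K k) p q \<longleftrightarrow> \<not> (dx G k w = dx G k v \<and> \<not> s k (da k w i) (da k v j))"
proof -
  let ?x = "dx G k w" and ?y = "dx G k v" and ?a = "da k w i" and ?b = "da k v j"
  have kn: "k \<le> n" using assms by simp
  note P = adapted_word_dir[OF assms(1,3,4)] and Q = adapted_word_dir[OF assms(2,3,5)]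
  have xc: "?x \<in> carrier G" "?y \<in> carrier G" using P Q K.H_closed assms by blast+
  have pq: "p \<in> \<Lambda>" "q \<in> \<Lambda>" using K.cd_in assms KL by auto
  have ne: "act z (ptK K c) \<noteq> ptK K k" if "z \<in> K k" "c \<le> n" "c \<noteq> k" for z c
    using act_inj[of z "ptK K c" "ptK K k"] K.act_stab[OF assms(3) that(1)] K.vpt_inj[of c k] that pin kn K.H_closed[OF assms(3) that(1)] by metis
  have "S (ptK K k) p q \<longleftrightarrow> S (ptK K k) (act ?x (ptK K ?a)) (act ?y (ptK K ?b))"
    by (rule S.sep_cong[OF P(1) Q(1)])
       (use ne[OF P(2-4)] ne[OF Q(2-4)] assms(4,5) pin[OF P(3)] pin[OF Q(3)] act_closed xc pq in auto)
  also have "\<dots> \<longleftrightarrow> S (ptK K k) (ptK K ?a) (act (inv ?x \<otimes> ?y) (ptK K ?b))"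
  proof -
    have "act ?x (act (inv ?x \<otimes> ?y) (ptK K ?b)) = act ?y (ptK K ?b)"
      using act_mult[OF xc(1) _ pin[OF Q(3)], of "inv ?x \<otimes> ?y"] xc by (simp add: m_assoc[symmetric])
    then show ?thesis
      using S_act[OF xc(1) pin[OF kn] pin[OF P(3)] act_closed[OF _ pin[OF Q(3)]], of "inv ?x \<otimes> ?y"] xc K.act_stab[OF assms(3) P(2)] by simp
  qed
  also have "\<dots> \<longleftrightarrow> \<not> (inv ?x \<otimes> ?y = \<one> \<and> \<not> s k ?a ?b)"
    using adapted_full[OF assms(3) P(3) Q(3) P(4) Q(4)] K.H_ops P Q assms(3) by blast
  also have "inv ?x \<otimes> ?y = \<one> \<longleftrightarrow> ?x = ?y" using xc by (metis inv_equality inv_inv l_inv inv_closed)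
  finally show ?thesis by blast
qed

text \<open>A vertex outside the basis sees all of it through the vertex \<open>k\<close> at which
  its code starts.\<close>

lemma adapted_far:
  assumes "K.cd p ((k, y) # w) l" "i \<le> n" "j \<le> n" shows "\<not> S p (ptK K i) (ptK K j)"
proof -
  have k: "k \<le> n" using assms(1) by (simp add: K.cd_Cons)
  have 1: "\<not> S p (ptK K i) (ptK K k)" if "i \<le> n" for i
    using adapted_word[OF assms(1) that] S.sym S.ax S.irrefl by metis
  have "ptK K k \<noteq> p" using K.cd_vpt[OF assms(1) k] by auto
  then show ?thesis using S_not_trans[OF 1[OF assms(2)]] 1[OF assms(3)] S.sym pin[OF k] by blast
qed

lemma adapted_adj_S: assumes "T.adj i j" shows "sep_adj \<Lambda> S (ptK K i) (ptK K j)"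
proof -
  have ij: "i \<le> n" "j \<le> n" "i \<noteq> j" using T.adjD(1)[OF assms] by auto
  have "\<not> S l (ptK K i) (ptK K j)" for l
  proof
    assume a: "S l (ptK K i) (ptK K j)"
    then have lL: "l \<in> \<Lambda>" "ptK K i \<noteq> l" "ptK K j \<noteq> l" using S.dom by auto
    then obtain w k where c: "K.cd l w k" using K.cd_ex' KL by blast
    show False
    proof (cases w)
      case Nil
      then have l: "l = ptK K k" "k \<le> n" using c by (auto simp: K.cd_Nil)
      then show False using adapted_full1[of k i j] a ij lL T.adjD(2)[OF assms] by auto
    next
      case (Cons c' w')
      then show False using adapted_far[of l "fst c'" "snd c'" w' k i j] c a ij by simp
    qed
  qed
  then show ?thesis using ij pin K.vpt_inj by (simp add: sep_adj_def)
qed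

lemma adapted_S_adj:
  assumes "k \<le> n" "sep_adj \<Lambda> S (ptK K k) q"
  obtains x j where "x \<in> carrier G" "act x (ptK K k) = ptK K k" "j \<le> n" "j \<noteq> k" "q = act x (ptK K j)" "T.adj k j"
proof -
  have q: "q \<in> \<Lambda>" "q \<noteq> ptK K k" "\<And>l. \<not> S l (ptK K k) q" using assms(2) by (auto simp: sep_adj_def)
  obtain w j where c: "K.cd q w j" using K.cd_ex' q KL by blast
  have jn: "j \<le> n" using c by (simp add: K.cd_def)
  have "\<exists>x. x \<in> carrier G \<and> act x (ptK K k) = ptK K k \<and> j \<noteq> k \<and> q = act x (ptK K j)"
  proof (cases w)
    case Nil
    then have "q = ptK K j" "j \<noteq> k" using c q(2) by (auto simp: K.cd_Nil)
    then show ?thesis using act_one pin assms(1) jn by (intro exI[of _ \<one>]) auto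
  next
    case (Cons c' w')
    obtain k1 y where c': "c' = (k1, y)" by force
    have cq: "K.cd q ((k1, y) # w') j" using c by (simp add: Cons c')
    have kk: "k1 = k" using adapted_word[OF cq assms(1)] q(3) S.sym by blast
    obtain r where r: "k1 \<in> {1..n}" "y \<in> K k" "hl w' j \<noteq> k" "K.cd r w' j" "q = act y r" using cq by (auto simp: K.cd_Cons kk)
    have yc: "y \<in> carrier G" using K.H_closed r kk by blast
    have yk: "act y (ptK K k) = ptK K k" using K.act_stab r kk by simp
    have rL: "r \<in> \<Lambda>" using K.cd_in[OF r(4)] KL by simp
    have "w' = []"
    proof (cases w')
      case (Cons c'' w'')
      obtain k2 z where c'': "c'' = (k2, z)" by force
      have cr: "K.cd r ((k2, z) # w'') j" "k2 \<noteq> k" "k2 \<le> n" using r by (auto simp: Cons c'' hl_def K.cd_Cons)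
      have "S (ptK K k2) r (ptK K k)" using adapted_word[OF cr(1) assms(1)] cr(2) by simp
      then have "S (act y (ptK K k2)) q (ptK K k)"
        using S_act[OF yc pin[OF cr(3)] rL pin[OF assms(1)]] yk r(5) by simp
      then show ?thesis using q(3) S.sym by blast
    qed
    then have "r = ptK K j" "j \<noteq> k" using r by (auto simp: K.cd_Nil hl_def)
    then show ?thesis using yc yk r by blast
  qed
  then obtain x where x: "x \<in> carrier G" "act x (ptK K k) = ptK K k" "j \<noteq> k" "q = act x (ptK K j)" by blast
  have "T.adj k j"
  proof -
    have "\<not> s l k j" for l
    proof
      assume a: "s l k j"
      have l: "l \<le> n" "k \<noteq> l" "j \<noteq> l" using T.dom[OF a] by auto
      then have "S (ptK K l) (ptK K k) (ptK K j)" using adapted_full1[of l k j] a assms jn by simp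
      then have "S (act x (ptK K l)) (ptK K k) q" using S_act[OF x(1) pin[OF l(1)] pin[OF assms(1)] pin[OF jn]] x by simp
      then show False using q(3) by blast
    qed
    then show ?thesis using assms(1) jn x(3) by (simp add: sep_adj_def)
  qed
  then show ?thesis using that x jn by blast
qed

text \<open>Two vertices of the basis are separated only by vertices of the basis. Each letter of
  the code of \<open>p\<close> adds finitely many vertices and a translate of the finite set for the
  remaining word. The finiteness of the volume rests on this.\<close>

lemma adapted_finite_sep: assumes "p \<in> \<Lambda>" shows "finite {l. S l (ptK K 0) p}"
proof -
  have fin1: "finite {l. S l (ptK K i) (ptK K j)}" if ij: "i \<le> n" "j \<le> n" for i j
  proof (rule finite_subset)
    show "{l. S l (ptK K i) (ptK K j)} \<subseteq> ptK K ` {0..n}"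
    proof
      fix l assume "l \<in> {l. S l (ptK K i) (ptK K j)}"
      then have a: "S l (ptK K i) (ptK K j)" by simp
      then obtain w k where c: "K.cd l w k" using K.cd_ex' KL S.dom by blast
      show "l \<in> ptK K ` {0..n}"
      proof (cases w)
        case Nil
        then show ?thesis using c by (auto simp: K.cd_Nil)
      next
        case (Cons c' w')
        then show ?thesis using adapted_far[of l "fst c'" "snd c'" w' k i j] c a ij by simp
      qed
    qed
  qed simp
  have "finite {l. S l (ptK K 0) p}" if "K.cd p w j" for p w j
    using that
  proof (induction w arbitrary: p)
    case Nil
    then show ?case using fin1[of 0 j] by (auto simp: K.cd_Nil)
  next
    case (Cons c w)
    obtain k y where c: "c = (k, y)" by force
    obtain q where q: "k \<in> {1..n}" "y \<in> K k" "K.cd q w j" "p = act y q" using Cons.prems by (auto simp: K.cd_Cons c)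
    have yc: "y \<in> carrier G" using K.H_closed q by blast
    have kn: "k \<le> n" using q by simp
    have qL: "q \<in> \<Lambda>" using K.cd_in[OF q(3)] KL by simp
    let ?F = "{ptK K k, act y (ptK K 0)} \<union> {l. S l (ptK K 0) (ptK K k)} \<union> act y ` ({l. S l (ptK K k) (ptK K 0)} \<union> {l. S l (ptK K 0) q})"
    have "{l. S l (ptK K 0) p} \<subseteq> ?F"
    proof
      fix l assume "l \<in> {l. S l (ptK K 0) p}"
      then have a: "S l (ptK K 0) p" by simp
      then have lL: "l \<in> \<Lambda>" using S.dom by blast
      show "l \<in> ?F"
      proof (cases "l = ptK K k \<or> l = act y (ptK K 0)")
        case False
        then have "S l (ptK K 0) (ptK K k) \<or> S l (ptK K k) p" using S.tri[OF a pin[OF kn]] by blast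
        then show ?thesis
        proof
          assume b: "S l (ptK K k) p"
          let ?l = "act (inv y) l"
          have l': "?l \<in> \<Lambda>" "l = act y ?l" using act_closed yc lL act_inv(2) by auto
          have "S (act y ?l) (act y (ptK K k)) (act y q)" using b l' q(4) K.act_stab[OF q(1,2)] by simp
          then have S': "S ?l (ptK K k) q" using S_act[OF yc l'(1) pin[OF kn] qL] by simp
          have "ptK K 0 \<noteq> ?l" using False l' by auto
          then have "S ?l (ptK K k) (ptK K 0) \<or> S ?l (ptK K 0) q" using S.tri[OF S' pin] by blast
          then show ?thesis using l'(2) by blast
        qed simp
      qed blast
    qed
    moreover have "finite ?F" using fin1[of 0 k] fin1[of k 0] kn Cons.IH[OF q(3)] by simp
    ultimately show ?case by (rule finite_subset)
  qed
  then show ?thesis using K.cd_ex' assms KL by metis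
qed

end

lemma adapted_eqv:
  assumes K: "bas K" "bas K'" and s: "pointed_sep n s" and ad: "adapted K s" and e: "eqv s K K'"
  shows "adapted K' s"
  unfolding adapted_def
proof (intro ballI allI impI)
  interpret T: fin_sep_tree "{0..n}" s using s by (simp add: pointed_sep_def)
  interpret K: free_prod G n K by (rule bas_fp[OF K(1)])
  interpret K': free_prod G n K' by (rule bas_fp[OF K(2)])
  fix k i j x assume k: "k \<in> {1..n}" and a: "T.adj k i \<and> T.adj k j" and x: "x \<in> K' k"
  have kn: "k \<le> n" using k by simp
  have ij: "i \<le> n" "j \<le> n" using a T.adjD(1) by force+
  have pin: "ptK K l \<in> \<Lambda>" if "l \<le> n" for l using ptK_in[OF K(1) that] .
  have xc: "x \<in> carrier G" using K'.H_closed k x by blast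
  have "\<exists>g h. g \<in> carrier G \<and> h \<in> carrier G \<and> ptK K' k = act g (ptK K k) \<and> ptK K' i = act g (ptK K i) \<and>
      ptK K' k = act h (ptK K k) \<and> ptK K' j = act h (ptK K j) \<and> (\<not> s k i j \<longrightarrow> g = h)"
  proof (cases "s k i j")
    case False
    then have "transl K K' {k, i, j}" using e a unfolding bas_eqv_def by blast
    then show ?thesis by (auto simp: bas_transl_def)
  next
    case True
    have "transl K K' {k, i, i}" "transl K K' {k, j, j}" using e a T.irrefl unfolding bas_eqv_def by blast+
    then show ?thesis using True by (auto simp: bas_transl_def)
  qed
  then obtain g h where g: "g \<in> carrier G" "h \<in> carrier G" "ptK K' k = act g (ptK K k)" "ptK K' i = act g (ptK K i)"
    "ptK K' k = act h (ptK K k)" "ptK K' j = act h (ptK K j)" "\<not> s k i j \<Longrightarrow> g = h" by blast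
  \<comment> \<open>If \<open>k\<close> separates \<open>i\<close> from \<open>j\<close>, the two
    may be translated by different elements \<open>g\<close> and \<open>h\<close>. This element lies
    in \<open>K k\<close> and reduces the claim for \<open>K'\<close> to the one for
    \<open>K\<close>, after translation by \<open>g\<close>.\<close>
  let ?z = "inv g \<otimes> x \<otimes> h"
  have zc: "?z \<in> carrier G" using g xc by simp
  have gz: "g \<otimes> ?z = x \<otimes> h" using g xc by (simp add: m_assoc[symmetric])
  have xk: "act x (ptK K' k) = ptK K' k" using K'.act_stab[OF k x] .
  have tr: "act g (act ?z (ptK K l)) = act x (act h (ptK K l))" if "l \<le> n" for l
    using act_mult[OF g(1) zc pin[OF that]] gz act_mult[OF xc g(2) pin[OF that]] by simp
  have "act g (act ?z (ptK K k)) = act g (ptK K k)" using tr[OF kn] g xk by metis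
  then have "act ?z (ptK K k) = ptK K k" using act_inj[OF g(1) act_closed[OF zc pin[OF kn]] pin[OF kn]] by simp
  then have zk: "?z \<in> K k" using K.stab_vpt[OF zc k] by simp
  have "S (ptK K' k) (ptK K' i) (act x (ptK K' j)) \<longleftrightarrow> S (act g (ptK K k)) (act g (ptK K i)) (act g (act ?z (ptK K j)))"
    using g tr[OF ij(2)] by simp
  also have "\<dots> \<longleftrightarrow> S (ptK K k) (ptK K i) (act ?z (ptK K j))"
    using S_act[OF g(1) pin[OF kn] pin[OF ij(1)] act_closed[OF zc pin[OF ij(2)]]] .
  finally have "\<not> S (ptK K' k) (ptK K' i) (act x (ptK K' j)) \<longleftrightarrow> ?z = \<one> \<and> \<not> s k i j"
    using ad a zk k unfolding adapted_def by blast
  moreover have "?z = \<one> \<longleftrightarrow> x = \<one>" if "g = h"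
  proof
    assume "?z = \<one>"
    then have "x \<otimes> h = h" using gz g that by simp
    then show "x = \<one>" using xc g by simp
  qed (use g that in simp)
  ultimately show "\<not> S (ptK K' k) (ptK K' i) (act x (ptK K' j)) \<longleftrightarrow> x = \<one> \<and> \<not> s k i j" using g(7) by blast
qed

text \<open>The tree \<open>S\<close> determines the vertex type to which it is adapted: neighbours in \<open>S\<close> of a vertex
  of one basis are translates of neighbours in the other one.\<close>

theorem adapted_unique:
  assumes K: "bas K" "pointed_sep n s" "adapted K s" and L: "bas L" "pointed_sep n t" "adapted L t"
  shows "cls K s = cls L t"
proof -
  interpret s: fin_sep_tree "{0..n}" s using K by (simp add: pointed_sep_def)
  interpret t: fin_sep_tree "{0..n}" t using L by (simp add: pointed_sep_def)
  interpret K: free_prod G n K by (rule bas_fp[OF K(1)])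
  interpret L: free_prod G n L by (rule bas_fp[OF L(1)])
  have pK: "ptK K j \<in> \<Lambda>" and pL: "ptK L j \<in> \<Lambda>" if "j \<le> n" for j using ptK_in K L that by auto
  have ex: "\<exists>g\<in>carrier G. ptK K k = act g (ptK L k) \<and> ptK K i = act g (ptK L i) \<and> t.adj k i" if a: "s.adj k i" for k i
  proof -
    have ki: "k \<le> n" "i \<le> n" using s.adjD(1)[OF a] by auto
    obtain g where g: "g \<in> carrier G" "ptK K k = act g (ptK L k)"
      using ptK_in[OF K(1) ki(1)] bas_points[OF L(1)] L.label_unique K.label_unique
    proof -
      obtain a b where ab: "a \<in> carrier G" "ptK K k = act a (vpt k)" "b \<in> carrier G" "ptK L k = act b (vpt k)"
        using bas_conj[OF K(1) ki(1)] bas_conj[OF L(1) ki(1)] by blast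
      have "ptK K k = act (a \<otimes> inv b) (ptK L k)"
        using ab act_mult[of "a \<otimes> inv b" b "vpt k"] vpt_in[OF ki(1)] by (simp add: m_assoc)
      then show ?thesis using that[of "a \<otimes> inv b"] ab by simp
    qed
    have "sep_adj \<Lambda> S (ptK K k) (ptK K i)" by (rule adapted_adj_S[OF K a])
    then have "sep_adj \<Lambda> S (ptK L k) (act (inv g) (ptK K i))"
    proof -
      have b: "ptK L k = act (inv g) (ptK K k)" using g act_inv(1)[OF g(1) pL[OF ki(1)]] by simp
      have "\<not> S l (ptK L k) (act (inv g) (ptK K i))" for l
      proof
        assume S: "S l (ptK L k) (act (inv g) (ptK K i))"
        then have lL: "l \<in> \<Lambda>" using S.dom by blast
        have "S (act g l) (act g (ptK L k)) (act g (act (inv g) (ptK K i)))"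
          using S S_act[OF g(1) lL pL[OF ki(1)] act_closed[OF _ pK[OF ki(2)]], of "inv g"] g by simp
        then have "S (act g l) (ptK K k) (ptK K i)" using g act_inv(2)[OF g(1) pK[OF ki(2)]] by simp
        then show False using \<open>sep_adj \<Lambda> S (ptK K k) (ptK K i)\<close> by (simp add: sep_adj_def)
      qed
      moreover have "ptK L k \<noteq> act (inv g) (ptK K i)"
        unfolding b using act_inj[OF inv_closed[OF g(1)] pK[OF ki(1)] pK[OF ki(2)]] K.vpt_inj[OF ki] s.adjD(1)[OF a] by simp
      ultimately show ?thesis using pL ki act_closed[OF _ pK[OF ki(2)]] g by (simp add: sep_adj_def)
    qed
    then obtain x j where x: "x \<in> carrier G" "act x (ptK L k) = ptK L k" "j \<le> n" "act (inv g) (ptK K i) = act x (ptK L j)" "t.adj k j"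
      using adapted_S_adj[OF L ki(1)] by metis
    have i: "ptK K i = act (g \<otimes> x) (ptK L j)"
      using x(4) act_inv(2)[OF g(1) pK[OF ki(2)]] act_mult[OF g(1) x(1) pL[OF x(3)]] by simp
    have "i = j"
    proof -
      obtain a b where ab: "a \<in> carrier G" "ptK K i = act a (vpt i)" "b \<in> carrier G" "ptK L j = act b (vpt j)"
        using bas_conj[OF K(1) ki(2)] bas_conj[OF L(1) x(3)] by blast
      then have "act a (vpt i) = act (g \<otimes> x \<otimes> b) (vpt j)" using i act_mult[of "g \<otimes> x" b "vpt j"] g x vpt_in[OF x(3)] by simp
      moreover have "g \<otimes> x \<otimes> b \<in> carrier G" using g x ab by simp
      ultimately show ?thesis using label_unique[OF ab(1) _ ki(2) x(3)] by blast
    qed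
    moreover have "ptK K k = act (g \<otimes> x) (ptK L k)" using g x(1,2) act_mult[OF g(1) x(1) pL[OF ki(1)]] by simp
    ultimately show ?thesis using i x g by (intro bexI[of _ "g \<otimes> x"]) auto
  qed
  have "eqv s L K"
    unfolding bas_eqv_def
  proof (intro allI impI)
    fix k i j assume a: "s.adj k i \<and> s.adj k j \<and> \<not> s k i j"
    have kij: "k \<le> n" "i \<le> n" "j \<le> n" "i \<noteq> k" "j \<noteq> k" using s.adjD(1)[of k i] s.adjD(1)[of k j] a by auto
    obtain g where g: "g \<in> carrier G" "ptK K k = act g (ptK L k)" "ptK K i = act g (ptK L i)" "t.adj k i" using ex a by blast
    obtain h where h: "h \<in> carrier G" "ptK K k = act h (ptK L k)" "ptK K j = act h (ptK L j)" "t.adj k j" using ex a by blast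
    \<comment> \<open>The two translations differ by an element of \<open>L k\<close>. As
      \<open>S\<close> does not separate \<open>i\<close> from \<open>j\<close> at \<open>k\<close>
      for the basis \<open>K\<close>, adaptedness of \<open>L\<close> forces this element to be
      trivial.\<close>
    have "g = h"
    proof (cases "k = 0")
      case True
      then show ?thesis using g h by (simp add: pt_def)
    next
      case False
      then have k1: "k \<in> {1..n}" using kij by simp
      let ?z = "inv g \<otimes> h"
      have zc: "?z \<in> carrier G" using g h by simp
      have gz: "act g (act ?z (ptK L l)) = act h (ptK L l)" if "l \<le> n" for l
        using act_mult[OF g(1) zc pL[OF that]] g h by (simp add: m_assoc[symmetric])
      have "act g (act ?z (ptK L k)) = act g (ptK L k)" using gz[OF kij(1)] g h by metis
      then have "act ?z (ptK L k) = ptK L k" using act_inj[OF g(1) act_closed[OF zc pL[OF kij(1)]] pL[OF kij(1)]] by simp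
      then have zk: "?z \<in> L k" using L.stab_vpt[OF zc k1] by simp
      have "\<not> S (ptK K k) (ptK K i) (ptK K j)" using adapted_adj[OF K k1] a by blast
      then have "\<not> S (act g (ptK L k)) (act g (ptK L i)) (act g (act ?z (ptK L j)))" using g h gz[OF kij(3)] by simp
      then have "\<not> S (ptK L k) (ptK L i) (act ?z (ptK L j))"
        using S_act[OF g(1) pL[OF kij(1)] pL[OF kij(2)] act_closed[OF zc pL[OF kij(3)]]] by simp
      then have "?z = \<one>" using L(3) g(4) h(4) k1 zk unfolding adapted_def by blast
      then show ?thesis using g h by (metis inv_equality inv_inv inv_closed)
    qed
    then show "transl L K {k, i, j}" unfolding bas_transl_def using g h by auto
  qed
  then have e: "eqv s K L" using eqv_sym[OF L(1) K(1)] by blast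
  have adL: "adapted L s" by (rule adapted_eqv[OF K(1) L(1) K(2,3) e])
  have "s k i j \<longleftrightarrow> t k i j" for k i j
  proof (cases "k \<le> n \<and> i \<le> n \<and> j \<le> n \<and> i \<noteq> k \<and> j \<noteq> k")
    case True
    then show ?thesis using adapted_full1[OF L(1) K(2) adL, of k i j] adapted_full1[OF L, of k i j] by simp
  next
    case False
    then show ?thesis using s.dom[of k i j] t.dom[of k i j] by auto
  qed
  then have "s = t" by (simp add: fun_eq_iff)
  then show ?thesis using cls_eq_iff[OF K(1) L(1) K(2) L(2)] e by simp
qed

end

text \<open>By invariance the separating vertex may be moved into the basis, where both trees are
  read off the same codes.\<close>

lemma adapted_determines:
  assumes "gtree G n Gs S" "gtree G n Gs S'" "is_basis G n Gs K" "pointed_sep n s"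
    and ad: "gtree.adapted G n S K s" "gtree.adapted G n S' K s"
  shows "S = S'"
proof -
  interpret A: gtree G n Gs S by fact
  interpret B: gtree G n Gs S' by fact
  interpret K: free_prod G n K using A.bas_fp assms by blast
  have KL: "points G n K = points G n Gs" using A.bas_points assms by blast
  have pin: "pt G K j \<in> points G n Gs" if "j \<le> n" for j using A.ptK_in assms(3) that by blast
  have "S l p q \<longleftrightarrow> S' l p q" for l p q
  proof (cases "l \<in> points G n Gs \<and> p \<in> points G n Gs \<and> q \<in> points G n Gs \<and> p \<noteq> l \<and> q \<noteq> l")
    case True
    then obtain g k where g: "g \<in> carrier G" "k \<le> n" "l = pact G g (pt G K k)" unfolding KL[symmetric] by (auto simp: points_def)
    show ?thesis
    proof (cases "k = 0")
      case True
      then show ?thesis using g A.S_leaf B.S_leaf by (simp add: pt_def)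
    next
      case False
      then have k: "k \<in> {1..n}" using g by simp
      define p' where "p' = pact G (inv\<^bsub>G\<^esub> g) p"
      define q' where "q' = pact G (inv\<^bsub>G\<^esub> g) q"
      have pq: "p' \<in> points G n Gs" "q' \<in> points G n Gs" "p = pact G g p'" "q = pact G g q'"
        using True A.act_closed g A.act_inv(2) by (auto simp: p'_def q'_def)
      then have ne: "p' \<noteq> pt G K k" "q' \<noteq> pt G K k" using True g by auto
      obtain w i v j where c: "K.cd p' w i" "K.cd q' v j" using K.cd_ex' pq KL by metis
      have "S l p q \<longleftrightarrow> S (pt G K k) p' q'" using A.S_act[OF g(1) pin[OF g(2)] pq(1,2)] g(3) pq by simp
      also have "\<dots> \<longleftrightarrow> S' (pt G K k) p' q'"
        using A.adapted_dir_iff[OF assms(3,4) ad(1) c k ne] B.adapted_dir_iff[OF assms(3,4) ad(2) c k ne] by simp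
      also have "\<dots> \<longleftrightarrow> S' l p q" using B.S_act[OF g(1) pin[OF g(2)] pq(1,2)] g(3) pq by simp
      finally show ?thesis .
    qed
  next
    case False
    then show ?thesis using sep_tree.dom[OF A.S_tree] sep_tree.dom[OF B.S_tree] by blast
  qed
  then show ?thesis by (simp add: fun_eq_iff)
qed

section \<open>Folding towards a fixed tree\<close>

locale gtree0 = gtree +
  fixes H0 s0
  assumes H0: "bas H0" and s0: "pointed_sep n s0" and ad0: "adapted H0 s0"
begin

interpretation S: sep_tree \<Lambda> S by (rule S_tree)

abbreviation SK :: "(nat \<Rightarrow> 'a set) \<Rightarrow> nat \<Rightarrow> nat \<Rightarrow> nat \<Rightarrow> bool" where
  "SK K k i j \<equiv> S (ptK K k) (ptK K i) (ptK K j)"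

section \<open>Half-spaces and volume\<close>

text \<open>This set stands for the edge of the tree \<open>S\<close> that leaves \<open>l\<close>
  towards \<open>p\<close>. Edges are thus encoded by sets of labelled points, and unlabelled
  vertices of \<open>S\<close> need not be named.\<close>

definition hs :: "'a + 'a set \<Rightarrow> 'a + 'a set \<Rightarrow> ('a + 'a set) set" where
  "hs l p = {q \<in> \<Lambda>. q \<noteq> l \<and> \<not> S l p q}"

definition HS :: "('a + 'a set) set set" where
  "HS = {hs l p | l p. l \<in> \<Lambda> \<and> p \<in> \<Lambda> \<and> p \<noteq> l}"

text \<open>Removing an edge from a tree leaves two subtrees, so a half-space and its complement are
  both convex.\<close>

lemma HS_convex:
  assumes "D \<in> HS" "S k p q" shows "p \<in> D \<Longrightarrow> q \<in> D \<Longrightarrow> k \<in> D" "p \<notin> D \<Longrightarrow> q \<notin> D \<Longrightarrow> k \<notin> D"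
proof -
  obtain l r where D: "D = hs l r" "l \<in> \<Lambda>" "r \<in> \<Lambda>" "r \<noteq> l" using assms(1) by (auto simp: HS_def)
  have d: "k \<in> \<Lambda>" "p \<in> \<Lambda>" "q \<in> \<Lambda>" "p \<noteq> k" "q \<noteq> k" using S.dom[OF assms(2)] by auto
  show "k \<in> D" if a: "p \<in> D" "q \<in> D"
  proof (rule ccontr)
    assume n: "k \<notin> D"
    have pq: "p \<noteq> l" "q \<noteq> l" "\<not> S l r p" "\<not> S l r q" using a D by (auto simp: hs_def)
    show False
    proof (cases "k = l")
      case True
      then show False using assms(2) pq S.tri[of l p q r] S.sym D by blast
    next
      case False
      then have rk: "S l r k" using n d D by (auto simp: hs_def)
      then have "S l p k" "S l q k" using S.tri[OF rk] pq d by blast+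
      then have "\<not> S k p l" "\<not> S k q l" using S.ax by blast+
      then show False using S.tri[OF assms(2), of l] False D S.sym by blast
    qed
  qed
  show "k \<notin> D" if a: "p \<notin> D" "q \<notin> D"
  proof
    assume "k \<in> D"
    then have k: "k \<noteq> l" "\<not> S l r k" using D by (auto simp: hs_def)
    have "p = l \<or> \<not> S k p l" if "p \<notin> D" "p \<in> \<Lambda>" for p
    proof (cases "p = l")
      case False
      then have rp: "S l r p" using that D by (auto simp: hs_def)
      have "S l k p" using S.tri[OF rp, of k] k d by blast
      then show ?thesis using S.ax S.sym by blast
    qed simp
    then have "p = l \<or> \<not> S k p l" "q = l \<or> \<not> S k q l" using a d by auto
    moreover have "S k p l \<or> S k l q" using S.tri[OF assms(2) D(2)] k by blast
    ultimately show False using S.sym S.irrefl by metis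
  qed
qed

lemma HS_act: assumes "D \<in> HS" "g \<in> carrier G" shows "act g ` D \<in> HS" "D \<subseteq> \<Lambda>"
proof -
  obtain l p where D: "D = hs l p" "l \<in> \<Lambda>" "p \<in> \<Lambda>" "p \<noteq> l" using assms(1) by (auto simp: HS_def)
  show "D \<subseteq> \<Lambda>" using D by (auto simp: hs_def)
  have "act g ` hs l p = hs (act g l) (act g p)"
  proof (intro equalityI subsetI)
    fix r assume "r \<in> act g ` hs l p"
    then show "r \<in> hs (act g l) (act g p)"
      using S_act[OF assms(2) D(2,3)] act_inj[OF assms(2) _ D(2)] act_closed[OF assms(2)] by (auto simp: hs_def)
  next
    fix r assume r: "r \<in> hs (act g l) (act g p)"
    let ?r = "act (inv g) r"
    have rr: "r \<in> \<Lambda>" "r \<noteq> act g l" "\<not> S (act g l) (act g p) r" using r by (auto simp: hs_def)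
    have r': "?r \<in> \<Lambda>" "act g ?r = r" using act_closed act_inv(2) assms(2) rr by auto
    then have "?r \<in> hs l p" using rr S_act[OF assms(2) D(2,3) r'(1)] by (auto simp: hs_def)
    then show "r \<in> act g ` hs l p" using r'(2) by force
  qed
  moreover have "act g p \<noteq> act g l" using act_inj[OF assms(2) D(3,2)] D by simp
  ultimately show "act g ` D \<in> HS" unfolding HS_def using D act_closed[OF assms(2)] by blast
qed

text \<open>A half-space that contains \<open>a\<close> but not \<open>b\<close> is the direction of
  \<open>a\<close> at \<open>b\<close> or at one of the finitely many vertices separating
  \<open>a\<close> from \<open>b\<close>.\<close>

lemma finite_split: assumes "a \<in> \<Lambda>" "b \<in> \<Lambda>" shows "finite {D \<in> HS. a \<in> D \<and> b \<notin> D}"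
proof -
  have "finite {l. S l a b}"
  proof (rule finite_subset)
    show "{l. S l a b} \<subseteq> {l. S l (ptK H0 0) a} \<union> {l. S l (ptK H0 0) b}"
    proof
      fix l assume "l \<in> {l. S l a b}"
      then have l: "S l a b" by simp
      have "ptK H0 0 \<noteq> l" using l S_leaf0 by metis
      then show "l \<in> {l. S l (ptK H0 0) a} \<union> {l. S l (ptK H0 0) b}"
        using S.tri[OF l ptK_in[OF H0, of 0]] S.sym by blast
    qed
    show "finite ({l. S l (ptK H0 0) a} \<union> {l. S l (ptK H0 0) b})"
      using adapted_finite_sep[OF H0 s0 ad0] assms by simp
  qed
  then have "finite ((\<lambda>l. hs l a) ` ({b} \<union> {l. S l a b}))" by simp
  moreover have "{D \<in> HS. a \<in> D \<and> b \<notin> D} \<subseteq> (\<lambda>l. hs l a) ` ({b} \<union> {l. S l a b})"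
  proof
    fix D assume "D \<in> {D \<in> HS. a \<in> D \<and> b \<notin> D}"
    then obtain l p where D: "D = hs l p" "l \<in> \<Lambda>" "p \<in> \<Lambda>" "p \<noteq> l" and ab: "a \<in> D" "b \<notin> D" by (auto simp: HS_def)
    have pa: "a \<noteq> l" "\<not> S l p a" using D ab by (auto simp: hs_def)
    have "hs l p = hs l a" using pa S.tri[of l _ _ p] S.tri[of l _ _ a] S.sym D(3,4) assms(1) by (auto simp: hs_def; blast)
    moreover have "l = b \<or> S l a b" using ab calculation D assms by (auto simp: hs_def)
    ultimately show "D \<in> (\<lambda>l. hs l a) ` ({b} \<union> {l. S l a b})" using D by blast
  qed
  ultimately show ?thesis using finite_subset by blast
qed

text \<open>The volume of \<open>(K, s)\<close> is the number of edges of the tree \<open>S\<close> in the hulls of the unlabelled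
  vertices; an edge is a half-space, and it lies in the hull of a set which it splits.\<close>

definition vset :: "(nat \<Rightarrow> 'a set) \<Rightarrow> (nat \<Rightarrow> nat \<Rightarrow> nat \<Rightarrow> bool) \<Rightarrow> (nat set \<times> ('a + 'a set) set) set" where
  "vset K s = {(u, D). u \<in> sep_hyps {0..n} s \<and> D \<in> HS \<and> (\<exists>a\<in>u. \<exists>b\<in>u. ptK K a \<in> D \<and> ptK K b \<notin> D)}"

definition vol :: "(nat \<Rightarrow> 'a set) \<Rightarrow> (nat \<Rightarrow> nat \<Rightarrow> nat \<Rightarrow> bool) \<Rightarrow> nat" where
  "vol K s = card (vset K s)"

text \<open>The edge \<open>D\<close> of \<open>S\<close> is counted at two unlabelled vertices of
  \<open>t\<close> which are merged in \<open>s\<close>, where it is counted once.\<close>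

definition double :: "(nat \<Rightarrow> 'a set) \<Rightarrow> (nat \<Rightarrow> nat \<Rightarrow> nat \<Rightarrow> bool) \<Rightarrow> (nat \<Rightarrow> nat \<Rightarrow> nat \<Rightarrow> bool) \<Rightarrow> bool" where
  "double K s t \<longleftrightarrow> (\<exists>u1 u2 D v. (u1, D) \<in> vset K t \<and> (u2, D) \<in> vset K t \<and> u1 \<noteq> u2 \<and> v \<in> sep_hyps {0..n} s \<and> u1 \<subseteq> v \<and> u2 \<subseteq> v)"

lemma pointedD: "pointed_sep n s \<Longrightarrow> fin_sep_tree {0..n} s" "pointed_sep n s \<Longrightarrow> \<not> s 0 i j"
  by (auto simp: pointed_sep_def)

lemma finite_vset: assumes "bas K" "pointed_sep n s" shows "finite (vset K s)"
proof -
  interpret T: fin_sep_tree "{0..n}" s by (rule pointedD(1)[OF assms(2)])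
  have "vset K s \<subseteq> T.hyps \<times> (\<Union>a\<in>{0..n}. \<Union>b\<in>{0..n}. {D \<in> HS. ptK K a \<in> D \<and> ptK K b \<notin> D})"
    using T.hypsD(1) by (fastforce simp: vset_def)
  moreover have "finite \<dots>" using T.finite_hyps finite_split ptK_in[OF assms(1)] by (intro finite_SigmaI finite_UN_I) auto
  ultimately show ?thesis using finite_subset by blast
qed

text \<open>Merging unlabelled vertices maps the pairs counted for \<open>t\<close> onto those
  counted for \<open>s\<close>, since an edge which splits a merged vertex splits one of its parts.
  The volume drops exactly if two pairs have the same image.\<close>

lemma vol_compare:
  assumes K: "bas K" and s: "pointed_sep n s" and t: "pointed_sep n t" and le: "\<And>k i j. s k i j \<Longrightarrow> t k i j"
  shows "vol K s \<le> vol K t" "vol K s = vol K t \<longleftrightarrow> \<not> double K s t"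
proof -
  interpret P: sep_tree_pair "{0..n}" s t
    by (rule sep_tree_pair.intro[OF pointedD(1)[OF s] pointedD(1)[OF t]]) (unfold_locales, rule le)
  define up where "up u = (THE v. v \<in> P.A.hyps \<and> u \<subseteq> v)" for u
  have up: "up u \<in> P.A.hyps" "u \<subseteq> up u" if "u \<in> P.B.hyps" for u
    using theI'[OF P.hyps_up[OF that]] by (auto simp: up_def)
  have upeq: "up u = v" if "u \<in> P.B.hyps" "v \<in> P.A.hyps" "u \<subseteq> v" for u v using P.hyps_up[OF that(1)] up[OF that(1)] that by blast
  let ?f = "\<lambda>(u, D). (up u, D)"
  have img: "?f ` vset K t = vset K s"
  proof (intro equalityI subsetI)
    fix z assume "z \<in> ?f ` vset K t"
    then obtain u D where "(u, D) \<in> vset K t" "z = (up u, D)" by auto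
    then show "z \<in> vset K s" using up[of u] by (auto simp: vset_def)
  next
    fix z assume "z \<in> vset K s"
    then obtain v D a b where z: "z = (v, D)" "v \<in> P.A.hyps" "D \<in> HS" "a \<in> v" "b \<in> v" "ptK K a \<in> D" "ptK K b \<notin> D" by (auto simp: vset_def)
    obtain l m where lm: "P.B.adj l m" "(ptK K l \<in> D) \<noteq> (ptK K m \<in> D)" "P.B.hyp l m \<subseteq> v"
      using P.split_down[OF z(2,4,5), of "\<lambda>x. ptK K x \<in> D"] z by blast
    have h: "P.B.hyp l m \<in> P.B.hyps" "l \<in> P.B.hyp l m" "m \<in> P.B.hyp l m" using P.B.hyp_in P.B.hyp_sub lm by auto
    have "(P.B.hyp l m, D) \<in> vset K t"
    proof (cases "ptK K l \<in> D")
      case True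
      then show ?thesis using h lm(2) z(3) unfolding vset_def by blast
    next
      case False
      then show ?thesis using h lm(2) z(3) unfolding vset_def by blast
    qed
    moreover have "z = ?f (P.B.hyp l m, D)" using upeq[OF h(1) z(2) lm(3)] z(1) by simp
    ultimately show "z \<in> ?f ` vset K t" by blast
  qed
  have fin: "finite (vset K t)" by (rule finite_vset[OF K t])
  show "vol K s \<le> vol K t" unfolding vol_def img[symmetric] by (rule card_image_le[OF fin])
  have "double K s t \<longleftrightarrow> \<not> inj_on ?f (vset K t)"
  proof
    assume "double K s t"
    then obtain u1 u2 D v where d: "(u1, D) \<in> vset K t" "(u2, D) \<in> vset K t" "u1 \<noteq> u2" "v \<in> P.A.hyps" "u1 \<subseteq> v" "u2 \<subseteq> v"
      by (auto simp: double_def)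
    have "up u1 = v" "up u2 = v" using upeq d by (auto simp: vset_def)
    then show "\<not> inj_on ?f (vset K t)" using d(1-3) inj_onD[of ?f "vset K t" "(u1, D)" "(u2, D)"] by auto
  next
    assume "\<not> inj_on ?f (vset K t)"
    then obtain u1 u2 D where d: "(u1, D) \<in> vset K t" "(u2, D) \<in> vset K t" "u1 \<noteq> u2" "up u1 = up u2" by (auto simp: inj_on_def)
    then have "u1 \<in> P.B.hyps" "u2 \<in> P.B.hyps" by (auto simp: vset_def)
    then have "up u1 \<in> P.A.hyps" "u1 \<subseteq> up u1" "u2 \<subseteq> up u1" using up d(4) by auto
    then show "double K s t" unfolding double_def using d by blast
  qed
  then show "vol K s = vol K t \<longleftrightarrow> \<not> double K s t"
    unfolding vol_def img[symmetric] using eq_card_imp_inj_on[OF fin] card_image by metis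
qed

text \<open>All triples at one unlabelled vertex share \<open>k\<close> and \<open>i\<close>, and
  these two determine the translation; so a single one works for the whole vertex.\<close>

lemma eqv_hyp:
  assumes "bas K" "pointed_sep n s" "eqv s K K'" "u \<in> sep_hyps {0..n} s" shows "transl K K' u"
proof -
  interpret T: fin_sep_tree "{0..n}" s by (rule pointedD(1)[OF assms(2)])
  interpret K: free_prod G n K by (rule bas_fp[OF assms(1)])
  obtain k i where u: "u = T.hyp k i" "T.adj k i" using assms(4) by (auto simp: sep_hyps_def)
  have ki: "k \<le> n" "i \<le> n" "k \<noteq> i" using T.adjD(1)[OF u(2)] by auto
  have "transl K K' {k, i, i}" using assms(3) u(2) T.irrefl unfolding bas_eqv_def by blast
  then obtain g where g: "g \<in> carrier G" "ptK K' k = act g (ptK K k)" "ptK K' i = act g (ptK K i)" by (auto simp: bas_transl_def)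
  have "ptK K' j = act g (ptK K j)" if j: "j \<in> u" for j
  proof (cases "j = k")
    case False
    then have "T.adj k j" "\<not> s k i j" using j u by (auto simp: sep_hyp_def)
    then have "transl K K' {k, i, j}" using assms(3) u(2) unfolding bas_eqv_def by blast
    then obtain h where h: "h \<in> carrier G" "ptK K' k = act h (ptK K k)" "ptK K' i = act h (ptK K i)" "ptK K' j = act h (ptK K j)"
      by (auto simp: bas_transl_def)
    have "h = g" using K.transl_unique[OF h(1) g(1) ki] h g by simp
    then show ?thesis using h by simp
  qed (use g in simp)
  then show ?thesis unfolding bas_transl_def using g(1) by blast
qed

text \<open>At each unlabelled vertex the half-spaces are moved by the translation belonging to that
  vertex, so the counts agree vertex by vertex.\<close>

lemma vol_eqv:
  assumes "bas K" "bas K'" "pointed_sep n s" "eqv s K K'" shows "vol K s = vol K' s"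
proof -
  have le: "vol K s \<le> vol K' s" if K: "bas K" "bas K'" "eqv s K K'" for K K'
  proof -
    interpret T: fin_sep_tree "{0..n}" s by (rule pointedD(1)[OF assms(3)])
    have "\<forall>u\<in>T.hyps. \<exists>g. g \<in> carrier G \<and> (\<forall>j\<in>u. ptK K' j = act g (ptK K j))"
      using eqv_hyp[OF K(1) assms(3) K(3)] by (auto simp: bas_transl_def)
    then obtain g where g: "\<And>u. u \<in> T.hyps \<Longrightarrow> g u \<in> carrier G" "\<And>u j. u \<in> T.hyps \<Longrightarrow> j \<in> u \<Longrightarrow> ptK K' j = act (g u) (ptK K j)"
      by metis
    let ?f = "\<lambda>(u, D). (u, act (g u) ` D)"
    have mem: "act h p \<in> act h ` D \<longleftrightarrow> p \<in> D" if "D \<in> HS" "h \<in> carrier G" "p \<in> \<Lambda>" for h p D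
      using act_inj[OF that(2,3)] HS_act(2)[OF that(1,2)] by auto
    have "?f ` vset K s \<subseteq> vset K' s"
    proof
      fix z assume "z \<in> ?f ` vset K s"
      then obtain u D a b where z: "z = (u, act (g u) ` D)" "u \<in> T.hyps" "D \<in> HS" "a \<in> u" "b \<in> u" "ptK K a \<in> D" "ptK K b \<notin> D"
        by (auto simp: vset_def)
      have ab: "a \<le> n" "b \<le> n" using T.hypsD(1)[OF z(2)] z by auto
      have "act (g u) ` D \<in> HS" using HS_act(1)[OF z(3) g(1)[OF z(2)]] .
      moreover have "ptK K' a \<in> act (g u) ` D" "ptK K' b \<notin> act (g u) ` D"
        using mem[OF z(3) g(1)[OF z(2)] ptK_in[OF K(1) ab(1)]] mem[OF z(3) g(1)[OF z(2)] ptK_in[OF K(1) ab(2)]] g(2)[OF z(2)] z by auto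
      ultimately show "z \<in> vset K' s" unfolding vset_def z(1) using z(2,4,5) by blast
    qed
    moreover have "inj_on ?f (vset K s)"
    proof (rule inj_onI)
      fix y z assume "y \<in> vset K s" "z \<in> vset K s" "?f y = ?f z"
      moreover obtain u D u' D' where yz: "y = (u, D)" "z = (u', D')" by (metis surj_pair)
      ultimately have u: "u = u'" "u \<in> T.hyps" "D \<in> HS" "D' \<in> HS" "act (g u) ` D = act (g u) ` D'" by (auto simp: vset_def)
      have "inj_on (act (g u)) \<Lambda>" using act_inj[OF g(1)[OF u(2)]] by (auto simp: inj_on_def)
      then have "D = D'" using inj_on_image_eq_iff[of "act (g u)" \<Lambda> D D'] HS_act(2)[OF u(3) g(1)[OF u(2)]] HS_act(2)[OF u(4) g(1)[OF u(2)]] u(5) by blast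
      then show "y = z" using yz u by simp
    qed
    ultimately show ?thesis unfolding vol_def using card_inj_on_le[OF _ _ finite_vset[OF K(2) assms(3)]] by blast
  qed
  show ?thesis using le[OF assms(1,2,4)] le[OF assms(2,1) eqv_sym[OF assms(1,2,4)]] by simp
qed

section \<open>Refining along \<open>S\<close> and its effect on the volume\<close>

text \<open>The directions at \<open>k\<close> are those of \<open>t\<close>; separations of
  \<open>s\<close> are kept, and those directions which \<open>S\<close> separates are separated in
  addition. With \<open>t = s\<close> this splits \<open>s\<close> along \<open>S\<close>. For
  \<open>s\<close> below \<open>t\<close> it undoes the identifications of \<open>s\<close> that are
  not foldings. If \<open>s\<close> separates nothing, all foldings of \<open>t\<close> are
  performed.\<close>

definition rf :: "(nat \<Rightarrow> 'a set) \<Rightarrow> (nat \<Rightarrow> nat \<Rightarrow> nat \<Rightarrow> bool) \<Rightarrow> (nat \<Rightarrow> nat \<Rightarrow> nat \<Rightarrow> bool) \<Rightarrow> nat \<Rightarrow> nat \<Rightarrow> nat \<Rightarrow> bool" where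
  "rf K t s = sep_refine {0..n} t (SK K) s"

lemma SK_tri:
  assumes "bas K" "SK K k i l" "j \<le> n" "j \<noteq> k" "k \<le> n" shows "SK K k i j \<or> SK K k j l"
proof -
  interpret K: free_prod G n K by (rule bas_fp[OF assms(1)])
  show ?thesis using S.tri[OF assms(2) ptK_in[OF assms(1,3)]] K.vpt_inj assms by blast
qed

lemma rf_self_pointed:
  assumes "bas K" "pointed_sep n s" shows "pointed_sep n (rf K s s)"
proof -
  interpret T: fin_sep_tree "{0..n}" s by (rule pointedD(1)[OF assms(2)])
  have "fin_sep_tree {0..n} (rf K s s)"
    unfolding rf_def
  proof (rule T.sep_tree_refine)
    show "\<not> SK K k i i" for k i using S.irrefl .
    show "SK K k i j \<Longrightarrow> SK K k j i" for k i j using S.sym .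
    show "SK K k i j \<or> SK K k j l" if "T.adj k i" "T.adj k j" "T.adj k l" "SK K k i l" for k i j l
      using SK_tri[OF assms(1) that(4), of j] T.adjD(1)[OF that(2)] by auto
    show "\<not> SK K l i k" if "SK K k i l" for k i l using S.ax[OF that] .
  qed
  then show ?thesis using assms(2) S_leaf0 by (auto simp: pointed_sep_def rf_def sep_refine_def)
qed

lemma rf_ge: "pointed_sep n s \<Longrightarrow> s k i j \<Longrightarrow> rf K t s k i j"
  using sep_tree.dom[OF fin_sep_tree.axioms(1)[OF pointedD(1)], of s k i j] by (auto simp: rf_def sep_refine_def)

text \<open>The local form of \<open>rf K t t = t\<close>: nothing is left to be split along
  \<open>S\<close>.\<close>

definition rfix :: "(nat \<Rightarrow> 'a set) \<Rightarrow> (nat \<Rightarrow> nat \<Rightarrow> nat \<Rightarrow> bool) \<Rightarrow> bool" where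
  "rfix K t \<longleftrightarrow> (\<forall>k i j. sep_adj {0..n} t k i \<and> sep_adj {0..n} t k j \<and> \<not> t k i j \<longrightarrow> \<not> SK K k i j)"

lemma rfixI: assumes "pointed_sep n t" "rf K t t = t" shows "rfix K t"
  unfolding rfix_def
proof (intro allI impI)
  interpret T: fin_sep_tree "{0..n}" t by (rule pointedD(1)[OF assms(1)])
  fix k i j assume a: "T.adj k i \<and> T.adj k j \<and> \<not> t k i j"
  have m: "k \<in> {0..n}" "i \<in> {0..n}" "j \<in> {0..n}" "i \<noteq> k" "j \<noteq> k" using T.adjD(1)[of k i] T.adjD(1)[of k j] a by auto
  have "\<not> rf K t t k i j" using assms(2) a by simp
  then show "\<not> SK K k i j" using m T.nb_adj[of k i] T.nb_adj[of k j] a by (simp add: rf_def sep_refine_def)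
qed

lemma rf_between:
  assumes K: "bas K" and s: "pointed_sep n s" and t: "pointed_sep n t" and le: "\<And>k i j. s k i j \<Longrightarrow> t k i j" and r: "rfix K t"
  shows "pointed_sep n (rf K t s)" "rf K t s k i j \<Longrightarrow> t k i j"
proof -
  interpret T: fin_sep_tree "{0..n}" t by (rule pointedD(1)[OF t])
  interpret s: fin_sep_tree "{0..n}" s by (rule pointedD(1)[OF s])
  show *: "t k i j" if a: "rf K t s k i j" for k i j
  proof -
    have m: "k \<in> {0..n}" "i \<in> {0..n}" "j \<in> {0..n}" "i \<noteq> k" "j \<noteq> k" "s k i j \<or> SK K k (T.nb k i) (T.nb k j)"
      using a by (auto simp: rf_def sep_refine_def)
    note ni = T.nb[of k i] and nj = T.nb[of k j]
    show ?thesis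
    proof (rule ccontr)
      assume n: "\<not> t k i j"
      then have "SK K k (T.nb k i) (T.nb k j)" using m(6) le by blast
      moreover have "\<not> t k (T.nb k i) (T.nb k j)"
        using n T.sep_cong[of k i "T.nb k i" j "T.nb k j"] ni nj m by auto
      ultimately show False using r ni(1) nj(1) m unfolding rfix_def by blast
    qed
  qed
  have "fin_sep_tree {0..n} (rf K t s)"
  proof (rule sep_tree_coarsen[OF pointedD(1)[OF t] *])
    show "rf K t s k i j \<Longrightarrow> rf K t s k j i" for k i j using s.sym S.sym by (auto simp: rf_def sep_refine_def)
    show "rf K t s k i j \<or> rf K t s k j l" if "rf K t s k i l" "j \<in> {0..n}" "j \<noteq> k" for k i j l
    proof -
      have m: "k \<in> {0..n}" "i \<in> {0..n}" "l \<in> {0..n}" "i \<noteq> k" "l \<noteq> k" "s k i l \<or> SK K k (T.nb k i) (T.nb k l)"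
        using that(1) by (auto simp: rf_def sep_refine_def)
      have "T.nb k j \<le> n" "T.nb k j \<noteq> k" using T.nb[of k j] that m by auto
      then show ?thesis using m that s.tri[of k i l j] SK_tri[OF K, of k "T.nb k i" "T.nb k l" "T.nb k j"]
        by (auto simp: rf_def sep_refine_def)
    qed
  qed
  moreover have "\<not> rf K t s 0 i j" for i j using * pointedD(2)[OF t] by blast
  ultimately show "pointed_sep n (rf K t s)" using t by (simp add: pointed_sep_def)
qed

lemma SK_transl:
  assumes "bas K" "transl K K' T" "T \<subseteq> {0..n}" "k \<in> T" "i \<in> T" "j \<in> T" shows "SK K' k i j \<longleftrightarrow> SK K k i j"
proof -
  obtain g where g: "g \<in> carrier G" "\<And>l. l \<in> T \<Longrightarrow> ptK K' l = act g (ptK K l)" using assms(2) by (auto simp: bas_transl_def)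
  have "k \<le> n" "i \<le> n" "j \<le> n" using assms by auto
  then show ?thesis using S_act[OF g(1)] ptK_in[OF assms(1)] g(2) assms(4-6) by simp
qed

lemma SK_eqv:
  assumes "bas K" "eqv s K K'" "sep_adj {0..n} s k i" "sep_adj {0..n} s k j" "\<not> s k i j" shows "SK K' k i j \<longleftrightarrow> SK K k i j"
proof -
  have "transl K K' {k, i, j}" using assms unfolding bas_eqv_def by blast
  then show ?thesis using SK_transl[OF assms(1)] adj_triple[OF assms(3,4)] by blast
qed

text \<open>\<open>S\<close> matters only at labels which \<open>s\<close> does not separate, and
  around these the two bases are translates of each other. So the refinement depends on the vertex
  type alone.\<close>

lemma rf_eqv:
  assumes K: "bas K" and s: "pointed_sep n s" and t: "pointed_sep n t" and le: "\<And>k i j. s k i j \<Longrightarrow> t k i j" and e: "eqv s K K'"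
  shows "rf K t s = rf K' t s"
proof -
  interpret P: sep_tree_pair "{0..n}" s t
    by (rule sep_tree_pair.intro[OF pointedD(1)[OF s] pointedD(1)[OF t]]) (unfold_locales, rule le)
  have "rf K t s k i j \<longleftrightarrow> rf K' t s k i j" for k i j
  proof (cases "k \<in> {0..n} \<and> i \<in> {0..n} \<and> j \<in> {0..n} \<and> i \<noteq> k \<and> j \<noteq> k \<and> \<not> s k i j")
    case True
    then have m: "k \<in> {0..n}" "i \<in> {0..n}" "j \<in> {0..n}" "k \<noteq> i" "k \<noteq> j" by auto
    note ni = P.B.nb[OF m(1,2,4)] and nj = P.B.nb[OF m(1,3,5)]
    have "\<not> s k (P.B.nb k i) (P.B.nb k j)"
      using P.A.sep_cong[of k i "P.B.nb k i" j "P.B.nb k j"] ni nj m P.le True by blast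
    then have "SK K' k (P.B.nb k i) (P.B.nb k j) \<longleftrightarrow> SK K k (P.B.nb k i) (P.B.nb k j)"
      using SK_eqv[OF K e] P.adj_le ni(1) nj(1) by blast
    then show ?thesis by (simp add: rf_def sep_refine_def)
  qed (auto simp: rf_def sep_refine_def)
  then show ?thesis by (simp add: fun_eq_iff)
qed

text \<open>Two unlabelled vertices of \<open>t\<close> are joined through a gate \<open>k\<close>.
  If \<open>S\<close> separates at \<open>k\<close> as well, then for a half-space splitting both,
  either it or its complement would meet both sides of \<open>k\<close> without containing
  \<open>k\<close>, against convexity.\<close>

lemma no_double:
  assumes K: "bas K" and s: "pointed_sep n s" and t: "pointed_sep n t"
    and sep: "\<And>v k x y. v \<in> sep_hyps {0..n} s \<Longrightarrow> k \<in> v \<Longrightarrow> x \<in> v \<Longrightarrow> y \<in> v \<Longrightarrow> t k x y \<Longrightarrow> SK K k x y"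
  shows "\<not> double K s t"
proof
  interpret T: fin_sep_tree "{0..n}" t by (rule pointedD(1)[OF t])
  assume "double K s t"
  then obtain u1 u2 D v where d: "(u1, D) \<in> vset K t" "(u2, D) \<in> vset K t" "u1 \<noteq> u2" "v \<in> sep_hyps {0..n} s" "u1 \<subseteq> v" "u2 \<subseteq> v"
    by (auto simp: double_def)
  have h: "u1 \<in> T.hyps" "u2 \<in> T.hyps" "D \<in> HS" using d by (auto simp: vset_def)
  obtain k where k: "k \<in> u1" "\<And>x y. x \<in> u1 \<Longrightarrow> x \<noteq> k \<Longrightarrow> y \<in> u2 \<Longrightarrow> y \<noteq> k \<Longrightarrow> t k x y"
    using T.hyps_gate[OF h(1,2) d(3)] by blast
  obtain a a' where a: "a \<in> u1" "a' \<in> u1" "ptK K a \<in> D" "ptK K a' \<notin> D" using d(1) by (auto simp: vset_def)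
  obtain b b' where b: "b \<in> u2" "b' \<in> u2" "ptK K b \<in> D" "ptK K b' \<notin> D" using d(2) by (auto simp: vset_def)
  have kv: "k \<in> v" using k d by auto
  show False
  proof (cases "ptK K k \<in> D")
    case True
    then have "a' \<noteq> k" "b' \<noteq> k" using a b by auto
    then have "SK K k a' b'" using sep[OF d(4) kv, of a' b'] k(2) a b d by blast
    then show False using HS_convex(2)[OF h(3)] a b True by blast
  next
    case False
    then have "a \<noteq> k" "b \<noteq> k" using a b by auto
    then have "SK K k a b" using sep[OF d(4) kv, of a b] k(2) a b d by blast
    then show False using HS_convex(1)[OF h(3)] a b False by blast
  qed
qed

lemma vol_rf_self:
  assumes K: "bas K" and s: "pointed_sep n s" shows "vol K s = vol K (rf K s s)"
proof -
  interpret T: fin_sep_tree "{0..n}" s by (rule pointedD(1)[OF s])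
  note p = rf_self_pointed[OF K s]
  have "\<not> double K s (rf K s s)"
  proof (rule no_double[OF K s p])
    fix v k x y assume a: "v \<in> T.hyps" "k \<in> v" "x \<in> v" "y \<in> v" "rf K s s k x y"
    then have ne: "x \<noteq> k" "y \<noteq> k" by (auto simp: rf_def sep_refine_def)
    have ad: "T.adj k x" "T.adj k y" "v = T.hyp k x" using T.hypsD(2)[OF a(1,2)] a(3,4) ne by auto
    then have "\<not> s k x y" using a(4) ne by (auto simp: sep_hyp_def)
    then show "SK K k x y" using a(5) T.nb_adj[OF ad(1)] T.nb_adj[OF ad(2)] by (simp add: rf_def sep_refine_def)
  qed
  then show ?thesis using vol_compare(2)[OF K s p] rf_ge[OF s] by blast
qed

text \<open>The edge counted twice is the common \<open>S\<close>-direction of \<open>i\<close> and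
  \<open>j\<close> at \<open>k\<close>, the one over which the two edges of \<open>t\<close> are
  folded.\<close>

lemma doubleI:
  assumes K: "bas K" and s: "pointed_sep n s" and t: "pointed_sep n t" and le: "\<And>k i j. s k i j \<Longrightarrow> t k i j"
    and a: "sep_adj {0..n} t k i" "sep_adj {0..n} t k j" "t k i j" "\<not> s k i j" "\<not> SK K k i j"
  shows "double K s t"
proof -
  interpret P: sep_tree_pair "{0..n}" s t
    by (rule sep_tree_pair.intro[OF pointedD(1)[OF s] pointedD(1)[OF t]]) (unfold_locales, rule le)
  interpret K: free_prod G n K by (rule bas_fp[OF K])
  have m: "k \<le> n" "i \<le> n" "j \<le> n" "i \<noteq> k" "j \<noteq> k" using P.B.adjD(1)[OF a(1)] P.B.adjD(1)[OF a(2)] by auto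
  let ?D = "hs (ptK K k) (ptK K i)"
  have D: "?D \<in> HS" using ptK_in[OF K] K.vpt_inj m unfolding HS_def by blast
  have in_D: "ptK K i \<in> ?D" "ptK K j \<in> ?D" "ptK K k \<notin> ?D" using ptK_in[OF K] K.vpt_inj m S.irrefl a(5) by (auto simp: hs_def)
  have "(P.B.hyp k i, ?D) \<in> vset K t" "(P.B.hyp k j, ?D) \<in> vset K t"
    using P.B.hyp_in[OF a(1)] P.B.hyp_in[OF a(2)] P.B.hyp_sub(2,3) a(1,2) D in_D unfolding vset_def by blast+
  moreover have "P.B.hyp k i \<noteq> P.B.hyp k j"
  proof
    assume "P.B.hyp k i = P.B.hyp k j"
    then have "j \<in> P.B.hyp k i" using P.B.hyp_sub(3)[OF a(2)] by simp
    then show False using a(3) m by (simp add: sep_hyp_def)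
  qed
  moreover have "P.B.hyp k i \<subseteq> P.A.hyp k i" "P.B.hyp k j \<subseteq> P.A.hyp k i"
  proof -
    show "P.B.hyp k i \<subseteq> P.A.hyp k i" using P.hyp_le[OF a(1)] .
    have "j \<in> P.A.hyp k i" using P.adj_le[OF a(2)] a(4) by (simp add: sep_hyp_def)
    then have "P.A.hyp k j = P.A.hyp k i" using P.A.hypsD(2)[OF P.A.hyp_in[OF P.adj_le[OF a(1)]] P.A.hyp_sub(2), of j] m by auto
    then show "P.B.hyp k j \<subseteq> P.A.hyp k i" using P.hyp_le[OF a(2)] by simp
  qed
  ultimately show ?thesis unfolding double_def using P.A.hyp_in[OF P.adj_le[OF a(1)]] by blast
qed

text \<open>Equal volume means that no edge is counted twice. If the first labels from
  \<open>k\<close> towards \<open>i\<close> in \<open>s\<close> and in \<open>t\<close> had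
  different \<open>S\<close>-directions, then a path of \<open>t\<close> inside one unlabelled
  vertex of \<open>s\<close> would cross the same edge of \<open>S\<close> first outwards and later
  back again.\<close>

lemma rf_eq:
  assumes K: "bas K" and s: "pointed_sep n s" and t: "pointed_sep n t" and le: "\<And>k i j. s k i j \<Longrightarrow> t k i j"
    and v: "vol K s = vol K t"
  shows "rf K s s = rf K t t"
proof -
  interpret P: sep_tree_pair "{0..n}" s t
    by (rule sep_tree_pair.intro[OF pointedD(1)[OF s] pointedD(1)[OF t]]) (unfold_locales, rule le)
  interpret K: free_prod G n K by (rule bas_fp[OF K])
  have nd: "\<not> double K s t" using vol_compare(2)[OF K s t le] v by simp
  have same: "\<not> SK K k (P.A.nb k i) (P.B.nb k i)" if ki: "k \<in> {0..n}" "i \<in> {0..n}" "k \<noteq> i" for k i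
  proof
    let ?i = "P.A.nb k i" and ?j = "P.B.nb k i"
    assume S: "SK K k ?i ?j"
    note ni = P.A.nb[OF ki] and nj = P.B.nb[OF ki]
    have ne: "?i \<noteq> ?j" using S S.irrefl by metis
    have m: "k \<le> n" "?i \<le> n" "?j \<le> n" using ki ni nj by auto
    have "P.B.nb k ?i = ?j" using ni(2) P.B.nb_sep[of ?i k i] P.le by auto
    then have tj: "t ?j k ?i" using P.B.nb(2)[of k ?i] ni ki ne by metis
    let ?v = "P.A.hyp k ?i"
    have vh: "?v \<in> P.A.hyps" "k \<in> ?v" using P.A.hyp_in[OF ni(1)] P.A.hyp_sub(2) by auto
    have bet: "l \<in> ?v" if "t l k ?i" for l using P.between_in_hyp[OF ni(1) that] .
    let ?D = "hs (ptK K k) (ptK K ?j)"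
    have D: "?D \<in> HS" using ptK_in[OF K] K.vpt_inj m nj(5) unfolding HS_def by blast
    have in_D: "ptK K ?j \<in> ?D" "ptK K ?i \<notin> ?D" "ptK K k \<notin> ?D"
      using ptK_in[OF K] K.vpt_inj m nj(5) S.irrefl S S.sym by (auto simp: hs_def)
    \<comment> \<open>The path in \<open>t\<close> has entered \<open>?D\<close> at
      \<open>?j\<close> and must leave it again on the way to \<open>?i\<close>.\<close>
    obtain l l' where l: "P.B.adj l l'" "(ptK K l \<in> ?D) \<noteq> (ptK K l' \<in> ?D)" "l = ?j \<or> l = ?i \<or> t l ?j ?i" "l' = ?j \<or> l' = ?i \<or> t l' ?j ?i"
      using P.B.colour_change[of ?j ?i "\<lambda>x. ptK K x \<in> ?D"] in_D m by auto
    \<comment> \<open>The second crossing lies beyond \<open>?j\<close> as seen from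
      \<open>k\<close>, hence at another unlabelled vertex than the first one.\<close>
    have beyond: "x = ?j \<or> t ?j k x" if x: "x = ?j \<or> x = ?i \<or> t x ?j ?i" for x
      using x tj P.B.between_order[of x ?i ?j k] P.B.sym by blast
    have inv: "x \<in> ?v" if x: "x = ?j \<or> x = ?i \<or> t x ?j ?i" for x
      using x tj bet P.B.between_trans[of x ?i ?j k] P.B.sym P.A.hyp_sub(3)[OF ni(1)] by blast
    have h1: "P.B.hyp k ?j \<in> P.B.hyps" "k \<in> P.B.hyp k ?j" "?j \<in> P.B.hyp k ?j" using P.B.hyp_in[OF nj(1)] P.B.hyp_sub nj(1) by auto
    have h2: "P.B.hyp l l' \<in> P.B.hyps" "l \<in> P.B.hyp l l'" "l' \<in> P.B.hyp l l'" using P.B.hyp_in[OF l(1)] P.B.hyp_sub l(1) by auto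
    have "(P.B.hyp k ?j, ?D) \<in> vset K t" using h1 D in_D unfolding vset_def by blast
    moreover have "(P.B.hyp l l', ?D) \<in> vset K t"
      by (cases "ptK K l \<in> ?D") (use h2 D l(2) in \<open>unfold vset_def, blast+\<close>)
    moreover have "P.B.hyp k ?j \<noteq> P.B.hyp l l'"
    proof
      assume eq: "P.B.hyp k ?j = P.B.hyp l l'"
      obtain x where x: "x \<in> {l, l'}" "x \<noteq> ?j" using P.B.adjD(1)[OF l(1)] by auto
      then have tx: "t ?j k x" using beyond l(3,4) by blast
      have "x \<in> P.B.hyp k ?j" using x h2 eq by auto
      moreover have "x \<noteq> k" using tx P.B.irrefl by metis
      ultimately have "P.B.adj k x" by (simp add: sep_hyp_def)
      then show False using tx P.B.adjD(2) by blast
    qed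
    moreover have "P.B.hyp k ?j \<subseteq> ?v" "P.B.hyp l l' \<subseteq> ?v"
    proof -
      have "?v = P.A.hyp k ?j" using P.A.hypsD(2)[OF vh bet[OF tj]] nj(5)[symmetric] by blast
      then show "P.B.hyp k ?j \<subseteq> ?v" using P.hyp_le[OF nj(1)] by simp
      have "?v = P.A.hyp l l'" using P.A.hypsD(2)[OF vh(1) inv[OF l(3)] inv[OF l(4)]] P.B.adjD(1)[OF l(1)] by blast
      then show "P.B.hyp l l' \<subseteq> ?v" using P.hyp_le[OF l(1)] by simp
    qed
    ultimately have "double K s t" unfolding double_def using vh(1) by blast
    then show False using nd by simp
  qed
  have "rf K s s k i j \<longleftrightarrow> rf K t t k i j" for k i j
  proof (cases "k \<in> {0..n} \<and> i \<in> {0..n} \<and> j \<in> {0..n} \<and> i \<noteq> k \<and> j \<noteq> k")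
    case True
    then have m: "k \<in> {0..n}" "i \<in> {0..n}" "j \<in> {0..n}" "k \<noteq> i" "k \<noteq> j" by auto
    let ?i = "P.A.nb k i" and ?j = "P.A.nb k j" and ?i' = "P.B.nb k i" and ?j' = "P.B.nb k j"
    note ni = P.A.nb[OF m(1,2,4)] and nj = P.A.nb[OF m(1,3,5)] and ni' = P.B.nb[OF m(1,2,4)] and nj' = P.B.nb[OF m(1,3,5)]
    have c: "SK K k ?i ?j \<longleftrightarrow> SK K k ?i' ?j'"
      by (rule S.sep_cong[OF same[OF m(1,2,4)] same[OF m(1,3,5)]])
         (use ptK_in[OF K] K.vpt_inj ni(4,5) nj(4,5) ni'(4,5) nj'(4,5) m in auto)
    have "SK K k ?i' ?j'" if st: "t k i j" "\<not> s k i j"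
    proof (rule ccontr)
      assume n: "\<not> SK K k ?i' ?j'"
      have "t k ?i' ?j'" using st(1) P.B.sep_cong[of k i ?i' j ?j'] ni' nj' m by auto
      moreover have "\<not> s k ?i' ?j'" using st(2) P.A.sep_cong[of k i ?i' j ?j'] ni' nj' m P.le by blast
      ultimately have "double K s t" using doubleI[OF K s t le ni'(1) nj'(1)] n by blast
      then show False using nd by simp
    qed
    then show ?thesis using c True P.le by (auto simp: rf_def sep_refine_def)
  qed (auto simp: rf_def sep_refine_def)
  then show ?thesis by (simp add: fun_eq_iff)
qed

text \<open>Otherwise \<open>rf K t s\<close> identifies no edge, so every turn of \<open>t\<close>
  that \<open>s\<close> gives up is separated in \<open>S\<close>. Paths of \<open>t\<close> inside
  an unlabelled vertex of \<open>s\<close> then have only such turns and are geodesic in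
  \<open>S\<close>. So \<open>s\<close> would not identify any edge either, against
  \<open>v\<close>.\<close>

lemma vol_rf_less:
  assumes K: "bas K" and s: "pointed_sep n s" and t: "pointed_sep n t" and le: "\<And>k i j. s k i j \<Longrightarrow> t k i j" and r: "rfix K t"
    and v: "vol K s < vol K t"
  shows "vol K (rf K t s) < vol K t"
proof (rule ccontr)
  assume nv: "\<not> ?thesis"
  interpret P: sep_tree_pair "{0..n}" s t
    by (rule sep_tree_pair.intro[OF pointedD(1)[OF s] pointedD(1)[OF t]]) (unfold_locales, rule le)
  interpret K: free_prod G n K by (rule bas_fp[OF K])
  note p = rf_between(1)[OF K s t le r]
  have le': "rf K t s k i j \<Longrightarrow> t k i j" for k i j by (rule rf_between(2)[OF K s t le r])
  have nd: "\<not> double K (rf K t s) t" using vol_compare[OF K p t le'] nv by linarith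
  have leaf: "\<not> t 0 x y" for x y using pointedD(2)[OF t] .
  have legal: "SK K k i j" if a: "P.B.adj k i" "P.B.adj k j" "t k i j" "\<not> s k i j" for k i j
  proof (rule ccontr)
    assume n: "\<not> SK K k i j"
    then have "\<not> rf K t s k i j" using a P.B.nb_adj by (simp add: rf_def sep_refine_def)
    then show False using doubleI[OF K p t le' a(1-3)] n nd by blast
  qed
  have clique: "P.A.adj x y" if "v \<in> P.A.hyps" "x \<in> v" "y \<in> v" "x \<noteq> y" for v x y using P.A.hypsD(2)[OF that] by blast
  have nbv: "P.B.nb k x \<in> v" if "v \<in> P.A.hyps" "k \<in> v" "x \<in> v" "k \<noteq> x" for v k x
  proof -
    have h: "P.A.adj k x" "v = P.A.hyp k x" using P.A.hypsD(2)[OF that] by auto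
    have "P.B.nb k x = x \<or> t (P.B.nb k x) k x" using P.B.nb(2)[of k x] P.A.adjD(1)[OF h(1)] by auto
    then show ?thesis using P.between_in_hyp[OF h(1)] h(2) that by auto
  qed
  \<comment> \<open>From local to global again: if every turn of the path is separated in
    \<open>S\<close>, the endpoint lies in the \<open>S\<close>-direction of the first step.\<close>
  have chain: "\<not> SK K k x (P.B.nb k x)" if "v \<in> P.A.hyps" "k \<in> v" "x \<in> v" "k \<noteq> x" for v k x
    using that
  proof (induction "card {l. t l k x}" arbitrary: k rule: less_induct)
    case less
    let ?c = "P.B.nb k x"
    have N: "k \<in> {0..n}" "x \<in> {0..n}" using P.A.hypsD(1)[OF less.prems(1)] less.prems by auto
    note c = P.B.nb[OF N less.prems(4)]
    show ?case
    proof (cases "?c = x")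
      case True
      then show ?thesis using S.irrefl by simp
    next
      case False
      then have tc: "t ?c k x" using c(2) by simp
      have cv: "?c \<in> v" by (rule nbv[OF less.prems])
      have sub: "t l k x" if "t l ?c x" for l using P.B.between_trans[of l x ?c k] that tc P.B.sym by blast
      then have "{l. t l ?c x} \<subset> {l. t l k x}" using tc P.B.dom by blast
      then have "card {l. t l ?c x} < card {l. t l k x}" using P.B.finite_sep by (rule psubset_card_mono[rotated])
      then have IH: "\<not> SK K ?c x (P.B.nb ?c x)" using less.hyps[of ?c] less.prems cv False by simp
      let ?d = "P.B.nb ?c x"
      note d = P.B.nb[OF c(4) N(2) False]
      have dv: "?d \<in> v" by (rule nbv[OF less.prems(1) cv less.prems(3) False])
      have tcd: "t ?c k ?d" using P.B.tri[OF tc, of ?d] d P.B.sym by blast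
      have "k \<noteq> ?d" using tcd P.B.irrefl by metis
      then have "\<not> s ?c k ?d" using clique[OF less.prems(1,2) dv] P.A.adjD(2) by blast
      then have "SK K ?c k ?d" using legal[OF P.B.adj_sym[OF c(1)] d(1) tcd] by simp
      then have "SK K ?c k x" using SK_tri[OF K, of ?c k ?d x] IH N c False by auto
      then show ?thesis using S.ax S.sym by blast
    qed
  qed
  have "\<not> double K s t"
  proof (rule no_double[OF K s t])
    fix v k x y assume a: "v \<in> P.A.hyps" "k \<in> v" "x \<in> v" "y \<in> v" "t k x y"
    have ne: "k \<noteq> x" "k \<noteq> y" "k \<in> {0..n}" "x \<in> {0..n}" "y \<in> {0..n}" using P.B.dom[OF a(5)] by auto
    let ?x = "P.B.nb k x" and ?y = "P.B.nb k y"
    note nx = P.B.nb[OF ne(3,4,1)] and ny = P.B.nb[OF ne(3,5,2)]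
    have "t k ?x ?y" using a(5) P.B.sep_cong[of k x ?x y ?y] nx ny ne by auto
    moreover have "?x \<noteq> ?y" using calculation P.B.irrefl by metis
    then have "\<not> s k ?x ?y" using clique[OF a(1) nbv[OF a(1-3) ne(1)] nbv[OF a(1,2,4) ne(2)]] P.A.adjD(2) by blast
    ultimately have "SK K k ?x ?y" using legal nx(1) ny(1) by blast
    moreover have "SK K k x y \<longleftrightarrow> SK K k ?x ?y"
      by (rule S.sep_cong[OF chain[OF a(1-3) ne(1)] chain[OF a(1,2,4) ne(2)]])
         (use ptK_in[OF K] K.vpt_inj nx(4,5) ny(4,5) ne in auto)
    ultimately show "SK K k x y" by simp
  qed
  then show False using vol_compare(2)[OF K s t le] v by simp
qed

end

section \<open>Normalised bases and maximal folding\<close>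

context gtree0
begin

interpretation S: sep_tree \<Lambda> S by (rule S_tree)

text \<open>A basis is normalised if edges which can be folded towards \<open>S\<close> after translation can be
  folded right away.\<close>

definition normat :: "(nat \<Rightarrow> 'a set) \<Rightarrow> (nat \<Rightarrow> nat \<Rightarrow> nat \<Rightarrow> bool) \<Rightarrow> nat \<Rightarrow> bool" where
  "normat K t k \<longleftrightarrow> (\<forall>i j. sep_adj {0..n} t k i \<and> sep_adj {0..n} t k j \<longrightarrow>
     (\<forall>x\<in>K k. \<not> S (ptK K k) (ptK K i) (act x (ptK K j)) \<longrightarrow> \<not> SK K k i j))"

text \<open>What \<open>r\<close> identifies at a vertex of \<open>t\<close> is a folding towards
  \<open>S\<close>. This allows normalising automorphisms to be carried by \<open>r\<close>, so that
  the vertex type of \<open>r\<close> is preserved.\<close>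

definition fold_compat :: "(nat \<Rightarrow> 'a set) \<Rightarrow> (nat \<Rightarrow> nat \<Rightarrow> nat \<Rightarrow> bool) \<Rightarrow> (nat \<Rightarrow> nat \<Rightarrow> nat \<Rightarrow> bool) \<Rightarrow> bool" where
  "fold_compat K t r \<longleftrightarrow> (\<forall>k i j. sep_adj {0..n} t k i \<and> sep_adj {0..n} t k j \<and> \<not> r k i j \<longrightarrow> \<not> SK K k i j)"

text \<open>Since stabilisers act freely on directions, the element moving a vertex into a given
  direction is unique. This makes the choices during normalisation consistent.\<close>

lemma free_eq:
  assumes "l \<in> \<Lambda>" "y \<in> carrier G" "z \<in> carrier G" "act y l = l" "act z l = l" "p \<in> \<Lambda>" "p \<noteq> l" "\<not> S l (act y p) (act z p)"
  shows "y = z"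
proof (rule ccontr)
  assume ne: "y \<noteq> z"
  let ?x = "z \<otimes> inv y"
  have xc: "?x \<in> carrier G" using assms by simp
  have "?x \<noteq> \<one>" using ne assms(2,3) by (metis inv_equality inv_inv inv_closed)
  moreover have "act ?x l = l" using act_mult[OF assms(3) inv_closed[OF assms(2)] assms(1)] act_inv(1)[OF assms(2,1)] assms(4,5) by simp
  moreover have "act y p \<noteq> l" using act_inj[OF assms(2,6,1)] assms(4,7) by metis
  ultimately have "S l (act y p) (act ?x (act y p))" using S_free[OF assms(1) xc _ _ act_closed[OF assms(2,6)]] by blast
  moreover have "act ?x (act y p) = act z p" using act_mult[OF xc assms(2,6)] assms(2,3) by (simp add: m_assoc)
  ultimately show False using assms(8) by simp
qed

text \<open>Two directions at \<open>k\<close> are related if an element of \<open>L k\<close> moves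
  one into the \<open>S\<close>-direction of the other. Moving every class into the direction of a
  representative is a symmetric Whitehead automorphism. By freeness its values are unique, hence
  constant on the petals of \<open>r\<close>.\<close>

lemma normalise_at:
  assumes L: "bas L" and t: "pointed_sep n t" and r: "pointed_sep n r" and le: "\<And>k i j. r k i j \<Longrightarrow> t k i j"
    and fc: "fold_compat L t r" and k: "k \<in> {1..n}"
  obtains L' where "bas L'" "eqv r L L'" "normat L' t k" "\<And>l. l \<in> {1..n} \<Longrightarrow> normat L t l \<Longrightarrow> normat L' t l"
proof -
  interpret P: sep_tree_pair "{0..n}" r t
    by (rule sep_tree_pair.intro[OF pointedD(1)[OF r] pointedD(1)[OF t]]) (unfold_locales, rule le)
  interpret L: free_prod G n L by (rule bas_fp[OF L])
  have kn: "k \<le> n" "k \<in> {0..n}" using k by auto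
  have pin: "ptK L j \<in> \<Lambda>" if "j \<le> n" for j using ptK_in[OF L that] .
  let ?k = "ptK L k"
  define Q where "Q i = ptK L (P.B.nb k i)" for i
  have nb: "P.B.adj k (P.B.nb k i)" "\<not> t k i (P.B.nb k i)" "P.B.nb k i \<le> n" "P.B.nb k i \<noteq> k" if "i \<le> n" "i \<noteq> k" for i
    using P.B.nb[of k i] that kn by auto
  have Q: "Q i \<in> \<Lambda>" "Q i \<noteq> ?k" if "i \<le> n" "i \<noteq> k" for i
    using nb[OF that] pin L.vpt_inj kn by (auto simp: Q_def)
  have Lc: "x \<in> carrier G" "act x ?k = ?k" if "x \<in> L k" for x using L.H_closed[OF k that] L.act_stab[OF k that] by auto
  have aQ: "act x (Q i) \<in> \<Lambda>" "act x (Q i) \<noteq> ?k" if "x \<in> L k" "i \<le> n" "i \<noteq> k" for x i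
    using act_closed[OF Lc(1)[OF that(1)] Q(1)[OF that(2,3)]] act_inj[OF Lc(1)[OF that(1)] Q(1)[OF that(2,3)] pin[OF kn(1)]] Lc(2)[OF that(1)] Q(2)[OF that(2,3)] by auto
  have Sx: "S ?k (act x p) (act x q) \<longleftrightarrow> S ?k p q" if "x \<in> L k" "p \<in> \<Lambda>" "q \<in> \<Lambda>" for x p q
    using S_act[OF Lc(1)[OF that(1)] pin[OF kn(1)] that(2,3)] Lc(2)[OF that(1)] by simp
  define rel where "rel i j \<longleftrightarrow> (\<exists>x\<in>L k. \<not> S ?k (Q i) (act x (Q j)))" for i j
  have rel1: "rel i j" if "\<not> S ?k (Q i) (Q j)" "j \<le> n" "j \<noteq> k" for i j
    unfolding rel_def using that L.H_ops(3)[OF k] act_one[OF Q(1)[OF that(2,3)]] by (intro bexI[of _ \<one>]) auto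
  have rel_sym: "rel j i" if ij: "rel i j" "i \<le> n" "j \<le> n" "i \<noteq> k" "j \<noteq> k" for i j
  proof -
    obtain x where x: "x \<in> L k" "\<not> S ?k (Q i) (act x (Q j))" using ij by (auto simp: rel_def)
    have ix: "inv x \<in> L k" using L.H_ops(2)[OF k x(1)] .
    have "\<not> S ?k (act (inv x) (Q i)) (act (inv x) (act x (Q j)))" using Sx[OF ix Q(1) aQ(1)] x ij by simp
    then have "\<not> S ?k (Q j) (act (inv x) (Q i))" using act_inv(1)[OF Lc(1)[OF x(1)] Q(1)] ij S.sym by metis
    then show ?thesis using ix by (auto simp: rel_def)
  qed
  have rel_trans: "rel i l" if ijl: "rel i j" "rel j l" "i \<le> n" "j \<le> n" "l \<le> n" "i \<noteq> k" "j \<noteq> k" "l \<noteq> k" for i j l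
  proof -
    obtain x where x: "x \<in> L k" "\<not> S ?k (Q i) (act x (Q j))" using ijl by (auto simp: rel_def)
    obtain y where y: "y \<in> L k" "\<not> S ?k (Q j) (act y (Q l))" using ijl by (auto simp: rel_def)
    have "\<not> S ?k (act x (Q j)) (act x (act y (Q l)))" using Sx[OF x(1) Q(1) aQ(1)[OF y(1)]] y ijl by simp
    then have "\<not> S ?k (Q i) (act x (act y (Q l)))" using S_not_trans[OF x(2)] aQ[OF x(1)] ijl by blast
    then have "\<not> S ?k (Q i) (act (x \<otimes> y) (Q l))" using act_mult[OF Lc(1)[OF x(1)] Lc(1)[OF y(1)] Q(1)] ijl by simp
    then show ?thesis using L.H_ops(1)[OF k x(1) y(1)] by (auto simp: rel_def)
  qed
  \<comment> \<open>Taking the least label makes the base point 0 represent its own class. So it is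
    not moved, as a carried automorphism requires.\<close>
  define rep where "rep i = (LEAST j. j \<le> n \<and> j \<noteq> k \<and> rel j i)" for i
  have rep: "rep i \<le> n \<and> rep i \<noteq> k \<and> rel (rep i) i" if i: "i \<le> n" "i \<noteq> k" for i
    unfolding rep_def by (rule LeastI[of _ i]) (use rel1[of i i] S.irrefl i in auto)
  have rep_eq: "rep i = rep j" if ij: "rel i j" "i \<le> n" "j \<le> n" "i \<noteq> k" "j \<noteq> k" for i j
  proof -
    have "(\<lambda>a. a \<le> n \<and> a \<noteq> k \<and> rel a i) = (\<lambda>a. a \<le> n \<and> a \<noteq> k \<and> rel a j)"
      using rel_trans[OF _ ij(1)] rel_trans[OF _ rel_sym[OF ij]] ij by blast
    then show ?thesis by (simp add: rep_def)
  qed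
  define x where "x i = (if i = k then \<one> else SOME x. x \<in> L k \<and> \<not> S ?k (Q (rep i)) (act x (Q i)))" for i
  have x: "x i \<in> L k" "\<not> S ?k (Q (rep i)) (act (x i) (Q i))" if i: "i \<le> n" "i \<noteq> k" for i
  proof -
    have "\<exists>x. x \<in> L k \<and> \<not> S ?k (Q (rep i)) (act x (Q i))" using rep[OF i] by (auto simp: rel_def)
    from someI_ex[OF this] show "x i \<in> L k" "\<not> S ?k (Q (rep i)) (act (x i) (Q i))" using i by (auto simp: x_def)
  qed
  have xrel: "\<not> S ?k (act (x i) (Q i)) (act (x j) (Q j))" if ij: "rel i j" "i \<le> n" "j \<le> n" "i \<noteq> k" "j \<noteq> k" for i j
    using S_not_trans[of ?k "act (x i) (Q i)" "Q (rep i)" "act (x j) (Q j)"] x[OF ij(2,4)] x[OF ij(3,5)] rep_eq[OF ij] rep[OF ij(2,4)] Q S.sym by metis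
  have x_eq: "x i = x j" if ij: "\<not> S ?k (Q i) (Q j)" "i \<le> n" "j \<le> n" "i \<noteq> k" "j \<noteq> k" for i j
  proof -
    have "\<not> S ?k (act (x i) (Q i)) (act (x j) (Q j))" using xrel[OF rel1[OF ij(1,3,5)] ij(2-5)] .
    moreover have "\<not> S ?k (act (x j) (Q j)) (act (x j) (Q i))" using Sx[OF x(1)[OF ij(3,5)] Q(1) Q(1)] ij S.sym by blast
    ultimately have "\<not> S ?k (act (x i) (Q i)) (act (x j) (Q i))" using S_not_trans aQ[OF x(1)[OF ij(3,5)]] ij by blast
    then show ?thesis using free_eq[OF pin[OF kn(1)] _ _ _ _ Q[OF ij(2,4)]] Lc x(1) ij by metis
  qed
  have x0: "x 0 = \<one>"
  proof -
    have 0: "0 \<le> n" "0 \<noteq> k" using k by auto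
    have "rel 0 0" using rel1[of 0 0] S.irrefl 0 by blast
    then have "rep 0 = 0" using 0 unfolding rep_def by (intro Least_equality) auto
    then have "\<not> S ?k (act \<one> (Q 0)) (act (x 0) (Q 0))" using x(2)[OF 0] act_one[OF Q(1)[OF 0]] by simp
    then show ?thesis using free_eq[OF pin[OF kn(1)] one_closed _ act_one[OF pin[OF kn(1)]] _ Q[OF 0]] Lc[OF x(1)[OF 0]] by metis
  qed
  have xr: "x i = x j" if ij: "i \<le> n" "j \<le> n" "i \<noteq> k" "j \<noteq> k" "\<not> r k i j" for i j
  proof -
    have "\<not> r k (P.B.nb k i) (P.B.nb k j)"
      using ij P.A.sep_cong[of k i "P.B.nb k i" j "P.B.nb k j"] nb[OF ij(1,3)] nb[OF ij(2,4)] P.le by auto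
    then have "\<not> S ?k (Q i) (Q j)" using fc nb(1)[OF ij(1,3)] nb(1)[OF ij(2,4)] unfolding fold_compat_def Q_def by blast
    then show ?thesis using x_eq ij by blast
  qed
  have xk: "x k = \<one>" by (simp add: x_def)
  have wh: "is_sym_wh G n L k x" using k x(1) xk L.H_ops(3)[OF k] by (auto simp: is_sym_wh_def) (metis One_nat_def)
  have car: "carried G n L (Fam r) k x"
  proof (rule carriedI[OF r wh])
    fix i assume i: "i \<in> {1..n}" "i \<noteq> k" "\<not> r k 0 i"
    show "x i = \<one>" using xr[of 0 i] i x0 k by simp
  next
    fix i j assume "i \<in> {1..n}" "j \<in> {1..n}" "i \<noteq> k" "j \<noteq> k" "\<not> r k i j"
    then show "x i = x j" using xr[of i j] by simp
  qed
  let ?L = "basis_img n (whitehead G n L x) L"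
  have L': "bas ?L" using whitehead_img(1)[OF L wh] .
  interpret L': free_prod G n ?L by (rule bas_fp[OF L'])
  have pt': "ptK ?L j = act (x j) (ptK L j)" if "j \<le> n" for j
    using whitehead_img(2)[OF L wh, of j] that x0 act_one[OF pin] by (cases "j = 0") (auto simp: pt_def)
  have ptk: "ptK ?L k = ?k" using pt'[OF kn(1)] xk act_one[OF pin[OF kn(1)]] by simp
  have Lk: "?L k = L k" using ptk k by (simp add: pt_def)
  have e: "eqv r L ?L" by (rule whitehead_eqv(1)[OF r L car])
  have nk: "normat ?L t k"
    unfolding normat_def
  proof (intro allI impI ballI)
    fix i j y assume a: "P.B.adj k i \<and> P.B.adj k j" and y: "y \<in> ?L k" and n: "\<not> S (ptK ?L k) (ptK ?L i) (act y (ptK ?L j))"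
    have ij: "i \<le> n" "j \<le> n" "i \<noteq> k" "j \<noteq> k" using P.B.adjD(1)[of k i] P.B.adjD(1)[of k j] a by auto
    have Qi: "Q i = ptK L i" "Q j = ptK L j" using P.B.nb_adj a by (auto simp: Q_def)
    note xi = x(1)[OF ij(1,3)] and xj = x(1)[OF ij(2,4)]
    have y': "y \<in> L k" using y Lk by simp
    have p: "ptK ?L i = act (x i) (Q i)" "ptK ?L j = act (x j) (Q j)" using pt' ij Qi by auto
    let ?z = "inv (x i) \<otimes> (y \<otimes> x j)"
    have z: "?z \<in> L k" using L.H_ops[OF k] xi xj y' by blast
    have "act (x i) (act ?z (Q j)) = act y (act (x j) (Q j))"
    proof -
      have "x i \<otimes> ?z = y \<otimes> x j" using Lc(1) xi xj y' by (simp add: m_assoc[symmetric])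
      then show ?thesis using act_mult[OF Lc(1)[OF xi] Lc(1)[OF z] Q(1)] act_mult[OF Lc(1)[OF y'] Lc(1)[OF xj] Q(1)] ij by simp
    qed
    then have "\<not> S ?k (act (x i) (Q i)) (act (x i) (act ?z (Q j)))" using n p ptk by simp
    then have "\<not> S ?k (Q i) (act ?z (Q j))" using Sx[OF xi Q(1)[OF ij(1,3)] aQ(1)[OF z ij(2,4)]] by simp
    then have "rel i j" using z by (auto simp: rel_def)
    then show "\<not> SK ?L k i j" using xrel ij p ptk by simp
  qed
  \<comment> \<open>At another label \<open>l\<close>, no neighbour is separated from
    \<open>l\<close> by \<open>k\<close>; so \<open>l\<close> and its neighbours other than
    \<open>k\<close> are translated by the same element \<open>x l\<close>, which also fixes the
    vertex \<open>k\<close>. The situation at \<open>l\<close> is merely translated.\<close>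
  have nl: "normat ?L t l" if l: "l \<in> {1..n}" and nl: "normat L t l" for l
  proof (cases "l = k")
    case False
    have ln: "l \<le> n" using l by simp
    let ?g = "x l"
    have gk: "?g \<in> L k" and g: "?g \<in> carrier G" using x(1)[OF ln False] Lc(1) by auto
    have tr: "ptK ?L a = act ?g (ptK L a)" if a: "a = l \<or> P.B.adj l a" for a
    proof (cases "a = k")
      case True
      then show ?thesis using ptk Lc(2)[OF gk] by simp
    next
      case ak: False
      have an: "a \<le> n" using a ln P.B.adjD(1)[of l a] by auto
      have "x a = x l"
      proof (cases "a = l")
        case False
        then have "\<not> t k l a" using a P.B.adjD(2) by blast
        then show ?thesis using xr[OF an ln ak \<open>l \<noteq> k\<close>] P.le P.A.sym by blast
      qed simp
      then show ?thesis using pt'[OF an] by simp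
    qed
    show ?thesis
      unfolding normat_def
    proof (intro allI impI ballI)
      fix i j y assume a: "P.B.adj l i \<and> P.B.adj l j" and y: "y \<in> ?L l" and n: "\<not> S (ptK ?L l) (ptK ?L i) (act y (ptK ?L j))"
      have ij: "i \<le> n" "j \<le> n" using P.B.adjD(1)[of l i] P.B.adjD(1)[of l j] a by auto
      have p: "ptK ?L l = act ?g (ptK L l)" "ptK ?L i = act ?g (ptK L i)" "ptK ?L j = act ?g (ptK L j)" using tr a by auto
      have yc: "y \<in> carrier G" using L'.H_closed[OF l y] .
      let ?z = "inv ?g \<otimes> (y \<otimes> ?g)"
      have zc: "?z \<in> carrier G" using g yc by simp
      have gz: "act ?g (act ?z q) = act y (act ?g q)" if "q \<in> \<Lambda>" for q
      proof -
        have "?g \<otimes> ?z = y \<otimes> ?g" using g yc by (simp add: m_assoc[symmetric])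
        then show ?thesis using act_mult[OF g zc that] act_mult[OF yc g that] by simp
      qed
      have "act ?g (act ?z (ptK L l)) = act ?g (ptK L l)" using gz[OF pin[OF ln]] L'.act_stab[OF l y] p(1) by simp
      then have "act ?z (ptK L l) = ptK L l" using act_inj[OF g act_closed[OF zc pin[OF ln]] pin[OF ln]] by simp
      then have z: "?z \<in> L l" using L.stab_vpt[OF zc l] by simp
      have "\<not> S (act ?g (ptK L l)) (act ?g (ptK L i)) (act ?g (act ?z (ptK L j)))" using n p gz[OF pin[OF ij(2)]] by simp
      then have "\<not> S (ptK L l) (ptK L i) (act ?z (ptK L j))" using S_act[OF g pin[OF ln] pin[OF ij(1)] act_closed[OF zc pin[OF ij(2)]]] by simp
      then have "\<not> SK L l i j" using nl a z unfolding normat_def by blast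
      then show "\<not> SK ?L l i j" using S_act[OF g pin[OF ln] pin[OF ij(1)] pin[OF ij(2)]] p by simp
    qed
  qed (use nk in simp)
  show ?thesis using that[OF L' e nk nl] .
qed

definition normd :: "(nat \<Rightarrow> 'a set) \<Rightarrow> (nat \<Rightarrow> nat \<Rightarrow> nat \<Rightarrow> bool) \<Rightarrow> bool" where
  "normd K t \<longleftrightarrow> (\<forall>k\<in>{1..n}. normat K t k)"

lemma fold_compat_eqv:
  assumes "bas K" "eqv r K L" "\<And>k i j. r k i j \<Longrightarrow> t k i j" "fold_compat K t r" shows "fold_compat L t r"
  unfolding fold_compat_def
proof (intro allI impI)
  fix k i j assume a: "sep_adj {0..n} t k i \<and> sep_adj {0..n} t k j \<and> \<not> r k i j"
  then have "sep_adj {0..n} r k i" "sep_adj {0..n} r k j" using assms(3) unfolding sep_adj_def by metis+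
  then show "\<not> SK L k i j" using SK_eqv[OF assms(1,2)] assms(4) a unfolding fold_compat_def by blast
qed

lemma normalise:
  assumes K: "bas K" and t: "pointed_sep n t" and r: "pointed_sep n r" and le: "\<And>k i j. r k i j \<Longrightarrow> t k i j"
    and fc: "fold_compat K t r"
  obtains L where "bas L" "eqv r K L" "normd L t" "fold_compat L t r"
proof -
  have "\<exists>L. bas L \<and> eqv r K L \<and> (\<forall>k\<in>{1..m}. normat L t k)" if "m \<le> n" for m
    using that
  proof (induction m)
    case 0
    then show ?case using K eqv_refl by auto
  next
    case (Suc m)
    then obtain L where L: "bas L" "eqv r K L" "\<forall>k\<in>{1..m}. normat L t k" by auto
    obtain L' where L': "bas L'" "eqv r L L'" "normat L' t (Suc m)" "\<And>l. l \<in> {1..n} \<Longrightarrow> normat L t l \<Longrightarrow> normat L' t l"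
      using normalise_at[OF L(1) t r le fold_compat_eqv[OF K L(2) le fc], of "Suc m"] Suc.prems by auto
    have "normat L' t k" if "k \<in> {1..Suc m}" for k
    proof (cases "k = Suc m")
      case False
      then show ?thesis using L'(4)[of k] L(3) that Suc.prems by auto
    qed (use L' in simp)
    then show ?case using L'(1) eqv_trans[OF K L(2) L'(2)] by blast
  qed
  then obtain L where L: "bas L" "eqv r K L" "normd L t" unfolding normd_def by blast
  then show ?thesis using that fold_compat_eqv[OF K L(2) le fc] by blast
qed

text \<open>The tree with a single unlabelled vertex, smallest in the order. With it
  \<open>rf L t star\<close> merges exactly those directions of \<open>t\<close> which agree in
  \<open>S\<close>: this is the maximal folding.\<close>

abbreviation star :: "nat \<Rightarrow> nat \<Rightarrow> nat \<Rightarrow> bool" where "star \<equiv> \<lambda>k i j. False"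

lemma star_pointed: "pointed_sep n star"
proof -
  have "fin_sep_tree {0..n} star" by unfold_locales auto
  then show ?thesis using s0 by (simp add: pointed_sep_def)
qed

text \<open>Equivalence for the coarser tree \<open>c\<close> can be tested on neighbours in
  \<open>t\<close>. Along a path of \<open>t\<close> inside an unlabelled vertex of
  \<open>c\<close>, consecutive translations agree on two labels and so coincide.\<close>

lemma eqv_glue:
  assumes L: "bas L" and c: "pointed_sep n c" and t: "pointed_sep n t" and le: "\<And>k i j. c k i j \<Longrightarrow> t k i j"
    and H: "\<And>k i j. sep_adj {0..n} t k i \<Longrightarrow> sep_adj {0..n} t k j \<Longrightarrow> \<not> c k i j \<Longrightarrow> transl L L' {k, i, j}"
  shows "eqv c L L'"
proof -
  interpret P: sep_tree_pair "{0..n}" c t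
    by (rule sep_tree_pair.intro[OF pointedD(1)[OF c] pointedD(1)[OF t]]) (unfold_locales, rule le)
  interpret L: free_prod G n L by (rule bas_fp[OF L])
  have nbv: "P.B.nb k x \<in> v" if h: "v \<in> P.A.hyps" "k \<in> v" "x \<in> v" "k \<noteq> x" for v k x
  proof -
    have h': "P.A.adj k x" "v = P.A.hyp k x" using P.A.hypsD(2)[OF h] by auto
    have "P.B.nb k x = x \<or> t (P.B.nb k x) k x" using P.B.nb(2)[of k x] P.A.adjD(1)[OF h'(1)] by auto
    then show ?thesis using P.between_in_hyp[OF h'(1)] h'(2) h by auto
  qed
  have nsep: "\<not> c k x y" if h: "v \<in> P.A.hyps" "x \<in> v" "y \<in> v" for v k x y
    using P.A.hypsD(2)[OF h] P.A.adjD(2) P.A.irrefl by blast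
  have claim: "ptK L' b = act g (ptK L b)"
    if "v \<in> P.A.hyps" "a \<in> v" "b \<in> v" "a \<noteq> b" "g \<in> carrier G" "ptK L' a = act g (ptK L a)" "ptK L' (P.B.nb a b) = act g (ptK L (P.B.nb a b))" for v a b g
    using that
  proof (induction "card {l. t l a b}" arbitrary: a rule: less_induct)
    case less
    let ?d = "P.B.nb a b"
    have N: "a \<in> {0..n}" "b \<in> {0..n}" using P.A.hypsD(1)[OF less.prems(1)] less.prems by auto
    note d = P.B.nb[OF N less.prems(4)]
    show ?case
    proof (cases "?d = b")
      case False
      then have td: "t ?d a b" using d(2) by simp
      have dv: "?d \<in> v" by (rule nbv[OF less.prems(1-4)])
      let ?e = "P.B.nb ?d b"
      note e = P.B.nb[OF d(4) N(2) False]
      have ev: "?e \<in> v" by (rule nbv[OF less.prems(1) dv less.prems(3) False])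
      have "transl L L' {?d, a, ?e}" by (rule H[OF P.B.adj_sym[OF d(1)] e(1) nsep[OF less.prems(1,2) ev]])
      then obtain h where h: "h \<in> carrier G" "ptK L' ?d = act h (ptK L ?d)" "ptK L' a = act h (ptK L a)" "ptK L' ?e = act h (ptK L ?e)"
        by (auto simp: bas_transl_def)
      have "h = g" using L.transl_unique[OF h(1) less.prems(5), of a ?d] h less.prems(6,7) N d by simp
      moreover have sub: "t l a b" if "t l ?d b" for l using P.B.between_trans[of l b ?d a] that td P.B.sym by blast
      then have "{l. t l ?d b} \<subset> {l. t l a b}" using td P.B.dom by blast
      then have "card {l. t l ?d b} < card {l. t l a b}" using P.B.finite_sep by (rule psubset_card_mono[rotated])
      ultimately show ?thesis using less.hyps[of ?d] less.prems dv False h by blast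
    qed (use less.prems in simp)
  qed
  show ?thesis
    unfolding bas_eqv_def
  proof (intro allI impI)
    fix k i j assume a: "P.A.adj k i \<and> P.A.adj k j \<and> \<not> c k i j"
    let ?v = "P.A.hyp k i"
    have v: "?v \<in> P.A.hyps" "k \<in> ?v" "i \<in> ?v" "j \<in> ?v" using a P.A.hyp_in P.A.hyp_sub by (auto simp: sep_hyp_def)
    have ne: "k \<noteq> i" "k \<noteq> j" "k \<in> {0..n}" "i \<in> {0..n}" "j \<in> {0..n}" using P.A.adjD(1)[of k i] P.A.adjD(1)[of k j] a by auto
    note ni = P.B.nb[OF ne(3,4,1)] and nj = P.B.nb[OF ne(3,5,2)]
    have "transl L L' {k, P.B.nb k i, P.B.nb k j}"
      by (rule H[OF ni(1) nj(1) nsep[OF v(1) nbv[OF v(1-3) ne(1)] nbv[OF v(1,2,4) ne(2)]]])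
    then obtain g where g: "g \<in> carrier G" "ptK L' k = act g (ptK L k)" "ptK L' (P.B.nb k i) = act g (ptK L (P.B.nb k i))"
        "ptK L' (P.B.nb k j) = act g (ptK L (P.B.nb k j))" by (auto simp: bas_transl_def)
    have "ptK L' i = act g (ptK L i)" "ptK L' j = act g (ptK L j)"
      using claim[OF v(1-3) ne(1) g(1,2,3)] claim[OF v(1,2,4) ne(2) g(1,2,4)] by auto
    then show "transl L L' {k, i, j}" unfolding bas_transl_def using g by blast
  qed
qed

text \<open>The maximal folding does not depend on which normalised basis represents the vertex type
  of \<open>t\<close>. All canonicity of \<mu> comes from here.\<close>

lemma fold_unique:
  assumes L: "bas L" "bas L'" and t: "pointed_sep n t" and rx: "rfix L t" and nm: "normd L t" "normd L' t"
    and e: "eqv t L L'"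
  shows "eqv (rf L t star) L L'"
proof -
  interpret T: fin_sep_tree "{0..n}" t by (rule pointedD(1)[OF t])
  interpret L: free_prod G n L by (rule bas_fp[OF L(1)])
  interpret L': free_prod G n L' by (rule bas_fp[OF L(2)])
  let ?c = "rf L t star"
  have c: "pointed_sep n ?c" using rf_between(1)[OF L(1) star_pointed t _ rx] by blast
  have le: "?c k i j \<Longrightarrow> t k i j" for k i j using rf_between(2)[OF L(1) star_pointed t _ rx] by blast
  have pL: "ptK L j \<in> \<Lambda>" if "j \<le> n" for j using ptK_in[OF L(1) that] .
  show ?thesis
  proof (rule eqv_glue[OF L(1) c t le])
    fix k i j assume a: "T.adj k i" "T.adj k j" "\<not> ?c k i j"
    have m: "k \<le> n" "i \<le> n" "j \<le> n" "i \<noteq> k" "j \<noteq> k" using T.adjD(1)[OF a(1)] T.adjD(1)[OF a(2)] by auto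
    have nS: "\<not> SK L k i j" using a(3) m T.nb_adj[OF a(1)] T.nb_adj[OF a(2)] by (simp add: rf_def sep_refine_def)
    show "transl L L' {k, i, j}"
    proof (cases "t k i j")
      case False
      then show ?thesis using e a unfolding bas_eqv_def by blast
    next
      case True
      then have k: "k \<in> {1..n}" using pointedD(2)[OF t] m by (cases "k = 0") auto
      have "transl L L' {k, i, i}" "transl L L' {k, j, j}" using e a T.irrefl unfolding bas_eqv_def by blast+
      then obtain g h where g: "g \<in> carrier G" "ptK L' k = act g (ptK L k)" "ptK L' i = act g (ptK L i)"
        and h: "h \<in> carrier G" "ptK L' k = act h (ptK L k)" "ptK L' j = act h (ptK L j)" by (auto simp: bas_transl_def)
      \<comment> \<open>This element of \<open>L' k\<close> measures how far \<open>i\<close> and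
        \<open>j\<close> fail to be translated together. Normalisation of \<open>L'\<close> puts
        them into one direction without it, and freeness then forces \<open>g = h\<close>.\<close>
      let ?y = "g \<otimes> inv h"
      have yc: "?y \<in> carrier G" using g h by simp
      have yh: "act ?y (act h p) = act g p" if "p \<in> \<Lambda>" for p using act_mult[OF yc h(1) that] g h by (simp add: m_assoc)
      have "act ?y (ptK L' k) = ptK L' k" using yh[OF pL[OF m(1)]] g(2) h(2) by metis
      then have y: "?y \<in> L' k" using L'.stab_vpt[OF yc k] by simp
      have "\<not> S (act g (ptK L k)) (act g (ptK L i)) (act g (ptK L j))" using nS S_act[OF g(1) pL[OF m(1)] pL[OF m(2)] pL[OF m(3)]] by simp
      then have "\<not> S (ptK L' k) (ptK L' i) (act ?y (ptK L' j))" using g h yh[OF pL[OF m(3)]] by simp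
      then have "\<not> SK L' k i j" using nm(2) k a y unfolding normd_def normat_def by blast
      let ?z = "inv g \<otimes> h"
      have zc: "?z \<in> carrier G" using g h by simp
      have gz: "act g (act ?z p) = act h p" if "p \<in> \<Lambda>" for p using act_mult[OF g(1) zc that] g h by (simp add: m_assoc[symmetric])
      have "act g (act ?z (ptK L k)) = act g (ptK L k)" using gz[OF pL[OF m(1)]] g(2) h(2) by metis
      then have zk: "act ?z (ptK L k) = ptK L k" using act_inj[OF g(1) act_closed[OF zc pL[OF m(1)]] pL[OF m(1)]] by simp
      have "\<not> S (act g (ptK L k)) (act g (ptK L i)) (act g (act ?z (ptK L j)))"
        using \<open>\<not> SK L' k i j\<close> g h gz[OF pL[OF m(3)]] by simp
      then have "\<not> S (ptK L k) (ptK L i) (act ?z (ptK L j))" using S_act[OF g(1) pL[OF m(1)] pL[OF m(2)] act_closed[OF zc pL[OF m(3)]]] by simp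
      then have "\<not> S (ptK L k) (act \<one> (ptK L j)) (act ?z (ptK L j))"
        using S_not_trans[of "ptK L k" "ptK L j" "ptK L i"] nS S.sym pL m L.vpt_inj act_one by metis
      then have "\<one> = ?z" using free_eq[OF pL[OF m(1)] one_closed zc act_one[OF pL[OF m(1)]] zk pL[OF m(3)]] L.vpt_inj m by blast
      then have "g = h" using g h by (metis inv_equality inv_inv inv_closed)
      then show ?thesis unfolding bas_transl_def using g h by blast
    qed
  qed
qed

text \<open>By uniqueness of the adapted type, \<open>t\<close> disagrees with \<open>S\<close>
  somewhere. As \<open>t\<close> is closed and stabilisers act freely, the disagreement is a turn
  which \<open>t\<close> separates but \<open>S\<close> does not after a translation. Normalisation
  removes the translation, so this turn is folded and an edge is saved.\<close>

lemma fold_strict: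
  assumes L: "bas L" and t: "pointed_sep n t" and rx: "rfix L t" and nm: "normd L t" and ne: "cls L t \<noteq> cls H0 s0"
  shows "vol L (rf L t star) < vol L t"
proof -
  interpret T: fin_sep_tree "{0..n}" t by (rule pointedD(1)[OF t])
  interpret L: free_prod G n L by (rule bas_fp[OF L])
  let ?c = "rf L t star"
  have c: "pointed_sep n ?c" using rf_between(1)[OF L star_pointed t _ rx] by blast
  have le: "?c k i j \<Longrightarrow> t k i j" for k i j using rf_between(2)[OF L star_pointed t _ rx] by blast
  have pL: "ptK L j \<in> \<Lambda>" if "j \<le> n" for j using ptK_in[OF L that] .
  have "\<not> adapted L t" using adapted_unique[OF L t _ H0 s0 ad0] ne by blast
  then obtain k i j x where k: "k \<in> {1..n}" "T.adj k i" "T.adj k j" "x \<in> L k"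
    and ns: "\<not> (\<not> S (ptK L k) (ptK L i) (act x (ptK L j)) \<longleftrightarrow> x = \<one> \<and> \<not> t k i j)" unfolding adapted_def by blast
  have m: "k \<le> n" "i \<le> n" "j \<le> n" "i \<noteq> k" "j \<noteq> k" using T.adjD(1)[OF k(2)] T.adjD(1)[OF k(3)] by auto
  have xc: "x \<in> carrier G" "act x (ptK L k) = ptK L k" using L.H_closed[OF k(1,4)] L.act_stab[OF k(1,4)] by auto
  have tk: "t k i j"
  proof (rule ccontr)
    assume n: "\<not> t k i j"
    then have nS: "\<not> SK L k i j" using rx k unfolding rfix_def by blast
    show False
    proof (cases "x = \<one>")
      case True
      then show False using ns n nS act_one[OF pL[OF m(3)]] by simp
    next
      case False
      then have "\<not> S (ptK L k) (ptK L i) (act x (ptK L j))" using ns by blast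
      then have "\<not> S (ptK L k) (act \<one> (ptK L j)) (act x (ptK L j))"
        using S_not_trans[of "ptK L k" "ptK L j" "ptK L i"] nS S.sym pL m L.vpt_inj act_one by metis
      then have "\<one> = x" using free_eq[OF pL[OF m(1)] one_closed xc(1) act_one[OF pL[OF m(1)]] xc(2) pL[OF m(3)]] L.vpt_inj m by blast
      then show False using False by simp
    qed
  qed
  then have "\<not> S (ptK L k) (ptK L i) (act x (ptK L j))" using ns by blast
  then have nS: "\<not> SK L k i j" using nm k unfolding normd_def normat_def by blast
  then have "\<not> ?c k i j" using T.nb_adj k by (simp add: rf_def sep_refine_def)
  then have "double L ?c t" using doubleI[OF L c t le k(2,3) tk] nS by blast
  then show ?thesis using vol_compare[OF L c t le] by fastforce
qed

section \<open>Maps on vertex types and the contraction of the fixed complex\<close>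

text \<open>Here and in the next two definitions, the description ranges over all representatives;
  the lemmas ending in \<open>_cls\<close> show that the result does not depend on them.\<close>

definition vc :: "'a lpair set \<Rightarrow> nat" where
  "vc c = (THE v. \<exists>K s. bas K \<and> pointed_sep n s \<and> c = cls K s \<and> v = vol K s)"

definition Rc :: "'a lpair set \<Rightarrow> 'a lpair set" where
  "Rc c = (THE d. \<exists>K s. bas K \<and> pointed_sep n s \<and> c = cls K s \<and> d = cls K (rf K s s))"

definition fc :: "'a lpair set \<Rightarrow> 'a lpair set \<Rightarrow> 'a lpair set" where
  "fc m c = (THE d. \<exists>K s t. bas K \<and> pointed_sep n s \<and> pointed_sep n t \<and> (\<forall>k i j. s k i j \<longrightarrow> t k i j) \<and> rfix K t \<and>
      m = cls K t \<and> c = cls K s \<and> d = cls K (rf K t s))"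

lemma vc_cls: assumes "bas K" "pointed_sep n s" shows "vc (cls K s) = vol K s"
  unfolding vc_def
proof (rule the_equality)
  fix v assume "\<exists>K' s'. bas K' \<and> pointed_sep n s' \<and> cls K s = cls K' s' \<and> v = vol K' s'"
  then obtain K' s' where K': "bas K'" "pointed_sep n s'" "cls K s = cls K' s'" "v = vol K' s'" by blast
  then have "s = s'" "eqv s K K'" using cls_eq_iff[OF assms(1) K'(1) assms(2) K'(2)] by auto
  then show "v = vol K s" using vol_eqv[OF assms(1) K'(1) assms(2)] K'(4) by simp
qed (use assms in blast)

lemma Rc_cls: assumes "bas K" "pointed_sep n s" shows "Rc (cls K s) = cls K (rf K s s)"
  unfolding Rc_def
proof (rule the_equality)
  fix d assume "\<exists>K' s'. bas K' \<and> pointed_sep n s' \<and> cls K s = cls K' s' \<and> d = cls K' (rf K' s' s')"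
  then obtain K' s' where K': "bas K'" "pointed_sep n s'" "cls K s = cls K' s'" "d = cls K' (rf K' s' s')" by blast
  then have e: "s' = s" "eqv s K K'" using cls_eq_iff[OF assms(1) K'(1) assms(2) K'(2)] by auto
  have r: "rf K s s = rf K' s s" by (rule rf_eqv[OF assms(1,2,2) _ e(2)])
  have "eqv (rf K s s) K K'" using eqv_mono[of s "rf K s s"] rf_ge[OF assms(2)] e(2) by blast
  then show "d = cls K (rf K s s)"
    using cls_eq_iff[OF assms(1) K'(1) rf_self_pointed[OF assms] rf_self_pointed[OF assms]] K'(4) e(1) r by simp
qed (use assms in blast)

lemma fc_cls:
  assumes "bas K" "pointed_sep n s" "pointed_sep n t" "\<And>k i j. s k i j \<Longrightarrow> t k i j" "rfix K t"
  shows "fc (cls K t) (cls K s) = cls K (rf K t s)"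
  unfolding fc_def
proof (rule the_equality)
  fix d assume "\<exists>K' s' t'. bas K' \<and> pointed_sep n s' \<and> pointed_sep n t' \<and> (\<forall>k i j. s' k i j \<longrightarrow> t' k i j) \<and> rfix K' t' \<and>
      cls K t = cls K' t' \<and> cls K s = cls K' s' \<and> d = cls K' (rf K' t' s')"
  then obtain K' s' t' where K': "bas K'" "pointed_sep n s'" "pointed_sep n t'" "cls K t = cls K' t'" "cls K s = cls K' s'" "d = cls K' (rf K' t' s')" by blast
  then have e: "s' = s" "t' = t" "eqv s K K'"
    using cls_eq_iff[OF assms(1) K'(1) assms(2) K'(2)] cls_eq_iff[OF assms(1) K'(1) assms(3) K'(3)] by auto
  have r: "rf K t s = rf K' t s" by (rule rf_eqv[OF assms(1-4) e(3)])
  have p: "pointed_sep n (rf K t s)" by (rule rf_between(1)[OF assms])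
  have "eqv (rf K t s) K K'" using eqv_mono[of s "rf K t s"] rf_ge[OF assms(2)] e(3) by blast
  then show "d = cls K (rf K t s)" using cls_eq_iff[OF assms(1) K'(1) p p] K'(6) e r by simp
qed (use assms in blast)

theorem contractible_fixed:
  assumes F: "F \<subseteq> sigma_aut1 G n Gs"
    and F_S: "\<And>\<phi> l p q. \<phi> \<in> F \<Longrightarrow> l \<in> \<Lambda> \<Longrightarrow> p \<in> \<Lambda> \<Longrightarrow> q \<in> \<Lambda> \<Longrightarrow> S (pmap \<phi> l) (pmap \<phi> p) (pmap \<phi> q) \<longleftrightarrow> S l p q"
    and m0: "cls H0 s0 \<in> LG_fixed G n Gs F"
  shows "contractible_space (realization (LG_fixed G n Gs F) (vle n))"
proof -
  let ?V = "LG_fixed G n Gs F"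
  have fixed: "cls K s \<in> ?V \<longleftrightarrow> (\<forall>\<phi>\<in>F. eqv s K (basis_img n \<phi> K))" if K: "bas K" "pointed_sep n s" for K s
  proof -
    have "vact G n Gs \<phi> (cls K s) = cls K s \<longleftrightarrow> eqv s K (basis_img n \<phi> K)" if "\<phi> \<in> F" for \<phi>
    proof -
      have \<phi>: "\<phi> \<in> sigma_aut1 G n Gs" using F that by blast
      show ?thesis using vact_cls[OF \<phi> K] cls_eq_iff[OF K(1) aut_bas[OF \<phi> K(1)] K(2,2)] by auto
    qed
    then show ?thesis using cls_vertex[OF K] by (simp add: LG_fixed_def)
  qed
  \<comment> \<open>An equivalence for \<open>s\<close> is one for every finer tree, so on a given
    basis fixedness passes upwards. This covers the closure and \<open>fc\<close>, but not \<mu>,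
    which lies below \<open>m\<close>.\<close>
  have up: "cls K r \<in> ?V" if K: "bas K" "pointed_sep n s" "pointed_sep n r" "cls K s \<in> ?V" "\<And>k i j. s k i j \<Longrightarrow> r k i j" for K s r
    using fixed[OF K(1,2)] fixed[OF K(1,3)] K(4) eqv_mono[of s r] K(5) by blast
  have vE: "\<exists>K s. bas K \<and> pointed_sep n s \<and> c = cls K s" if "c \<in> ?V" for c
  proof -
    have "c \<in> LG_vertices G n Gs" using that by (simp add: LG_fixed_def)
    then show ?thesis by (metis LG_vertexE)
  qed
  show ?thesis
  proof (rule contractible_realization_by_volume[where vol=vc and R=Rc and ?m0.0="cls H0 s0"])
    fix x assume "x \<in> ?V"
    then obtain K s where K: "bas K" "pointed_sep n s" "x = cls K s" using vE by blast
    show "vle n x x" using vle_refl K by simp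
  next
    fix x y z assume V: "x \<in> ?V" "y \<in> ?V" "z \<in> ?V" and xy: "vle n x y" "vle n y z"
    obtain K1 s1 K2 s2 K3 s3 where K: "bas K1" "pointed_sep n s1" "x = cls K1 s1" "bas K2" "pointed_sep n s2" "y = cls K2 s2"
      "bas K3" "pointed_sep n s3" "z = cls K3 s3" using vE[OF V(1)] vE[OF V(2)] vE[OF V(3)] by metis
    obtain L where L: "bas L" "x = cls L s1" "z = cls L s3" "\<And>k i j. s1 k i j \<Longrightarrow> s2 k i j" "\<And>k i j. s2 k i j \<Longrightarrow> s3 k i j"
      using vle_chain[OF K(1,2,4,5,7,8)] xy K(3,6,9) by metis
    show "vle n x z" unfolding L(2,3) by (rule vleI[OF L(1) K(2,8)]) (use L(4,5) in blast)
  next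
    fix x y assume V: "x \<in> ?V" "y \<in> ?V" and xy: "vle n x y" "vle n y x"
    obtain K1 s1 K2 s2 where K: "bas K1" "pointed_sep n s1" "x = cls K1 s1" "bas K2" "pointed_sep n s2" "y = cls K2 s2"
      using vE[OF V(1)] vE[OF V(2)] by metis
    obtain L where L: "bas L" "x = cls L s1" "y = cls L s2" "\<And>k i j. s1 k i j \<Longrightarrow> s2 k i j" "\<And>k i j. s2 k i j \<Longrightarrow> s1 k i j"
      using vle_chain[OF K(1,2,4,5,1,2)] xy K(3,6) by metis
    have "s1 = s2" using L(4,5) by (auto simp: fun_eq_iff)
    then show "x = y" using L by simp
  next
    fix x y assume V: "x \<in> ?V" "y \<in> ?V" and xy: "vle n x y"
    obtain K1 s1 K2 s2 where K: "bas K1" "pointed_sep n s1" "x = cls K1 s1" "bas K2" "pointed_sep n s2" "y = cls K2 s2"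
      using vE[OF V(1)] vE[OF V(2)] by metis
    obtain L where L: "bas L" "x = cls L s1" "y = cls L s2" "\<And>k i j. s1 k i j \<Longrightarrow> s2 k i j"
      using vleE[OF K(1,2,4,5)] xy K(3,6) by metis
    show "vc x \<le> vc y" using vol_compare(1)[OF L(1) K(2,5) L(4)] vc_cls[OF L(1) K(2)] vc_cls[OF L(1) K(5)] L(2,3) by simp
    show "Rc x = Rc y" if v: "vc x = vc y"
    proof -
      have "vol L s1 = vol L s2" using v vc_cls[OF L(1) K(2)] vc_cls[OF L(1) K(5)] L(2,3) by simp
      then show ?thesis using rf_eq[OF L(1) K(2,5) L(4)] Rc_cls[OF L(1) K(2)] Rc_cls[OF L(1) K(5)] L(2,3) by simp
    qed
  next
    fix x assume x: "x \<in> ?V"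
    then obtain K s where K: "bas K" "pointed_sep n s" "x = cls K s" using vE by blast
    note p = rf_self_pointed[OF K(1,2)]
    have ge: "s k i j \<Longrightarrow> rf K s s k i j" for k i j using rf_ge[OF K(2)] .
    have "cls K (rf K s s) \<in> ?V" using up[OF K(1,2) p] x K(3) ge by blast
    moreover have "vle n (cls K s) (cls K (rf K s s))" by (rule vleI[OF K(1,2) p ge])
    ultimately show "Rc x \<in> ?V \<and> vle n x (Rc x) \<and> vc (Rc x) = vc x"
      using Rc_cls[OF K(1,2)] vc_cls[OF K(1) p] vc_cls[OF K(1,2)] vol_rf_self[OF K(1,2)] K(3) by simp
  next
    show "cls H0 s0 \<in> ?V" by (rule m0)
  next
    fix m assume m: "m \<in> ?V" "Rc m = m" "m \<noteq> cls H0 s0"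
    obtain K t where K: "bas K" "pointed_sep n t" "m = cls K t" using vE[OF m(1)] by blast
    have rfx: "rfix K' t" if K': "bas K'" "m = cls K' t" for K'
    proof -
      have "cls K' (rf K' t t) = cls K' t" using m(2) Rc_cls[OF K'(1) K(2)] K'(2) by simp
      then have "rf K' t t = t" using cls_eq_iff[OF K'(1,1) rf_self_pointed[OF K'(1) K(2)] K(2)] by simp
      then show ?thesis by (rule rfixI[OF K(2)])
    qed
    have "fold_compat K t t" using rfx[OF K(1,3)] by (simp add: fold_compat_def rfix_def)
    then obtain L where L: "bas L" "eqv t K L" "normd L t" using normalise[OF K(1,2,2)] by blast
    have mL: "m = cls L t" using cls_eq_iff[OF K(1) L(1) K(2,2)] L(2) K(3) by simp
    have rL: "rfix L t" by (rule rfx[OF L(1) mL])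
    let ?c = "rf L t star"
    have c: "pointed_sep n ?c" using rf_between(1)[OF L(1) star_pointed K(2) _ rL] by blast
    have cle: "?c k i j \<Longrightarrow> t k i j" for k i j using rf_between(2)[OF L(1) star_pointed K(2) _ rL] by blast
    let ?mu = "cls L ?c"
    \<comment> \<open>An element of \<open>F\<close> keeps the type \<open>m\<close> and preserves
      \<open>S\<close>, so it sends the normalised basis \<open>L\<close> to another normalised
      basis of \<open>m\<close>. By \<open>fold_unique\<close> the maximal folding is the
      same.\<close>
    have muV: "?mu \<in> ?V"
      unfolding fixed[OF L(1) c]
    proof
      fix \<phi> assume \<phi>F: "\<phi> \<in> F"
      let ?L = "basis_img n \<phi> L"
      have \<phi>: "\<phi> \<in> sigma_aut1 G n Gs" "\<phi> \<in> hom G G" "bij_betw \<phi> (carrier G) (carrier G)" using F \<phi>F by (auto simp: sigma_aut1_def)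
      have L': "bas ?L" by (rule aut_bas[OF \<phi>(1) L(1)])
      have e: "eqv t L ?L" using fixed[OF L(1) K(2)] m(1) mL \<phi>F by blast
      have "normat ?L t k" if k: "k \<in> {1..n}" for k
        unfolding normat_def
      proof (intro allI impI ballI)
        fix i j y assume a: "sep_adj {0..n} t k i \<and> sep_adj {0..n} t k j" and y: "y \<in> ?L k" and ns: "\<not> S (ptK ?L k) (ptK ?L i) (act y (ptK ?L j))"
        have kij: "k \<le> n" "i \<le> n" "j \<le> n" using a by (auto simp: sep_adj_def)
        obtain x where x: "x \<in> L k" "y = \<phi> x" using y k by (auto simp: basis_img_def)
        interpret L: free_prod G n L by (rule bas_fp[OF L(1)])
        have xc: "x \<in> carrier G" using L.H_closed[OF k x(1)] .
        have pp: "ptK ?L l = pmap \<phi> (ptK L l)" if "l \<le> n" for l using pmap_pt[OF \<phi>(2) that] by simp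
        have "act y (ptK ?L j) = pmap \<phi> (act x (ptK L j))" using pmap_act[OF \<phi>(2) xc ptK_in[OF L(1) kij(3)]] pp[OF kij(3)] x(2) by simp
        then have "\<not> S (ptK L k) (ptK L i) (act x (ptK L j))"
          using ns pp kij F_S[OF \<phi>F ptK_in[OF L(1) kij(1)] ptK_in[OF L(1) kij(2)] act_closed[OF xc ptK_in[OF L(1) kij(3)]]] by simp
        then have "\<not> SK L k i j" using L(3) k a x(1) unfolding normd_def normat_def by blast
        then show "\<not> SK ?L k i j"
          using pp kij F_S[OF \<phi>F ptK_in[OF L(1) kij(1)] ptK_in[OF L(1) kij(2)] ptK_in[OF L(1) kij(3)]] by simp
      qed
      then have "normd ?L t" by (simp add: normd_def)
      then show "eqv ?c L ?L" by (rule fold_unique[OF L(1) L' K(2) rL L(3) _ e])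
    qed
    have mu_ok: "?mu \<in> ?V \<and> vc ?mu < vc m \<and> vle n ?mu m"
    proof -
      have "vle n ?mu m" unfolding mL by (rule vleI[OF L(1) c K(2) cle])
      moreover have "vc ?mu < vc m" using fold_strict[OF L(1) K(2) rL L(3)] m(3) mL vc_cls[OF L(1) c] vc_cls[OF L(1) K(2)] by simp
      ultimately show ?thesis using muV by blast
    qed
    have f_ok: "fc m x \<in> ?V \<and> vc (fc m x) < vc m \<and> vle n x (fc m x) \<and> vle n (fc m x) m \<and> vle n ?mu (fc m x)"
      if x: "x \<in> ?V" "vle n x m" "vc x < vc m" for x
    proof -
      obtain K1 s where K1: "bas K1" "pointed_sep n s" "x = cls K1 s" using vE[OF x(1)] by blast
      obtain M where M: "bas M" "x = cls M s" "m = cls M t" "\<And>k i j. s k i j \<Longrightarrow> t k i j"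
        using vleE[OF K1(1,2) K(1,2)] x(2) K1(3) K(3) by metis
      have rM: "rfix M t" by (rule rfx[OF M(1,3)])
      let ?r = "rf M t s"
      have fcx: "fc m x = cls M ?r" using fc_cls[OF M(1) K1(2) K(2) M(4) rM] M(2,3) by simp
      have r: "pointed_sep n ?r" by (rule rf_between(1)[OF M(1) K1(2) K(2) M(4) rM])
      have rle: "?r k i j \<Longrightarrow> t k i j" for k i j by (rule rf_between(2)[OF M(1) K1(2) K(2) M(4) rM])
      have rge: "s k i j \<Longrightarrow> ?r k i j" for k i j using rf_ge[OF K1(2)] .
      have "vol M s < vol M t" using x(3) vc_cls[OF M(1) K1(2)] vc_cls[OF M(1) K(2)] M(2,3) by simp
      with M(4) have "vol M ?r < vol M t" using vol_rf_less[OF M(1) K1(2) K(2) _ rM] by blast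
      then have 1: "vc (fc m x) < vc m" using vc_cls[OF M(1) r] vc_cls[OF M(1) K(2)] fcx M(3) by simp
      have 2: "fc m x \<in> ?V" unfolding fcx using up[OF M(1) K1(2) r] x(1) M(2) rge by blast
      have 3: "vle n x (fc m x)" using vleI[OF M(1) K1(2) r rge] fcx M(2) by simp
      have 4: "vle n (fc m x) m" using vleI[OF M(1) r K(2) rle] fcx M(3) by simp
      \<comment> \<open>A basis is wanted that represents \<open>fc m x\<close> and is normalised
        for \<open>t\<close>. Everything \<open>?r\<close> identifies is a folding, so
        \<open>M\<close> can be normalised within the type of \<open>?r\<close>; then \<mu> is
        represented over the new basis too.\<close>
      have "vle n ?mu (cls M ?r)"
      proof -
        interpret P: sep_tree_pair "{0..n}" ?r t
          by (rule sep_tree_pair.intro[OF pointedD(1)[OF r] pointedD(1)[OF K(2)]], rule sep_tree_pair_axioms.intro, rule rle)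
        have fcp: "fold_compat M t ?r"
          unfolding fold_compat_def
        proof (intro allI impI)
          fix k i j assume a: "P.B.adj k i \<and> P.B.adj k j \<and> \<not> ?r k i j"
          have m': "k \<in> {0..n}" "i \<in> {0..n}" "j \<in> {0..n}" "i \<noteq> k" "j \<noteq> k" using P.B.adjD(1)[of k i] P.B.adjD(1)[of k j] a by auto
          show "\<not> SK M k i j"
          proof
            assume "SK M k i j"
            then have "?r k i j" using m' P.B.nb_adj[of k i] P.B.nb_adj[of k j] a unfolding rf_def sep_refine_def by simp
            then show False using a by blast
          qed
        qed
        obtain L2 where L2: "bas L2" "eqv ?r M L2" "normd L2 t" "fold_compat L2 t ?r"
          using normalise[OF M(1) K(2) r rle fcp] by blast
        have fL2: "cls M ?r = cls L2 ?r" using cls_eq_iff[OF M(1) L2(1) r r] L2(2) by simp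
        have eM: "eqv t M L2" using eqv_mono[of ?r t] rle L2(2) by blast
        then have m2: "m = cls L2 t" using cls_eq_iff[OF M(1) L2(1) K(2,2)] M(3) by simp
        have eL: "eqv t L L2" using cls_eq_iff[OF L(1) L2(1) K(2,2)] mL m2 by simp
        have "eqv ?c L L2" by (rule fold_unique[OF L(1) L2(1) K(2) rL L(3) L2(3) eL])
        then have muL2: "?mu = cls L2 ?c" using cls_eq_iff[OF L(1) L2(1) c c] by simp
        \<comment> \<open>\<open>L\<close> and \<open>L2\<close> are comparable only where the
          folded tree does not separate. A turn identified by \<open>?r\<close> is foldable for
          \<open>L2\<close>, hence identified in \<open>?c2\<close>; there \<open>L\<close> is a
          translate of \<open>L2\<close>, so the turn is foldable for \<open>L\<close> as
          well.\<close>
        let ?c2 = "rf L2 t star"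
        have r2: "rfix L2 t" by (rule rfx[OF L2(1) m2])
        have c2le: "?c2 k i j \<Longrightarrow> t k i j" for k i j using rf_between(2)[OF L2(1) star_pointed K(2) _ r2] by blast
        have "eqv t L2 L" using cls_eq_iff[OF L2(1) L(1) K(2,2)] mL m2 by simp
        then have e2: "eqv ?c2 L2 L" by (rule fold_unique[OF L2(1) L(1) K(2) r2 L2(3) L(3)])
        have cr: "?r k i j" if ck: "?c k i j" for k i j
        proof (rule ccontr)
          assume nr: "\<not> ?r k i j"
          have m': "k \<in> {0..n}" "i \<in> {0..n}" "j \<in> {0..n}" "k \<noteq> i" "k \<noteq> j" using ck by (auto simp: rf_def sep_refine_def)
          note ni = P.B.nb[OF m'(1,2,4)] and nj = P.B.nb[OF m'(1,3,5)]
          have nr': "\<not> ?r k (P.B.nb k i) (P.B.nb k j)"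
            using nr P.A.sep_cong[of k i "P.B.nb k i" j "P.B.nb k j"] ni nj m' P.le by blast
          have nS2: "\<not> SK L2 k (P.B.nb k i) (P.B.nb k j)" using L2(4) ni(1) nj(1) nr' unfolding fold_compat_def by blast
          then have nc2: "\<not> ?c2 k (P.B.nb k i) (P.B.nb k j)"
            using P.B.nb_adj[OF ni(1)] P.B.nb_adj[OF nj(1)] by (simp add: rf_def sep_refine_def)
          have "sep_adj {0..n} ?c2 k (P.B.nb k i)" "sep_adj {0..n} ?c2 k (P.B.nb k j)"
            using ni(1) nj(1) c2le unfolding sep_adj_def by blast+
          then have "\<not> SK L k (P.B.nb k i) (P.B.nb k j)"
            using SK_eqv[OF L2(1) e2, of k "P.B.nb k i" "P.B.nb k j"] nc2 nS2 by blast
          then show False using ck by (simp add: rf_def sep_refine_def)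
        qed
        show ?thesis unfolding fL2 muL2 by (rule vleI[OF L2(1) c r cr])
      qed
      then have 5: "vle n ?mu (fc m x)" by (simp add: fcx)
      show ?thesis using 1 2 3 4 5 by blast
    qed
    have f_mono: "vle n (fc m x) (fc m y)" if xy: "x \<in> ?V" "y \<in> ?V" "vle n x y" "vle n y m" for x y
    proof -
      obtain K1 s1 K2 s2 where K12: "bas K1" "pointed_sep n s1" "x = cls K1 s1" "bas K2" "pointed_sep n s2" "y = cls K2 s2"
        using vE[OF xy(1)] vE[OF xy(2)] by metis
      obtain M where M: "bas M" "x = cls M s1" "y = cls M s2" "m = cls M t" "\<And>k i j. s1 k i j \<Longrightarrow> s2 k i j" "\<And>k i j. s2 k i j \<Longrightarrow> t k i j"
        using vle_chain[OF K12(1,2,4,5) K(1,2)] xy(3,4) K12(3,6) K(3) by metis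
      have rM: "rfix M t" by (rule rfx[OF M(1,4)])
      have le1: "s1 k i j \<Longrightarrow> t k i j" for k i j using M(5,6) by blast
      have "fc m x = cls M (rf M t s1)" using fc_cls[OF M(1) K12(2) K(2) le1 rM] M(2,4) by simp
      moreover have "fc m y = cls M (rf M t s2)" using fc_cls[OF M(1) K12(5) K(2) M(6) rM] M(3,4) by simp
      moreover have "rf M t s1 k i j \<Longrightarrow> rf M t s2 k i j" for k i j using M(5) by (auto simp: rf_def sep_refine_def)
      ultimately show ?thesis
        using vleI[OF M(1) rf_between(1)[OF M(1) K12(2) K(2) le1 rM] rf_between(1)[OF M(1) K12(5) K(2) M(6) rM]] by metis
    qed
    show "\<exists>\<mu> f. \<mu> \<in> ?V \<and> vc \<mu> < vc m \<and> vle n \<mu> m \<and>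
        (\<forall>x\<in>?V. vle n x m \<and> vc x < vc m \<longrightarrow> f x \<in> ?V \<and> vc (f x) < vc m \<and> vle n x (f x) \<and> vle n (f x) m \<and> vle n \<mu> (f x)) \<and>
        (\<forall>x\<in>?V. \<forall>y\<in>?V. vle n x y \<and> vle n y m \<and> vc y < vc m \<longrightarrow> vle n (f x) (f y))"
      by (intro exI[of _ ?mu] exI[of _ "fc m"] conjI ballI impI) (use mu_ok f_ok f_mono in auto)
  qed
qed

end

context gtree
begin

interpretation S: sep_tree \<Lambda> S by (rule S_tree)

text \<open>An automorphism fixing the vertex type to which \<open>S\<close> is adapted preserves \<open>S\<close>, because \<open>S\<close> is
  determined by that vertex type.\<close>

lemma adapted_aut_invariant:
  assumes K: "bas K" "pointed_sep n s" "adapted K s" and \<phi>: "\<phi> \<in> sigma_aut1 G n Gs" and e: "eqv s K (basis_img n \<phi> K)"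
    and lpq: "l \<in> \<Lambda>" "p \<in> \<Lambda>" "q \<in> \<Lambda>"
  shows "S (pmap \<phi> l) (pmap \<phi> p) (pmap \<phi> q) \<longleftrightarrow> S l p q"
proof -
  interpret K: free_prod G n K by (rule bas_fp[OF K(1)])
  have hom: "\<phi> \<in> hom G G" and bij: "bij_betw \<phi> (carrier G) (carrier G)" using \<phi> by (auto simp: sigma_aut1_def)
  have inj: "inj_on \<phi> (carrier G)" using bij by (simp add: bij_betw_def)
  have one: "\<phi> \<one> = \<one>" using hom_one[OF hom is_group is_group] .
  have K': "bas (basis_img n \<phi> K)" by (rule aut_bas[OF \<phi> K(1)])
  have pm: "pmap \<phi> p \<in> \<Lambda>" if p: "p \<in> \<Lambda>" for p
  proof -
    obtain g j where g: "g \<in> carrier G" "j \<le> n" "p = act g (ptK K j)" using p unfolding bas_points[OF K(1), symmetric] by (auto simp: points_def)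
    then show ?thesis
      using pmap_act[OF hom g(1) ptK_in[OF K(1) g(2)]] pmap_pt[OF hom g(2)] act_closed[OF hom_in_carrier[OF hom g(1)] ptK_in[OF K' g(2)]] by simp
  qed
  have car: "(\<exists>a. p = Inl a \<and> a \<in> carrier G) \<or> (\<exists>L. p = Inr L \<and> L \<subseteq> carrier G)" if p: "p \<in> \<Lambda>" for p
  proof -
    obtain g j where g: "g \<in> carrier G" "j \<le> n" "p = act g (vpt j)" using p by (auto simp: points_def)
    show ?thesis
    proof (cases "j = 0")
      case True
      then show ?thesis using g by (simp add: pt_def)
    next
      case False
      then have "j \<in> {1..n}" using g by simp
      then show ?thesis using g False conjugate_set_closed[OF g(1) H_sub] by (simp add: pt_def)
    qed
  qed
  have pinj: "pmap \<phi> p = pmap \<phi> q \<longleftrightarrow> p = q" if pq: "p \<in> \<Lambda>" "q \<in> \<Lambda>" for p q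
    using car[OF pq(1)] car[OF pq(2)] inj inj_on_image_eq_iff[OF inj] by (auto simp: inj_on_def)
  \<comment> \<open>The pullback of \<open>S\<close> along \<phi> is again a tree of this kind, and
    it is adapted to the same pair because the image of \<open>K\<close> is equivalent to
    \<open>K\<close>. Two trees adapted to one pair coincide.\<close>
  define S' where "S' l p q \<longleftrightarrow> l \<in> \<Lambda> \<and> p \<in> \<Lambda> \<and> q \<in> \<Lambda> \<and> S (pmap \<phi> l) (pmap \<phi> p) (pmap \<phi> q)" for l p q
  have gt: "gtree G n Gs S'"
  proof
    fix k i j l
    show "S' k i j \<Longrightarrow> k \<in> \<Lambda> \<and> i \<in> \<Lambda> \<and> j \<in> \<Lambda> \<and> i \<noteq> k \<and> j \<noteq> k" using S.dom by (auto simp: S'_def)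
    show "\<not> S' k i i" using S.irrefl by (simp add: S'_def)
    show "S' k i j \<Longrightarrow> S' k j i" using S.sym by (simp add: S'_def)
    show "S' k i l \<Longrightarrow> j \<in> \<Lambda> \<Longrightarrow> j \<noteq> k \<Longrightarrow> S' k i j \<or> S' k j l" using S.tri pm pinj by (auto simp: S'_def)
    show "S' k i l \<Longrightarrow> \<not> S' l i k" using S.ax by (auto simp: S'_def)
  next
    fix g l p q assume a: "g \<in> carrier G" "l \<in> \<Lambda>" "p \<in> \<Lambda>" "q \<in> \<Lambda>"
    then show "S' (act g l) (act g p) (act g q) \<longleftrightarrow> S' l p q"
      using S_act[OF hom_in_carrier[OF hom a(1)] pm pm pm] pmap_act[OF hom a(1)] act_closed[OF a(1)] by (simp add: S'_def)
  next
    fix a p q show "\<not> S' (Inl a) p q" using S_leaf by (simp add: S'_def)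
  next
    fix l x p assume a: "l \<in> \<Lambda>" "x \<in> carrier G" "x \<noteq> \<one>" "act x l = l" "p \<in> \<Lambda>" "p \<noteq> l"
    have "\<phi> x \<noteq> \<one>" using inj_onD[OF inj, of x \<one>] one a by auto
    moreover have "act (\<phi> x) (pmap \<phi> l) = pmap \<phi> l" using pmap_act[OF hom a(2,1)] a(4) by simp
    moreover have "pmap \<phi> p \<noteq> pmap \<phi> l" using pinj a by simp
    ultimately show "S' l p (act x p)"
      using S_free[OF pm[OF a(1)] hom_in_carrier[OF hom a(2)] _ _ pm[OF a(5)]] pmap_act[OF hom a(2,5)] a act_closed[OF a(2,5)] by (simp add: S'_def)
  qed
  have ad': "adapted (basis_img n \<phi> K) s" by (rule adapted_eqv[OF K(1) K' K(2,3) e])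
  have "gtree.adapted G n S' K s"
    unfolding gtree.adapted_def[OF gt]
  proof (intro ballI allI impI)
    fix k i j x assume k: "k \<in> {1..n}" and a: "sep_adj {0..n} s k i \<and> sep_adj {0..n} s k j" and x: "x \<in> K k"
    have kij: "k \<le> n" "i \<le> n" "j \<le> n" using a by (auto simp: sep_adj_def)
    have xc: "x \<in> carrier G" using K.H_closed[OF k x] .
    have px: "\<phi> x \<in> basis_img n \<phi> K k" using x k by (auto simp: basis_img_def)
    have "\<phi> x = \<one> \<longleftrightarrow> x = \<one>" using inj_onD[OF inj, of x \<one>] one xc by auto
    moreover have "S' (ptK K k) (ptK K i) (act x (ptK K j)) \<longleftrightarrow>
       S (ptK (basis_img n \<phi> K) k) (ptK (basis_img n \<phi> K) i) (act (\<phi> x) (ptK (basis_img n \<phi> K) j))"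
      using pmap_pt[OF hom] pmap_act[OF hom xc ptK_in[OF K(1) kij(3)]] kij ptK_in[OF K(1)] act_closed[OF xc ptK_in[OF K(1) kij(3)]] by (simp add: S'_def)
    ultimately show "\<not> S' (ptK K k) (ptK K i) (act x (ptK K j)) \<longleftrightarrow> x = \<one> \<and> \<not> s k i j"
      using ad' k a px unfolding adapted_def by blast
  qed
  then have "S = S'" using adapted_determines[OF gtree_axioms gt K(1,2)] K(3) by blast
  then show ?thesis using lpq S'_def[of l p q] by simp
qed

end

theorem theorem7p5:
  fixes G :: "('g, 'b) monoid_scheme" and n :: nat and Gs :: "nat \<Rightarrow> 'g set"
    and F :: "('g \<Rightarrow> 'g) set" and c0 :: "'g lpair set"
  assumes "group G"
    and "is_free_product G n Gs"
    and "\<forall>i \<in> {1..n}. finite (Gs i) \<and> Gs i \<noteq> {\<one>\<^bsub>G\<^esub>}"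
    and "finite_subgroup_SA G n Gs F"
    and "c0 \<in> LG_fixed G n Gs F"
    and "reduced_in n (LG_fixed G n Gs F) c0"
  shows "contractible_space (realization (LG_fixed G n Gs F) (vle n))"
proof -
  interpret group G by fact
  interpret free_prod_bases G n Gs by (intro free_prod_bases.intro free_prod.intro free_prod_axioms.intro) (use assms(1-3) in auto)
  have F: "F \<subseteq> sigma_aut1 G n Gs" using assms(4) by (simp add: finite_subgroup_SA_def)
  have "c0 \<in> LG_vertices G n Gs" using assms(5) by (simp add: LG_fixed_def)
  then obtain H s where H: "bas H" "pointed_sep n s" "c0 = cls H s" using LG_vertexE by blast
  interpret H: free_prod G n H by (rule bas_fp[OF H(1)])
  have HL: "points G n H = points G n Gs" by (rule bas_points[OF H(1)])
  interpret T: fin_sep_tree "{0..n}" s using H(2) by (simp add: pointed_sep_def)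
  \<comment> \<open>The tree is built from the basis \<open>H\<close>, but it lives on the points of
    \<open>Gs\<close>: conjugate factors have the same translates, so the two sets of points
    agree.\<close>
  interpret gtree G n Gs "H.base_sep s"
  proof (intro gtree.intro gtree_axioms.intro)
    show "free_prod_bases G n Gs" by unfold_locales
    show "sep_tree \<Lambda> (H.base_sep s)" using H.base_sep_tree[OF H(2)] HL by simp
    show "H.base_sep s (act g l) (act g p) (act g q) \<longleftrightarrow> H.base_sep s l p q"
      if "g \<in> carrier G" "l \<in> \<Lambda>" "p \<in> \<Lambda>" "q \<in> \<Lambda>" for g l p q using H.base_sep_act[of g l p q s] that HL by simp
    show "\<not> H.base_sep s (Inl a) p q" for a p q by (rule H.base_sep_leaf)
    show "H.base_sep s l p (act x p)"
      if a: "l \<in> \<Lambda>" "x \<in> carrier G" "x \<noteq> \<one>\<^bsub>G\<^esub>" "act x l = l" "p \<in> \<Lambda>" "p \<noteq> l" for l x p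
    proof -
      obtain g k where g: "g \<in> carrier G" "k \<le> n" "l = act g (ptK H k)" using a(1) unfolding HL[symmetric] by (auto simp: points_def)
      have "k \<noteq> 0"
      proof
        assume "k = 0"
        then have "x \<otimes>\<^bsub>G\<^esub> g = g" using a(4) g a(2) by (simp add: pt_def)
        then show False using a(2,3) g(1) by simp
      qed
      then show ?thesis using H.base_sep_free[of k g x p s] a g HL by simp
    qed
  qed
  have ad: "adapted H s"
    unfolding adapted_def
  proof (intro ballI allI impI)
    fix k i j x assume k: "k \<in> {1..n}" and a: "T.adj k i \<and> T.adj k j" and x: "x \<in> H k"
    have "i \<le> n" "j \<le> n" "i \<noteq> k" "j \<noteq> k" using T.adjD(1)[of k i] T.adjD(1)[of k j] a by auto
    from H.base_sep_adapted[OF k this x]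
    show "\<not> H.base_sep s (ptK H k) (ptK H i) (act x (ptK H j)) \<longleftrightarrow> x = \<one>\<^bsub>G\<^esub> \<and> \<not> s k i j" .
  qed
  interpret gtree0 G n Gs "H.base_sep s" H s
    by (rule gtree0.intro[OF gtree_axioms gtree0_axioms.intro[OF H(1,2) ad]])
  have inv: "H.base_sep s (pmap \<phi> l) (pmap \<phi> p) (pmap \<phi> q) \<longleftrightarrow> H.base_sep s l p q"
    if \<phi>: "\<phi> \<in> F" and lpq: "l \<in> \<Lambda>" "p \<in> \<Lambda>" "q \<in> \<Lambda>" for \<phi> l p q
  proof (rule adapted_aut_invariant[OF H(1,2) ad _ _ lpq])
    show \<phi>': "\<phi> \<in> sigma_aut1 G n Gs" using \<phi> F by blast
    have "vact G n Gs \<phi> c0 = c0" using assms(5) \<phi> by (simp add: LG_fixed_def)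
    then show "eqv s H (basis_img n \<phi> H)"
      using vact_cls[OF \<phi>' H(1,2)] cls_eq_iff[OF H(1) aut_bas[OF \<phi>' H(1)] H(2,2)] H(3) by simp
  qed
  have "cls H s \<in> LG_fixed G n Gs F" using assms(5) H(3) by simp
  with F inv show ?thesis by (rule contractible_fixed)
qed

end
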